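(* Let $A$ be a simple (not necessarily unital) tracially $\mathcal{Z}$-absorbing C*-algebra. Then: (1) the Cuntz semigroup $W(A)$ is almost unperforated; (2) $A$ has weak strict comparison; (3) $A$ is weakly almost divisible.
   Context: $\mathbb{N}=\{1,2,\dots\}$. For positive elements $a,b$ of a C*-algebra $A$, $a \precsim b$ (Cuntz subequivalence) means there is a sequence $(v_n)$ in $A$ with $\|a - v_n b v_n^*\| \to 0$; $a\sim b$ means $a \precsim b$ and $b\precsim a$. Let $M_\infty(A)=\bigcup_n M_n(A)$ (upper left corner embeddings); $\precsim$ and $\sim$ on $M_\infty(A)_+$ are computed in $M_n(A)$ for $n$ large enough. $W(A)=M_\infty(A)_+/\sim$, with class of $a$ denoted $\langle a\rangle$, addition $\langle a\rangle+\langle b\rangle=\langle a\oplus b\rangle$, and order $\langle a\rangle\le\langle b\rangle$ iff $a\precsim b$. For self-adjoint $c$ and $\varepsilon>0$, $(c-\varepsilon)_+$ is obtained by applying $t\mapsto\max(t-\varepsilon,0)$. $W(A)$ is almost unperforated if whenever $\mu,\nu\in W(A)$ and $k\ge 2$ satisfy $k\mu\le(k-1)\nu$, then $\mu\le\nu$ (equivalently, $n\mu\le m\nu$ with $n>m$ in $\mathbb{N}$ implies $\mu\le\nu$). A dimension function on $A$ is an additive order preserving function $d\colon W(A)\to[0,\infty]$; write $d(a)=d(\langle a\rangle)$ for $a\in M_\infty(A)_+$. $A$ has weak strict comparison if whenever $a,b\in M_\infty(A)_+$ are such that $a$ is in the closed two-sided ideal generated by $b$ and $d(a)<d(b)$ for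 every dimension function $d$ on $A$ with $d(b)=1$, then $a\precsim b$. $A$ is weakly almost divisible if for every $a\in M_\infty(A)_+$, $n\in\mathbb{N}$, and $\varepsilon>0$ there is $\eta\in W(A)$ such that $n\eta\le\langle a\rangle$ and $\langle(a-\varepsilon)_+\rangle\le(n+1)\eta$. $M_n=M_n(\mathbb{C})$, $[y,z]=yz-zy$. A completely positive contractive (c.p.c.) map $\varphi$ has order zero if $\varphi(y)\varphi(z)=0$ whenever $y,z$ are positive with $yz=0$. A simple C*-algebra $A$ is tracially $\mathcal{Z}$-absorbing if $A\not\cong\mathbb{C}$ and for every $x,a\in A_+$ with $a\ne0$, every finite set $F\subseteq A$, every $\varepsilon>0$, and every $n\in\mathbb{N}$, there is a c.p.c. order zero map $\varphi\colon M_n\to A$ such that (i) $(x^2-x\varphi(1)x-\varepsilon)_+\precsim a$, and (ii) $\|[\varphi(z),b]\|<\varepsilon$ for all $z\in M_n$ with $\|z\|\le1$ and all $b\in F$. *)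

theory Defs
  imports
    "HOL-Analysis.Analysis"
    "HOL-Computational_Algebra.Polynomial"
    "HOL-Algebra.Algebraic_Closure_Type"
    "HOL-Algebra.Module"
begin

section \<open>C*-algebras\<close>

text \<open>
  The record extends the library's modules over the ring of complex numbers. The inherited field
  \<open>one\<close> is not constrained by any axiom, since C*-algebras need not be unital; it is only used
  for the concrete algebras of complex matrices below, where it is the unit matrix.
\<close>

record 'a calg = "(complex, 'a) module" +
  star :: "'a \<Rightarrow> 'a"
  nrm :: "'a \<Rightarrow> real"

locale cstar_algebra =
  module "ring_of_type_algebra :: complex ring" A for A :: "('a, 'm) calg_scheme" (structure) +
  assumes mult_closed: "\<lbrakk>x \<in> carrier A; y \<in> carrier A\<rbrakk> \<Longrightarrow> x \<otimes> y \<in> carrier A"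
    and mult_assoc: "\<lbrakk>x \<in> carrier A; y \<in> carrier A; z \<in> carrier A\<rbrakk>
      \<Longrightarrow> (x \<otimes> y) \<otimes> z = x \<otimes> (y \<otimes> z)"
    and mult_add_left: "\<lbrakk>x \<in> carrier A; y \<in> carrier A; z \<in> carrier A\<rbrakk>
      \<Longrightarrow> (x \<oplus> y) \<otimes> z = x \<otimes> z \<oplus> y \<otimes> z"
    and mult_add_right: "\<lbrakk>x \<in> carrier A; y \<in> carrier A; z \<in> carrier A\<rbrakk>
      \<Longrightarrow> x \<otimes> (y \<oplus> z) = x \<otimes> y \<oplus> x \<otimes> z"
    and smult_mult_left: "\<lbrakk>x \<in> carrier A; y \<in> carrier A\<rbrakk> \<Longrightarrow> (c \<odot> x) \<otimes> y = c \<odot> (x \<otimes> y)"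
    and smult_mult_right: "\<lbrakk>x \<in> carrier A; y \<in> carrier A\<rbrakk> \<Longrightarrow> x \<otimes> (c \<odot> y) = c \<odot> (x \<otimes> y)"
    and star_closed: "x \<in> carrier A \<Longrightarrow> star A x \<in> carrier A"
    and star_star: "x \<in> carrier A \<Longrightarrow> star A (star A x) = x"
    and star_add: "\<lbrakk>x \<in> carrier A; y \<in> carrier A\<rbrakk> \<Longrightarrow> star A (x \<oplus> y) = star A x \<oplus> star A y"
    and star_smult: "x \<in> carrier A \<Longrightarrow> star A (c \<odot> x) = cnj c \<odot> star A x"
    and star_mult: "\<lbrakk>x \<in> carrier A; y \<in> carrier A\<rbrakk> \<Longrightarrow> star A (x \<otimes> y) = star A y \<otimes> star A x"
    and nrm_nonneg: "x \<in> carrier A \<Longrightarrow> 0 \<le> nrm A x"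
    and nrm_eq_0: "x \<in> carrier A \<Longrightarrow> nrm A x = 0 \<longleftrightarrow> x = \<zero>"
    and nrm_triangle: "\<lbrakk>x \<in> carrier A; y \<in> carrier A\<rbrakk> \<Longrightarrow> nrm A (x \<oplus> y) \<le> nrm A x + nrm A y"
    and nrm_smult: "x \<in> carrier A \<Longrightarrow> nrm A (c \<odot> x) = cmod c * nrm A x"
    and nrm_mult: "\<lbrakk>x \<in> carrier A; y \<in> carrier A\<rbrakk> \<Longrightarrow> nrm A (x \<otimes> y) \<le> nrm A x * nrm A y"
    and cstar_identity: "x \<in> carrier A \<Longrightarrow> nrm A (star A x \<otimes> x) = (nrm A x)\<^sup>2"
    and complete: "\<lbrakk>\<And>n. s n \<in> carrier A;
        \<And>e. e > 0 \<Longrightarrow> \<exists>N. \<forall>m\<ge>N. \<forall>n\<ge>N. nrm A (s m \<ominus> s n) < e\<rbrakk>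
      \<Longrightarrow> \<exists>x\<in>carrier A. (\<lambda>n. nrm A (s n \<ominus> x)) \<longlonglongrightarrow> 0"

definition complex_calg :: "complex calg" where
  "complex_calg = \<lparr>carrier = UNIV, monoid.mult = (*), one = 1, zero = 0, add = (+),
     smult = (*), star = cnj, nrm = cmod\<rparr>"

definition calg_iso :: "('a, 'm) calg_scheme \<Rightarrow> ('b, 'n) calg_scheme \<Rightarrow> bool" where
  "calg_iso A B \<longleftrightarrow> (\<exists>f. bij_betw f (carrier A) (carrier B) \<and>
     (\<forall>x\<in>carrier A. \<forall>y\<in>carrier A. f (x \<oplus>\<^bsub>A\<^esub> y) = f x \<oplus>\<^bsub>B\<^esub> f y \<and> f (x \<otimes>\<^bsub>A\<^esub> y) = f x \<otimes>\<^bsub>B\<^esub> f y) \<and>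
     (\<forall>x\<in>carrier A. f (star A x) = star B (f x) \<and> (\<forall>c. f (c \<odot>\<^bsub>A\<^esub> x) = c \<odot>\<^bsub>B\<^esub> f x)))"

definition closed_ideal :: "('a, 'm) calg_scheme \<Rightarrow> 'a set \<Rightarrow> bool" where
  "closed_ideal A I \<longleftrightarrow> submodule I (ring_of_type_algebra :: complex ring) A \<and>
     (\<forall>x\<in>carrier A. \<forall>y\<in>I. x \<otimes>\<^bsub>A\<^esub> y \<in> I \<and> y \<otimes>\<^bsub>A\<^esub> x \<in> I) \<and>
     (\<forall>s. \<forall>x\<in>carrier A. (\<forall>n::nat. s n \<in> I) \<and> (\<lambda>n. nrm A (s n \<ominus>\<^bsub>A\<^esub> x)) \<longlonglongrightarrow> 0 \<longrightarrow> x \<in> I)"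

definition simple_calg :: "('a, 'm) calg_scheme \<Rightarrow> bool" where
  "simple_calg A \<longleftrightarrow> (\<forall>I. closed_ideal A I \<longrightarrow> I = {\<zero>\<^bsub>A\<^esub>} \<or> I = carrier A)"


section \<open>Spectrum, positive elements and functional calculus\<close>

text \<open>
  The spectrum is taken in the unitization, which is formed even if the algebra already has a unit.
  This affects only whether 0 belongs to the spectrum, and that is irrelevant for positivity and for
  functions vanishing at 0.
\<close>

definition unitization :: "('a, 'm) calg_scheme \<Rightarrow> ('a \<times> complex) ring" where
  "unitization A =
    \<lparr>carrier = carrier A \<times> UNIV,
     monoid.mult = (\<lambda>(x, r) (y, s). (x \<otimes>\<^bsub>A\<^esub> y \<oplus>\<^bsub>A\<^esub> (s \<odot>\<^bsub>A\<^esub> x \<oplus>\<^bsub>A\<^esub> r \<odot>\<^bsub>A\<^esub> y), r * s)),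
     one = (\<zero>\<^bsub>A\<^esub>, 1),
     zero = (\<zero>\<^bsub>A\<^esub>, 0),
     add = (\<lambda>(x, r) (y, s). (x \<oplus>\<^bsub>A\<^esub> y, r + s))\<rparr>"

definition spectrum :: "('a, 'm) calg_scheme \<Rightarrow> 'a \<Rightarrow> complex set" where
  "spectrum A x = {r. (\<ominus>\<^bsub>A\<^esub> x, r) \<notin> Units (unitization A)}"

definition selfadjoint :: "('a, 'm) calg_scheme \<Rightarrow> 'a \<Rightarrow> bool" where
  "selfadjoint A x \<longleftrightarrow> x \<in> carrier A \<and> star A x = x"

definition positive_elem :: "('a, 'm) calg_scheme \<Rightarrow> 'a \<Rightarrow> bool" where
  "positive_elem A x \<longleftrightarrow> selfadjoint A x \<and> spectrum A x \<subseteq> \<real>\<^sub>\<ge>\<^sub>0"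

text \<open>\<open>pow_Suc A x n\<close> is the power of \<open>x\<close> with exponent \<open>n + 1\<close>.\<close>

primrec pow_Suc :: "('a, 'm) calg_scheme \<Rightarrow> 'a \<Rightarrow> nat \<Rightarrow> 'a" where
  "pow_Suc A x 0 = x"
| "pow_Suc A x (Suc n) = pow_Suc A x n \<otimes>\<^bsub>A\<^esub> x"

text \<open>The value at \<open>x\<close> of a polynomial without constant term.\<close>

definition poly_at :: "('a, 'm) calg_scheme \<Rightarrow> real poly \<Rightarrow> 'a \<Rightarrow> 'a" where
  "poly_at A p x = (\<Oplus>\<^bsub>A\<^esub>i\<in>{1..Polynomial.degree p}.
     complex_of_real (poly.coeff p i) \<odot>\<^bsub>A\<^esub> pow_Suc A x (i - 1))"

text \<open>
  Continuous functional calculus for self-adjoint \<open>c\<close> and continuous \<open>f\<close> with \<open>f 0 = 0\<close>: the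
  element \<open>f(c)\<close> is the common limit of \<open>p\<^sub>n(c)\<close> over all sequences of real polynomials without
  constant term converging to \<open>f\<close> uniformly on the (real, compact) spectrum of \<open>c\<close>. Such sequences
  exist by the Weierstrass approximation theorem.
\<close>

definition fun_calc :: "('a, 'm) calg_scheme \<Rightarrow> (real \<Rightarrow> real) \<Rightarrow> 'a \<Rightarrow> 'a" where
  "fun_calc A f c = (THE y. y \<in> carrier A \<and>
     (\<forall>p. (\<forall>n. poly (p n) 0 = 0) \<and>
          uniform_limit {t. complex_of_real t \<in> spectrum A c} (\<lambda>n. poly (p n)) f sequentially
        \<longrightarrow> (\<lambda>n. nrm A (poly_at A (p n) c \<ominus>\<^bsub>A\<^esub> y)) \<longlonglongrightarrow> 0))"

text \<open>\<open>cutdown A c \<epsilon>\<close> is \<open>(c - \<epsilon>)\<^sub>+\<close>.\<close>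

definition cutdown :: "('a, 'm) calg_scheme \<Rightarrow> 'a \<Rightarrow> real \<Rightarrow> 'a" where
  "cutdown A c \<epsilon> = fun_calc A (\<lambda>t. max (t - \<epsilon>) 0) c"

definition cuntz_le :: "('a, 'm) calg_scheme \<Rightarrow> 'a \<Rightarrow> 'a \<Rightarrow> bool" where
  "cuntz_le A a b \<longleftrightarrow> (\<exists>v :: nat \<Rightarrow> 'a. (\<forall>n. v n \<in> carrier A) \<and>
     (\<lambda>n. nrm A (a \<ominus>\<^bsub>A\<^esub> v n \<otimes>\<^bsub>A\<^esub> b \<otimes>\<^bsub>A\<^esub> star A (v n))) \<longlonglongrightarrow> 0)"


section \<open>Matrix algebras\<close>

text \<open>
  Elements of \<open>M\<^sub>n(A)\<close> are functions of two indices that vanish unless both indices are below \<open>n\<close>,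
  so the upper left corner embedding of \<open>M\<^sub>n(A)\<close> into \<open>M\<^sub>m(A)\<close> for \<open>n \<le> m\<close> is an inclusion of
  carriers. The norm is the operator norm for the action on the Hilbert module \<open>A\<^sup>n\<close>, whose norm is
  \<open>col_nrm\<close>; as this action is faithful, it is the unique C*-norm on \<open>M\<^sub>n(A)\<close>.
\<close>

definition col_nrm :: "nat \<Rightarrow> ('a, 'm) calg_scheme \<Rightarrow> (nat \<Rightarrow> 'a) \<Rightarrow> real" where
  "col_nrm n A \<xi> = sqrt (nrm A (\<Oplus>\<^bsub>A\<^esub>i\<in>{..<n}. star A (\<xi> i) \<otimes>\<^bsub>A\<^esub> \<xi> i))"

definition matrix_calg :: "nat \<Rightarrow> ('a, 'm) calg_scheme \<Rightarrow> (nat \<Rightarrow> nat \<Rightarrow> 'a) calg" where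
  "matrix_calg n A =
    \<lparr>carrier = {a. (\<forall>i j. a i j \<in> carrier A) \<and> (\<forall>i j. i \<ge> n \<or> j \<ge> n \<longrightarrow> a i j = \<zero>\<^bsub>A\<^esub>)},
     monoid.mult = (\<lambda>a b i j. \<Oplus>\<^bsub>A\<^esub>k\<in>{..<n}. a i k \<otimes>\<^bsub>A\<^esub> b k j),
     one = (\<lambda>i j. if i = j \<and> i < n then \<one>\<^bsub>A\<^esub> else \<zero>\<^bsub>A\<^esub>),
     zero = (\<lambda>i j. \<zero>\<^bsub>A\<^esub>),
     add = (\<lambda>a b i j. a i j \<oplus>\<^bsub>A\<^esub> b i j),
     smult = (\<lambda>c a i j. c \<odot>\<^bsub>A\<^esub> a i j),
     star = (\<lambda>a i j. star A (a j i)),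
     nrm = (\<lambda>a. SUP \<xi>\<in>{\<xi>. (\<forall>i. \<xi> i \<in> carrier A) \<and> col_nrm n A \<xi> \<le> 1}.
              col_nrm n A (\<lambda>i. \<Oplus>\<^bsub>A\<^esub>k\<in>{..<n}. a i k \<otimes>\<^bsub>A\<^esub> \<xi> k))\<rparr>"

definition minf_pos :: "('a, 'm) calg_scheme \<Rightarrow> (nat \<Rightarrow> nat \<Rightarrow> 'a) set" where
  "minf_pos A = (\<Union>n. {a. positive_elem (matrix_calg n A) a})"

definition minf_cuntz_le ::
  "('a, 'm) calg_scheme \<Rightarrow> (nat \<Rightarrow> nat \<Rightarrow> 'a) \<Rightarrow> (nat \<Rightarrow> nat \<Rightarrow> 'a) \<Rightarrow> bool" where
  "minf_cuntz_le A a b \<longleftrightarrow> (\<forall>\<^sub>F n in sequentially. cuntz_le (matrix_calg n A) a b)"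

text \<open>\<open>dsum A m a b\<close> is \<open>a \<oplus> b\<close> where \<open>a\<close> is regarded as an element of \<open>M\<^sub>m(A)\<close>.\<close>

definition dsum :: "('a, 'm) calg_scheme \<Rightarrow> nat \<Rightarrow> (nat \<Rightarrow> nat \<Rightarrow> 'a) \<Rightarrow> (nat \<Rightarrow> nat \<Rightarrow> 'a)
    \<Rightarrow> nat \<Rightarrow> nat \<Rightarrow> 'a" where
  "dsum A m a b = (\<lambda>i j. if i < m \<and> j < m then a i j
     else if m \<le> i \<and> m \<le> j then b (i - m) (j - m) else \<zero>\<^bsub>A\<^esub>)"


section \<open>The Cuntz semigroup\<close>

type_synonym 'a cuntz_class = "(nat \<Rightarrow> nat \<Rightarrow> 'a) set"

definition cuntz_rel ::
  "('a, 'm) calg_scheme \<Rightarrow> ((nat \<Rightarrow> nat \<Rightarrow> 'a) \<times> (nat \<Rightarrow> nat \<Rightarrow> 'a)) set" where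
  "cuntz_rel A = {(a, b). a \<in> minf_pos A \<and> b \<in> minf_pos A \<and>
     minf_cuntz_le A a b \<and> minf_cuntz_le A b a}"

definition W :: "('a, 'm) calg_scheme \<Rightarrow> 'a cuntz_class set" where
  "W A = minf_pos A // cuntz_rel A"

definition W_class :: "('a, 'm) calg_scheme \<Rightarrow> (nat \<Rightarrow> nat \<Rightarrow> 'a) \<Rightarrow> 'a cuntz_class" where
  "W_class A a = cuntz_rel A `` {a}"

text \<open>
  All members of the following union are equal: the class of \<open>a \<oplus> b\<close> depends neither on the
  representatives nor on the size \<open>m\<close> of the matrices among which \<open>a\<close> is considered.
\<close>

definition W_add ::
  "('a, 'm) calg_scheme \<Rightarrow> 'a cuntz_class \<Rightarrow> 'a cuntz_class \<Rightarrow> 'a cuntz_class" where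
  "W_add A \<mu> \<nu> = (\<Union>a\<in>\<mu>. \<Union>b\<in>\<nu>. \<Union>m\<in>{m. a \<in> carrier (matrix_calg m A)}. W_class A (dsum A m a b))"

primrec W_multiple :: "('a, 'm) calg_scheme \<Rightarrow> nat \<Rightarrow> 'a cuntz_class \<Rightarrow> 'a cuntz_class" where
  "W_multiple A 0 \<mu> = W_class A (\<lambda>i j. \<zero>\<^bsub>A\<^esub>)"
| "W_multiple A (Suc n) \<mu> = W_add A (W_multiple A n \<mu>) \<mu>"

definition W_le :: "('a, 'm) calg_scheme \<Rightarrow> 'a cuntz_class \<Rightarrow> 'a cuntz_class \<Rightarrow> bool" where
  "W_le A \<mu> \<nu> \<longleftrightarrow> (\<exists>a\<in>\<mu>. \<exists>b\<in>\<nu>. minf_cuntz_le A a b)"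

definition almost_unperforated :: "('a, 'm) calg_scheme \<Rightarrow> bool" where
  "almost_unperforated A \<longleftrightarrow> (\<forall>\<mu>\<in>W A. \<forall>\<nu>\<in>W A. \<forall>k\<ge>2.
     W_le A (W_multiple A k \<mu>) (W_multiple A (k - 1) \<nu>) \<longrightarrow> W_le A \<mu> \<nu>)"

definition dimension_function :: "('a, 'm) calg_scheme \<Rightarrow> ('a cuntz_class \<Rightarrow> ennreal) \<Rightarrow> bool" where
  "dimension_function A d \<longleftrightarrow> (\<forall>\<mu>\<in>W A. \<forall>\<nu>\<in>W A.
     d (W_add A \<mu> \<nu>) = d \<mu> + d \<nu> \<and> (W_le A \<mu> \<nu> \<longrightarrow> d \<mu> \<le> d \<nu>))"

definition minf_in_ideal ::
  "('a, 'm) calg_scheme \<Rightarrow> (nat \<Rightarrow> nat \<Rightarrow> 'a) \<Rightarrow> (nat \<Rightarrow> nat \<Rightarrow> 'a) \<Rightarrow> bool" where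
  "minf_in_ideal A a b \<longleftrightarrow>
     (\<forall>\<^sub>F n in sequentially. a \<in> closed_ideal (matrix_calg n A) hull {b})"

definition weak_strict_comparison :: "('a, 'm) calg_scheme \<Rightarrow> bool" where
  "weak_strict_comparison A \<longleftrightarrow> (\<forall>a\<in>minf_pos A. \<forall>b\<in>minf_pos A.
     minf_in_ideal A a b \<and>
     (\<forall>d. dimension_function A d \<and> d (W_class A b) = 1 \<longrightarrow> d (W_class A a) < d (W_class A b))
     \<longrightarrow> minf_cuntz_le A a b)"

text \<open>
  For \<open>a\<close> in \<open>M\<^sub>m(A)\<close> the matrix \<open>(a - \<epsilon>)\<^sub>+\<close> does not depend on the choice of \<open>m\<close>, because the
  function \<open>t \<mapsto> max (t - \<epsilon>) 0\<close> vanishes at 0.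
\<close>

definition weakly_almost_divisible :: "('a, 'm) calg_scheme \<Rightarrow> bool" where
  "weakly_almost_divisible A \<longleftrightarrow> (\<forall>m a. positive_elem (matrix_calg m A) a \<longrightarrow>
     (\<forall>n\<ge>1. \<forall>\<epsilon>>0. \<exists>\<eta>\<in>W A. W_le A (W_multiple A n \<eta>) (W_class A a) \<and>
        W_le A (W_class A (cutdown (matrix_calg m A) a \<epsilon>)) (W_multiple A (n + 1) \<eta>)))"


section \<open>Order zero maps and tracial \<open>\<Z>\<close>-absorption\<close>

definition calg_linear ::
  "('a, 'm) calg_scheme \<Rightarrow> ('b, 'n) calg_scheme \<Rightarrow> ('a \<Rightarrow> 'b) \<Rightarrow> bool" where
  "calg_linear B A \<phi> \<longleftrightarrow> (\<forall>x\<in>carrier B. \<phi> x \<in> carrier A \<and>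
     (\<forall>y\<in>carrier B. \<phi> (x \<oplus>\<^bsub>B\<^esub> y) = \<phi> x \<oplus>\<^bsub>A\<^esub> \<phi> y) \<and> (\<forall>c. \<phi> (c \<odot>\<^bsub>B\<^esub> x) = c \<odot>\<^bsub>A\<^esub> \<phi> x))"

definition cpc_order_zero ::
  "('a, 'm) calg_scheme \<Rightarrow> ('b, 'n) calg_scheme \<Rightarrow> ('a \<Rightarrow> 'b) \<Rightarrow> bool" where
  "cpc_order_zero B A \<phi> \<longleftrightarrow> calg_linear B A \<phi> \<and>
     (\<forall>k y. positive_elem (matrix_calg k B) y \<longrightarrow> positive_elem (matrix_calg k A) (\<lambda>i j. \<phi> (y i j))) \<and>
     (\<forall>y\<in>carrier B. nrm A (\<phi> y) \<le> nrm B y) \<and>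
     (\<forall>y z. positive_elem B y \<and> positive_elem B z \<and> y \<otimes>\<^bsub>B\<^esub> z = \<zero>\<^bsub>B\<^esub> \<longrightarrow> \<phi> y \<otimes>\<^bsub>A\<^esub> \<phi> z = \<zero>\<^bsub>A\<^esub>)"

abbreviation Mat :: "nat \<Rightarrow> (nat \<Rightarrow> nat \<Rightarrow> complex) calg" where
  "Mat n \<equiv> matrix_calg n complex_calg"

definition tracially_Z_absorbing :: "('a, 'm) calg_scheme \<Rightarrow> bool" where
  "tracially_Z_absorbing A \<longleftrightarrow> \<not> calg_iso A complex_calg \<and>
     (\<forall>x a F \<epsilon> n. positive_elem A x \<and> positive_elem A a \<and> a \<noteq> \<zero>\<^bsub>A\<^esub> \<and> finite F \<and> F \<subseteq> carrier A \<and> \<epsilon> > 0 \<and> n \<ge> 1 \<longrightarrow>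
       (\<exists>\<phi>. cpc_order_zero (Mat n) A \<phi> \<and>
         cuntz_le A
           (cutdown A (x \<otimes>\<^bsub>A\<^esub> x \<ominus>\<^bsub>A\<^esub> x \<otimes>\<^bsub>A\<^esub> \<phi> \<one>\<^bsub>Mat n\<^esub> \<otimes>\<^bsub>A\<^esub> x) \<epsilon>) a \<and>
         (\<forall>z\<in>carrier (Mat n). nrm (Mat n) z \<le> 1 \<longrightarrow>
            (\<forall>b\<in>F. nrm A (\<phi> z \<otimes>\<^bsub>A\<^esub> b \<ominus>\<^bsub>A\<^esub> b \<otimes>\<^bsub>A\<^esub> \<phi> z) < \<epsilon>))))"

end

theory Submission
  imports Defs
begin

text \<open>
 All computations take place in the free complex *-algebra over the carrier of \<open>A\<close>, which is a ring type,
 with the C*-seminorm \<open>N\<close> pulled back from the unitization; \<open>\<sim>\<close> is equality modulo its kernel.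

 Comparison: if \<open>k\<close> copies of \<open>a\<close> lie below \<open>k\<close> copies of \<open>b\<close> via a matrix \<open>c\<close>, and \<open>d \<noteq> 0\<close> is orthogonal to \<open>b\<close>,
 then \<open>a\<close> lies below \<open>b + d\<close>: implement \<open>c\<close> by the images of the matrix units under an almost central order zero
 map and put the tracially small rest below \<open>d\<close>. Since \<open>A\<close> has no minimal projection, the gap in
 \<open>k a \<le> (k - 1) b\<close> provides such a \<open>d\<close>. Divisibility: cut \<open>a\<close> down by the image of one diagonal matrix unit
 and absorb the tracially small rest. Both arguments need the properties for \<open>M\<^sub>\<infinity>(A)\<close>, which is
 again tracially Z-absorbing. Weak strict comparison follows from almost unperforation by extending states
 on preordered monoids.
\<close>

section \<open>Free complex star algebras\<close>

text \<open>The complex numbers satisfy the tracial condition too: order zero maps from larger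
  matrix algebras vanish there, and every nonzero positive scalar dominates all others. That
  \<open>A\<close> is not isomorphic to them serves to rule out minimal projections. This yields
  orthogonal pairs, hence arbitrarily small elements, below every nonzero positive element, and all
  room for tracial remainders is made from these. The remainder left by an order zero map lies below
  a prescribed nonzero \<open>d\<close>, but adding it to the main part costs a direct sum unless
  \<open>d\<close> is orthogonal to the dominating element. Hence comparison is proved for
  \<open>b + d\<close>, and the spare copy of \<open>b\<close> pays for carving out
  \<open>d\<close>. The union of the matrix algebras is not complete. The limits taken are limits of
  polynomials in a single element, so completeness is asked of some star subalgebra around each
  element, and one locale serves both \<open>A\<close> and its matrices. Equality holds only modulo
  the kernel of the seminorm; lifts and values of the functional calculus are nevertheless chosen
  exactly self-adjoint, so that rewriting with \<open>st\<close> remains unconditional.\<close>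

class star_alg = ring_1 +
 fixes sc :: "complex \<Rightarrow> 'a" and st :: "'a \<Rightarrow> 'a"
 assumes sc_add: "sc (a + b) = sc a + sc b"
  and sc_mult: "sc (a * b) = sc a * sc b"
  and sc_1 [simp]: "sc 1 = 1"
  and sc_comm: "sc a * x = x * sc a"
  and st_add [simp]: "st (x + y) = st x + st y"
  and st_mult [simp]: "st (x * y) = st y * st x"
  and st_st [simp]: "st (st x) = x"
  and st_sc [simp]: "st (sc a) = sc (cnj a)"

text \<open>Generators range over a whole type; those outside the carrier get the value zero once
  terms are evaluated. Zero and one are the scalars \<open>FSc 0\<close> and
  \<open>FSc 1\<close>.\<close>

datatype 'g fterm = FGen 'g | FSc complex | FAdd "'g fterm" "'g fterm" | FMul "'g fterm" "'g fterm"
 | FNeg "'g fterm" | FSt "'g fterm"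

text \<open>The congruence generated by the axioms of \<open>star_alg\<close>: any evaluation that
  respects these axioms descends to the quotient.\<close>

inductive feq :: "'g fterm \<Rightarrow> 'g fterm \<Rightarrow> bool" where
 f_refl: "feq x x"
| f_sym: "feq x y \<Longrightarrow> feq y x"
| f_trans: "feq x y \<Longrightarrow> feq y z \<Longrightarrow> feq x z"
| f_cong_add: "feq x x' \<Longrightarrow> feq y y' \<Longrightarrow> feq (FAdd x y) (FAdd x' y')"
| f_cong_mul: "feq x x' \<Longrightarrow> feq y y' \<Longrightarrow> feq (FMul x y) (FMul x' y')"
| f_cong_neg: "feq x x' \<Longrightarrow> feq (FNeg x) (FNeg x')"
| f_cong_st: "feq x x' \<Longrightarrow> feq (FSt x) (FSt x')"
| f_add_assoc: "feq (FAdd (FAdd x y) z) (FAdd x (FAdd y z))"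
| f_add_comm: "feq (FAdd x y) (FAdd y x)"
| f_add_0: "feq (FAdd (FSc 0) x) x"
| f_add_neg: "feq (FAdd (FNeg x) x) (FSc 0)"
| f_mul_assoc: "feq (FMul (FMul x y) z) (FMul x (FMul y z))"
| f_mul_1l: "feq (FMul (FSc 1) x) x"
| f_mul_1r: "feq (FMul x (FSc 1)) x"
| f_distl: "feq (FMul (FAdd x y) z) (FAdd (FMul x z) (FMul y z))"
| f_distr: "feq (FMul x (FAdd y z)) (FAdd (FMul x y) (FMul x z))"
| f_sc_add: "feq (FSc (a + b)) (FAdd (FSc a) (FSc b))"
| f_sc_mult: "feq (FSc (a * b)) (FMul (FSc a) (FSc b))"
| f_sc_comm: "feq (FMul (FSc a) x) (FMul x (FSc a))"
| f_st_add: "feq (FSt (FAdd x y)) (FAdd (FSt x) (FSt y))"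
| f_st_mult: "feq (FSt (FMul x y)) (FMul (FSt y) (FSt x))"
| f_st_st: "feq (FSt (FSt x)) x"
| f_st_sc: "feq (FSt (FSc a)) (FSc (cnj a))"

lemma equivp_feq: "equivp feq" by (rule equivpI) (auto intro: feq.f_refl feq.f_sym feq.f_trans simp: reflp_def symp_def transp_def)

primrec fch :: "'g fterm \<Rightarrow> complex" where
 "fch (FGen g) = 0"
| "fch (FSc c) = c"
| "fch (FAdd x y) = fch x + fch y"
| "fch (FMul x y) = fch x * fch y"
| "fch (FNeg x) = - fch x"
| "fch (FSt x) = cnj (fch x)"

lemma feq_fch: "feq x y \<Longrightarrow> fch x = fch y" by (induction rule: feq.induct) (auto simp: algebra_simps)

quotient_type 'g fa = "'g fterm" / feq by (rule equivp_feq)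

lift_definition gen :: "'g \<Rightarrow> 'g fa" is FGen .

text \<open>It becomes the character of the unitization whose kernel is the algebra.\<close>

lift_definition ch :: "'g fa \<Rightarrow> complex" is fch by (rule feq_fch)

instantiation fa :: (type) star_alg
begin
lift_definition zero_fa :: "'a fa" is "FSc 0" .
lift_definition one_fa :: "'a fa" is "FSc 1" .
lift_definition plus_fa :: "'a fa \<Rightarrow> 'a fa \<Rightarrow> 'a fa" is FAdd by (rule feq.f_cong_add)
lift_definition times_fa :: "'a fa \<Rightarrow> 'a fa \<Rightarrow> 'a fa" is FMul by (rule feq.f_cong_mul)
lift_definition uminus_fa :: "'a fa \<Rightarrow> 'a fa" is FNeg by (rule feq.f_cong_neg)
lift_definition minus_fa :: "'a fa \<Rightarrow> 'a fa \<Rightarrow> 'a fa" is "\<lambda>x y. FAdd x (FNeg y)" by (intro feq.f_cong_add feq.f_cong_neg)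
lift_definition sc_fa :: "complex \<Rightarrow> 'a fa" is FSc .
lift_definition st_fa :: "'a fa \<Rightarrow> 'a fa" is FSt by (rule feq.f_cong_st)
instance
proof
 fix a b c :: "'a fa" and r s :: complex
 \<comment> \<open>The scalar part \<open>fch\<close> is invariant under the congruence and
   separates the two.\<close>
 show "(0::'a fa) \<noteq> 1" by transfer (metis feq_fch fch.simps(2) zero_neq_one)
 show "a + b + c = a + (b + c)" by transfer (rule feq.f_add_assoc)
 show "a + b = b + a" by transfer (rule feq.f_add_comm)
 show "0 + a = a" by transfer (rule feq.f_add_0)
 show "- a + a = 0" by transfer (rule feq.f_add_neg)
 show "a - b = a + - b" by transfer (rule feq.f_refl)
 show "a * b * c = a * (b * c)" by transfer (rule feq.f_mul_assoc)
 show "1 * a = a" by transfer (rule feq.f_mul_1l)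
 show "a * 1 = a" by transfer (rule feq.f_mul_1r)
 show "(a + b) * c = a * c + b * c" by transfer (rule feq.f_distl)
 show "a * (b + c) = a * b + a * c" by transfer (rule feq.f_distr)
 show "sc (r + s) = (sc r + sc s :: 'a fa)" by transfer (rule feq.f_sc_add)
 show "sc (r * s) = (sc r * sc s :: 'a fa)" by transfer (rule feq.f_sc_mult)
 show "sc 1 = (1 :: 'a fa)" by transfer (rule feq.f_refl)
 show "sc r * a = a * sc r" by transfer (rule feq.f_sc_comm)
 show "st (a + b) = st a + st b" by transfer (rule feq.f_st_add)
 show "st (a * b) = st b * st a" by transfer (rule feq.f_st_mult)
 show "st (st a) = a" by transfer (rule feq.f_st_st)
 show "st (sc r) = (sc (cnj r) :: 'a fa)" by transfer (rule feq.f_st_sc)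
qed
end

lemma ch_simps [simp]: "ch (x + y) = ch x + ch y" "ch (x * y) = ch x * ch y" "ch (- x) = - ch x"
 "ch (x - y) = ch x - ch y" "ch (sc c) = c" "ch (st x) = cnj (ch x)" "ch (gen g) = 0" "ch 0 = 0" "ch 1 = 1" by (transfer; simp)+

context star_alg
begin

lemma sc_0 [simp]: "sc 0 = 0" using sc_add[of 0 0] by simp

lemma sc_neg: "sc (- a) = - sc a" using sc_add[of a "- a"] by (simp add: eq_neg_iff_add_eq_0 add.commute)

lemma sc_diff: "sc (a - b) = sc a - sc b" using sc_add[of a "- b"] by (simp add: sc_neg)

lemma st_0 [simp]: "st 0 = 0" using st_sc[of 0] by simp

lemma st_1 [simp]: "st 1 = 1" using st_sc[of 1] by simp

lemma st_neg [simp]: "st (- x) = - st x" using st_add[of x "- x"] by (simp add: eq_neg_iff_add_eq_0 add.commute)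

lemma st_diff [simp]: "st (x - y) = st x - st y" using st_add[of x "- y"] by simp

lemma st_sum [simp]: "st (sum f I) = (\<Sum>i\<in>I. st (f i))" by (induction I rule: infinite_finite_induct) auto

lemma st_power [simp]: "st (x ^ n) = st x ^ n" by (induction n) (auto simp: power_commutes)

lemma sc_left_comm: "x * (sc a * y) = sc a * (x * y)" by (metis mult_assoc sc_comm)

end

section \<open>Locally complete C*-seminorms\<close>

definition pe :: "complex poly \<Rightarrow> 'r::star_alg \<Rightarrow> 'r" where
 "pe p x = fold_coeffs (\<lambda>a b. sc a + x * b) p 0"

lemma pe_0 [simp]: "pe 0 x = 0" by (simp add: pe_def)

lemma pe_pCons [simp]: "pe (pCons a p) x = sc a + x * pe p x" by (cases "p = 0 \<and> a = 0") (auto simp: pe_def)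

lemma pe_add: "pe (p + q) x = pe p x + pe q x"
proof (induction p arbitrary: q)
 case (pCons a p)
 show ?case using pCons.IH by (cases q rule: pCons_cases) (simp add: sc_add distrib_left)
qed simp

lemma pe_smult: "pe (Polynomial.smult c p) x = sc c * pe p x" by (induction p) (simp_all add: sc_mult distrib_left sc_left_comm)

lemma pe_commute: "x * y = y * x \<Longrightarrow> pe p x * y = y * pe p x"
proof (induction p)
 case (pCons a p)
 have "x * pe p x * y = x * (y * pe p x)" using pCons by (simp add: mult.assoc)
 also have "... = y * (x * pe p x)" using pCons.prems by (metis mult.assoc)
 finally show ?case by (simp add: distrib_left distrib_right sc_comm)
qed simp

lemma pe_mult: "pe (p * q) x = pe p x * pe q x" by (induction p) (simp_all add: pe_add pe_smult algebra_simps)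

abbreviation (input) cp :: "real poly \<Rightarrow> complex poly" where
 "cp p \<equiv> map_poly complex_of_real p"

abbreviation rsc :: "real \<Rightarrow> 'r::star_alg" where
 "rsc r \<equiv> sc (complex_of_real r)"

definition rp :: "real poly \<Rightarrow> 'r::star_alg \<Rightarrow> 'r" where
 "rp p x = pe (cp p) x"

lemma rp_0 [simp]: "rp 0 x = 0" by (simp add: rp_def)

lemma rp_pCons [simp]: "rp (pCons a p) x = rsc a + x * rp p x" by (simp add: rp_def map_poly_pCons)

lemma rp_add: "rp (p + q) x = rp p x + rp q x"
proof (induction p arbitrary: q)
 case (pCons a p)
 show ?case using pCons.IH by (cases q rule: pCons_cases) (simp add: sc_add distrib_left)
qed simp

lemma rp_smult: "rp (Polynomial.smult c p) x = rsc c * rp p x" by (induction p) (simp_all add: sc_mult distrib_left sc_left_comm)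

lemma rp_minus: "rp (- p) x = - rp p x" using rp_smult[of "-1" p x] by (simp add: sc_neg)

lemma rp_diff: "rp (p - q) x = rp p x - rp q x" using rp_add[of p "- q" x] by (simp add: rp_minus)

lemma rp_mult: "rp (p * q) x = rp p x * rp q x" by (induction p) (simp_all add: rp_add rp_smult algebra_simps)

lemma rp_st: "st x = x \<Longrightarrow> st (rp p x) = rp p x"
proof -
 assume x: "st x = x"
 have "rp p x * x = x * rp p x"
  unfolding rp_def by (rule pe_commute) simp
 moreover have "\<And>p. rp p x * x = x * rp p x"
  unfolding rp_def by (rule pe_commute) simp
 ultimately show ?thesis using x by (induction p) simp_all
qed

lemma poly_cp: "poly (cp p) (complex_of_real t) = complex_of_real (poly p t)" by (induction p) (simp_all add: map_poly_pCons)

lemma ch_rp: "ch x = complex_of_real t \<Longrightarrow> ch (rp p x) = complex_of_real (poly p t)" by (induction p) simp_all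

lemma Weierstrass_poly:
 assumes "continuous_on {a..b} f" "e > 0"
 obtains p where "\<And>t. t \<in> {a..b} \<Longrightarrow> \<bar>poly p t - f t\<bar> < (e::real)"
proof -
 obtain g where g: "real_polynomial_function g" "\<And>x. x \<in> {a..b} \<Longrightarrow> \<bar>f x - g x\<bar> < e"
  using Stone_Weierstrass_real_polynomial_function[of "{a..b}" f e] assms by auto
 obtain c n where "g = (\<lambda>x. \<Sum>i\<le>n. c i * x ^ i)" using g(1) real_polynomial_function_iff_sum by blast
 then have "poly (\<Sum>i\<le>n. Polynomial.monom (c i) i) t = g t" for t by (simp add: poly_sum poly_monom)
 then show ?thesis using g(2) by (intro that[of "\<Sum>i\<le>n. Polynomial.monom (c i) i"]) (auto simp: abs_minus_commute)
qed

text \<open>A unital star subalgebra that is complete for the seminorm, limits being understood up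
  to distance zero. Neumann series and functional calculus of an element of \<open>U\<close> stay in
  \<open>U\<close>.\<close>

definition csub :: "('r::star_alg \<Rightarrow> real) \<Rightarrow> 'r set \<Rightarrow> bool" where
 "csub N U \<longleftrightarrow> (\<forall>a\<in>U. \<forall>b\<in>U. a + b \<in> U \<and> a * b \<in> U) \<and> range sc \<subseteq> U \<and> (\<forall>a\<in>U. st a \<in> U) \<and>
   (\<forall>s. range s \<subseteq> U \<and> (\<forall>e>0. \<exists>K. \<forall>m\<ge>K. \<forall>n\<ge>(K::nat). N (s m - s n) < e)
    \<longrightarrow> (\<exists>y\<in>U. (\<lambda>n. N (s n - y)) \<longlonglongrightarrow> 0))"

lemma csub_closed:
 assumes "csub N U"
 shows "a \<in> U \<Longrightarrow> b \<in> U \<Longrightarrow> a + b \<in> U" "a \<in> U \<Longrightarrow> b \<in> U \<Longrightarrow> a * b \<in> U" "sc c \<in> U" "a \<in> U \<Longrightarrow> st a \<in> U"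
  "0 \<in> U" "1 \<in> U" using assms unfolding csub_def by (auto simp: image_subset_iff) (metis sc_0, metis sc_1)

lemma csub_complete:
 assumes "csub N U" "\<And>n. s n \<in> U" "\<And>e. e > 0 \<Longrightarrow> \<exists>K. \<forall>m\<ge>K. \<forall>n\<ge>(K::nat). N (s m - s n) < e"
 obtains y where "y \<in> U" "(\<lambda>n. N (s n - y)) \<longlonglongrightarrow> 0" using assms unfolding csub_def by (metis image_subsetI)

text \<open>That the character is bounded by \<open>N\<close> forces \<open>N\<close> to be
  nonnegative with \<open>N 1 = 1\<close>, and makes \<open>ch\<close> constant on classes modulo
  the kernel of \<open>N\<close>.\<close>

locale lcs =
 fixes N :: "'g fa \<Rightarrow> real"
 assumes N_triangle: "N (x + y) \<le> N x + N y"
  and N_mult: "N (x * y) \<le> N x * N y"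
  and N_scale [simp]: "N (sc c * x) = cmod c * N x"
  and N_cstar: "N (st x * x) = (N x)\<^sup>2"
  and ch_le: "cmod (ch x) \<le> N x"
  and local_complete: "\<exists>U. x \<in> U \<and> csub N U"
begin

lemma N_nonneg [simp]: "0 \<le> N x" using ch_le[of x] norm_ge_zero order_trans by blast

lemma N_0 [simp]: "N 0 = 0" using N_scale[of 0 0] by simp

lemma N_neg [simp]: "N (- x) = N x" using N_scale[of "-1" x] by (simp add: sc_neg)

lemma N_diff: "N (x - y) \<le> N x + N y" using N_triangle[of x "- y"] by simp

lemma N_minus_commute: "N (x - y) = N (y - x)" using N_neg[of "x - y"] by simp

lemma N_triangle2: "N (x - z) \<le> N (x - y) + N (y - z)" using N_triangle[of "x - y" "y - z"] by simp

lemma N_1 [simp]: "N 1 = 1"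
proof -
 have "N 1 = (N 1)\<^sup>2" using N_cstar[of 1] by simp
 moreover have "1 \<le> N 1" using ch_le[of 1] by simp
 ultimately show ?thesis by (simp add: power2_eq_square)
qed

lemma N_sc [simp]: "N (sc c) = cmod c" using N_scale[of c 1] by simp

lemma N_st [simp]: "N (st x) = N x"
proof -
 have *: "N x \<le> N (st x)" for x
 proof (cases "N x = 0")
  case False
  have "N x * N x \<le> N (st x) * N x" using N_cstar[of x] N_mult[of "st x" x] by (simp add: power2_eq_square)
  then show ?thesis using False by (simp add: mult_le_cancel_right) (use N_nonneg[of x] in linarith)
 qed simp
 show ?thesis using *[of x] *[of "st x"] by simp
qed

lemma N_cstar': "N (x * st x) = (N x)\<^sup>2" using N_cstar[of "st x"] by simp

lemma N_sq: "st x = x \<Longrightarrow> N (x * x) = (N x)\<^sup>2" using N_cstar[of x] by simp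

lemma N_sum: "N (sum f I) \<le> (\<Sum>i\<in>I. N (f i))" by (induction rule: infinite_finite_induct) (auto intro: order_trans[OF N_triangle])

lemma N_power: "N (x ^ n) \<le> N x ^ n"
proof (induction n)
 case (Suc n)
 show ?case using order_trans[OF N_mult[of x "x ^ n"] mult_left_mono[OF Suc]] by simp
qed simp

lemma N_reverse: "\<bar>N x - N y\<bar> \<le> N (x - y)" using N_triangle[of "x - y" y] N_triangle[of "y - x" x] N_minus_commute[of x y] by simp

lemma N_mult_le: "N x \<le> a \<Longrightarrow> N y \<le> b \<Longrightarrow> N (x * y) \<le> a * b" by (rule order_trans[OF N_mult]) (meson N_nonneg mult_mono order_trans)

lemma N_mult3_le: "N x \<le> a \<Longrightarrow> N y \<le> b \<Longrightarrow> N z \<le> c \<Longrightarrow> N (x * y * z) \<le> a * b * c" by (intro N_mult_le)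

lemma N_add_le: "N x \<le> a \<Longrightarrow> N y \<le> b \<Longrightarrow> N (x + y) \<le> a + b" by (rule order_trans[OF N_triangle]) simp

lemma N_diff_le: "N x \<le> a \<Longrightarrow> N y \<le> b \<Longrightarrow> N (x - y) \<le> a + b" by (rule order_trans[OF N_diff]) simp

lemma N_trans: "N (x - y) \<le> a \<Longrightarrow> N (y - z) \<le> b \<Longrightarrow> N (x - z) \<le> a + b" by (rule order_trans[OF N_triangle2[of x z y]]) simp

lemma N_trans3: "N (x - y) \<le> a \<Longrightarrow> N (y - z) \<le> b \<Longrightarrow> N (z - w) \<le> c \<Longrightarrow> N (x - w) \<le> a + b + c" by (intro N_trans[of x z _ w] N_trans[of x y a z b])

lemma N_mult_diff: "N (a * b - a' * b') \<le> N a * N (b - b') + N (a - a') * N b'"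
proof -
 have "a * b - a' * b' = a * (b - b') + (a - a') * b'" by (simp add: algebra_simps)
 then show ?thesis by (metis N_add_le N_mult)
qed

definition eqv :: "'g fa \<Rightarrow> 'g fa \<Rightarrow> bool" (infix "\<sim>" 50) where
 "x \<sim> y \<longleftrightarrow> N (x - y) = 0"

lemma eqv_refl [simp, intro]: "x \<sim> x" by (simp add: eqv_def)

lemma eqv_sym: "x \<sim> y \<Longrightarrow> y \<sim> x" by (simp add: eqv_def N_minus_commute)

lemma eqv_trans [trans]: "x \<sim> y \<Longrightarrow> y \<sim> z \<Longrightarrow> x \<sim> z"
 unfolding eqv_def using N_triangle2[of x z y] N_nonneg[of "x - z"] by linarith

lemma eqv_N: "x \<sim> y \<Longrightarrow> N x = N y"
 unfolding eqv_def using N_reverse[of x y] by linarith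

lemma eqv_0_iff: "x \<sim> 0 \<longleftrightarrow> N x = 0" by (simp add: eqv_def)

lemma eqv_le: "(\<And>e. e > 0 \<Longrightarrow> N (x - y) \<le> e) \<Longrightarrow> x \<sim> y"
 unfolding eqv_def by (meson N_nonneg antisym field_le_epsilon[of _ 0, simplified])

lemma eqv_add: "x \<sim> x' \<Longrightarrow> y \<sim> y' \<Longrightarrow> x + y \<sim> x' + y'"
 unfolding eqv_def using N_triangle[of "x - x'" "y - y'"] N_nonneg[of "x + y - (x' + y')"] by (simp add: algebra_simps)

lemma eqv_neg: "x \<sim> x' \<Longrightarrow> - x \<sim> - x'"
 unfolding eqv_def using N_neg[of "x - x'"] by simp

lemma eqv_diff: "x \<sim> x' \<Longrightarrow> y \<sim> y' \<Longrightarrow> x - y \<sim> x' - y'" using eqv_add[OF _ eqv_neg, of x x' y y'] by simp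

lemma eqv_mult: "x \<sim> x' \<Longrightarrow> y \<sim> y' \<Longrightarrow> x * y \<sim> x' * y'"
 unfolding eqv_def using N_mult_diff[of x y x' y'] N_nonneg[of "x * y - x' * y'"] by simp

lemma eqv_st: "x \<sim> x' \<Longrightarrow> st x \<sim> st x'"
 unfolding eqv_def by (metis N_st st_diff)

lemma eqv_sum: "(\<And>i. i \<in> I \<Longrightarrow> f i \<sim> g i) \<Longrightarrow> sum f I \<sim> sum g I" by (induction rule: infinite_finite_induct) (auto intro: eqv_add)

lemma eqv_ch: "x \<sim> y \<Longrightarrow> ch x = ch y"
 unfolding eqv_def using ch_le[of "x - y"] by simp

lemma N_cong: "x \<sim> x' \<Longrightarrow> y \<sim> y' \<Longrightarrow> N (x - y) = N (x' - y')" by (intro eqv_N eqv_diff)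

lemma eqv_0_multl: "x \<sim> 0 \<Longrightarrow> x * y \<sim> 0" using eqv_mult[of x 0 y y] by simp

lemma eqv_0_multr: "y \<sim> 0 \<Longrightarrow> x * y \<sim> 0" using eqv_mult[of x x y 0] by simp

lemma st_mult_0: "st x * x \<sim> 0 \<Longrightarrow> x \<sim> 0" by (simp add: eqv_0_iff N_cstar)

definition invert :: "'g fa \<Rightarrow> bool" where
 "invert x \<longleftrightarrow> (\<exists>y. x * y \<sim> 1 \<and> y * x \<sim> 1)"

lemma invert_sc: "c \<noteq> 0 \<Longrightarrow> invert (sc c)"
 unfolding invert_def by (rule exI[of _ "sc (inverse c)"]) (simp flip: sc_mult)

lemma invert_mult: assumes "invert x" "invert y" shows "invert (x * y)"
proof -
 obtain x' y' where *: "x * x' \<sim> 1" "x' * x \<sim> 1" "y * y' \<sim> 1" "y' * y \<sim> 1" using assms unfolding invert_def by blast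
 have "x * (y * y') * x' \<sim> x * 1 * x'" by (intro eqv_mult * eqv_refl)
 moreover have "y' * (x' * x) * y \<sim> y' * 1 * y" by (intro eqv_mult * eqv_refl)
 ultimately show ?thesis
  unfolding invert_def using * by (intro exI[of _ "y' * x'"]) (auto simp: mult.assoc intro: eqv_trans)
qed

lemma invert_left_right: assumes "x * y \<sim> 1" "z * x \<sim> 1" shows "invert x"
proof -
 have "z * (x * y) \<sim> z * 1" "z * x * y \<sim> 1 * y" by (intro eqv_mult assms eqv_refl)+
 then have "y * x \<sim> z * x" by (metis eqv_trans eqv_sym mult.assoc mult_1 mult_1_right eqv_mult eqv_refl)
 then show ?thesis
  unfolding invert_def using assms eqv_trans by blast
qed

lemma invert_scale: "c \<noteq> 0 \<Longrightarrow> invert (sc c * x) \<longleftrightarrow> invert x"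
proof -
 assume c: "c \<noteq> 0"
 have "invert (sc (inverse c) * (sc c * x))" if "invert (sc c * x)" by (intro invert_mult invert_sc that) (use c in simp)
 moreover have "sc (inverse c) * (sc c * x) = x" using c by (simp flip: sc_mult mult.assoc)
 ultimately show ?thesis using c by (auto intro!: invert_mult invert_sc)
qed

text \<open>The partial sums of the geometric series are Cauchy inside a complete subalgebra
  containing \<open>x\<close>. Multiplying them by \<open>1 - x\<close> from either side telescopes,
  so the limit is a two-sided inverse modulo the kernel.\<close>

lemma neumann:
 assumes "N x < 1"
 shows "invert (1 - x)"
proof -
 obtain U where "x \<in> U" and U: "csub N U" using local_complete by blast
 define s where "s n = (\<Sum>i<n. x ^ i)" for n
 have xU: "x ^ i \<in> U" for i using \<open>x \<in> U\<close> by (induction i) (auto intro: csub_closed[OF U])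
 then have "s n \<in> U" for n
  unfolding s_def by (induction n) (auto intro: csub_closed[OF U])
 moreover have "\<exists>K. \<forall>m\<ge>K. \<forall>n\<ge>K. N (s m - s n) < e" if e: "e > 0" for e
 proof -
  have "Cauchy (\<lambda>n. \<Sum>i<n. N x ^ i)" using assms by (intro convergent_Cauchy) (simp add: summable_iff_convergent[symmetric])
  from metric_CauchyD[OF this e] obtain K where
   "\<forall>m\<ge>K. \<forall>n\<ge>K. dist (\<Sum>i<m. N x ^ i) (\<Sum>i<n. N x ^ i) < e" by blast
  then have K: "\<And>m n. m \<ge> K \<Longrightarrow> n \<ge> K \<Longrightarrow> \<bar>(\<Sum>i<m. N x ^ i) - (\<Sum>i<n. N x ^ i)\<bar> < e" by (simp add: dist_real_def)
  have *: "N (s m - s n) \<le> \<bar>(\<Sum>i<m. N x ^ i) - (\<Sum>i<n. N x ^ i)\<bar>" if "n \<le> m" for m n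
  proof -
   have "s m - s n = (\<Sum>i=n..<m. x ^ i)" "(\<Sum>i<m. N x ^ i) - (\<Sum>i<n. N x ^ i) = (\<Sum>i=n..<m. N x ^ i)"
    unfolding s_def using that by (simp_all add: lessThan_atLeast0 sum_diff_nat_ivl)
   moreover have "N (\<Sum>i=n..<m. x ^ i) \<le> (\<Sum>i=n..<m. N x ^ i)" by (rule order_trans[OF N_sum sum_mono]) (rule N_power)
   ultimately show ?thesis by simp
  qed
  show ?thesis
  proof (intro exI[of _ K] allI impI)
   fix m n assume "K \<le> m" "K \<le> n"
   then show "N (s m - s n) < e" using *[of n m] *[of m n] K[of n m] N_minus_commute[of "s m" "s n"] by (cases "n \<le> m") linarith+
  qed
 qed
 ultimately obtain y where y: "(\<lambda>n. N (s n - y)) \<longlonglongrightarrow> 0" by (rule csub_complete[OF U, of s])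
 have eq: "(1 - x) * s n = 1 - x ^ n" "s n * (1 - x) = 1 - x ^ n" for n
 proof -
  have s: "s (Suc n) = s n + x ^ n" for n by (simp add: s_def)
  show "(1 - x) * s n = 1 - x ^ n" by (induction n) (simp add: s_def, simp add: s distrib_left, simp add: algebra_simps)
  show "s n * (1 - x) = 1 - x ^ n" by (induction n) (simp add: s_def, simp add: s distrib_right, simp add: algebra_simps power_commutes)
 qed
 have lim: "(\<lambda>n. N (1 - x) * N (s n - y) + N x ^ n) \<longlonglongrightarrow> N (1 - x) * 0 + 0" using assms by (intro tendsto_intros y LIMSEQ_power_zero) simp
 have "N ((1 - x) * y - 1) \<le> N (1 - x) * N (s n - y) + N x ^ n" for n
 proof -
  have "(1 - x) * y - 1 = - ((1 - x) * (s n - y)) - x ^ n" using eq(1)[of n] by (simp add: algebra_simps)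
  also have "N ... \<le> N (1 - x) * N (s n - y) + N x ^ n" by (intro N_diff_le N_power) (simp add: N_mult)
  finally show ?thesis .
 qed
 moreover have "N (y * (1 - x) - 1) \<le> N (1 - x) * N (s n - y) + N x ^ n" for n
 proof -
  have "y * (1 - x) - 1 = - ((s n - y) * (1 - x)) - x ^ n" using eq(2)[of n] by (simp add: algebra_simps)
  also have "N ... \<le> N (1 - x) * N (s n - y) + N x ^ n" by (intro N_diff_le N_power) (simp add: N_mult mult.commute[of "N (1 - x)"])
  finally show ?thesis .
 qed
 ultimately have "N ((1 - x) * y - 1) \<le> 0" "N (y * (1 - x) - 1) \<le> 0" using LIMSEQ_le_const[OF lim] by simp_all
 then show ?thesis
  unfolding invert_def using eqv_def N_nonneg antisym by blast
qed

lemma neumann_sc: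
 assumes "N x < cmod c"
 shows "invert (x - sc c)"
proof -
 have c: "c \<noteq> 0" using order_le_less_trans[OF N_nonneg assms] by force
 then have "invert (1 - sc (inverse c) * x)" using assms by (intro neumann) (simp add: norm_divide divide_simps)
 then have "invert (sc (- c) * (1 - sc (inverse c) * x))" using c by (subst invert_scale) auto
 then show ?thesis using c by (simp add: right_diff_distrib sc_neg flip: mult.assoc sc_mult)
qed

text \<open>Arens' trick: translating by \<open>in\<close> for large \<open>n\<close>.\<close>

lemma selfadjoint_invert:
 assumes "st x = x" "Im z \<noteq> 0"
 shows "invert (x - sc z)"
proof (rule ccontr)
 assume not: "\<not> invert (x - sc z)"
 define y where "y = x - rsc (Re z)"
 \<comment> \<open>This \<open>n\<close> turns the cross term \<open>2 * Im z * n\<close> into twice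
   the square of \<open>N y\<close>, more than the right-hand side of the final estimate
   allows.\<close>
 define n where "n = (N y)\<^sup>2 / Im z"
 define w where "w = y + sc (\<i> * n)"
 have sy: "st y = y" by (simp add: y_def assms)
 have "sc (\<i> * complex_of_real n) * sc (\<i> * complex_of_real n) = (- sc (n * n) :: 'g fa)" by (simp add: algebra_simps flip: sc_mult sc_neg)
 then have ww: "st w * w = y * y + sc (n * n)"
  unfolding w_def by (simp add: sy distrib_left left_diff_distrib sc_comm[of _ y] sc_neg)
 have "x - sc z = w - sc (\<i> * (Im z + n))"
  unfolding w_def y_def by (subst complex_eq[of z]) (simp add: sc_add distrib_left)
 then have "(Im z + n)\<^sup>2 \<le> (N w)\<^sup>2"
  using not neumann_sc[of w "\<i> * (Im z + n)"] norm_ii norm_mult norm_of_real mult_1 by (metis abs_ge_zero linorder_not_le power2_abs power_mono)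
 also have "... = N (st w * w)" by (simp add: N_cstar)
 also have "st w * w = y * y + sc (n * n)" by (rule ww)
 also have "N ... \<le> N y * N y + n * n" by (intro N_add_le N_mult) (metis N_sc norm_of_real abs_mult abs_mult_self_eq order_refl)
 finally have "(Im z)\<^sup>2 + 2 * Im z * n \<le> (N y)\<^sup>2" by (simp add: power2_eq_square algebra_simps)
 moreover have "Im z * n = (N y)\<^sup>2" using assms(2) by (simp add: n_def)
 ultimately have "(Im z)\<^sup>2 \<le> 0" using zero_le_power2[of "N y"] unfolding mult.assoc by linarith
 then show False using assms(2) by simp
qed

end

section \<open>Spectra of self-adjoint elements and continuous functional calculus\<close>

context lcs
begin

text \<open>The C*-identity gives norm one for the exponents \<open>2 ^ k\<close>; since
  \<open>n \<le> 2 ^ n\<close>, submultiplicativity leaves no room for a smaller norm of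
  \<open>h ^ n\<close>.\<close>

lemma N_power_sa:
 assumes "st h = h" "N h = 1"
 shows "N (h ^ n) = 1"
proof -
 have *: "N (h ^ 2 ^ k) = 1" for k
 proof (induction k)
  case (Suc k)
  then show ?case using N_sq[of "h ^ 2 ^ k"] assms(1) by (simp add: mult_2 power_add)
 qed (use assms in simp)
 have "h ^ 2 ^ n = h ^ n * h ^ (2 ^ n - n)" by (simp flip: power_add)
 then have "1 \<le> N (h ^ n) * N (h ^ (2 ^ n - n))" using N_mult[of "h ^ n" "h ^ (2 ^ n - n)"] *[of n] by simp
 also have "... \<le> N (h ^ n) * 1" using N_power[of h "2 ^ n - n"] assms(2) by (intro mult_left_mono) auto
 finally show ?thesis using N_power[of h n] assms(2) by simp
qed

text \<open>For the normal element \<open>z = x + i y\<close> the right-hand side is the norm of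
  \<open>st z * z\<close>, and the real part of \<open>z\<close> is no larger in norm than
  \<open>z\<close>.\<close>

lemma N_sum_squares:
 assumes "st x = x" "st y = y" "x * y = y * x"
 shows "(N x)\<^sup>2 \<le> N (x * x + y * y)"
proof -
 define v z where "v = sc \<i> * y" and "z = x + v"
 have v: "st v = - v" "x * v = v * x" "v * v = - (y * y)"
 proof -
  show "st v = - v" by (simp add: v_def assms sc_neg sc_comm)
  show "x * v = v * x" by (simp add: v_def sc_left_comm assms(3) mult.assoc)
  have "v * v = sc \<i> * sc \<i> * (y * y)" by (metis v_def mult.assoc sc_comm)
  then show "v * v = - (y * y)" by (simp add: sc_neg flip: sc_mult)
 qed
 have "st z * z = x * x + y * y" by (simp add: z_def v assms algebra_simps)
 then have "N (x * x + y * y) = (N z)\<^sup>2" by (metis N_cstar)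
 moreover have "N x \<le> N z"
 proof -
  have "sc (1/2) * x + sc (1/2) * x = x" by (simp flip: distrib_right sc_add)
  then have "x = sc (1/2) * (z + st z)" by (simp add: z_def v assms distrib_left)
  then have "N x \<le> 1/2 * (N z + N (st z))" by (metis N_scale N_triangle mult_left_mono norm_divide norm_ge_zero norm_numeral norm_one)
  then show ?thesis by simp
 qed
 ultimately show ?thesis by simp
qed

text \<open>The identity \<open>(1 + w\<^sup>2)\<^sup>2 = (2 w)\<^sup>2 + (1 -
  w\<^sup>2)\<^sup>2\<close>, multiplied by \<open>z\<^sup>2\<close>, writes the square of the
  right-hand element as a sum of two commuting self-adjoint squares.\<close>

lemma N_doubling:
 assumes "st z = z" "st w = w" "w * z = z * w"
 shows "2 * N (z * w) \<le> N (z * (1 + w * w))"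
proof -
 define x y where "x = sc 2 * (z * w)" and "y = z * (1 - w * w)"
 have c: "w * (z * u) = z * (w * u)" for u by (metis assms(3) mult.assoc)
 have sa: "st x = x" "st y = y" "st (z * (1 + w * w)) = z * (1 + w * w)" by (simp_all add: x_def y_def assms c algebra_simps sc_comm)
 have two: "sc 2 * u = u + u" for u :: "'g fa"
 proof -
  have "sc (1 + 1) * u = u + u" by (simp only: sc_add sc_1 distrib_right mult_1_left)
  then show ?thesis by simp
 qed
 have "(z * (1 + w * w)) * (z * (1 + w * w)) = x * x + y * y" by (simp add: x_def y_def two assms c algebra_simps)
 moreover have "x * y = y * x" by (simp add: x_def y_def assms c algebra_simps sc_left_comm)
 ultimately have "(N x)\<^sup>2 \<le> (N (z * (1 + w * w)))\<^sup>2" using N_sum_squares[OF sa(1,2)] N_sq[OF sa(3)] by simp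
 then have "N x \<le> N (z * (1 + w * w))" by (rule power2_le_imp_le) simp
 then show ?thesis by (simp add: x_def)
qed

text \<open>The partial products of \<open>\<Prod>\<^sub>j (1 + h\<^bsup>2\<^sup>j\<^esup>h\<^bsup>2\<^sup>j\<^esup>)\<close> would be bounded if
 \<open>1 - h\<^sup>2\<close> were invertible, but their norms at least double in each step.\<close>

lemma norm_one_not_invert:
 assumes "st h = h" "N h = 1"
 shows "\<not> (invert (1 - h) \<and> invert (1 + h))"
proof
 assume "invert (1 - h) \<and> invert (1 + h)"
 then have "invert ((1 - h) * (1 + h))" by (intro invert_mult) auto
 then obtain k where k: "k * (1 - h * h) \<sim> 1"
  unfolding invert_def by (auto simp: algebra_simps)
 define P where "P = rec_nat 1 (\<lambda>k p. p * (1 + h ^ 2 ^ k * h ^ 2 ^ k))"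
 have P: "P 0 = 1" "P (Suc k) = P k * (1 + h ^ 2 ^ k * h ^ 2 ^ k)" for k by (simp_all add: P_def)
 have comm: "P k * h ^ m = h ^ m * P k" for k m
 proof (induction k)
  case (Suc k)
  have "P (Suc k) * h ^ m = P k * (h ^ m * (1 + h ^ 2 ^ k * h ^ 2 ^ k))" by (simp add: P algebra_simps flip: power_add)
  also have "... = h ^ m * P (Suc k)" using Suc by (metis P(2) mult.assoc)
  finally show ?case .
 qed (simp add: P)
 have st_P: "st (P k) = P k" for k by (induction k) (use comm assms in \<open>simp_all add: P algebra_simps flip: power_add\<close>)
 \<comment> \<open>The product telescopes, so a left inverse of \<open>1 - h * h\<close> bounds all
   \<open>P k\<close> by one constant.\<close>
 have tele: "(1 - h * h) * P k = 1 - h ^ 2 ^ k * h ^ 2 ^ k" for k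
 proof (induction k)
  case (Suc k)
  define u where "u = h ^ 2 ^ k"
  have "(1 - h * h) * P (Suc k) = (1 - u * u) * (1 + u * u)" using Suc by (simp add: P u_def flip: mult.assoc)
  also have "... = 1 - (u * u) * (u * u)" by (simp add: algebra_simps)
  finally show ?case by (simp add: u_def mult_2 flip: power_add)
 qed (simp add: P)
 have "N (P k) \<le> N k' * 2" if "k' * (1 - h * h) \<sim> 1" for k k'
 proof -
  have "k' * (1 - h * h) * P k \<sim> 1 * P k" by (intro eqv_mult that eqv_refl)
  then have "N (P k) = N (k' * (1 - h ^ 2 ^ k * h ^ 2 ^ k))" using eqv_N tele by (metis mult.assoc mult_1)
  also have "... \<le> N k' * (1 + 1)" by (intro N_mult_le N_diff_le) (simp_all add: N_power_sa[OF assms] flip: power_add)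
  finally show ?thesis by simp
 qed
 \<comment> \<open>The spare power \<open>h ^ m\<close> is carried along because each doubling
   consumes a factor \<open>h ^ 2 ^ k\<close>.\<close>
 moreover have "2 ^ k \<le> N (P k * h ^ m)" for k m
 proof (induction k arbitrary: m)
  case (Suc k)
  have "2 * 2 ^ k \<le> 2 * N (P k * h ^ (m + 2 ^ k))" using Suc by (intro mult_left_mono) auto
  also have "... = 2 * N (P k * h ^ m * h ^ 2 ^ k)" by (simp add: power_add mult.assoc)
  also have "... \<le> N (P k * h ^ m * (1 + h ^ 2 ^ k * h ^ 2 ^ k))"
  proof (rule N_doubling)
   show "st (P k * h ^ m) = P k * h ^ m" "st (h ^ 2 ^ k) = h ^ 2 ^ k" by (simp_all add: st_P assms comm)
   show "h ^ 2 ^ k * (P k * h ^ m) = P k * h ^ m * h ^ 2 ^ k" by (metis comm mult.assoc power_add add.commute)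
  qed
  also have "P k * h ^ m * (1 + h ^ 2 ^ k * h ^ 2 ^ k) = P (Suc k) * h ^ m" by (simp add: P algebra_simps flip: power_add)
  finally show ?case by simp
 qed (simp add: P N_power_sa[OF assms])
 from this[of _ 0] have "2 ^ k \<le> N (P k)" for k by simp
 moreover obtain n where "N k * 2 < 2 ^ n" using real_arch_pow[of 2] by auto
 ultimately show False using k by (meson not_le order_trans)
qed

definition spr :: "'g fa \<Rightarrow> real set" where
 "spr c = {t. \<not> invert (c - rsc t)}"

lemma spr_bound: "t \<in> spr c \<Longrightarrow> \<bar>t\<bar> \<le> N c" using neumann_sc[of c "complex_of_real t"] by (fastforce simp: spr_def)

text \<open>Takes the place of the spectral radius formula: after scaling to norm one,
  \<open>norm_one_not_invert\<close> forbids that both \<open>1 - h\<close> and \<open>1 + h\<close>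
  are invertible, so the norm or its negative is a spectral value. No complex analysis is
  involved.\<close>

lemma norm_in_spr:
 assumes "st c = c"
 obtains t where "t \<in> spr c" "\<bar>t\<bar> = N c"
proof (cases "N c = 0")
 case True
 have "\<not> invert c"
 proof
  assume "invert c"
  then obtain y where "c * y \<sim> 1"
   unfolding invert_def by blast
  moreover have "c * y \<sim> 0" using True by (intro eqv_0_multl) (simp add: eqv_0_iff)
  ultimately show False using eqv_N[of "c * y" 1] eqv_N[of "c * y" 0] by simp
 qed
 then show ?thesis using True by (intro that[of 0]) (auto simp: spr_def)
next
 case False
 define r where "r = complex_of_real (N c)"
 define h where "h = sc (inverse r) * c"
 have r: "r \<noteq> 0" "sc r * h = c" using False by (auto simp: r_def h_def simp flip: mult.assoc sc_mult)
 have "st h = h" by (simp add: h_def assms r_def sc_comm)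
 moreover have "N h = 1" using False by (simp add: h_def r_def norm_inverse)
 ultimately have "\<not> invert (sc r * (1 - h)) \<or> \<not> invert (sc r * (1 + h))" using norm_one_not_invert[of h] r by (simp add: invert_scale)
 then have "\<not> invert (sc r - c) \<or> \<not> invert (sc r + c)" using r by (simp add: algebra_simps)
 moreover have "sc r - c = sc (-1) * (c - sc r)" "sc r + c = c - sc (- r)" by (simp_all add: sc_neg)
 ultimately have "\<not> invert (c - sc r) \<or> \<not> invert (c - sc (- r))" using invert_scale[of "-1" "c - sc r"] by simp
 then show ?thesis using that[of "N c"] that[of "- N c"] by (auto simp: spr_def r_def)
qed

text \<open>The polynomial splits into linear factors over the complex numbers, and each factor is
  invertible at \<open>x\<close>.\<close>

lemma invert_pe:
 assumes "q \<noteq> 0" "\<And>z. poly q z = 0 \<Longrightarrow> invert (x - sc z)"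
 shows "invert (pe q x)" using assms
proof (induction "Polynomial.degree q" arbitrary: q)
 case 0
 then obtain c where "q = [:c:]" using degree_0_id by metis
 then show ?case using 0 by (simp add: invert_sc)
next
 case (Suc n)
 then obtain z where z: "poly q z = 0" using fundamental_theorem_of_algebra[of q] constant_degree[of q] by auto
 then obtain r where r: "q = [:-z, 1:] * r" using poly_eq_0_iff_dvd by blast
 then have r0: "r \<noteq> 0" using Suc.prems by auto
 have deg: "Polynomial.degree q = Suc (Polynomial.degree r)" using r r0 by (simp add: degree_mult_eq del: mult_pCons_left)
 have "invert (pe r x)" using Suc.hyps deg Suc.prems(2) by (intro Suc.hyps) (auto simp: r)
 moreover have "pe q x = (x - sc z) * pe r x"
  unfolding r pe_mult by (simp add: sc_neg)
 ultimately show ?case using Suc.prems(2)[OF z] by (simp add: invert_mult)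
qed

text \<open>The norm of \<open>p(c)\<close> is attained at a spectral value \<open>s\<close> of
  \<open>p(c)\<close>. Some complex root \<open>z\<close> of \<open>p - s\<close> must make
  \<open>c - z\<close> non-invertible, and self-adjointness of \<open>c\<close> forces
  \<open>z\<close> to be real, hence in \<open>spr c\<close> with \<open>p(z) = s\<close>.\<close>

lemma rp_bound:
 assumes c: "st c = c" and M: "\<And>t. t \<in> spr c \<Longrightarrow> \<bar>poly p t\<bar> \<le> M"
 shows "N (rp p c) \<le> M"
proof -
 obtain s where s: "s \<in> spr (rp p c)" "\<bar>s\<bar> = N (rp p c)" using norm_in_spr[OF rp_st[OF c]] by metis
 define q where "q = p - [:s:]"
 have "rp q c = rp p c - rsc s" by (simp add: q_def rp_diff)
 then have not: "\<not> invert (pe (cp q) c)" using s(1) by (simp add: spr_def rp_def)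
 show ?thesis
 proof (cases "q = 0")
  \<comment> \<open>A constant \<open>p\<close> offers no root; here the spectrum of
    \<open>c\<close> only has to be nonempty.\<close>
  case True
  then have "poly p t = s" for t by (simp add: q_def)
  then show ?thesis using M norm_in_spr[OF c] s(2) by metis
 next
  case False
  then obtain z where z: "poly (cp q) z = 0" "\<not> invert (c - sc z)"
   using invert_pe not by (metis coeff_map_poly of_real_eq_0_iff leading_coeff_0_iff coeff_0)
  then obtain t where t: "z = complex_of_real t" using selfadjoint_invert[OF c] by (metis complex_is_Real_iff Reals_cases)
  then show ?thesis using M[of t] s(2) using z poly_cp[of q t] spr_def by (simp add: q_def)
 qed
qed

text \<open>Otherwise \<open>p(c) - p(t)\<close> is invertible by the Neumann series. It is a
  product of \<open>c - t\<close> with a commuting factor, so \<open>c - t\<close> would be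
  invertible as well.\<close>

lemma rp_lower:
 assumes "t \<in> spr c"
 shows "\<bar>poly p t\<bar> \<le> N (rp p c)"
proof (rule ccontr)
 assume "\<not> \<bar>poly p t\<bar> \<le> N (rp p c)"
 then have inv: "invert (rp p c - rsc (poly p t))" by (intro neumann_sc) simp
 have "poly (p - [:poly p t:]) t = 0" by simp
 then obtain q where q: "p - [:poly p t:] = [:-t, 1:] * q" using poly_eq_0_iff_dvd by blast
 have "rp p c - rsc (poly p t) = rp (p - [:poly p t:]) c" by (simp add: rp_diff)
 also have "... = (c - rsc t) * rp q c"
  unfolding q rp_mult by (simp add: sc_neg)
 finally have *: "rp p c - rsc (poly p t) = (c - rsc t) * rp q c" .
 have comm: "(c - rsc t) * rp q c = rp q c * (c - rsc t)" using pe_commute[of c c "cp q"] by (simp add: rp_def algebra_simps sc_comm)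
 from inv obtain y where "(c - rsc t) * rp q c * y \<sim> 1" "y * (rp q c * (c - rsc t)) \<sim> 1"
  unfolding invert_def by (metis * comm)
 then show False using assms by (simp add: invert_left_right[of _ "rp q c * y" "y * rp q c"] mult.assoc spr_def)
qed

text \<open>The value is pinned down only modulo the kernel, by its distance to polynomials close to
  \<open>f\<close> on the spectrum. Self-adjointness, in contrast, is required as an equation in the
  ring.\<close>

definition isfc :: "(real \<Rightarrow> real) \<Rightarrow> 'g fa \<Rightarrow> 'g fa \<Rightarrow> bool" where
 "isfc f c y \<longleftrightarrow> st y = y \<and> (\<forall>p e. (\<forall>t\<in>spr c. \<bar>poly p t - f t\<bar> \<le> e) \<longrightarrow> N (rp p c - y) \<le> e)"

definition fc :: "(real \<Rightarrow> real) \<Rightarrow> 'g fa \<Rightarrow> 'g fa" where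
 "fc f c = (SOME y. isfc f c y)"

lemma fc_poly:
 assumes "continuous_on UNIV f" "e > 0"
 obtains p where "\<And>t. t \<in> spr c \<Longrightarrow> \<bar>poly p t - f t\<bar> \<le> e"
proof -
 obtain p where "\<And>t. t \<in> {- N c..N c} \<Longrightarrow> \<bar>poly p t - f t\<bar> < e"
  using Weierstrass_poly[of "- N c" "N c" f e] assms continuous_on_subset[of UNIV f] by blast
 moreover have "t \<in> {- N c..N c}" if "t \<in> spr c" for t using spr_bound[OF that] by auto
 ultimately show ?thesis by (intro that[of p]) fastforce
qed

lemma isfc_fc:
 assumes c: "st c = c" and f: "continuous_on UNIV f"
 shows "isfc f c (fc f c)"
proof -
 obtain U where "c \<in> U" and U: "csub N U" using local_complete by blast
 have "\<exists>p. \<forall>t\<in>spr c. \<bar>poly p t - f t\<bar> \<le> 1 / (Suc n)" for n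
  using fc_poly[OF f, of "1 / Suc n" c] by (metis of_nat_0_less_iff zero_less_Suc zero_less_divide_1_iff)
 then obtain p where p: "\<And>n t. t \<in> spr c \<Longrightarrow> \<bar>poly (p n) t - f t\<bar> \<le> 1 / (Suc n)" by metis
 define s where "s n = rp (p n) c" for n
 have close: "N (rp q c - s n) \<le> e + 1 / Suc n" if "\<forall>t\<in>spr c. \<bar>poly q t - f t\<bar> \<le> e" for q e n
 proof -
  have "N (rp (q - p n) c) \<le> e + 1 / Suc n"
  proof (rule rp_bound[OF c])
   fix t assume t: "t \<in> spr c"
   then have "\<bar>poly q t - f t\<bar> \<le> e" "\<bar>poly (p n) t - f t\<bar> \<le> 1 / Suc n" using that p by auto
   then show "\<bar>poly (q - p n) t\<bar> \<le> e + 1 / Suc n" by simp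
  qed
  then show ?thesis by (simp add: s_def rp_diff)
 qed
 have "rp q c \<in> U" for q by (induction q) (use \<open>c \<in> U\<close> in \<open>auto intro!: csub_closed[OF U]\<close>)
 then have "s n \<in> U" for n by (simp add: s_def)
 moreover have "\<exists>K. \<forall>m\<ge>K. \<forall>n\<ge>K. N (s m - s n) < e" if "e > 0" for e
 proof -
  obtain K where K: "1 / real (Suc K) < e / 2" using \<open>e > 0\<close> nat_approx_posE[of "e / 2"] by (metis half_gt_zero)
  have "N (s m - s n) < e" if "m \<ge> K" "n \<ge> K" for m n
  proof -
   have "1 / real (Suc m) \<le> 1 / real (Suc K)" "1 / real (Suc n) \<le> 1 / real (Suc K)" using that by (simp_all add: frac_le)
   moreover have "N (s m - s n) \<le> 1 / Suc m + 1 / Suc n" using close[of "p m" "1 / Suc m" n] p by (simp add: s_def)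
   ultimately show ?thesis using K by linarith
  qed
  then show ?thesis by blast
 qed
 ultimately obtain y where y: "(\<lambda>n. N (s n - y)) \<longlonglongrightarrow> 0" by (rule csub_complete[OF U, of s])
 \<comment> \<open>The limit is replaced by its self-adjoint part to obtain \<open>st z = z\<close>
   on the nose; since the approximants are self-adjoint, this does not increase the distance to
   them.\<close>
 define z where "z = sc (1/2) * (y + st y)"
 have sn: "N (s n - z) \<le> N (s n - y)" for n
 proof -
  have "sc (1/2) * s n + sc (1/2) * s n = s n" by (simp flip: distrib_right sc_add)
  then have "s n - z = sc (1/2) * ((s n - y) + st (s n - y))" by (simp add: z_def s_def rp_st c algebra_simps)
  also have "N ... \<le> 1/2 * (N (s n - y) + N (st (s n - y)))"
   by (metis N_scale N_triangle mult_left_mono norm_divide norm_ge_zero norm_numeral norm_one)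
  finally show ?thesis by (simp del: st_diff)
 qed
 have "isfc f c z"
  unfolding isfc_def
 proof (intro conjI allI impI)
  show "st z = z" by (simp add: z_def sc_comm add.commute)
  fix q e assume q: "\<forall>t\<in>spr c. \<bar>poly q t - f t\<bar> \<le> e"
  have "(\<lambda>n. e + 1 / Suc n + N (s n - y)) \<longlonglongrightarrow> e + 0 + 0" by (intro tendsto_intros y LIMSEQ_Suc[OF lim_1_over_n])
  moreover have "N (rp q c - z) \<le> e + 1 / Suc n + N (s n - y)" for n using N_trans[OF close[OF q, of n] sn[of n]] by simp
  ultimately show "N (rp q c - z) \<le> e" using LIMSEQ_le_const by fastforce
 qed
 then show ?thesis
  unfolding fc_def by (rule someI)
qed

context
 fixes c :: "'g fa"
 assumes c: "st c = c"
begin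

lemma fc_approx:
 assumes "continuous_on UNIV f" "\<And>t. t \<in> spr c \<Longrightarrow> \<bar>poly p t - f t\<bar> \<le> e"
 shows "N (rp p c - fc f c) \<le> e" using isfc_fc[OF c assms(1)] assms(2) unfolding isfc_def by blast

lemma st_fc: "continuous_on UNIV f \<Longrightarrow> st (fc f c) = fc f c" using isfc_fc[OF c] unfolding isfc_def by blast

lemma fc_eqvI:
 assumes f: "continuous_on UNIV f"
  and p: "\<And>e. e > 0 \<Longrightarrow> \<exists>p. (\<forall>t\<in>spr c. \<bar>poly p t - f t\<bar> \<le> e) \<and> N (rp p c - y) \<le> e"
 shows "fc f c \<sim> y"
proof (rule eqv_le)
 fix e :: real assume "e > 0"
 then obtain p where "\<forall>t\<in>spr c. \<bar>poly p t - f t\<bar> \<le> e/2" "N (rp p c - y) \<le> e/2" using p[of "e/2"] by auto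
 then show "N (fc f c - y) \<le> e"
  using fc_approx[OF f, of p "e/2"] N_trans[of "fc f c" "rp p c" "e/2" y "e/2"] by (simp add: N_minus_commute)
qed

lemma fc_rp: "continuous_on UNIV f \<Longrightarrow> (\<And>t. t \<in> spr c \<Longrightarrow> f t = poly p t) \<Longrightarrow> fc f c \<sim> rp p c" by (rule fc_eqvI) (auto intro!: exI[of _ p])

lemma fc_id: "fc (\<lambda>t. t) c \<sim> c" using fc_rp[of "\<lambda>t. t" "[:0, 1:]"] by simp

lemma fc_const: "fc (\<lambda>t. r) c \<sim> rsc r" using fc_rp[of "\<lambda>t. r" "[:r:]"] by simp

lemma fc_bound:
 assumes f: "continuous_on UNIV f" and B: "\<And>t. t \<in> spr c \<Longrightarrow> \<bar>f t\<bar> \<le> B"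
 shows "N (fc f c) \<le> B"
proof (rule field_le_epsilon)
 fix e :: real assume "e > 0"
 obtain p where p: "\<And>t. t \<in> spr c \<Longrightarrow> \<bar>poly p t - f t\<bar> \<le> e/2" using fc_poly[OF f, of "e/2" c] \<open>e > 0\<close> by auto
 have "\<bar>poly p t\<bar> \<le> B + e/2" if "t \<in> spr c" for t using p[OF that] B[OF that] by linarith
 then have "N (rp p c) \<le> B + e/2" by (rule rp_bound[OF c])
 then show "N (fc f c) \<le> B + e" using fc_approx[OF f p] N_reverse[of "rp p c" "fc f c"] by linarith
qed

lemma fc_lower:
 assumes f: "continuous_on UNIV f" and t: "t \<in> spr c"
 shows "\<bar>f t\<bar> \<le> N (fc f c)"
proof (rule field_le_epsilon)
 fix e :: real assume "e > 0"
 obtain p where p: "\<And>t. t \<in> spr c \<Longrightarrow> \<bar>poly p t - f t\<bar> \<le> e/2" using fc_poly[OF f, of "e/2" c] \<open>e > 0\<close> by auto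
 show "\<bar>f t\<bar> \<le> N (fc f c) + e" using fc_approx[OF f p] N_reverse[of "rp p c" "fc f c"] rp_lower[OF t, of p] p[OF t] by linarith
qed

lemma fc_cong:
 assumes "continuous_on UNIV f" "continuous_on UNIV g" "\<And>t. t \<in> spr c \<Longrightarrow> f t = g t"
 shows "fc f c \<sim> fc g c"
proof (rule fc_eqvI)
 fix e :: real assume "e > 0"
 obtain p where p: "\<And>t. t \<in> spr c \<Longrightarrow> \<bar>poly p t - f t\<bar> \<le> e" using fc_poly[OF assms(1), of "e" c] \<open>e > 0\<close> by auto
 then show "\<exists>p. (\<forall>t\<in>spr c. \<bar>poly p t - f t\<bar> \<le> e) \<and> N (rp p c - fc g c) \<le> e" using fc_approx[OF assms(2), of p e] assms(3) by auto
qed fact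

lemma fc_add:
 assumes "continuous_on UNIV f" "continuous_on UNIV g"
 shows "fc (\<lambda>t. f t + g t) c \<sim> fc f c + fc g c"
proof (rule fc_eqvI)
 show "continuous_on UNIV (\<lambda>t. f t + g t)" by (intro continuous_intros assms)
 fix e :: real assume "e > 0"
 obtain p where p: "\<And>t. t \<in> spr c \<Longrightarrow> \<bar>poly p t - f t\<bar> \<le> e/2" using fc_poly[OF assms(1), of "e/2" c] \<open>e > 0\<close> by auto
 obtain q where q: "\<And>t. t \<in> spr c \<Longrightarrow> \<bar>poly q t - g t\<bar> \<le> e/2" using fc_poly[OF assms(2), of "e/2" c] \<open>e > 0\<close> by auto
 have "N (rp (p + q) c - (fc f c + fc g c)) \<le> e/2 + e/2"
  using N_add_le[OF fc_approx[OF assms(1) p] fc_approx[OF assms(2) q]] by (simp add: rp_add algebra_simps)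
 moreover have "\<bar>poly (p + q) t - (f t + g t)\<bar> \<le> e" if "t \<in> spr c" for t using p[OF that] q[OF that] unfolding poly_add by linarith
 ultimately show "\<exists>p. (\<forall>t\<in>spr c. \<bar>poly p t - (f t + g t)\<bar> \<le> e) \<and> N (rp p c - (fc f c + fc g c)) \<le> e" by (intro exI[of _ "p + q"]) auto
qed

lemma fc_bounded:
 fixes f :: "real \<Rightarrow> real"
 assumes "continuous_on UNIV f"
 obtains B where "B \<ge> 0" "\<And>t. t \<in> spr c \<Longrightarrow> \<bar>f t\<bar> \<le> B"
proof -
 have "bounded (f ` {- N c..N c})" using assms by (intro compact_imp_bounded compact_continuous_image) (auto intro: continuous_on_subset)
 then obtain B where B: "B > 0" "\<And>t. t \<in> {- N c..N c} \<Longrightarrow> \<bar>f t\<bar> \<le> B"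
  unfolding bounded_pos by auto
 moreover have "t \<in> {- N c..N c}" if "t \<in> spr c" for t using spr_bound[OF that] by auto
 ultimately show ?thesis using that[of B] by simp
qed

lemma fc_mult:
 assumes "continuous_on UNIV f" "continuous_on UNIV g"
 shows "fc (\<lambda>t. f t * g t) c \<sim> fc f c * fc g c"
proof (rule fc_eqvI)
 show "continuous_on UNIV (\<lambda>t. f t * g t)" by (intro continuous_intros assms)
 fix e :: real assume "e > 0"
 obtain F where F: "F \<ge> 0" "\<And>t. t \<in> spr c \<Longrightarrow> \<bar>f t\<bar> \<le> F" using fc_bounded[OF assms(1)] by blast
 obtain G where G: "G \<ge> 0" "\<And>t. t \<in> spr c \<Longrightarrow> \<bar>g t\<bar> \<le> G" using fc_bounded[OF assms(2)] by blast
 define d where "d = min 1 (e / (F + 1 + G))"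
 have d: "d > 0" "d \<le> 1" "d \<le> e / (F + 1 + G)" using F(1) G(1) \<open>e > 0\<close> by (auto simp: d_def)
 have "(F + 1) * d + d * G = d * (F + 1 + G)" by (simp add: algebra_simps)
 also have "... \<le> e" using d(3) F(1) G(1) by (simp add: pos_le_divide_eq)
 finally have de: "(F + 1) * d + d * G \<le> e" .
 obtain p where p: "\<And>t. t \<in> spr c \<Longrightarrow> \<bar>poly p t - f t\<bar> \<le> d" using fc_poly[OF assms(1) d(1), of c] by auto
 obtain q where q: "\<And>t. t \<in> spr c \<Longrightarrow> \<bar>poly q t - g t\<bar> \<le> d" using fc_poly[OF assms(2) d(1), of c] by auto
 have pF: "\<bar>poly p t\<bar> \<le> F + 1" if "t \<in> spr c" for t using p[OF that] F(2)[OF that] d(2) by linarith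
 have "N (rp p c * rp q c - fc f c * fc g c) \<le> N (rp p c) * N (rp q c - fc g c) + N (rp p c - fc f c) * N (fc g c)" by (rule N_mult_diff)
 also have "... \<le> (F + 1) * d + d * G"
  using fc_approx[OF assms(1) p] fc_approx[OF assms(2) q] fc_bound[OF assms(2) G(2)] rp_bound[OF c pF] F(1) d(1)
  by (intro add_mono mult_mono) auto
 finally have "N (rp (p * q) c - fc f c * fc g c) \<le> e" using de by (simp add: rp_mult)
 moreover have "\<bar>poly (p * q) t - f t * g t\<bar> \<le> e" if t: "t \<in> spr c" for t
 proof -
  have "poly (p * q) t - f t * g t = poly p t * (poly q t - g t) + (poly p t - f t) * g t" by (simp add: algebra_simps)
  also have "\<bar>...\<bar> \<le> \<bar>poly p t\<bar> * \<bar>poly q t - g t\<bar> + \<bar>poly p t - f t\<bar> * \<bar>g t\<bar>" by (metis abs_mult abs_triangle_ineq)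
  also have "... \<le> (F + 1) * d + d * G" using pF[OF t] p[OF t] q[OF t] G(2)[OF t] by (intro add_mono mult_mono) auto
  finally show ?thesis using de by simp
 qed
 ultimately show "\<exists>p. (\<forall>t\<in>spr c. \<bar>poly p t - f t * g t\<bar> \<le> e) \<and> N (rp p c - fc f c * fc g c) \<le> e" by blast
qed

lemma fc_cmult:
 assumes "continuous_on UNIV f"
 shows "fc (\<lambda>t. r * f t) c \<sim> rsc r * fc f c" using eqv_trans[OF fc_mult[OF continuous_on_const assms] eqv_mult[OF fc_const eqv_refl]] .

lemma fc_diff:
 assumes "continuous_on UNIV f" "continuous_on UNIV g"
 shows "fc (\<lambda>t. f t - g t) c \<sim> fc f c - fc g c"
proof -
 have "fc (\<lambda>t. f t + (-1) * g t) c \<sim> fc f c + fc (\<lambda>t. (-1) * g t) c" by (intro fc_add continuous_intros assms)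
 also have "... \<sim> fc f c + rsc (-1) * fc g c" by (intro eqv_add eqv_refl fc_cmult assms)
 finally show ?thesis by (simp add: sc_neg)
qed

text \<open>Here \<open>w\<close> behaves like an eigenvector for \<open>t\<close>. If it is not
  null then \<open>t\<close> lies in the spectrum, so polynomials approximating \<open>f\<close>
  there also approximate \<open>f t\<close>. The value \<open>t = 0\<close> gives the annihilation
  rule \<open>fc_ann\<close>.\<close>

lemma fc_rel:
 assumes f: "continuous_on UNIV f" and w: "c * w \<sim> rsc t * w"
 shows "fc f c * w \<sim> rsc (f t) * w"
proof (cases "N w = 0")
 case True
 then show ?thesis using eqv_0_multr eqv_sym eqv_trans by (metis eqv_0_iff)
next
 case False
 have "t \<in> spr c"
  unfolding spr_def
 proof (clarify)
  assume "invert (c - rsc t)"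
  then obtain y where "y * (c - rsc t) \<sim> 1"
   unfolding invert_def by blast
  then have "y * (c - rsc t) * w \<sim> 1 * w" by (intro eqv_mult eqv_refl)
  moreover have "(c - rsc t) * w \<sim> 0" using eqv_diff[OF w eqv_refl, of "rsc t * w"] by (simp add: left_diff_distrib)
  then have "y * ((c - rsc t) * w) \<sim> 0" by (rule eqv_0_multr)
  ultimately show False using False eqv_N by (metis N_0 mult.assoc mult_1)
 qed
 have p: "rp p c * w \<sim> rsc (poly p t) * w" for p
 proof (induction p)
  case (pCons a p)
  have "c * (rp p c * w) \<sim> c * (rsc (poly p t) * w)" by (intro eqv_mult eqv_refl pCons.IH)
  also have "... = rsc (poly p t) * (c * w)" by (rule sc_left_comm)
  also have "... \<sim> rsc (poly p t) * (rsc t * w)" by (intro eqv_mult eqv_refl w)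
  finally have "rsc a * w + c * (rp p c * w) \<sim>
    rsc a * w + rsc (poly p t) * (rsc t * w)" by (intro eqv_add eqv_refl)
  moreover have "rsc (poly (pCons a p) t) =
    (rsc a + rsc (poly p t) * rsc t :: 'g fa)" by (simp only: poly_pCons of_real_add of_real_mult sc_add sc_mult
     sc_comm[of "complex_of_real t" "rsc (poly p t)"])
  ultimately show ?case by (simp only: rp_pCons distrib_right mult.assoc)
 qed simp
 show ?thesis
 proof (rule eqv_le)
  fix e :: real assume "e > 0"
  define d where "d = e / (2 * N w)"
  have "N w > 0" using False N_nonneg[of w] by linarith
  then have d: "d > 0" "d * N w + d * N w = e" using \<open>e > 0\<close> by (auto simp: d_def)
  obtain p where q: "\<And>t. t \<in> spr c \<Longrightarrow> \<bar>poly p t - f t\<bar> \<le> d" using fc_poly[OF f d(1), of c] by auto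
  have "N (fc f c * w - rp p c * w) \<le> d * N w"
   using N_mult_le[OF fc_approx[OF f q], of w "N w"] N_minus_commute by (metis left_diff_distrib order_refl)
  moreover have "N (rp p c * w - rsc (poly p t) * w) \<le> 0" using p[of p] by (simp add: eqv_def)
  moreover have "N (rsc (poly p t) * w - rsc (f t) * w) \<le> d * N w"
  proof -
   have "rsc (poly p t) * w - rsc (f t) * w = rsc (poly p t - f t) * w" by (simp add: sc_diff left_diff_distrib)
   then show ?thesis using mult_right_mono[OF q[OF \<open>t \<in> spr c\<close>] N_nonneg[of w]] by (simp del: of_real_diff)
  qed
  ultimately show "N (fc f c * w - rsc (f t) * w) \<le> e" using N_trans3[of "fc f c * w" "rp p c * w" "d * N w" _ 0 _ "d * N w"] d(2) by simp
 qed
qed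

lemma fc_ann:
 assumes "continuous_on UNIV f" "f 0 = 0" "c * w \<sim> 0"
 shows "fc f c * w \<sim> 0" using fc_rel[of f w 0] assms by simp

lemma ch_real: "ch c = complex_of_real (Re (ch c))" using arg_cong[OF c, of ch] by (metis Reals_cnj_iff ch_simps(6) of_real_Re)

text \<open>A character value is always a spectral value, because \<open>ch\<close> sends
  \<open>c\<close> minus that value to zero; the approximating polynomials are therefore controlled
  at this point.\<close>

lemma fc_ch:
 assumes "continuous_on UNIV f"
 shows "ch (fc f c) = complex_of_real (f (Re (ch c)))"
proof -
 have t: "Re (ch c) \<in> spr c"
  unfolding spr_def
 proof clarify
  assume "invert (c - rsc (Re (ch c)))"
  then obtain y where "(c - rsc (Re (ch c))) * y \<sim> 1"
   unfolding invert_def by blast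
  from eqv_ch[OF this] show False using ch_real by simp
 qed
 have "cmod (ch (fc f c) - complex_of_real (f (Re (ch c)))) \<le> 0 + e" if "e > 0" for e
 proof -
  obtain p where p: "\<And>t. t \<in> spr c \<Longrightarrow> \<bar>poly p t - f t\<bar> \<le> e/2" using fc_poly[OF assms, of "e/2" c] \<open>e > 0\<close> by auto
  have "cmod (ch (rp p c) - ch (fc f c)) \<le> e/2" using order_trans[OF ch_le fc_approx[OF assms p]] by simp
  moreover have "cmod (ch (rp p c) - complex_of_real (f (Re (ch c)))) \<le> e/2"
   using p[OF t] ch_rp[OF ch_real, of p] by (simp flip: of_real_diff)
  ultimately show ?thesis using norm_triangle_ineq4[of "ch (rp p c) - complex_of_real (f (Re (ch c)))" "ch (rp p c) - ch (fc f c)"]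
   by simp
 qed
 then have "cmod (ch (fc f c) - complex_of_real (f (Re (ch c)))) \<le> 0" by (rule field_le_epsilon)
 then show ?thesis by simp
qed

lemma ch_fc_0: "continuous_on UNIV f \<Longrightarrow> f 0 = 0 \<Longrightarrow> ch c = 0 \<Longrightarrow> ch (fc f c) = 0" using fc_ch by simp

end

lemma fc_commute:
 assumes c: "st c = c" and f: "continuous_on UNIV f" and w: "c * w \<sim> w * c"
 shows "fc f c * w \<sim> w * fc f c"
proof (rule eqv_le)
 have p: "rp p c * w \<sim> w * rp p c" for p
 proof (induction p)
  case (pCons a p)
  have "c * (rp p c * w) \<sim> c * (w * rp p c)" by (intro eqv_mult eqv_refl pCons.IH)
  also have "... = c * w * rp p c" by (simp add: mult.assoc)
  also have "... \<sim> w * c * rp p c" by (intro eqv_mult eqv_refl w)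
  finally show ?case by (auto simp: distrib_right distrib_left mult.assoc sc_comm intro!: eqv_add)
 qed simp
 fix e :: real assume "e > 0"
 define d where "d = e / (2 * N w + 1)"
 have d0: "0 < 2 * N w + 1" using N_nonneg[of w] by linarith
 have d: "d > 0" "d * N w + N w * d \<le> e"
 proof -
  have "d * N w + N w * d = e * (2 * N w / (2 * N w + 1))" by (simp add: d_def)
  also have "... \<le> e * 1" using d0 \<open>e > 0\<close> by (intro mult_left_mono) auto
  finally show "d * N w + N w * d \<le> e" by simp
 qed (use d0 \<open>e > 0\<close> in \<open>simp add: d_def\<close>)
 obtain p where q: "\<And>t. t \<in> spr c \<Longrightarrow> \<bar>poly p t - f t\<bar> \<le> d" using fc_poly[OF f d(1), of c] by auto
 note q = fc_approx[OF c f q]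
 have "N (fc f c * w - rp p c * w) \<le> d * N w" using N_mult_le[OF q, of w "N w"] N_minus_commute by (metis left_diff_distrib order_refl)
 moreover have "N (rp p c * w - w * rp p c) \<le> 0" using p[of p] by (simp add: eqv_def)
 moreover have "N (w * rp p c - w * fc f c) \<le> N w * d" using N_mult_le[OF order_refl q, of w] by (simp add: right_diff_distrib)
 ultimately show "N (fc f c * w - w * fc f c) \<le> e" using N_trans3[of "fc f c * w" "rp p c * w" "d * N w" _ 0 _ "N w * d"] d(2) by fastforce
qed

section \<open>Positive elements\<close>

definition pos :: "'g fa \<Rightarrow> bool" where
 "pos x \<longleftrightarrow> st x = x \<and> spr x \<subseteq> {0..}"

lemma pos_st: "pos x \<Longrightarrow> st x = x" by (simp add: pos_def)

lemma pos_spr: "pos x \<Longrightarrow> t \<in> spr x \<Longrightarrow> 0 \<le> t \<and> t \<le> N x" using spr_bound[of t x] by (auto simp: pos_def)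

text \<open>Together with the converse \<open>norm_pos\<close> this describes positivity by a norm
  inequality, after which stability under sums is the triangle inequality.\<close>

lemma pos_norm:
 assumes "pos x" "N x \<le> K"
 shows "N (rsc K - x) \<le> K"
proof -
 have "N (rp [:K, -1:] x) \<le> K" using pos_spr[OF assms(1)] assms by (intro rp_bound pos_st) fastforce+
 then show ?thesis by (simp add: sc_neg)
qed

lemma norm_pos:
 assumes "st x = x" "N (rsc K - x) \<le> K"
 shows "pos x"
 unfolding pos_def
proof (intro conjI subsetI assms)
 fix t assume "t \<in> spr x"
 then have "\<bar>poly [:K, -1:] t\<bar> \<le> N (rp [:K, -1:] x)" by (rule rp_lower)
 then show "t \<in> {0..}" using assms(2) by (simp add: sc_neg)
qed

lemma pos_eqv: "pos x \<Longrightarrow> x \<sim> y \<Longrightarrow> st y = y \<Longrightarrow> pos y" using norm_pos[of y "N x"] pos_norm[of x "N x"] N_cong[OF eqv_refl, of x y] by simp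

lemma pos_add:
 assumes "pos x" "pos y"
 shows "pos (x + y)"
proof (rule norm_pos)
 have eq: "rsc (N x + N y) - (x + y) = (rsc (N x) - x) + (rsc (N y) - y)" by (simp add: sc_add)
 then show "N (rsc (N x + N y) - (x + y)) \<le> N x + N y"
  using N_add_le[OF pos_norm[OF assms(1) order_refl] pos_norm[OF assms(2) order_refl]] by (simp only:)
qed (use assms pos_st in simp)

lemma pos_scale:
 assumes "pos x" "r \<ge> 0"
 shows "pos (rsc r * x)"
proof (rule norm_pos)
 have "rsc (r * N x) - rsc r * x = rsc r * (rsc (N x) - x)" by (simp add: right_diff_distrib flip: sc_mult)
 then show "N (rsc (r * N x) - rsc r * x) \<le> r * N x" using mult_left_mono[OF pos_norm[OF assms(1) order_refl] assms(2)] assms(2) by simp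
qed (use pos_st[OF assms(1)] sc_comm[of "complex_of_real r" x] in simp)

lemma pos_sc: "r \<ge> 0 \<Longrightarrow> pos (rsc r)" by (rule norm_pos[of _ r]) simp_all

lemma pos_0 [simp]: "pos 0" using pos_sc[of 0] by simp

lemma pos_1 [simp]: "pos 1" using pos_sc[of 1] by simp

lemma pos_sum: "(\<And>i. i \<in> I \<Longrightarrow> pos (f i)) \<Longrightarrow> pos (sum f I)" by (induction rule: infinite_finite_induct) (auto intro: pos_add)

text \<open>For \<open>t < 0\<close> the element \<open>y * y - t\<close> factors as
  \<open>(y - z) * (y + z)\<close> with \<open>z\<close> purely imaginary, and both factors are
  invertible because \<open>y\<close> is self-adjoint.\<close>

lemma pos_sq:
 assumes "st y = y"
 shows "pos (y * y)"
 unfolding pos_def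
proof (intro conjI subsetI)
 fix t assume t: "t \<in> spr (y * y)"
 show "t \<in> {0..}"
 proof (rule ccontr)
  assume "t \<notin> {0..}"
  then have neg: "t < 0" by simp
  define z where "z = \<i> * complex_of_real (sqrt (- t))"
  have z: "z * z = complex_of_real t" "Im z \<noteq> 0" "Im (- z) \<noteq> 0"
  proof -
   have "complex_of_real (sqrt (- t)) * complex_of_real (sqrt (- t)) = complex_of_real (- t)" using neg by (simp del: flip: of_real_mult)
   then show "z * z = complex_of_real t" by (simp add: z_def algebra_simps)
  qed (use neg in \<open>auto simp: z_def\<close>)
  have "y * y - rsc t = (y - sc z) * (y - sc (- z))" by (simp add: algebra_simps sc_neg sc_comm[of z y] flip: z(1) sc_mult)
  then show False using t using selfadjoint_invert[OF assms] z invert_mult by (simp add: spr_def)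
 qed
qed (simp add: assms)

lemma pos_antisym:
 assumes "pos x" "pos (- x)"
 shows "x \<sim> 0"
proof -
 obtain t where t: "t \<in> spr x" "\<bar>t\<bar> = N x" using norm_in_spr[OF pos_st[OF assms(1)]] by metis
 have "\<bar>poly [:N x, 1:] t\<bar> \<le> N (rp [:N x, 1:] x)" by (rule rp_lower[OF t(1)])
 also have "rp [:N x, 1:] x = rsc (N x) - (- x)" by simp
 also have "N ... \<le> N x" by (rule pos_norm[OF assms(2)]) simp
 finally have "N x \<le> 0" using t pos_spr[OF assms(1) t(1)] by auto
 then show ?thesis by (simp add: eqv_0_iff antisym)
qed

lemma fc_pos:
 assumes "st c = c" "continuous_on UNIV f" "\<And>t. t \<in> spr c \<Longrightarrow> 0 \<le> f t"
 shows "pos (fc f c)"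
proof -
 have cont: "continuous_on UNIV (\<lambda>t. sqrt \<bar>f t\<bar>)" by (intro continuous_intros assms)
 have "fc (\<lambda>t. sqrt \<bar>f t\<bar>) c * fc (\<lambda>t. sqrt \<bar>f t\<bar>) c \<sim> fc (\<lambda>t. sqrt \<bar>f t\<bar> * sqrt \<bar>f t\<bar>) c" by (intro eqv_sym[OF fc_mult] assms cont)
 also have "... \<sim> fc f c" using assms by (intro fc_cong continuous_intros cont) auto
 finally show ?thesis using assms st_fc cont by (intro pos_eqv[OF pos_sq]) auto
qed

text \<open>Jacobson's identity: if \<open>u\<close> inverts \<open>1 - a * b\<close>, then
  \<open>1 + b * u * a\<close> inverts \<open>1 - b * a\<close>.\<close>

lemma invert_swap:
 assumes "invert (1 - a * b)"
 shows "invert (1 - b * a)"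
proof -
 obtain u where u: "(1 - a * b) * u \<sim> 1" "u * (1 - a * b) \<sim> 1" using assms unfolding invert_def by blast
 have "b * ((1 - a * b) * u) * a \<sim> b * 1 * a" "b * (u * (1 - a * b)) * a \<sim> b * 1 * a" by (intro eqv_mult u eqv_refl)+
 then have "1 + b * ((1 - a * b) * u) * a - b * a \<sim> 1 + b * 1 * a - b * a"
  "1 + b * (u * (1 - a * b)) * a - b * a \<sim> 1 + b * 1 * a - b * a" using eqv_diff[OF eqv_add[OF eqv_refl] eqv_refl] by blast+
 moreover have "(1 - b * a) * (1 + b * u * a) = 1 + b * ((1 - a * b) * u) * a - b * a"
  "(1 + b * u * a) * (1 - b * a) = 1 + b * (u * (1 - a * b)) * a - b * a" by (simp_all add: algebra_simps)
 ultimately show ?thesis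
  unfolding invert_def by (intro exI[of _ "1 + b * u * a"]) simp
qed

lemma spr_swap:
 assumes "t \<in> spr (a * b)" "t \<noteq> 0"
 shows "t \<in> spr (b * a)"
proof -
 define r where "r = complex_of_real t"
 have r: "r \<noteq> 0" using assms(2) by (simp add: r_def)
 have *: "x * y - sc r = sc (- r) * (1 - (sc (inverse r) * x) * y)" for x y :: "'g fa"
  using r by (simp add: right_diff_distrib sc_neg flip: mult.assoc sc_mult)
 have "invert (a * b - sc r)" if "invert (b * a - sc r)"
 proof -
  have "invert (1 - (sc (inverse r) * b) * a)" using that r unfolding *[of b a] by (subst (asm) invert_scale) auto
  then have "invert (1 - (sc (inverse r) * a) * b)" using invert_swap by (simp add: mult.assoc sc_left_comm)
  then show ?thesis
   unfolding *[of a b] using r by (subst invert_scale) auto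
 qed
 then show ?thesis using assms(1) by (auto simp: spr_def r_def)
qed

text \<open>Let \<open>g\<close> be the negative part of \<open>st v * v\<close> and
  \<open>y = v * g\<close>. Then \<open>st y * y\<close> is minus the cube of \<open>g\<close>.
  Since \<open>y * st y + st y * y\<close> is positive, so is \<open>y * st y\<close>, and
  exchanging the factors keeps the nonzero spectrum. Hence \<open>st y * y\<close> is both positive
  and negative, so it is null, and no negative spectral value remains.\<close>

theorem pos_star: "pos (st v * v)"
proof -
 define b where "b = st v * v"
 define m where "m t = max (- t) (0::real)" for t
 have b: "st b = b" by (simp add: b_def)
 have m: "continuous_on UNIV m" unfolding m_def by (intro continuous_intros)
 define g where "g = fc m b"
 have g: "st g = g" unfolding g_def by (rule st_fc[OF b m])
 define y where "y = v * g"
 have "st y * y = g * b * g" by (simp add: y_def b_def g mult.assoc)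
 also have "... \<sim> fc m b * fc (\<lambda>t. t) b * fc m b"
  unfolding g_def by (intro eqv_mult eqv_refl eqv_sym[OF fc_id[OF b]])
 also have "... \<sim> fc (\<lambda>t. m t * t) b * fc m b" by (intro eqv_mult eqv_refl eqv_sym[OF fc_mult[OF b]] m continuous_intros)
 also have "... \<sim> fc (\<lambda>t. m t * t * m t) b" by (intro eqv_sym[OF fc_mult[OF b]] m continuous_intros)
 finally have y1: "st y * y \<sim> fc (\<lambda>t. m t * t * m t) b" .
 have cont: "continuous_on UNIV (\<lambda>t. m t * t * m t)" by (intro m continuous_intros)
 have "fc (\<lambda>t. 0 - m t * t * m t) b \<sim> fc (\<lambda>t. 0) b - fc (\<lambda>t. m t * t * m t) b" by (intro fc_diff b continuous_intros cont)
 also have "... \<sim> rsc 0 - st y * y" by (intro eqv_diff fc_const b eqv_sym[OF y1])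
 finally have "fc (\<lambda>t. 0 - m t * t * m t) b \<sim> - (st y * y)" by simp
 with _ have neg: "pos (- (st y * y))"
 proof (rule pos_eqv)
  show "pos (fc (\<lambda>t. 0 - m t * t * m t) b)" by (intro fc_pos b continuous_intros cont) (auto simp: m_def max_def mult_nonneg_nonpos2)
 qed simp
 \<comment> \<open>Up to scaling, the real and imaginary parts of \<open>y\<close>:
   \<open>h * h + k * k\<close> is twice \<open>y * st y + st y * y\<close>.\<close>
 define h k where "h = y + st y" and "k = sc \<i> * (y - st y)"
 have k: "st k = k" by (simp add: k_def sc_neg sc_comm algebra_simps)
 have kk: "k * k = - ((y - st y) * (y - st y))"
 proof -
  have "k * k = sc \<i> * sc \<i> * ((y - st y) * (y - st y))"
   unfolding k_def by (metis mult.assoc sc_comm)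
  then show ?thesis by (simp add: sc_neg flip: sc_mult)
 qed
 have "pos (h * h + k * k)" by (intro pos_add pos_sq k) (simp add: h_def)
 moreover have "h * h + k * k = (y * st y + st y * y) + (y * st y + st y * y)"
  unfolding kk h_def by (simp add: algebra_simps)
 moreover have "rsc (1/2) * (u + u) = u" for u :: "'g fa"
 proof -
  have "rsc (1/2) * (u + u) = (rsc (1/2) + rsc (1/2)) * u" by (simp add: algebra_simps)
  also have "... = u" by (simp flip: sc_add)
  finally show ?thesis .
 qed
 ultimately have "pos (y * st y + st y * y)" using pos_scale[of "h * h + k * k" "1/2"] by simp
 from pos_add[OF this neg] have "pos (y * st y)" by simp
 then have "pos (st y * y)"
  unfolding pos_def using spr_swap[of _ "st y" y] by fastforce
 then have null: "N (fc (\<lambda>t. m t * t * m t) b) = 0" using y1 eqv_N using neg pos_antisym by (metis N_0)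
 have "t \<ge> 0" if "t \<in> spr b" for t by (use m_def fc_lower[OF b cont that] null in auto)
 then show ?thesis by (auto simp: pos_def b_def)
qed

lemma pos_star': "pos (v * st v)" using pos_star[of "st v"] by simp

definition rt :: "'g fa \<Rightarrow> 'g fa" where
 "rt x = fc sqrt x"

lemma cont_sqrt: "continuous_on UNIV sqrt" by (intro continuous_intros)

lemma rt:
 assumes "pos x"
 shows "st (rt x) = rt x" "rt x * rt x \<sim> x" "pos (rt x)" "ch x = 0 \<Longrightarrow> ch (rt x) = 0"
proof -
 note x = pos_st[OF assms]
 show "st (rt x) = rt x"
  unfolding rt_def by (rule st_fc[OF x cont_sqrt])
 have "rt x * rt x \<sim> fc (\<lambda>t. sqrt t * sqrt t) x"
  unfolding rt_def by (rule eqv_sym[OF fc_mult[OF x cont_sqrt cont_sqrt]])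
 also have "... \<sim> fc (\<lambda>t. t) x" using pos_spr[OF assms] by (intro fc_cong x continuous_intros) auto
 also have "... \<sim> x" by (rule fc_id[OF x])
 finally show "rt x * rt x \<sim> x" .
 show "pos (rt x)"
  unfolding rt_def using pos_spr[OF assms] by (intro fc_pos x cont_sqrt) auto
 show "ch x = 0 \<Longrightarrow> ch (rt x) = 0"
  unfolding rt_def by (intro ch_fc_0 x cont_sqrt) auto
qed

lemma pos_conj:
 assumes "pos x"
 shows "pos (v * x * st v)"
proof (rule pos_eqv)
 show "pos ((v * rt x) * st (v * rt x))" by (rule pos_star')
 have "v * (rt x * rt x) * st v \<sim> v * x * st v" by (intro eqv_mult eqv_refl rt assms)
 then show "(v * rt x) * st (v * rt x) \<sim> v * x * st v" by (simp add: rt(1)[OF assms] mult.assoc)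
qed (simp add: pos_st[OF assms] mult.assoc)

lemma pos_conj_le: "pos (y - x) \<Longrightarrow> pos (v * y * st v - v * x * st v)" using pos_conj[of "y - x" v] by (simp add: algebra_simps)

lemma pos_trans: "pos (y - x) \<Longrightarrow> pos (z - y) \<Longrightarrow> pos (z - x)" using pos_add[of "y - x" "z - y"] by simp

lemma pos_upper: "st x = x \<Longrightarrow> N x \<le> r \<Longrightarrow> pos (rsc r - x)" by (rule norm_pos[of _ r]) simp_all

lemma pos_N_le:
 assumes "pos x" "pos (rsc r - x)"
 shows "N x \<le> r"
proof -
 obtain t where t: "t \<in> spr x" "\<bar>t\<bar> = N x" using norm_in_spr[OF pos_st[OF assms(1)]] by metis
 have "r - t \<in> spr (rsc r - x)" using t(1) invert_scale[of "-1" "x - rsc t"] by (simp add: spr_def sc_neg sc_diff)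
 then show ?thesis using pos_spr[OF assms(2)] pos_spr[OF assms(1) t(1)] t(2) by fastforce
qed

lemma pos_mono:
 assumes "pos x" "pos (y - x)"
 shows "N x \<le> N y" by (use pos_add[OF assms] assms pos_upper[OF pos_st, of y "N y"] pos_trans[OF assms(2)] pos_N_le in simp)

end

section \<open>Comparison of diagonal direct sums\<close>

abbreviation copies :: "nat \<Rightarrow> 'a \<Rightarrow> 'a multiset" where
 "copies \<equiv> replicate_mset"

lemma sum_lessThan_add: "(\<Sum>j<m + n. f j) = (\<Sum>j<m. f j) + (\<Sum>j<n. f (m + j) :: 'a::comm_monoid_add)" for m n :: nat
 by (induction n) (simp_all add: add_ac)

context lcs
begin

text \<open>Comparison with an explicit tolerance, so that errors can be added up before any limit
  is taken. The implementing \<open>v\<close> may lie in the unitization; \<open>cz_corner\<close>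
  moves it into the algebra.\<close>

definition sub :: "real \<Rightarrow> 'g fa \<Rightarrow> 'g fa \<Rightarrow> bool" where
 "sub e a b \<longleftrightarrow> (\<exists>v. N (v * b * st v - a) \<le> e)"

definition cz :: "'g fa \<Rightarrow> 'g fa \<Rightarrow> bool" where
 "cz a b \<longleftrightarrow> (\<forall>e>0. sub e a b)"

text \<open>\<open>dle\<close> is Cuntz subequivalence of the diagonal matrices with the given entries; it is
 expressed by matrices of coefficients, so no matrix algebra is needed.\<close>

definition dsub :: "real \<Rightarrow> 'g fa list \<Rightarrow> 'g fa list \<Rightarrow> bool" where
 "dsub e xs ys \<longleftrightarrow> (\<exists>c. \<forall>i<length xs. \<forall>l<length xs.
   N ((\<Sum>j<length ys. c i j * ys ! j * st (c l j)) - (if i = l then xs ! i else 0)) \<le> e)"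

definition dle :: "'g fa list \<Rightarrow> 'g fa list \<Rightarrow> bool" where
 "dle xs ys \<longleftrightarrow> (\<forall>e>0. dsub e xs ys)"

lemma dsub_single: "dsub e [a] [b] \<longleftrightarrow> sub e a b"
 unfolding dsub_def sub_def by auto

lemma dle_single: "dle [a] [b] \<longleftrightarrow> cz a b" by (simp add: dle_def cz_def dsub_single)

text \<open>The coefficient matrices are multiplied. The error of the second comparison gets
  multiplied on both sides by entries of the first matrix and summed over \<open>n * n\<close>
  pairs, so it is chosen small against these.\<close>

lemma dsub_trans:
 assumes "dsub e xs ys" "dle ys zs" "d > 0"
 shows "dsub (e + d) xs zs"
proof -
 define m n p where "m = length xs" and "n = length ys" and "p = length zs"
 obtain c where c: "\<And>i l. i < m \<Longrightarrow> l < m \<Longrightarrow>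
   N ((\<Sum>j<n. c i j * ys ! j * st (c l j)) - (if i = l then xs ! i else 0)) \<le> e" using assms(1) unfolding dsub_def m_def n_def by blast
 define K where "K = (\<Sum>i<m. \<Sum>j<n. N (c i j))"
 have K0: "K \<ge> 0" by (auto simp: K_def intro!: sum_nonneg)
 have K: "N (c i j) \<le> K" if "i < m" "j < n" for i j
 proof -
  have "N (c i j) \<le> (\<Sum>j<n. N (c i j))" using that by (intro member_le_sum) auto
  also have "... \<le> K"
   unfolding K_def using that by (intro member_le_sum[of i "{..<m}" "\<lambda>i. \<Sum>j<n. N (c i j)"] sum_nonneg) auto
  finally show ?thesis .
 qed
 define h where "h = d / (real n * (real n * (K * K)) + 1)"
 have h0: "real n * (real n * (K * K)) + 1 > 0" using K0 by (intro add_nonneg_pos mult_nonneg_nonneg) auto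
 then have h: "h > 0" "real n * (real n * (K * h * K)) \<le> d"
 proof -
  have "real n * (real n * (K * h * K)) = d * ((real n * (real n * (K * K))) / (real n * (real n * (K * K)) + 1))" by (simp add: h_def)
  also have "... \<le> d * 1" using h0 assms(3) by (intro mult_left_mono) auto
  finally show "real n * (real n * (K * h * K)) \<le> d" by simp
 qed (use h0 assms(3) in \<open>simp add: h_def\<close>)
 have "dsub h ys zs" using assms(2) h(1) by (simp add: dle_def)
 then obtain c' where c': "\<And>j j'. j < n \<Longrightarrow> j' < n \<Longrightarrow>
   N ((\<Sum>k<p. c' j k * zs ! k * st (c' j' k)) - (if j = j' then ys ! j else 0)) \<le> h"
  unfolding dsub_def n_def p_def by blast
 define c'' where "c'' i k = (\<Sum>j<n. c i j * c' j k)" for i k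
 define Z where "Z j j' = (\<Sum>k<p. c' j k * zs ! k * st (c' j' k))" for j j'
 have B: "(\<Sum>k<p. c'' i k * zs ! k * st (c'' l k)) = (\<Sum>j<n. \<Sum>j'<n. c i j * Z j j' * st (c l j'))" for i l
 proof -
  have "(\<Sum>k<p. c'' i k * zs ! k * st (c'' l k)) = (\<Sum>k<p. \<Sum>j'<n. \<Sum>j<n. c i j * (c' j k * zs ! k * st (c' j' k)) * st (c l j'))"
   by (simp add: c''_def sum_distrib_left sum_distrib_right mult.assoc)
  also have "... = (\<Sum>k<p. \<Sum>j<n. \<Sum>j'<n. c i j * (c' j k * zs ! k * st (c' j' k)) * st (c l j'))" by (intro sum.cong refl sum.swap)
  also have "... = (\<Sum>j<n. \<Sum>k<p. \<Sum>j'<n. c i j * (c' j k * zs ! k * st (c' j' k)) * st (c l j'))" by (rule sum.swap)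
  also have "... = (\<Sum>j<n. \<Sum>j'<n. \<Sum>k<p. c i j * (c' j k * zs ! k * st (c' j' k)) * st (c l j'))" by (intro sum.cong refl sum.swap)
  also have "... = (\<Sum>j<n. \<Sum>j'<n. c i j * Z j j' * st (c l j'))" by (simp add: Z_def sum_distrib_left sum_distrib_right)
  finally show ?thesis .
 qed
 have A: "(\<Sum>j<n. c i j * ys ! j * st (c l j)) = (\<Sum>j<n. \<Sum>j'<n. c i j * (if j = j' then ys ! j else 0) * st (c l j'))" for i l
  by (intro sum.cong refl) (simp add: if_distrib[of "\<lambda>x. c i _ * x * _"] cong: if_cong)
 have "N ((\<Sum>k<p. c'' i k * zs ! k * st (c'' l k)) - (if i = l then xs ! i else 0)) \<le> e + d" if "i < m" "l < m" for i l
 proof -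
  have "(\<Sum>k<p. c'' i k * zs ! k * st (c'' l k)) - (\<Sum>j<n. c i j * ys ! j * st (c l j))
    = (\<Sum>j<n. \<Sum>j'<n. c i j * (Z j j' - (if j = j' then ys ! j else 0)) * st (c l j'))"
   unfolding A B by (simp add: algebra_simps sum_subtractf)
  also have "N ... \<le> (\<Sum>j<n. \<Sum>j'<n. K * h * K)"
  proof (intro order_trans[OF N_sum sum_mono])
   fix j j' assume "j \<in> {..<n}" "j' \<in> {..<n}"
   then show "N (c i j * (Z j j' - (if j = j' then ys ! j else 0)) * st (c l j')) \<le> K * h * K"
    using that K c' by (intro N_mult3_le) (auto simp: Z_def)
  qed
  also have "... \<le> d" using h(2) by simp
  finally have "N ((\<Sum>k<p. c'' i k * zs ! k * st (c'' l k)) - (\<Sum>j<n. c i j * ys ! j * st (c l j))) \<le> d" .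
  from N_trans[OF this c[OF that]] show ?thesis by simp
 qed
 then show ?thesis
  unfolding dsub_def m_def p_def by blast
qed

lemma dle_trans: "dle xs ys \<Longrightarrow> dle ys zs \<Longrightarrow> dle xs zs"
 unfolding dle_def[of xs] by (metis dsub_trans field_sum_of_halves half_gt_zero)

lemma sub_trans: "sub e a b \<Longrightarrow> cz b c \<Longrightarrow> d > 0 \<Longrightarrow> sub (e + d) a c"
 using dsub_trans[of e "[a]" "[b]" "[c]" d] by (simp add: dsub_single dle_single)

lemma cz_trans: "cz a b \<Longrightarrow> cz b c \<Longrightarrow> cz a c" using dle_trans[of "[a]" "[b]" "[c]"] by (simp add: dle_single)

text \<open>The coefficient matrix has a single nonzero entry per row, placed by \<open>f\<close>;
  injectivity makes distinct rows orthogonal.\<close>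

lemma dle_inj:
 assumes "inj_on f {..<length xs}" "\<And>i. i < length xs \<Longrightarrow> f i < length ys \<and> cz (xs ! i) (ys ! f i)"
 shows "dle xs ys"
 unfolding dle_def
proof (intro allI impI)
 fix e :: real assume "e > 0"
 then have "\<forall>i<length xs. \<exists>v. N (v * ys ! f i * st v - xs ! i) \<le> e" using assms(2) unfolding cz_def sub_def by blast
 then obtain v where v: "\<And>i. i < length xs \<Longrightarrow> N (v i * ys ! f i * st (v i) - xs ! i) \<le> e" by metis
 define c where "c i j = (if j = f i then v i else 0)" for i j
 have "(\<Sum>j<length ys. c i j * ys ! j * st (c l j)) = (if i = l then v i * ys ! f i * st (v i) else 0)"
  if "i < length xs" "l < length xs" for i l
 proof -
  have "(\<Sum>j<length ys. c i j * ys ! j * st (c l j)) = (\<Sum>j<length ys. if j = f i then v i * ys ! f i * st (c l (f i)) else 0)"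
   by (intro sum.cong) (auto simp: c_def)
  also have "... = v i * ys ! f i * st (c l (f i))" using assms(2) that by simp
  finally show ?thesis using assms(1) that by (auto simp: c_def dest: inj_onD)
 qed
 then show "dsub e xs ys"
  unfolding dsub_def using v \<open>e > 0\<close> by (intro exI[of _ c]) auto
qed

lemma eqv_cz: "a \<sim> b \<Longrightarrow> cz a b"
 unfolding cz_def sub_def by (auto intro!: exI[of _ 1] simp: eqv_def N_minus_commute)

lemma cz_refl [simp]: "cz a a" by (rule eqv_cz) simp

lemma sub_eqv: "sub e a b \<Longrightarrow> N (a' - a) \<le> d \<Longrightarrow> sub (e + d) a' b"
 unfolding sub_def by (metis N_minus_commute N_trans)

lemma sub_mono: "sub e a b \<Longrightarrow> e \<le> e' \<Longrightarrow> sub e' a b"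
 unfolding sub_def by (meson order_trans)

lemma cz_sub_close: "(\<And>e. e > 0 \<Longrightarrow> \<exists>a'. N (a - a') \<le> e \<and> cz a' b) \<Longrightarrow> cz a b"
 unfolding cz_def by (metis field_sum_of_halves half_gt_zero sub_eqv)

lemma dle_refl [simp]: "dle xs xs" by (rule dle_inj[of id]) auto

lemma dle_append:
 assumes "dle xs ys" "dle xs' ys'"
 shows "dle (xs @ xs') (ys @ ys')"
 unfolding dle_def
proof (intro allI impI)
 fix e :: real assume "e > 0"
 define m n m' n' where "m = length xs" and "n = length ys" and "m' = length xs'" and "n' = length ys'"
 have "dsub e xs ys" "dsub e xs' ys'" using assms \<open>e > 0\<close> by (simp_all add: dle_def)
 then obtain c c' where c: "\<And>i l. i < m \<Longrightarrow> l < m \<Longrightarrow>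
   N ((\<Sum>j<n. c i j * ys ! j * st (c l j)) - (if i = l then xs ! i else 0)) \<le> e"
  and c': "\<And>i l. i < m' \<Longrightarrow> l < m' \<Longrightarrow>
   N ((\<Sum>j<n'. c' i j * ys' ! j * st (c' l j)) - (if i = l then xs' ! i else 0)) \<le> e"
  unfolding dsub_def m_def n_def m'_def n'_def by blast
 define d where "d i j = (if i < m \<and> j < n then c i j else if m \<le> i \<and> n \<le> j then c' (i - m) (j - n) else 0)" for i j
 have "N ((\<Sum>j<n + n'. d i j * (ys @ ys') ! j * st (d l j)) - (if i = l then (xs @ xs') ! i else 0)) \<le> e"
  if "i < m + m'" "l < m + m'" for i l
 proof -
  have eq: "(\<Sum>j<n + n'. d i j * (ys @ ys') ! j * st (d l j)) =
   (\<Sum>j<n. d i j * ys ! j * st (d l j)) + (\<Sum>j<n'. d i (n + j) * ys' ! j * st (d l (n + j)))"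
   unfolding sum_lessThan_add n_def by (simp add: nth_append)
  consider "i < m" "l < m" | "m \<le> i" "m \<le> l" | "i < m" "m \<le> l" | "m \<le> i" "l < m" by linarith
  then show ?thesis
  proof cases
   case 1
   then show ?thesis using c[of i l] unfolding eq by (cases "i = l") (simp_all add: d_def nth_append m_def[symmetric])
  next
   case 2
   then have "i = l \<longleftrightarrow> i - m = l - m" by auto
   then show ?thesis
    using 2 that c'[of "i - m" "l - m"] unfolding eq by (cases "i = l") (simp_all add: d_def nth_append m_def[symmetric])
  next
   case 3
   then show ?thesis using \<open>e > 0\<close> unfolding eq by (auto simp: d_def)
  next
   case 4
   then show ?thesis using \<open>e > 0\<close> unfolding eq by (auto simp: d_def)
  qed
 qed
 then show "dsub e (xs @ xs') (ys @ ys')"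
  unfolding dsub_def length_append m_def n_def m'_def n'_def by (intro exI[of _ d] allI impI)
qed

lemma dle_mset: "mset xs = mset ys \<Longrightarrow> dle xs ys"
proof -
 assume "mset xs = mset ys"
 then obtain p where p: "p permutes {..<length ys}" "permute_list p ys = xs" by (rule mset_eq_permutation)
 then have l: "length xs = length ys" by (metis length_permute_list)
 show ?thesis
 proof (rule dle_inj[of p])
  show "inj_on p {..<length xs}" using permutes_inj_on[OF p(1)] .
  fix i assume "i < length xs"
  then show "p i < length ys \<and> cz (xs ! i) (ys ! p i)"
   using p l permute_list_nth[OF p(1)] permutes_in_image[OF p(1), of i] by (metis cz_refl lessThan_iff)
 qed
qed

text \<open>On multisets the direct sum becomes a commutative addition in which permutations are
  invisible. This is also the preordered monoid on which states are constructed later.\<close>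

definition mle :: "'g fa multiset \<Rightarrow> 'g fa multiset \<Rightarrow> bool" where
 "mle A B \<longleftrightarrow> (\<exists>xs ys. mset xs = A \<and> mset ys = B \<and> dle xs ys)"

lemma mle_mset: "mle (mset xs) (mset ys) \<longleftrightarrow> dle xs ys"
 unfolding mle_def by (metis dle_mset dle_trans)

lemma mle_refl [simp]: "mle A A" by (metis dle_refl ex_mset mle_def)

lemma mle_trans: "mle A B \<Longrightarrow> mle B C \<Longrightarrow> mle A C" by (metis dle_trans ex_mset mle_mset)

lemma mle_add: "mle A B \<Longrightarrow> mle C D \<Longrightarrow> mle (A + C) (B + D)"
 unfolding mle_def by (metis dle_append mset_append)

lemma mle_single: "mle {#a#} {#b#} \<longleftrightarrow> cz a b" using mle_mset[of "[a]" "[b]"] by (simp add: dle_single)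

lemma dle_Nil: "dle [] ys" by (rule dle_inj[of id]) auto

lemma mle_subset: "A \<subseteq># B \<Longrightarrow> mle A B"
 by (metis add.right_neutral dle_Nil mle_add mle_mset mle_refl mset.simps(1) ex_mset subset_mset.add_diff_inverse)

lemma mle_replicate: "mle A B \<Longrightarrow> mle (repeat_mset n A) (repeat_mset n B)" by (induction n) (auto intro: mle_add)

lemma mle_sum: "finite I \<Longrightarrow> (\<And>i. i \<in> I \<Longrightarrow> mle (A i) (B i)) \<Longrightarrow> mle (sum A I) (sum B I)" by (induction rule: finite_induct) (auto intro: mle_add)

lemma dsub_exact:
 assumes "\<And>e. e > 0 \<Longrightarrow> \<exists>c. \<forall>i<length xs. \<forall>l<length xs. N (c i * y * st (c l) - (if i = l then xs ! i else 0)) \<le> e"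
 shows "dle xs [y]"
 unfolding dle_def dsub_def
proof (intro allI impI)
 fix e :: real assume "e > 0"
 then obtain c where "\<forall>i<length xs. \<forall>l<length xs. N (c i * y * st (c l) - (if i = l then xs ! i else 0)) \<le> e" using assms by blast
 then show "\<exists>c. \<forall>i<length xs. \<forall>l<length xs. N ((\<Sum>j<length [y]. c i j * [y] ! j * st (c l j)) - (if i = l then xs ! i else 0)) \<le> e"
  by (intro exI[of _ "\<lambda>i j. c i"]) simp
qed

lemma dle_row:
 assumes "x \<sim> (\<Sum>j<length ys. u j * ys ! j * st (u j))"
 shows "dle [x] ys"
 unfolding dle_def dsub_def using eqv_sym[OF assms] by (auto intro!: exI[of _ "\<lambda>i. u"] simp: eqv_def)

lemma mle_row:
 assumes "x \<sim> (\<Sum>j<n. u j * y * st (u j))"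
 shows "mle {#x#} (copies n y)" by (use dle_row[where u = u] assms mle_mset[of "[x]" "replicate n y"] in simp)

lemma mle_plus: "mle {#x + y#} {#x, y#}" by (use dle_row[where u = "\<lambda>_. 1"] mle_mset[of "[x + y]" "[x, y]"] in simp)

lemma mle_sum_single: "finite I \<Longrightarrow> mle {#sum f I#} (\<Sum>i\<in>I. {#f i#})"
proof (induction I rule: finite_induct)
 case empty
 show ?case using mle_mset[of "[0]" "[]"] using dle_row[where u = "\<lambda>_. 1"] by simp
next
 case (insert i I)
 then have "mle {#f i, sum f I#} ({#f i#} + (\<Sum>i\<in>I. {#f i#}))"
  using mle_add[OF mle_refl, of "{#sum f I#}" _ "{#f i#}"] by (simp add: add_mset_commute)
 then show ?case using insert.hyps mle_trans[OF mle_plus] by simp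
qed

section \<open>Cuntz comparison through functional calculus and cut-downs\<close>

lemma fc3:
 assumes c: "st c = c" and f: "continuous_on UNIV f" "continuous_on UNIV g"
 shows "fc f c * c * fc g c \<sim> fc (\<lambda>t. f t * t * g t) c"
proof -
 have "fc f c * c * fc g c \<sim> fc f c * fc (\<lambda>t. t) c * fc g c" by (intro eqv_mult eqv_refl eqv_sym[OF fc_id[OF c]])
 also have "... \<sim> fc (\<lambda>t. f t * t) c * fc g c" by (intro eqv_mult eqv_refl eqv_sym[OF fc_mult[OF c]] f continuous_intros)
 also have "... \<sim> fc (\<lambda>t. f t * t * g t) c" by (intro eqv_sym[OF fc_mult[OF c]] f continuous_intros)
 finally show ?thesis .
qed

lemma cont_inv_max: "d > 0 \<Longrightarrow> continuous_on UNIV (\<lambda>t::real. 1 / max t d)" by (intro continuous_intros) auto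

lemma fc_diff_bound:
 assumes c: "st c = c" and f: "continuous_on UNIV f" "continuous_on UNIV g"
  and "\<And>t. t \<in> spr c \<Longrightarrow> \<bar>f t - g t\<bar> \<le> e"
 shows "N (fc f c - fc g c) \<le> e"
proof -
 have "N (fc (\<lambda>t. f t - g t) c) \<le> e" by (intro fc_bound continuous_intros f) (use assms in auto)
 then show ?thesis using eqv_N[OF fc_diff[OF c f]] by simp
qed

lemma fc_diff_pos:
 assumes c: "st c = c" and f: "continuous_on UNIV f" "continuous_on UNIV g"
  and "\<And>t. t \<in> spr c \<Longrightarrow> f t \<le> g t"
 shows "pos (fc g c - fc f c)"
proof (rule pos_eqv)
 show "pos (fc (\<lambda>t. g t - f t) c)" by (intro fc_pos continuous_intros f) (use assms in auto)
 show "fc (\<lambda>t. g t - f t) c \<sim> fc g c - fc f c" by (intro fc_diff c f)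
qed (simp add: st_fc c f)

lemma pos_le_eqv: "pos (y - x) \<Longrightarrow> x \<sim> x' \<Longrightarrow> y \<sim> y' \<Longrightarrow> st x' = x' \<Longrightarrow> st y' = y' \<Longrightarrow> pos (y' - x')" by (rule pos_eqv) (auto intro: eqv_diff)

lemma conj_cz: "cz (v * a * st v) a"
 unfolding cz_def sub_def by (auto intro!: exI[of _ v])

lemma null_cz: "N a = 0 \<Longrightarrow> cz a b"
 unfolding cz_def sub_def by (auto intro!: exI[of _ 0])

lemma scale_cz: assumes "r \<ge> 0" shows "cz (rsc r * a) a"
proof -
 have "rsc (sqrt r) * a * st (rsc (sqrt r)) = rsc (sqrt r) * rsc (sqrt r) * a"
  unfolding mult.assoc by (simp add: sc_comm[of _ a])
 also have "... = rsc r * a" using assms by (simp flip: sc_mult of_real_mult)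
 finally show ?thesis by (metis conj_cz)
qed

text \<open>Take \<open>v = s * w\<close> with \<open>s\<close> the square root of \<open>a\<close>
  and \<open>w\<close> the function \<open>1 / sqrt (max t e)\<close> of \<open>b\<close>. Writing
  \<open>1 - w * b * w = x * x\<close>, the error \<open>s * x * x * s\<close> has the norm of
  \<open>x * a * x\<close>, which is at most that of \<open>x * b * x\<close>, hence at most
  \<open>e\<close>.\<close>

lemma pos_le_cz:
 assumes a: "pos a" and ab: "pos (b - a)"
 shows "cz a b"
 unfolding cz_def
proof (intro allI impI)
 fix e :: real assume e: "e > 0"
 have b: "pos b" using pos_add[OF a ab] by simp
 note sb = pos_st[OF b]
 note cm = cont_inv_max[OF e]
 define f where "f t = sqrt (1 / max t e)" for t
 have f: "continuous_on UNIV f" unfolding f_def by (intro continuous_intros cm)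
 define q where "q t = sqrt (1 - t * (1 / max t e))" for t
 have q: "continuous_on UNIV q" unfolding q_def by (intro continuous_intros cm)
 define s w x where "s = rt a" and "w = fc f b" and "x = fc q b"
 have s: "st s = s" "s * s \<sim> a" unfolding s_def by (intro rt a)+
 have w: "st w = w" unfolding w_def by (intro st_fc sb f)
 have x: "st x = x" unfolding x_def by (intro st_fc sb q)
 have fq: "f t * t * f t + q t * q t = 1" if "t \<in> spr b" for t
 proof -
  have "q t * q t = 1 - t * (1 / max t e)"
   unfolding q_def using e by (intro real_sqrt_mult_self[THEN trans]) simp
  moreover have "f t * f t = 1 / max t e"
   unfolding f_def using e by (intro real_sqrt_mult_self[THEN trans]) (simp)
  ultimately show ?thesis by (simp add: mult.commute mult.left_commute)
 qed
 have "w * b * w + x * x \<sim> fc (\<lambda>t. f t * t * f t) b + fc (\<lambda>t. q t * q t) b"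
  unfolding w_def x_def by (intro eqv_add fc3 eqv_sym[OF fc_mult] sb f q)
 also have "... \<sim> fc (\<lambda>t. f t * t * f t + q t * q t) b" by (intro eqv_sym[OF fc_add] sb continuous_intros f q)
 also have "... \<sim> fc (\<lambda>t. 1) b" by (intro fc_cong sb continuous_intros f q fq)
 also have "... \<sim> rsc 1" by (rule fc_const[OF sb])
 finally have one: "w * b * w + x * x \<sim> 1" by simp
 have "s * (w * b * w + x * x) * s \<sim> s * 1 * s" by (intro eqv_mult eqv_refl one)
 then have "N ((s * w) * b * st (s * w) - a) = N ((s * w) * b * st (s * w) - s * (w * b * w + x * x) * s)"
  by (simp add: eqv_trans[OF _ s(2)] N_cong eqv_sym)
 also have "(s * w) * b * st (s * w) - s * (w * b * w + x * x) * s = - (st (x * s) * (x * s))" by (simp add: s w x algebra_simps)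
 also have "N ... = N ((x * s) * st (x * s))" by (simp only: N_neg N_cstar N_cstar')
 also have "... = N (x * (s * s) * x)" by (simp add: s x mult.assoc)
 also have "... = N (x * a * st x)"
  unfolding x by (intro eqv_N eqv_mult eqv_refl s)
 also have "... \<le> N (x * b * st x)" by (intro pos_mono pos_conj a pos_conj_le ab)
 also have "... = N (fc (\<lambda>t. q t * t * q t) b)"
  unfolding x unfolding x_def by (intro eqv_N fc3 sb q)
 also have "... \<le> e"
 proof (intro fc_bound sb continuous_intros q)
  fix t assume t: "t \<in> spr b"
  then have t0: "0 \<le> t" using pos_spr[OF b] by blast
  have "q t * t * q t = (1 - t / max t e) * t" by (simp add: q_def e max_def)
  moreover have "0 \<le> (1 - t / max t e) * t" "(1 - t / max t e) * t \<le> e"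
  proof -
   show "0 \<le> (1 - t / max t e) * t" using t0 e by (intro mult_nonneg_nonneg) (auto)
   show "(1 - t / max t e) * t \<le> e"
   proof (cases "t \<le> e")
    case True
    then have "(1 - t / max t e) * t \<le> 1 * t" using t0 by (intro mult_right_mono) (auto)
    then show ?thesis using True by simp
   qed (use e in \<open>auto simp: max_def\<close>)
  qed
  ultimately show "\<bar>q t * t * q t\<bar> \<le> e" by (metis abs_of_nonneg)
 qed
 finally show "sub e a b"
  unfolding sub_def by blast
qed

text \<open>The conjugate is below \<open>N w\<close> times \<open>b * b\<close>, and
  \<open>b * b\<close> is a conjugate of \<open>b\<close> by its square root.\<close>

lemma her_cz:
 assumes b: "pos b" and w: "pos w"
 shows "cz (b * w * b) b"
proof -
 have "pos (rsc (N w) - w)" by (intro pos_upper pos_st w) simp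
 from pos_conj_le[OF this, of b] have "pos (b * rsc (N w) * b - b * w * b)" by (simp add: pos_st[OF b])
 moreover have "pos (b * w * b)" using pos_conj[OF w, of b] by (simp add: pos_st[OF b])
 ultimately have "cz (b * w * b) (b * rsc (N w) * b)" using pos_le_cz by blast
 moreover have "b * rsc (N w) * b = rsc (N w) * (b * b)" by (simp add: mult.assoc sc_comm)
 ultimately have "cz (b * w * b) (b * b)" using cz_trans[OF _ scale_cz] by (metis N_nonneg)
 moreover have "cz (b * b) (rt b * b * st (rt b))"
 proof (rule eqv_cz)
  have "b * b \<sim> (rt b * rt b) * (rt b * rt b)" by (intro eqv_mult eqv_sym[OF rt(2)] b)
  also have "... = rt b * (rt b * rt b) * rt b" by (simp add: mult.assoc)
  also have "... \<sim> rt b * b * rt b" by (intro eqv_mult eqv_refl rt(2) b)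
  finally show "b * b \<sim> rt b * b * st (rt b)" by (simp add: rt(1) b)
 qed
 ultimately show ?thesis using cz_trans conj_cz by blast
qed

definition cut :: "'g fa \<Rightarrow> real \<Rightarrow> 'g fa" where
 "cut a e = fc (\<lambda>t. max (t - e) 0) a"

lemma cont_cut: "continuous_on UNIV (\<lambda>t::real. max (t - e) 0)" by (intro continuous_intros)

lemma cut_pos: "st a = a \<Longrightarrow> pos (cut a e)"
 unfolding cut_def by (intro fc_pos cont_cut) auto

lemma cut_ch: "st a = a \<Longrightarrow> e \<ge> 0 \<Longrightarrow> ch a = 0 \<Longrightarrow> ch (cut a e) = 0"
 unfolding cut_def by (intro ch_fc_0 cont_cut) auto

lemma cut_close:
 assumes "pos a" "e \<ge> 0"
 shows "N (a - cut a e) \<le> e"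
proof -
 have "N (fc (\<lambda>t. t) a - cut a e) \<le> e"
  unfolding cut_def using pos_spr[OF assms(1)] assms(2) by (intro fc_diff_bound pos_st assms cont_cut continuous_intros) fastforce
 then show ?thesis using N_cong[OF fc_id[OF pos_st[OF assms(1)]] eqv_refl] by simp
qed

lemma cut_le:
 assumes "pos a" "e \<ge> 0"
 shows "pos (a - cut a e)"
proof (rule pos_le_eqv)
 show "pos (fc (\<lambda>t. t) a - cut a e)"
  unfolding cut_def using pos_spr[OF assms(1)] assms(2) by (intro fc_diff_pos pos_st assms cont_cut continuous_intros) fastforce
 show "fc (\<lambda>t. t) a \<sim> a" by (intro fc_id pos_st assms)
qed (use assms pos_st cut_pos in auto)

lemma cut_cz: "pos a \<Longrightarrow> e \<ge> 0 \<Longrightarrow> cz (cut a e) a" by (intro pos_le_cz cut_le cut_pos pos_st)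

lemma cut_norm:
 assumes "pos a" "e < N a"
 shows "N (cut a e) > 0"
proof -
 obtain t where t: "t \<in> spr a" "\<bar>t\<bar> = N a" using norm_in_spr[OF pos_st[OF assms(1)]] by metis
 have "\<bar>max (t - e) 0\<bar> \<le> N (cut a e)"
  unfolding cut_def by (rule fc_lower[OF pos_st[OF assms(1)] cont_cut t(1)])
 moreover have "t = N a" using pos_spr[OF assms(1) t(1)] t(2) by simp
 ultimately show ?thesis using assms(2) by simp
qed

text \<open>Let \<open>G = g(a)\<close> where \<open>g\<close> vanishes up to \<open>r\<close> and
  equals one from \<open>e\<close> on. Then
  \<open>cut a e \<le> G * (a - r) * G \<le> G * b * G\<close>, which is below
  \<open>b\<close>.\<close>

lemma pos_le_cut_cz:
 assumes a: "pos a" and b: "pos b" and le: "pos (b + rsc r - a)" and r: "0 \<le> r" "r < e"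
 shows "cz (cut a e) b"
proof -
 define g where "g t = min 1 (max 0 ((t - r) / (e - r)))" for t
 have g: "continuous_on UNIV g" unfolding g_def using r by (intro continuous_intros) auto
 define G where "G = fc g a"
 note sa = pos_st[OF a]
 have G: "st G = G" unfolding G_def by (intro st_fc sa g)
 have "G * (a - rsc r) * G = G * a * G - rsc r * (G * G)" by (simp add: algebra_simps) (metis mult.assoc sc_comm)
 also have "... \<sim> fc (\<lambda>t. g t * t * g t) a - fc (\<lambda>t. r * (g t * g t)) a"
  unfolding G_def by (intro eqv_diff fc3 sa g eqv_trans[OF eqv_mult[OF eqv_refl eqv_sym[OF fc_mult]] eqv_sym[OF fc_cmult]] continuous_intros)
 also have "... \<sim> fc (\<lambda>t. g t * t * g t - r * (g t * g t)) a" by (intro eqv_sym[OF fc_diff] sa continuous_intros g)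
 finally have *: "G * (a - rsc r) * G \<sim> fc (\<lambda>t. g t * t * g t - r * (g t * g t)) a" .
 have "pos (fc (\<lambda>t. g t * t * g t - r * (g t * g t)) a - cut a e)"
  unfolding cut_def
 proof (intro fc_diff_pos sa cont_cut continuous_intros g)
  fix t assume "t \<in> spr a"
  have eq: "g t * t * g t - r * (g t * g t) = g t * g t * (t - r)" by (simp add: algebra_simps)
  show "max (t - e) 0 \<le> g t * t * g t - r * (g t * g t)"
  proof (cases "t \<le> r")
   case True
   then have "g t = 0" using r by (auto simp: g_def divide_nonpos_pos)
   then show ?thesis using True r by simp
  next
   case False
   then have "0 \<le> g t * g t * (t - r)" by simp
   moreover have "g t = 1" if "t \<ge> e" using that r by (simp add: g_def)
   ultimately show ?thesis
    unfolding eq using r by (cases "t \<ge> e") auto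
  qed
 qed
 then have 1: "pos (G * (a - rsc r) * G - cut a e)"
  by (rule pos_le_eqv[OF _ eqv_refl eqv_sym[OF *]]) (simp_all add: G sa pos_st cut_pos mult.assoc)
 have "pos (G * b * st G - G * (a - rsc r) * st G)" using le by (intro pos_conj_le) (simp add: algebra_simps)
 then show ?thesis using conj_cz cz_trans by (metis cut_pos[OF sa] 1 G pos_trans pos_le_cz)
qed

text \<open>An approximate comparison becomes exact after cutting \<open>a\<close> down beyond the
  error: the norm estimate gives \<open>a \<le> v * b * st v + r\<close>.\<close>

lemma sub_cut_cz:
 assumes a: "pos a" and b: "pos b" and s: "sub r a b" "r < e"
 shows "cz (cut a e) b"
proof -
 obtain v where v: "N (v * b * st v - a) \<le> r" using s(1) unfolding sub_def by blast
 have r0: "0 \<le> r" using v N_nonneg order_trans by blast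
 have "pos (rsc r - (a - v * b * st v))" using v pos_st[OF a] pos_st[OF b] by (intro pos_upper) (simp_all add: N_minus_commute mult.assoc)
 then have "cz (cut a e) (v * b * st v)" using r0 s(2) by (intro pos_le_cut_cz[OF a, of _ r] pos_conj b) (simp_all add: algebra_simps)
 then show ?thesis using conj_cz cz_trans by blast
qed

text \<open>Cutting at a level strictly between \<open>r\<close> and \<open>e\<close> gives an
  element dominated exactly and still close enough to \<open>a\<close>.\<close>

lemma pos_le_sub:
 assumes a: "pos a" and b: "pos b" and le: "pos (b + rsc r - a)" and r: "0 \<le> r" "r < e"
 shows "sub e a b"
proof -
 define e' where "e' = (r + e) / 2"
 have e': "r < e'" "e' < e" "0 \<le> e'" using r by (auto simp: e'_def)
 have "sub (e - e') (cut a e') b" using e' using r pos_le_cut_cz[OF a b le] by (simp add: cz_def)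
 from sub_eqv[OF this cut_close[OF a e'(3)]] show ?thesis by simp
qed

text \<open>An approximate unit for \<open>a\<close> inside the hereditary subalgebra generated by \<open>a\<close>.\<close>

definition au :: "real \<Rightarrow> 'g fa \<Rightarrow> 'g fa" where
 "au d a = fc (\<lambda>t. t * (1 / max t d)) a"

text \<open>Besides the unit estimates, two properties matter: whatever annihilates \<open>a\<close>
  annihilates the unit, and the unit factors through \<open>a\<close>, which lets coefficients be
  moved into the corner of \<open>a\<close>.\<close>

lemma au:
 assumes a: "pos a" and d: "d > 0"
 shows "st (au d a) = au d a" "N (au d a) \<le> 1" "ch a = 0 \<Longrightarrow> ch (au d a) = 0" "N (au d a * a - a) \<le> d"
  "N (a * au d a - a) \<le> d" "N (au d a * a * au d a - a) \<le> d + d" "a * w \<sim> 0 \<Longrightarrow> au d a * w \<sim> 0"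
  "w * a \<sim> 0 \<Longrightarrow> w * au d a \<sim> 0"
  "au d a \<sim> a * fc (\<lambda>t. 1 / max t d) a" "pos (au d a)"
proof -
 note sa = pos_st[OF a]
 note cm = cont_inv_max[OF d]
 have c: "continuous_on UNIV (\<lambda>t. t * (1 / max t d))" by (intro continuous_intros cm)
 show st: "st (au d a) = au d a"
  unfolding au_def by (intro st_fc sa c)
 show "N (au d a) \<le> 1"
  unfolding au_def using d pos_spr[OF a] by (intro fc_bound sa c) (auto)
 then have n1: "N (au d a) \<le> 1" .
 show "ch a = 0 \<Longrightarrow> ch (au d a) = 0"
  unfolding au_def by (intro ch_fc_0 sa c) auto
 show "pos (au d a)"
  unfolding au_def using pos_spr[OF a] d by (intro fc_pos sa c) (auto)
 have "au d a * a \<sim> fc (\<lambda>t. t * (1 / max t d)) a * fc (\<lambda>t. t) a"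
  unfolding au_def by (intro eqv_mult eqv_refl eqv_sym[OF fc_id[OF sa]])
 also have "... \<sim> fc (\<lambda>t. t * (1 / max t d) * t) a" by (intro eqv_sym[OF fc_mult] sa c continuous_intros)
 finally have "N (au d a * a - a) = N (fc (\<lambda>t. t * (1 / max t d) * t) a - fc (\<lambda>t. t) a)" by (intro N_cong eqv_sym[OF fc_id[OF sa]])
 also have "... \<le> d"
 proof (intro fc_diff_bound sa c continuous_intros cm)
  fix t assume "t \<in> spr a"
  then have t: "t \<ge> 0" using pos_spr[OF a] by blast
  show "\<bar>t * (1 / max t d) * t - t\<bar> \<le> d"
  proof (cases "t \<le> d")
   case True
   then have m: "max t d = d" by simp
   have "t * (1 / d) * t \<le> 1 * t" using True t d by (intro mult_right_mono) auto
   moreover have "0 \<le> t * (1 / d) * t" using d by auto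
   ultimately show ?thesis unfolding m using True by linarith
  qed (use d in \<open>auto simp: max_def\<close>)
 qed
 finally show 1: "N (au d a * a - a) \<le> d" .
 have "N (a * au d a - a) = N (st (au d a * a - a))" by (simp add: st sa)
 then show 2: "N (a * au d a - a) \<le> d" using 1 by (simp only: N_st)
 have "N (au d a * a * au d a - a * au d a) \<le> d * 1" using N_mult_le[OF 1 n1] by (simp add: algebra_simps)
 from N_trans[OF this 2] show "N (au d a * a * au d a - a) \<le> d + d" by simp
 show 3: "a * w \<sim> 0 \<Longrightarrow> au d a * w \<sim> 0" for w
  unfolding au_def by (intro fc_ann sa c) auto
 show "w * a \<sim> 0 \<Longrightarrow> w * au d a \<sim> 0" using 3[of "st w"] eqv_st[of "w * a" 0] eqv_st[of "au d a * st w" 0] by (simp add: st sa)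
 show "au d a \<sim> a * fc (\<lambda>t. 1 / max t d) a"
  unfolding au_def by (rule eqv_trans[OF fc_mult[OF sa _ cm] eqv_mult[OF fc_id[OF sa] eqv_refl]]) (intro continuous_intros)
qed

lemma orth_sym: "st x = x \<Longrightarrow> st y = y \<Longrightarrow> x * y \<sim> 0 \<Longrightarrow> y * x \<sim> 0" using eqv_st[of "x * y" 0] by simp

text \<open>The column of approximate units \<open>u\<close> of \<open>x\<close> and
  \<open>v\<close> of \<open>y\<close> implements the comparison: each unit recovers its own summand
  and kills the other, so the mixed products vanish.\<close>

lemma mle_orth:
 assumes x: "pos x" and y: "pos y" and o: "x * y \<sim> 0"
 shows "mle {#x, y#} {#x + y#}"
proof -
 have "dle [x, y] [x + y]"
 proof (rule dsub_exact)
  fix e :: real assume e: "e > 0"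
  define d where "d = e / 2"
  have d: "d > 0" "d + d = e" using e by (auto simp: d_def)
  note o' = orth_sym[OF pos_st[OF x] pos_st[OF y] o]
  define u v where "u = au d x" and "v = au d y"
  note X = au[OF x d(1), folded u_def] and Y = au[OF y d(1), folded v_def]
  note rules = eqv_add[OF eqv_0_multl[OF X(7)[OF o]] eqv_refl] eqv_add[OF eqv_refl eqv_0_multl[OF Y(7)[OF o']]]
  have uv: "u * y * w \<sim> 0" "v * x * w \<sim> 0" "w * (x * v) \<sim> 0" "w * (y * u) \<sim> 0" for w
   using X(7)[OF o] Y(7)[OF o'] X(8)[OF o'] Y(8)[OF o] by (auto intro: eqv_0_multl eqv_0_multr)
  have 00: "N (u * (x + y) * st u - x) \<le> e"
  proof -
   have "u * (x + y) * st u \<sim> u * x * u + 0"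
    unfolding X(1) distrib_left distrib_right by (intro eqv_add eqv_refl uv)
   then show ?thesis using N_cong[of "u * (x + y) * st u" _ x x] X(6) d(2) by simp
  qed
  have 11: "N (v * (x + y) * st v - y) \<le> e"
  proof -
   have "v * (x + y) * st v \<sim> 0 + v * y * v"
    unfolding Y(1) distrib_left distrib_right by (intro eqv_add eqv_refl uv)
   then show ?thesis using N_cong[of "v * (x + y) * st v" _ y y] Y(6) d(2) by simp
  qed
  have "u * (x + y) * st v \<sim> 0 + 0"
   unfolding Y(1) distrib_left distrib_right by (intro eqv_add uv) (use uv in \<open>simp add: mult.assoc\<close>)
  then have 01: "N (u * (x + y) * st v) \<le> e" using e by (simp add: eqv_0_iff)
  have "v * (x + y) * st u \<sim> 0 + 0"
   unfolding X(1) distrib_left distrib_right by (intro eqv_add uv) (use uv in \<open>simp add: mult.assoc\<close>)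
  then have 10: "N (v * (x + y) * st u) \<le> e" using e by (simp add: eqv_0_iff)
  show "\<exists>c. \<forall>i<length [x, y]. \<forall>l<length [x, y]. N (c i * (x + y) * st (c l) - (if i = l then [x, y] ! i else 0)) \<le> e"
   using 00 01 10 11 by (intro exI[of _ "\<lambda>i. if i = 0 then u else v"]) (auto)
 qed
 then show ?thesis using mle_mset[of "[x, y]" "[x + y]"] by simp
qed

lemma mle_orth_sum:
 fixes n :: nat
 assumes "\<And>i. i < n \<Longrightarrow> pos (f i)" "\<And>i j. i < n \<Longrightarrow> j < n \<Longrightarrow> i \<noteq> j \<Longrightarrow> f i * f j \<sim> 0"
 shows "mle (\<Sum>i<n. {#f i#}) {#\<Sum>i<n. f i#}" using assms
proof (induction n)
 case 0
 then show ?case by (simp add: mle_subset)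
next
 case (Suc n)
 have "(\<Sum>i<n. f i) * f n \<sim> (\<Sum>i<n. 0)"
  unfolding sum_distrib_right by (intro eqv_sum Suc.prems) auto
 then have m1: "mle {#\<Sum>i<n. f i, f n#} {#(\<Sum>i<n. f i) + f n#}" using Suc.prems(1) by (intro mle_orth pos_sum) auto
 have "mle ((\<Sum>i<n. {#f i#}) + {#f n#}) ({#\<Sum>i<n. f i#} + {#f n#})" by (intro mle_add Suc.IH mle_refl Suc.prems) auto
 then have "mle ((\<Sum>i<n. {#f i#}) + {#f n#}) {#\<Sum>i<n. f i, f n#}" by (simp add: add_mset_commute)
 from mle_trans[OF this m1] show ?case by simp
qed

text \<open>The sum \<open>p + q\<close> is compared with the direct sum of \<open>b\<close> and
  \<open>d\<close> by a single row; orthogonality then replaces the direct sum by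
  \<open>b + d\<close>.\<close>

lemma sub_orth:
 assumes "sub e p b" "sub e' q d" "pos b" "pos d" "b * d \<sim> 0" "r > 0"
 shows "sub (e + e' + r) (p + q) (b + d)"
proof -
 obtain v w where v: "N (v * b * st v - p) \<le> e" and w: "N (w * d * st w - q) \<le> e'" using assms(1,2) unfolding sub_def by blast
 have "dsub (e + e') [p + q] [b, d]"
  unfolding dsub_def using N_add_le[OF v w] by (intro exI[of _ "\<lambda>i j. if j = 0 then v else w"]) (simp add: algebra_simps)
 moreover have "dle [b, d] [b + d]" using mle_orth[OF assms(3,4,5)] mle_mset[of "[b, d]" "[b + d]"] by simp
 ultimately show ?thesis using dsub_trans[OF _ _ assms(6)] dsub_single by blast
qed

text \<open>Polarization: \<open>u * b * w\<close> plus its adjoint is at most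
  \<open>u * b * st u + st w * b * w\<close>. Thus an approximate representation of \<open>a\<close>
  in the ideal of \<open>b\<close> with \<open>n\<close> terms bounds \<open>a\<close> by
  \<open>2 * n\<close> conjugates of \<open>b\<close> up to \<open>r\<close>, and the cut removes
  the \<open>r\<close>.\<close>

lemma ideal_cut_mle:
 assumes a: "pos a" and b: "pos b" and n: "N (a - (\<Sum>i<n. u i * b * w i)) \<le> r" and r: "r < e"
 shows "mle {#cut a e#} (copies (2 * n) b)"
proof -
 define T where "T = (\<Sum>i<n. u i * b * w i)"
 define f where "f i = u i * b * st (u i) + st (w i) * b * st (st (w i))" for i
 have r0: "0 \<le> r" using n N_nonneg order_trans by blast
 note sa = pos_st[OF a] and sb = pos_st[OF b]
 have fpos: "pos (f i)" for i
  unfolding f_def by (intro pos_add pos_conj b)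
 have half: "rsc (1/2) * x + rsc (1/2) * x = x" for x :: "'g fa" by (simp flip: distrib_right sc_add)
 \<comment> \<open>The difference in the polarization inequality is a sum of conjugates of
   \<open>b\<close>, hence positive.\<close>
 have sq: "(\<Sum>i<n. f i) - (T + st T) = (\<Sum>i<n. (u i - st (w i)) * b * st (u i - st (w i)))"
 proof -
  have "(\<Sum>i<n. f i) - (T + st T) = (\<Sum>i<n. f i - (u i * b * w i + st (u i * b * w i)))"
   unfolding T_def st_sum by (simp only: sum_subtractf sum.distrib)
  also have "... = (\<Sum>i<n. (u i - st (w i)) * b * st (u i - st (w i)))" by (intro sum.cong refl) (simp add: f_def sb algebra_simps)
  finally show ?thesis .
 qed
 then have "pos ((\<Sum>i<n. f i) - (T + st T))"
  unfolding sq by (intro pos_sum pos_conj b)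
 then have p: "pos (rsc (1/2) * ((\<Sum>i<n. f i) - (T + st T)))" by (rule pos_scale) simp
 have "rsc (1/2) * ((a - T) + st (a - T)) =
   (rsc (1/2) * a + rsc (1/2) * a) - rsc (1/2) * (T + st T)" by (simp only: st_diff sa right_diff_distrib) (simp only: algebra_simps)
 then have "a - rsc (1/2) * (T + st T) = rsc (1/2) * ((a - T) + st (a - T))" by (simp only: half)
 also have "N ... \<le> r" using N_add_le[OF n[folded T_def], of "st (a - T)" r] n[folded T_def] by (simp del: st_diff)
 finally have "pos (rsc r - (a - rsc (1/2) * (T + st T)))" by (intro pos_upper) (simp_all add: sa sc_comm add.commute)
 from pos_add[OF this p] have "pos (rsc (1/2) * (\<Sum>i<n. f i) + rsc r - a)" by (simp add: algebra_simps)
 then have "cz (cut a e) (rsc (1/2) * (\<Sum>i<n. f i))" using r r0 fpos by (intro pos_le_cut_cz[OF a] pos_scale pos_sum) auto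
 then have "mle {#cut a e#} {#\<Sum>i<n. f i#}"
  unfolding mle_single by (rule cz_trans) (rule scale_cz, simp)
 moreover have "mle {#\<Sum>i<n. f i#} (\<Sum>i<n. {#f i#})" by (intro mle_sum_single) simp
 moreover have "mle {#f i#} ({#b#} + {#b#})" for i
 proof -
  have "mle ({#u i * b * st (u i)#} + {#st (w i) * b * st (st (w i))#}) ({#b#} + {#b#})"
   by (intro mle_add) (simp_all only: mle_single conj_cz)
  then show ?thesis
   unfolding f_def by (intro mle_trans[OF mle_plus]) (simp add: add_mset_commute)
 qed
 then have "mle (\<Sum>i<n. {#f i#}) (\<Sum>i<n. {#b#} + {#b#})" by (intro mle_sum) auto
 moreover have "(\<Sum>i<n. {#b#} + {#b#}) = copies (2 * n) b" by (induction n) simp_all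
 ultimately show ?thesis using mle_trans by metis
qed

end

section \<open>Tracially Z-absorbing algebras\<close>

context lcs
begin

text \<open>The kernel of \<open>ch\<close> is the original algebra inside the unitization, so these
  are the positive elements of the algebra proper.\<close>

definition PS :: "'g fa \<Rightarrow> bool" where
 "PS x \<longleftrightarrow> pos x \<and> ch x = 0"

lemma PS_pos: "PS x \<Longrightarrow> pos x" and PS_ch: "PS x \<Longrightarrow> ch x = 0" and PS_st: "PS x \<Longrightarrow> st x = x" by (simp_all add: PS_def pos_st)

lemma PS_star: "ch v = 0 \<Longrightarrow> PS (v * st v)" by (simp add: PS_def pos_star')

lemma PS_cut: "PS a \<Longrightarrow> e \<ge> 0 \<Longrightarrow> PS (cut a e)" by (simp add: PS_def cut_pos cut_ch pos_st)

lemma PS_conj: "PS a \<Longrightarrow> PS (v * a * st v)" by (simp add: PS_def pos_conj)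

lemma N_pos_iff: "N x > 0 \<longleftrightarrow> \<not> x \<sim> 0" by (auto simp: eqv_0_iff less_le)

text \<open>The relations satisfied by the images of the matrix units under a c.p.c. order zero map.\<close>

definition oz :: "nat \<Rightarrow> (nat \<Rightarrow> nat \<Rightarrow> 'g fa) \<Rightarrow> bool" where
 "oz k f \<longleftrightarrow> (\<forall>i<k. \<forall>j<k. ch (f i j) = 0 \<and> st (f i j) = f j i \<and> N (f i j) \<le> 1 \<and>
   (\<forall>p<k. \<forall>l<k. j \<noteq> p \<longrightarrow> f i j * f p l \<sim> 0) \<and> (\<forall>l<k. f i j * f j l \<sim> f i i * f i l)) \<and>
   pos (\<Sum>i<k. f i i) \<and> N (\<Sum>i<k. f i i) \<le> 1"

end

text \<open>The tracial condition is phrased through the images \<open>f i j\<close> of matrix units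
  and with a tolerance in place of a cut-down; \<open>not_scalars\<close> says that no nonzero
  projection spans the whole algebra.\<close>

locale tz = lcs N for N :: "'g fa \<Rightarrow> real" +
 assumes tracial: "\<lbrakk>k \<ge> 1; finite F; \<And>b. b \<in> F \<Longrightarrow> ch b = 0; PS x; PS d; N d > 0; e > 0\<rbrakk> \<Longrightarrow>
   \<exists>f. oz k f \<and> (\<forall>i<k. \<forall>j<k. \<forall>b\<in>F. N (f i j * b - b * f i j) \<le> e) \<and>
    sub e (x * x - x * (\<Sum>i<k. f i i) * x) d"
  and simple: "\<lbrakk>PS b; N b > 0; ch a = 0; e > 0\<rbrakk> \<Longrightarrow>
   \<exists>n u w. N (a - (\<Sum>i<(n::nat). u i * b * w i)) \<le> e"
  and not_scalars: "\<lbrakk>PS p; p * p \<sim> p; N p > 0\<rbrakk> \<Longrightarrow> \<exists>y. ch y = 0 \<and> (\<forall>r. \<not> y \<sim> sc r * p)"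
begin

text \<open>If all \<open>x * z * y\<close> were null, approximating \<open>st x\<close> by sums of
  \<open>u * (y * st y) * w\<close> would make \<open>x * st x\<close> arbitrarily small.\<close>

lemma prime:
 assumes "ch x = 0" "N x > 0" "ch y = 0" "N y > 0"
 obtains z where "N (x * z * y) > 0"
proof (rule ccontr)
 assume "\<not> thesis"
 then have 0: "x * z * y \<sim> 0" for z using that N_pos_iff by blast
 have b: "PS (y * st y)" "N (y * st y) > 0" using assms by (simp_all add: PS_star N_cstar')
 have "(N x)\<^sup>2 \<le> 0 + e" if e: "e > 0" for e
 proof -
  have "\<exists>n u w. N (st x - (\<Sum>i<(n::nat). u i * (y * st y) * w i)) \<le> e / N x" using assms e by (intro simple b) auto
  then obtain n u w where n: "N (st x - (\<Sum>i<(n::nat). u i * (y * st y) * w i)) \<le> e / N x" by blast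
  have "x * (\<Sum>i<n. u i * (y * st y) * w i) = (\<Sum>i<n. x * u i * y * (st y * w i))" by (simp add: sum_distrib_left mult.assoc)
  also have "... \<sim> (\<Sum>i<n. 0 * (st y * w i))" by (intro eqv_sum eqv_mult eqv_refl 0)
  finally have "N (x * st x) = N (x * st x - x * (\<Sum>i<n. u i * (y * st y) * w i))" using N_cong[OF eqv_refl, of _ 0 "x * st x"] by simp
  also have "... \<le> N x * (e / N x)" using N_mult_le[OF order_refl n, of x] by (simp add: right_diff_distrib)
  finally show ?thesis using assms by (simp add: N_cstar')
 qed
 then have "(N x)\<^sup>2 \<le> 0" by (rule field_le_epsilon)
 then show False using assms by simp
qed

text \<open>A dense part of the hereditary subalgebra of \<open>c\<close>. The explicit form
  \<open>c * w * c\<close> makes comparison with \<open>c\<close> immediate, also for sums of such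
  elements.\<close>

definition her :: "'g fa \<Rightarrow> 'g fa \<Rightarrow> bool" where
 "her c x \<longleftrightarrow> PS x \<and> (\<exists>w. pos w \<and> x \<sim> c * w * c)"

lemma her_pair_mle:
 assumes c: "PS c" and xy: "her c x" "her c y" "x * y \<sim> 0"
 shows "mle {#x, y#} {#c#}"
proof -
 obtain v w where v: "pos v" "x \<sim> c * v * c" and w: "pos w" "y \<sim> c * w * c" using xy unfolding her_def by blast
 have "x + y \<sim> c * (v + w) * c" using eqv_add[OF v(2) w(2)] by (simp add: algebra_simps)
 then have "cz (x + y) (c * (v + w) * c)" by (rule eqv_cz)
 moreover have "cz (c * (v + w) * c) c" by (intro her_cz pos_add v w PS_pos c)
 ultimately have "mle {#x + y#} {#c#}"
  unfolding mle_single by (rule cz_trans)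
 moreover have "mle {#x, y#} {#x + y#}" using xy by (intro mle_orth) (auto simp: her_def PS_def)
 ultimately show ?thesis using mle_trans by blast
qed

lemma her_cz': "PS c \<Longrightarrow> her c x \<Longrightarrow> cz x c"
 unfolding her_def using her_cz[OF PS_pos] eqv_cz cz_trans by blast

definition bump :: "real \<Rightarrow> real \<Rightarrow> real \<Rightarrow> real" where
 "bump s r t = max 0 (r - \<bar>t - s\<bar>)"

lemma cont_bump: "continuous_on UNIV (bump s r)"
 unfolding bump_def by (intro continuous_intros)

lemma bump_simps: "0 \<le> bump s r t" "r \<ge> 0 \<Longrightarrow> bump s r s = r" "r \<le> \<bar>t - s\<bar> \<Longrightarrow> bump s r t = 0" by (auto simp: bump_def)

lemma bump_disjoint: "2 * r \<le> \<bar>s - s'\<bar> \<Longrightarrow> bump s r t * bump s' r t = 0" by (auto simp: bump_def)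

lemma bump_orth:
 assumes c: "st c = c" and st: "s \<in> spr c" "t \<in> spr c" "s \<noteq> t" "s \<noteq> 0" "t \<noteq> 0"
 obtains x y where "pos x" "pos y" "N x > 0" "N y > 0" "x * y \<sim> 0" "\<And>w. c * w \<sim> 0 \<Longrightarrow> x * w \<sim> 0" "\<And>w. c * w \<sim> 0 \<Longrightarrow> y * w \<sim> 0"
  "ch c = 0 \<Longrightarrow> ch x = 0" "ch c = 0 \<Longrightarrow> ch y = 0" "N (c * x * c) > 0" "N (c * y * c) > 0" "c * x * c * (c * y * c) \<sim> 0"
proof -
 \<comment> \<open>Half the distance separates the supports of the two bumps; the bounds by the
   absolute values make both bumps vanish at 0.\<close>
 define r where "r = min (\<bar>s - t\<bar> / 2) (min \<bar>s\<bar> \<bar>t\<bar>)"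
 have r: "r > 0" "2 * r \<le> \<bar>s - t\<bar>" "r \<le> \<bar>0 - s\<bar>" "r \<le> \<bar>0 - t\<bar>" using st by (auto simp: r_def min_def)
 define f g where "f = bump s r" and "g = bump t r"
 have f: "continuous_on UNIV f" "f 0 = 0" "\<And>u. 0 \<le> f u" "f s = r" and g: "continuous_on UNIV g" "g 0 = 0" "\<And>u. 0 \<le> g u" "g t = r"
  using r by (simp_all add: f_def g_def cont_bump bump_simps)
 have fg: "f u * g u = 0" for u
  unfolding f_def g_def by (rule bump_disjoint[OF r(2)])
 define x y where "x = fc f c" and "y = fc g c"
 have "x * y \<sim> fc (\<lambda>u. f u * g u) c"
  unfolding x_def y_def by (intro eqv_sym[OF fc_mult] c f g)
 also have "... \<sim> fc (\<lambda>u. 0) c"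
  unfolding fg by simp
 also have "... \<sim> 0" using fc_const[OF c, of 0] by simp
 finally have xy: "x * y \<sim> 0" .
 have comm: "c * x \<sim> x * c" "c * y \<sim> y * c"
  unfolding x_def y_def by (intro eqv_sym[OF fc_commute[OF c]] f g eqv_refl)+
 have "c * x * c * (c * y * c) = c * (x * c) * (c * y * c)" by (simp add: mult.assoc)
 also have "... \<sim> c * (c * x) * (y * c * c)" by (intro eqv_mult eqv_refl eqv_sym[OF comm(1)] comm(2))
 also have "... = c * c * (x * y) * (c * c)" by (simp add: mult.assoc)
 also have "... \<sim> c * c * 0 * (c * c)" by (intro eqv_mult eqv_refl xy)
 finally have o: "c * x * c * (c * y * c) \<sim> 0" by simp
 have cxc: "c * fc h c * c \<sim> fc (\<lambda>u. u * h u * u) c" if "continuous_on UNIV h" for h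
 proof -
  have "c * fc h c * c \<sim> fc (\<lambda>u. u) c * fc h c * fc (\<lambda>u. u) c" by (intro eqv_mult eqv_refl eqv_sym[OF fc_id[OF c]])
  also have "... \<sim> fc (\<lambda>u. u * h u) c * fc (\<lambda>u. u) c" by (intro eqv_mult eqv_refl eqv_sym[OF fc_mult[OF c]] that continuous_intros)
  also have "... \<sim> fc (\<lambda>u. u * h u * u) c" by (intro eqv_sym[OF fc_mult[OF c]] that continuous_intros)
  finally show ?thesis .
 qed
 have nz: "N (c * fc h c * c) > 0" "N (fc h c) > 0" if "continuous_on UNIV h" "h v > 0" "v \<in> spr c" "v \<noteq> 0" for h v
 proof -
  have "\<bar>v * h v * v\<bar> \<le> N (fc (\<lambda>u. u * h u * u) c)" by (rule fc_lower[OF c _ that(3)]) (intro continuous_intros that)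
  moreover have "0 < \<bar>v * h v * v\<bar>" using that by simp
  ultimately show "N (c * fc h c * c) > 0" using eqv_N[OF cxc[OF that(1)]] by linarith
  show "N (fc h c) > 0" using fc_lower[OF c that(1,3)] that(2) by linarith
 qed
 show ?thesis
 proof (rule that[of x y])
  show "pos x" "pos y"
   unfolding x_def y_def by (intro fc_pos c f g)+
  show "N x > 0" "N y > 0" "N (c * x * c) > 0" "N (c * y * c) > 0"
   unfolding x_def y_def using nz f g r(1) st by metis+
  show "c * w \<sim> 0 \<Longrightarrow> x * w \<sim> 0" "c * w \<sim> 0 \<Longrightarrow> y * w \<sim> 0" for w
   unfolding x_def y_def by (intro fc_ann c f g; assumption)+
  show "ch c = 0 \<Longrightarrow> ch x = 0" "ch c = 0 \<Longrightarrow> ch y = 0"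
   unfolding x_def y_def by (intro ch_fc_0 c f g; assumption)+
 qed (fact xy o)+
qed

text \<open>The polynomial \<open>t * (t - r)\<close> vanishes on the spectrum.\<close>

lemma single_spectrum:
 assumes c: "st c = c" and r: "spr c \<subseteq> {0, r}"
 shows "c * c \<sim> rsc r * c"
proof -
 have "N (rp [:0, -r, 1:] c) \<le> 0" using r by (intro rp_bound[OF c]) auto
 moreover have "rp [:0, -r, 1:] c = c * c - rsc r * c" by (simp add: sc_neg algebra_simps sc_comm)
 ultimately show ?thesis by (simp add: eqv_def antisym)
qed

lemma proj_pos: "st p = p \<Longrightarrow> p * p \<sim> p \<Longrightarrow> pos p" by (rule pos_eqv[OF pos_sq]) auto

text \<open>If the algebra generated by a minimal projection \<open>p\<close> contains a partial isometry
 \<open>t\<close> with \<open>t t\<^sup>* = p\<close> and \<open>t\<^sup>* t \<perp> p\<close>, an order zero map almost commuting with \<open>p\<close> and \<open>t\<close>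
 is almost zero on \<open>p + t\<^sup>* t\<close>, so that this rank two projection would be dominated by \<open>p\<close>.\<close>

lemma minimal_projection_contradiction:
 assumes p: "PS p" "p * p \<sim> p" "N p = 1" and min: "\<And>y. \<exists>r. p * y * p \<sim> sc r * p"
  and t: "ch t = 0" "p * t \<sim> t" "t * p \<sim> 0" "t * st t \<sim> p"
 shows False
proof -
 define q where "q = st t * t"
 note sp = PS_st[OF p(1)]
 \<comment> \<open>Chosen such that \<open>5 * e = (1/16) ^ 4\<close>, the threshold met in
   \<open>small\<close> below.\<close>
 define e :: real where "e = 1/327680"
 have e: "e > 0" by (simp add: e_def)
 have tp: "st t * p \<sim> st t" "p * st t \<sim> 0" using eqv_st[OF t(2)] eqv_st[OF t(3)] by (simp_all add: sp)
 have "q * q = st t * (t * st t) * t" by (simp add: q_def mult.assoc)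
 also have "... \<sim> st t * p * t" by (intro eqv_mult eqv_refl t)
 also have "... \<sim> q" unfolding q_def by (intro eqv_mult eqv_refl tp)
 finally have qq: "q * q \<sim> q" .
 have pq: "p * q \<sim> 0" using eqv_0_multl[OF tp(2), of t] by (simp add: q_def mult.assoc)
 have q: "PS q" "st q = q" using pos_star[of t] t(1) by (simp_all add: PS_def q_def)
 have qp: "q * p \<sim> 0" using orth_sym[OF sp q(2) pq] .
 define x where "x = p + q"
 have x: "PS x" "st x = x" using p q by (auto simp: PS_def x_def sp intro: pos_add)
 have "x * x = p * p + p * q + (q * p + q * q)" by (simp add: x_def algebra_simps)
 also have "... \<sim> p + 0 + (0 + q)" by (intro eqv_add p qp pq qq)
 finally have xx: "x * x \<sim> x" by (simp add: x_def)
 have Nt: "N t = 1" using eqv_N[OF t(4)] p(3) N_cstar'[of t] N_nonneg[of t] by (simp add: power2_eq_1_iff)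
 have "\<exists>f. oz 2 f \<and> (\<forall>i<2. \<forall>j<2. \<forall>b\<in>{p, t, st t}. N (f i j * b - b * f i j) \<le> e) \<and>
   sub e (x * x - x * (\<Sum>i<2. f i i) * x) p" by (rule tracial) (use t(1) x(1) p e in \<open>auto simp: PS_ch\<close>)
 then obtain f where f: "oz 2 f" "\<And>i j b. i < 2 \<Longrightarrow> j < 2 \<Longrightarrow> b \<in> {p, t, st t} \<Longrightarrow> N (f i j * b - b * f i j) \<le> e"
  "sub e (x * x - x * (\<Sum>i<2. f i i) * x) p" by blast
 define a b u u' where "a = f 0 0" and "b = f 1 1" and "u = f 0 1" and "u' = f 1 0"
 have rel: "a * b \<sim> 0" "u * u' \<sim> a * a" "u' * u \<sim> b * b" using f(1) unfolding oz_def a_def b_def u_def u'_def by auto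
 have Nf: "N a \<le> 1" "N b \<le> 1" "N u \<le> 1" "N u' \<le> 1" using f(1) unfolding oz_def a_def b_def u_def u'_def by auto
 have comm: "N (y * z - z * y) \<le> e" if "y \<in> {a, b, u, u'}" "z \<in> {p, t, st t}" for y z
  using that f(2) unfolding a_def b_def u_def u'_def by auto
 obtain la where la: "p * a * p \<sim> sc la * p" using min by blast
 obtain lb where lb: "p * b * p \<sim> sc lb * p" using min by blast
 obtain lu where lu: "p * u * p \<sim> sc lu * p" using min by blast
 obtain lu' where lu': "p * u' * p \<sim> sc lu' * p" using min by blast
 note l = la lb lu lu'
 have Np: "N (sc r * p) = cmod r" for r by (simp add: p(3))
 \<comment> \<open>Minimality makes compressions by \<open>p\<close> scalar, and almost commutation
   with \<open>p\<close> makes the compression almost multiplicative. So the scalars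
   \<open>la\<close>, \<open>lb\<close>, \<open>lu\<close>, \<open>lu'\<close> approximately satisfy
   the relations of the matrix units.\<close>
 have prod: "N (sc r * p * (sc s * p) - p * (y * z) * p) \<le> e" if "p * y * p \<sim> sc r * p" "p * z * p \<sim> sc s * p"
  "y \<in> {a, b, u, u'}" "N z \<le> 1" for y z r s
 proof -
  have "sc r * p * (sc s * p) \<sim> p * y * p * (p * z * p)" by (rule eqv_mult[OF eqv_sym[OF that(1)] eqv_sym[OF that(2)]])
  also have "... = p * y * (p * p) * z * p" by (simp add: mult.assoc)
  also have "... \<sim> p * y * p * z * p" by (intro eqv_mult eqv_refl p)
  finally have 1: "sc r * p * (sc s * p) \<sim> p * y * p * z * p" .
  have 2: "p * (y * z) * p \<sim> p * p * y * z * p" using eqv_mult[OF eqv_sym[OF p(2)] eqv_refl, of "y * z * p"] by (simp add: mult.assoc)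
  have "N (p * (y * p - p * y) * (z * p)) \<le> 1 * e * (1 * 1)" using that p(3) comm[of y p] by (intro N_mult3_le N_mult_le) auto
  then show ?thesis
   unfolding N_cong[OF 1 2] by (simp add: algebra_simps)
 qed
 have scpp: "sc r * p * (sc s * p) \<sim> sc (r * s) * p" for r s by (simp add: sc_mult mult.assoc sc_left_comm[of p] eqv_mult p)
 have prod': "N (sc (r * s) * p - p * (y * z) * p) \<le> e" if "p * y * p \<sim> sc r * p" "p * z * p \<sim> sc s * p"
  "y \<in> {a, b, u, u'}" "N z \<le> 1" for y z r s using prod[OF that] N_cong[OF scpp eqv_refl] by simp
 have Nd: "cmod (r - s) \<le> N (sc r * p - z) + N (sc s * p - z)" for r s z
 by (metis Np[of "r - s"] sc_diff left_diff_distrib N_triangle2[of "sc r * p" "sc s * p" z] N_minus_commute[of z])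
 have 1: "cmod (la * lb) \<le> e"
 by (use eqv_0_multl[OF eqv_0_multr[OF rel(1)]] N_cong[OF eqv_refl, of "p * (a * b) * p" 0] prod'[OF l(1,2) _ Nf(2)] p(3) in simp)
 have z: "N (sc r * p - p * (u * u') * p) = N (sc r * p - p * (a * a) * p)" "N (sc r * p - p * (u' * u) * p) = N (sc r * p - p * (b * b) * p)" for r
  by (intro N_cong eqv_mult eqv_refl rel)+
 \<comment> \<open>Both squares are compared with the same scalar \<open>lu * lu'\<close>, because
   \<open>u * u' \<sim> a * a\<close> and \<open>u' * u \<sim> b * b\<close>.\<close>
 have 2: "cmod (la * la - lb * lb) \<le> 4 * e"
 proof -
  have "cmod (la * la - lu * lu') \<le> e + e"
   using Nd[of "la * la" "lu * lu'" "p * (a * a) * p"] z(1) prod'[OF l(1,1) _ Nf(1)] prod'[OF l(3,4) _ Nf(4)] by force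
  moreover have "cmod (lb * lb - lu' * lu) \<le> e + e"
   using Nd[of "lb * lb" "lu' * lu" "p * (b * b) * p"] z(2) prod'[OF l(2,2) _ Nf(2)] prod'[OF l(4,3) _ Nf(3)] by force
  ultimately show ?thesis using norm_triangle_ineq4[of "la * la - lu * lu'" "lb * lb - lu' * lu"] by simp
 qed
 \<comment> \<open>From \<open>r ^ 4 = r\<^sup>2 * (r\<^sup>2 - s\<^sup>2) + (r * s)\<^sup>2\<close>
   the fourth power of the modulus is at most \<open>5 * e\<close>.\<close>
 have small: "cmod r \<le> 1/16" if rs: "cmod (r * s) \<le> e" "cmod (r * r - s * s) \<le> 4 * e" "cmod r \<le> 1" for r s
 proof (rule ccontr)
  assume "\<not> cmod r \<le> 1/16"
  then have "(1/16) ^ 4 < cmod r ^ 4" by (intro power_strict_mono) auto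
  also have "cmod r ^ 4 = cmod (r * r * (r * r - s * s) + (r * s) * (r * s))"
  proof -
   have "r ^ 4 = r * r * (r * r - s * s) + (r * s) * (r * s)" by (simp add: algebra_simps power4_eq_xxxx)
   then show ?thesis by (metis norm_power)
  qed
  also have "... \<le> cmod r * cmod r * cmod (r * r - s * s) + cmod (r * s) * cmod (r * s)" by (metis norm_mult norm_triangle_ineq)
  also have "... \<le> 1 * 1 * (4 * e) + e * 1" using rs by (intro add_mono mult_mono) (auto simp: e_def)
  finally show False by (simp add: e_def power4_eq_xxxx)
 qed
 have l1: "cmod la \<le> 1" "cmod lb \<le> 1"
 proof -
  have "N (p * y * p) \<le> 1 * 1 * 1" if "N y \<le> 1" for y using that p(3) by (intro N_mult3_le) auto
  from this[OF Nf(1)] this[OF Nf(2)] show "cmod la \<le> 1" "cmod lb \<le> 1" by (simp_all add: eqv_N[OF l(1)] eqv_N[OF l(2)] p(3))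
 qed
 have lsmall: "cmod la \<le> 1/16" "cmod lb \<le> 1/16"
  using small[OF 1 2 l1(1)] small[of lb la] 1 2 l1(2) by (simp_all add: mult.commute norm_minus_commute)
 define h where "h = a + b"
 have h: "(\<Sum>i<2. f i i) = h" "N h \<le> 1" using f(1) by (auto simp: oz_def h_def a_def b_def numeral_2_eq_2)
 have hc: "N (h * y - y * h) \<le> 2 * e" if "y \<in> {p, t, st t}" for y
 proof -
  show ?thesis using N_add_le[OF comm[of a y] comm[of b y]] that by (simp add: h_def algebra_simps)
 qed
 have php: "N (p * h * p) \<le> 1/8"
 proof -
  have "N (p * h * p) = N (sc la * p + sc lb * p)" by (simp add: h_def distrib_left distrib_right eqv_add l eqv_N)
  also have "... \<le> 1/16 + 1/16" by (intro N_add_le) (simp_all only: Np lsmall)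
  finally show ?thesis by simp
 qed
 have phq: "N (p * h * q) \<le> 2 * e"
 proof -
  have "N (p * h * q) = N ((p * h - h * p) * q)"
   using N_cong[OF eqv_refl, of "h * p * q" 0 "p * h * q"] by (simp add: pq mult.assoc eqv_0_multr left_diff_distrib)
  also have "... \<le> 2 * e * (1 * 1)"
   unfolding q_def using hc[of p] Nt by (intro N_mult_le) (auto simp: N_minus_commute)
  finally show ?thesis by simp
 qed
 have qhp: "N (q * h * p) \<le> 2 * e" using phq N_st[of "p * h * q"] using f(1) h_def a_def b_def oz_def by (simp add: sp q mult.assoc)
 \<comment> \<open>The corner of \<open>q\<close> is carried to the corner of \<open>p\<close> by
   \<open>t\<close>, with which \<open>h\<close> almost commutes.\<close>
 have qhq: "N (q * h * q) \<le> 1/8 + 2 * e"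
 proof -
  have "q * h * q = st t * (t * h * st t) * t" by (simp add: q_def mult.assoc)
  also have "... \<sim> (st t * p) * (t * h * st t) * (p * t)" by (intro eqv_mult eqv_refl eqv_sym[OF tp(1)] eqv_sym[OF t(2)])
  finally have A: "q * h * q \<sim> st t * (p * (t * h * st t) * p) * t" by (simp add: mult.assoc)
  have "p * (t * st t * h) * p \<sim> p * (p * h) * p" using eqv_mult[OF t(4) eqv_refl] by (rule eqv_mult[OF eqv_mult[OF eqv_refl] eqv_refl])
  also have "... = (p * p) * h * p" by (simp add: mult.assoc)
  also have "... \<sim> p * h * p" by (intro eqv_mult eqv_refl p)
  finally have B: "N (p * (t * st t * h) * p) \<le> 1/8" using php eqv_N by metis
  have "N (p * (t * (h * st t - st t * h)) * p) \<le> 1 * (1 * (2 * e)) * 1" using hc[of "st t"] p(3) Nt by (intro N_mult3_le N_mult_le) auto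
  then have "N (p * (t * h * st t) * p) \<le> 1/8 + 2 * e" using B N_reverse[of "p * (t * h * st t) * p" "p * (t * st t * h) * p"] by (simp add: algebra_simps)
  then have "N (st t * (p * (t * h * st t) * p) * t) \<le> 1 * (1/8 + 2 * e) * 1" using Nt by (intro N_mult3_le) auto
  then show ?thesis using eqv_N[OF A] by simp
 qed
 have "x * h * x = (p * h * p + p * h * q) + (q * h * p + q * h * q)" by (simp add: x_def algebra_simps)
 also have "N ... \<le> (1/8 + 2 * e) + (2 * e + (1/8 + 2 * e))" by (intro N_add_le php phq qhp qhq)
 finally have xhx: "N (x * h * x) \<le> 1/4 + 6 * e" by simp
 obtain v where v: "N (v * p * st v - (x * x - x * h * x)) \<le> e" using f(3) unfolding sub_def h(1) by blast
 have vx: "N (v * p * st v - x) \<le> 2/5"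
 proof -
  have "N (x * x - x * h * x - x * x) \<le> 1/4 + 6 * e" using xhx by simp
  moreover have "N (x * x - x) \<le> 0" using xx by (simp add: eqv_def)
  ultimately have "N (v * p * st v - x) \<le> e + (1/4 + 6 * e) + 0" using v by (rule N_trans3[rotated])
  then show ?thesis by (simp add: e_def)
 qed
 \<comment> \<open>In the frame given by \<open>p\<close> and \<open>t\<close>, the element
   \<open>v * p * st v\<close> is the rank one matrix of the vector \<open>(al, be)\<close>, while
   \<open>x\<close> is the identity matrix. Being within 2/5 of each other entrywise, they give
   \<open>9/25 \<le> 4/25\<close>.\<close>
 obtain al where al: "p * v * p \<sim> sc al * p" using min by blast
 obtain be where be: "p * (t * v) * p \<sim> sc be * p" using min by blast
 have "t * v * p \<sim> p * t * v * p" by (rule eqv_mult[OF eqv_mult[OF eqv_sym[OF t(2)] eqv_refl] eqv_refl])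
 also have "p * t * v * p = p * (t * v) * p" by (simp add: mult.assoc)
 finally have be': "t * v * p \<sim> sc be * p" by (rule eqv_trans[OF _ be])
 have al': "p * st v * p \<sim> sc (cnj al) * p" using eqv_st[OF al] by (simp add: sp mult.assoc sc_comm[of _ p])
 have be'': "p * st v * st t \<sim> sc (cnj be) * p" using eqv_st[OF be'] by (simp add: sp mult.assoc sc_comm[of _ p])
 have vpv: "y * (v * p * st v) * st y' \<sim> sc (r * s) * p" if "y * v * p \<sim> sc r * p" "p * st v * st y' \<sim> sc s * p" for y y' r s
 proof -
  have "y * (v * p * st v) * st y' = y * v * p * (st v * st y')" by (simp add: mult.assoc)
  also have "... \<sim> y * v * (p * p) * (st v * st y')" by (intro eqv_mult eqv_refl eqv_sym[OF p(2)])
  also have "... = (y * v * p) * (p * st v * st y')" by (simp add: mult.assoc)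
  also have "... \<sim> sc r * p * (sc s * p)" by (intro eqv_mult that)
  also have "... \<sim> sc (r * s) * p" by (rule scpp)
  finally show ?thesis .
 qed
 have key: "cmod (r * s - g) \<le> 2/5" if "y * v * p \<sim> sc r * p" "p * st v * st y' \<sim> sc s * p" "y * x * st y' \<sim> sc g * p" "N y = 1" "N y' = 1" for y y' r s g
 proof -
  have "cmod (r * s - g) = N (sc (r * s) * p - sc g * p)" using Np[of "r * s - g"] by (simp add: sc_diff left_diff_distrib)
  also have "... = N (y * (v * p * st v) * st y' - y * x * st y')" by (rule N_cong[OF eqv_sym[OF vpv[OF that(1,2)]] eqv_sym[OF that(3)]])
  also have "... = N (y * (v * p * st v - x) * st y')" by (simp add: algebra_simps)
  also have "... \<le> 1 * (2/5) * 1" using that vx by (intro N_mult3_le) auto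
  finally show ?thesis by simp
 qed
 have px: "p * x \<sim> p" using eqv_add[OF p(2) pq] by (simp add: x_def distrib_left)
 have c1: "p * x * st p \<sim> sc 1 * p" using eqv_trans[OF _ p(2)] using sp eqv_mult px by simp
 have c2: "p * x * st t \<sim> sc 0 * p" using eqv_trans[OF _ tp(2)] using eqv_mult px by simp
 have c3: "t * x * st t \<sim> sc 1 * p"
 proof -
  have "t * x * st t = t * p * st t + (t * st t) * (t * st t)" by (simp add: x_def q_def algebra_simps)
  also have "... \<sim> 0 * st t + p * p" by (intro eqv_add eqv_mult t eqv_refl)
  finally show ?thesis using eqv_trans[OF _ p(2)] by simp
 qed
 have "cmod (al * cnj al - 1) \<le> 2/5" using key[OF al _ c1] al' p(3) by (simp add: sp)
 moreover have "cmod (be * cnj be - 1) \<le> 2/5" using key[OF be' be'' c3] Nt by simp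
 ultimately have "3/5 \<le> (cmod al)\<^sup>2" "3/5 \<le> (cmod be)\<^sup>2" "cmod al * cmod be \<le> 2/5"
  using norm_triangle_ineq2[of 1 "al * cnj al"] norm_triangle_ineq2[of 1 "be * cnj be"]
  using key[OF al be'' c2] p(3) Nt by (simp_all add: norm_mult power2_eq_square norm_minus_commute)
 then have "(3/5) * (3/5) \<le> (cmod al)\<^sup>2 * (cmod be)\<^sup>2" "(cmod al * cmod be)\<^sup>2 \<le> (2/5)\<^sup>2" by (intro mult_mono power_mono; simp)+
 then have "(3/5) * (3/5) \<le> (2/5 :: real)\<^sup>2"
  unfolding power_mult_distrib by linarith
 then show False by (simp add: power2_eq_square)
qed

end

section \<open>Absence of minimal projections; orthogonal and small elements\<close>

context lcs
begin

lemma st_scale: "st (sc a * x) = sc (cnj a) * st (x :: 'g fa)" by (metis sc_comm st_mult st_sc)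

lemma real_imag:
 fixes y :: "'g fa"
 obtains h k where "st h = h" "st k = k" "y = h + sc \<i> * k"
proof (rule that)
 have half: "sc (1/2) * x + sc (1/2) * x = x" for x :: "'g fa" by (simp flip: distrib_right sc_add)
 show "st (sc (1/2) * (y + st y)) = sc (1/2) * (y + st y)" by (simp del: st_mult add: st_scale add.commute)
 show "st (sc (- \<i>/2) * (y - st y)) = sc (- \<i>/2) * (y - st y)" by (simp del: st_mult add: st_scale sc_neg algebra_simps)
 have "sc (1/2) * (y + st y) + sc \<i> * (sc (- \<i>/2) * (y - st y)) = sc (1/2) * (y + st y) + sc (1/2) * (y - st y)"
  by (simp flip: sc_mult mult.assoc)
 also have "... = sc (1/2) * y + sc (1/2) * y" by (simp add: algebra_simps)
 finally show "y = sc (1/2) * (y + st y) + sc \<i> * (sc (- \<i>/2) * (y - st y))" using half[of y] by simp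
qed

lemma sc_mult_assoc: "sc r * (sc s * x) = sc (r * s) * x" by (simp add: sc_mult mult.assoc)

lemma sc_pull: "(sc r * x) * (sc s * y) = sc (r * s) * (x * y)" by (simp add: sc_mult mult.assoc sc_left_comm[of x])

end

context tz
begin

lemma nonzero_spr_single:
 assumes c: "st c = c" "N c > 0"
  and eq: "\<forall>s\<in>spr c. \<forall>t\<in>spr c. s \<noteq> 0 \<longrightarrow> t \<noteq> 0 \<longrightarrow> s = t"
 obtains r q where "r \<noteq> 0" "q = rsc (inverse r) * c" "c = rsc r * q"
  "st q = q" "q * q \<sim> q" "N q = 1" "pos q" "\<bar>r\<bar> = N c" "r \<in> spr c"
proof -
 obtain r where r: "r \<in> spr c" "\<bar>r\<bar> = N c" using norm_in_spr[OF c(1)] by metis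
 have r0: "r \<noteq> 0" using r c by auto
 have "spr c \<subseteq> {0, r}" using eq r(1) r0 by blast
 from single_spectrum[OF c(1) this] have cc: "c * c \<sim> rsc r * c" .
 define q where "q = rsc (inverse r) * c"
 have cq: "c = rsc r * q" using r0 by (simp add: q_def flip: sc_mult mult.assoc)
 have sq: "st q = q" by (simp add: q_def c sc_comm)
 have "q * q = sc (complex_of_real (inverse r) * complex_of_real (inverse r)) * (c * c)" by (simp add: q_def sc_pull)
 also have "... \<sim> sc (complex_of_real (inverse r) * complex_of_real (inverse r)) * (rsc r * c)" by (rule eqv_mult[OF eqv_refl cc])
 also have "... = q" by (simp add: q_def sc_mult_assoc field_simps)
 finally have qq: "q * q \<sim> q" .
 have "N q = 1" using r c by (simp add: q_def norm_inverse)
 then show ?thesis using that[of r q] r r0 q_def cq sq qq proj_pos by blast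
qed

lemma her_of_corner:
 assumes p: "st p = p" "p * p \<sim> p" and x: "pos x" "ch x = 0" "p * x \<sim> x"
 shows "her p x"
proof -
 have "x * p \<sim> x" using eqv_st[OF x(3)] by (simp add: p pos_st x)
 have "p * x * p \<sim> x * p" by (rule eqv_mult[OF x(3) eqv_refl])
 from eqv_sym[OF eqv_trans[OF this \<open>x * p \<sim> x\<close>]] show ?thesis
  unfolding her_def using x by (auto simp: PS_def)
qed

text \<open>Two distinct nonzero spectral values of \<open>c\<close> would give orthogonal bumps, so
  without a pair \<open>c\<close> is a multiple of a projection \<open>p\<close>. The same reasoning
  inside the corner of \<open>p\<close> makes \<open>p\<close> minimal. The algebra is larger than
  the multiples of \<open>p\<close>, and primeness then supplies the partial isometry excluded by
  \<open>minimal_projection_contradiction\<close>.\<close>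

theorem exists_orth_pair:
 assumes c: "PS c" "N c > 0"
 obtains x y where "her c x" "her c y" "N x > 0" "N y > 0" "x * y \<sim> 0"
proof (rule ccontr)
 assume "\<not> thesis"
 then have no: "\<And>x y. her c x \<Longrightarrow> her c y \<Longrightarrow> x * y \<sim> 0 \<Longrightarrow> \<not> (N x > 0 \<and> N y > 0)" using that by blast
 note sc' = PS_st[OF c(1)]
 have "s = t" if "s \<in> spr c" "t \<in> spr c" "s \<noteq> 0" "t \<noteq> 0" for s t
 proof (rule ccontr)
  assume "s \<noteq> t"
  from bump_orth[OF sc' that(1,2) this that(3,4)] obtain x y where xy: "pos x" "pos y"
   "N (c * x * c) > 0" "N (c * y * c) > 0" "c * x * c * (c * y * c) \<sim> 0" by metis
  have "her c (c * w * c)" if "pos w" for w using that pos_conj[OF that, of c] PS_ch[OF c(1)] by (auto simp: her_def PS_def sc')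
  then show False using no xy by blast
 qed
 then have "\<forall>s\<in>spr c. \<forall>t\<in>spr c. s \<noteq> 0 \<longrightarrow> t \<noteq> 0 \<longrightarrow> s = t" by blast
 from nonzero_spr_single[OF sc' c(2) this] obtain r p where r: "r \<noteq> 0" and p: "p = rsc (inverse r) * c"
  "st p = p" "p * p \<sim> p" "N p = 1" "pos p" by metis
 have PSp: "PS p" using p PS_ch[OF c(1)] by (simp add: PS_def)
 have herc: "her c x" if hx: "her p x" for x
 proof -
  obtain w where w: "pos w" "x \<sim> p * w * p" "PS x" using hx unfolding her_def by blast
  show ?thesis
   unfolding her_def using w pos_scale[OF w(1), of "inverse r * inverse r"]
   by (simp add: p(1) sc_mult mult.assoc sc_left_comm[of c] sc_left_comm[of w] exI[of _ "rsc (inverse r * inverse r) * w"])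
 qed
 have no': "\<not> (N x > 0 \<and> N y > 0)" if "her p x" "her p y" "x * y \<sim> 0" for x y using no herc that by blast
 \<comment> \<open>A self-adjoint \<open>z\<close> in the corner is a multiple of a projection
   \<open>q\<close> below \<open>p\<close>. Since \<open>q\<close> and \<open>p - q\<close> are
   orthogonal, one of them is null, and it has to be \<open>p - q\<close>.\<close>
 have min1: "\<exists>s. p * y * p \<sim> sc s * p" if y: "st y = y" for y
 proof (cases "N (p * y * p) = 0")
  case True
  then show ?thesis by (intro exI[of _ 0]) (simp add: eqv_0_iff)
 next
  case False
  define z where "z = p * y * p"
  have z: "st z = z" "N z > 0" "ch z = 0" using False PS_ch[OF PSp] by (simp_all add: z_def p(2) y mult.assoc less_le)
  have zp: "z * p \<sim> z" using eqv_mult[OF eqv_refl p(3), of "p * y"] by (simp add: z_def mult.assoc)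
  have pz: "p * z \<sim> z" using eqv_st[OF zp] by (simp add: p(2) z(1))
  have z1: "z * (1 - p) \<sim> 0" using eqv_diff[OF eqv_refl zp, of z] by (simp add: algebra_simps)
  have "s = t" if "s \<in> spr z" "t \<in> spr z" "s \<noteq> 0" "t \<noteq> 0" for s t
  proof (rule ccontr)
   assume "s \<noteq> t"
   from bump_orth[OF z(1) that(1,2) this that(3,4)] obtain x y where xy: "pos x" "pos y" "N x > 0" "N y > 0" "x * y \<sim> 0"
    "\<And>w. z * w \<sim> 0 \<Longrightarrow> x * w \<sim> 0" "\<And>w. z * w \<sim> 0 \<Longrightarrow> y * w \<sim> 0" "ch x = 0" "ch y = 0" using z(3) by metis
   have "her p x" if "pos x" "ch x = 0" "x * (1 - p) \<sim> 0" for x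
   proof (rule her_of_corner[OF p(2,3) that(1,2)])
    have "x \<sim> x * p" using eqv_add[OF that(3) eqv_refl, of "x * p"] by (simp add: algebra_simps)
    from eqv_st[OF eqv_sym[OF this]] show "p * x \<sim> x" by (simp add: p(2) pos_st that(1))
   qed
   from no'[OF this[OF xy(1,8) xy(6)[OF z1]] this[OF xy(2,9) xy(7)[OF z1]] xy(5)] xy(3,4) show False by blast
  qed
  then have "\<forall>s\<in>spr z. \<forall>t\<in>spr z. s \<noteq> 0 \<longrightarrow> t \<noteq> 0 \<longrightarrow> s = t" by blast
  from nonzero_spr_single[OF z(1,2) this] obtain s q where s: "z = rsc s * q" and q: "q = rsc (inverse s) * z"
   "st q = q" "q * q \<sim> q" "N q = 1" "pos q" by metis
  have pq: "p * q \<sim> q" using eqv_mult[OF eqv_refl pz, of "rsc (inverse s)"] by (simp add: q(1) sc_left_comm)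
  have qp: "q * p \<sim> q" using eqv_st[OF pq] by (simp add: p(2) q(2))
  have "(p - q) * (p - q) = (p * p - p * q) - (q * p - q * q)" by (simp add: algebra_simps)
  also have "... \<sim> (p - q) - (q - q)" by (intro eqv_diff p q pq qp)
  finally have "pos (p - q)" by (intro proj_pos) (simp_all add: p(2) q(2))
  moreover have "p * (p - q) \<sim> p - q" using eqv_diff[OF p(3) pq] by (simp add: right_diff_distrib)
  moreover have "ch q = 0" by (simp add: q(1) z)
  moreover have "q * (p - q) \<sim> 0" using eqv_diff[OF qp q(3)] by (simp add: right_diff_distrib)
  ultimately have "\<not> (N q > 0 \<and> N (p - q) > 0)" using PS_ch[OF PSp] by (intro no' her_of_corner p q pq) auto
  then have "p \<sim> q" using q(4) N_nonneg[of "p - q"] by (simp add: eqv_def)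
  from eqv_mult[OF eqv_refl eqv_sym[OF this], of "rsc s"] show ?thesis
   unfolding z_def[symmetric] s[symmetric] by blast
 qed
 have min: "\<exists>s. p * y * p \<sim> sc s * p" for y
 proof -
  obtain h k where hk: "st h = h" "st k = k" "y = h + sc \<i> * k" using real_imag .
  obtain a where a: "p * h * p \<sim> sc a * p" using min1[OF hk(1)] by blast
  obtain b where b: "p * k * p \<sim> sc b * p" using min1[OF hk(2)] by blast
  have "p * y * p = p * h * p + sc \<i> * (p * k * p)" by (simp add: hk(3) distrib_left distrib_right sc_left_comm mult.assoc)
  also have "... \<sim> sc a * p + sc \<i> * (sc b * p)" by (intro eqv_add a eqv_mult b eqv_refl)
  also have "... = sc (a + \<i> * b) * p" by (simp add: sc_add sc_mult_assoc distrib_right)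
  finally show ?thesis by blast
 qed
 obtain y0 where y0: "ch y0 = 0" "\<And>r. \<not> y0 \<sim> sc r * p" using not_scalars[OF PSp p(3)] p(4) by auto
 \<comment> \<open>An element that is not a multiple of \<open>p\<close> sticks out of the corner on
   the right or on the left. In the second case its adjoint is joined to \<open>p\<close> by
   primeness.\<close>
 have "\<exists>t. ch t = 0 \<and> p * t \<sim> t \<and> t * p \<sim> 0 \<and> N t > 0"
 proof (cases "N (p * y0 * (1 - p)) > 0")
  case True
  have "p * p * y0 * (1 - p) \<sim> p * y0 * (1 - p)" "p * y0 * (p - p * p) \<sim> p * y0 * (p - p)" by (intro eqv_mult eqv_diff eqv_refl p)+
  then show ?thesis using True y0(1) by (simp add: mult.assoc left_diff_distrib exI[of _ "p * y0 * (1 - p)"])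
 next
  case False
  then have 1: "p * y0 * (1 - p) \<sim> 0" using N_pos_iff by blast
  have "N ((1 - p) * y0) > 0"
  proof (rule ccontr)
   assume "\<not> N ((1 - p) * y0) > 0"
   then have "(1 - p) * y0 \<sim> 0" using N_pos_iff by blast
   from eqv_add[OF eqv_add[OF this 1] eqv_refl, of "p * y0 * p"] have "y0 \<sim> p * y0 * p" by (simp add: algebra_simps)
   then show False using min[of y0] y0(2) eqv_trans by blast
  qed
  then have "N (st ((1 - p) * y0)) > 0" "ch (st ((1 - p) * y0)) = 0" using y0(1) by (simp_all only: N_st) simp
  then obtain z where z: "N (p * z * st ((1 - p) * y0)) > 0" using prime[OF PS_ch[OF PSp]] p(4) by (metis zero_less_one)
  define t where "t = p * z * st ((1 - p) * y0)"
  have "p * p * z * st ((1 - p) * y0) \<sim> p * z * st ((1 - p) * y0)" by (intro eqv_mult eqv_refl p)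
  moreover have "p * z * st y0 * (p - p * p) \<sim> p * z * st y0 * (p - p)" by (intro eqv_mult eqv_diff eqv_refl p)
  ultimately have "p * t \<sim> t" "t * p \<sim> 0" by (simp_all add: t_def p(2) mult.assoc left_diff_distrib right_diff_distrib)
  moreover have "ch t = 0" using PS_ch[OF PSp] by (simp add: t_def)
  ultimately show ?thesis using z t_def by blast
 qed
 then obtain t where t: "ch t = 0" "p * t \<sim> t" "t * p \<sim> 0" "N t > 0" by blast
 obtain m where m: "p * (t * st t) * p \<sim> sc m * p" using min by blast
 have tp: "st t * p \<sim> st t" using eqv_st[OF t(2)] by (simp add: p(2))
 have "p * (t * st t) * p = (p * t) * (st t * p)" by (simp add: mult.assoc)
 also have "... \<sim> t * st t" by (rule eqv_mult[OF t(2) tp])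
 finally have tt: "t * st t \<sim> sc m * p" using m eqv_sym eqv_trans by blast
 have "t * st t \<sim> sc (cnj m) * p" using eqv_st[OF tt] by (simp add: p(2) sc_comm[of _ p])
 from eqv_diff[OF eqv_trans[OF eqv_sym[OF tt] this] eqv_refl, of "sc (cnj m) * p"] have "sc (m - cnj m) * p \<sim> 0"
  by (simp add: sc_diff left_diff_distrib)
 then have "m = cnj m" by (simp add: eqv_0_iff p(4))
 then obtain s where s: "m = complex_of_real s" by (metis Reals_cases Reals_cnj_iff)
 have "s > 0"
 proof (rule ccontr)
  assume "\<not> s > 0"
  then have "pos (rsc (- s) * p)" by (intro pos_scale p) simp
  then have "pos (- (t * st t))" by (rule pos_eqv) (use eqv_neg[OF eqv_sym[OF tt]] in \<open>simp_all add: s sc_neg\<close>)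
  then have "t * st t \<sim> 0" by (intro pos_antisym pos_star')
  then show False using t(4) by (simp add: eqv_0_iff N_cstar')
 qed
 \<comment> \<open>Scaling by \<open>1 / sqrt s\<close> turns \<open>t * st t \<sim> s * p\<close>
   into \<open>p\<close> itself.\<close>
 define r where "r = complex_of_real (1 / sqrt s)"
 have r2: "r * cnj r * m = 1" using \<open>s > 0\<close> by (simp add: r_def s flip: of_real_mult)
 have "(sc r * t) * st (sc r * t) = sc (r * cnj r) * (t * st t)"
  by (simp add: sc_mult mult.assoc sc_left_comm[of t] flip: sc_comm[of _ "st t"])
 also have "... \<sim> sc (r * cnj r) * (sc m * p)" by (rule eqv_mult[OF eqv_refl tt])
 also have "... = p" by (simp add: sc_mult_assoc r2)
 finally have "(sc r * t) * st (sc r * t) \<sim> p" .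
 moreover have "p * (sc r * t) \<sim> sc r * t" "sc r * t * p \<sim> 0"
  using eqv_mult[OF eqv_refl t(2), of "sc r"] eqv_0_multr[OF t(3), of "sc r"] by (simp_all add: sc_left_comm mult.assoc)
 ultimately show False using t(1) by (intro minimal_projection_contradiction[OF PSp p(3,4) min, of "sc r * t"]) simp_all
qed

text \<open>Primeness gives \<open>z\<close> with \<open>x * z * h\<close> not null, and this
  element times its adjoint has both forms: it lies in the hereditary part of \<open>x\<close> and
  is a conjugate of \<open>h * h\<close>.\<close>

lemma common_below:
 assumes x: "PS x" "N x > 0" and h: "PS h" "N h > 0"
 obtains y where "her x y" "cz y h" "N y > 0"
proof -
 obtain z where z: "N (x * z * h) > 0" using prime assms PS_ch by metis
 define y where "y = (x * z * h) * st (x * z * h)"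
 have y: "y = x * (z * (h * h) * st z) * x" "y = (x * z) * (h * h) * st (x * z)"
  by (simp_all add: y_def PS_st[OF x(1)] PS_st[OF h(1)] mult.assoc)
 have "her x y"
  unfolding her_def
 proof (intro conjI exI[of _ "z * (h * h) * st z"])
  show "PS y" unfolding y_def using PS_ch[OF x(1)] by (intro PS_star) simp
  show "pos (z * (h * h) * st z)" by (intro pos_conj pos_sq PS_st h)
 qed (use y in simp)
 moreover have "cz y h"
 proof -
  have "cz y (h * h)" unfolding y(2) by (rule conj_cz)
  moreover have "cz (h * 1 * h) h" by (rule her_cz[OF PS_pos[OF h(1)] pos_1])
  ultimately show ?thesis using cz_trans by simp
 qed
 moreover have "N y > 0" unfolding y_def N_cstar' using z by simp
 ultimately show ?thesis using that by blast
qed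

text \<open>An orthogonal pair below \<open>c\<close> need not consist of comparable elements, so
  \<open>h\<close> is taken in the hereditary part of one member and below the other.\<close>

lemma exists_half:
 assumes c: "PS c" "N c > 0"
 obtains h where "PS h" "N h > 0" "mle {#h, h#} {#c#}"
proof -
 obtain x y where xy: "her c x" "her c y" "N x > 0" "N y > 0" "x * y \<sim> 0" using exists_orth_pair[OF c] .
 then have PSxy: "PS x" "PS y" by (auto simp: her_def)
 obtain h where h: "her x h" "cz h y" "N h > 0" using common_below[OF PSxy(1) xy(3) PSxy(2) xy(4)] .
 have "mle ({#h#} + {#h#}) ({#x#} + {#y#})" by (intro mle_add) (simp_all add: mle_single h her_cz'[OF PSxy(1)])
 then have "mle {#h, h#} {#x, y#}" by (simp add: add_mset_commute)
 then show ?thesis using that h using her_pair_mle[OF c(1) xy(1,2,5)] mle_trans by (auto simp: her_def)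
qed

text \<open>Halving is iterated \<open>n\<close> times, which yields \<open>2 ^ n \<ge> n\<close>
  copies.\<close>

lemma exists_small:
 assumes c: "PS c" "N c > 0"
 obtains h where "PS h" "N h > 0" "mle (copies n h) {#c#}"
proof -
 have "\<exists>h. PS h \<and> N h > 0 \<and> mle (copies (2 ^ n) h) {#c#}"
 proof (induction n)
  case 0
  then show ?case using c by auto
 next
  case (Suc n)
  then obtain h where h: "PS h" "N h > 0" "mle (copies (2 ^ n) h) {#c#}" by blast
  obtain g where g: "PS g" "N g > 0" "mle {#g, g#} {#h#}" using exists_half[OF h(1,2)] .
  have "mle (repeat_mset (2 ^ n) {#g, g#}) (repeat_mset (2 ^ n) {#h#})" by (rule mle_replicate[OF g(3)])
  moreover have "repeat_mset (2 ^ n) {#h#} = copies (2 ^ n) h" for h :: "'g fa" and n :: nat by simp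
  moreover have "repeat_mset (2 ^ n) {#g, g#} = copies (2 ^ Suc n) g" by (simp add: multiset_eq_iff)
  ultimately show ?case using g h mle_trans by metis
 qed
 then obtain h where h: "PS h" "N h > 0" "mle (copies (2 ^ n) h) {#c#}" by blast
 have "copies n h \<subseteq># copies (2 ^ n) h" by (simp add: subseteq_mset_def)
 then show ?thesis using that[of h] h mle_trans mle_subset by blast
qed

end

section \<open>Comparison: almost unperforation for positive elements\<close>

context lcs
begin

text \<open>The square root \<open>r\<close> of \<open>y\<close> also satisfies
  \<open>r * b \<sim> r\<close>, whence \<open>y \<sim> r * b * r\<close>.\<close>

lemma unit_cz:
 assumes y: "pos y" and b: "st b = b" "b * y \<sim> y"
 shows "cz y b"
proof -
 define r where "r = rt y"
 have r: "st r = r" "r * r \<sim> y" using rt[OF y] by (simp_all add: r_def)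
 have "y * (1 - b) \<sim> 0" using eqv_st[OF eqv_diff[OF eqv_sym[OF b(2)] eqv_refl, of "b * y"]] by (simp add: pos_st y b(1) right_diff_distrib)
 then have "r * (1 - b) \<sim> 0"
  unfolding r_def rt_def by (intro fc_ann pos_st y cont_sqrt) auto
 from eqv_mult[OF eqv_add[OF this eqv_refl, of "r * b"] eqv_refl, of r] have "r * r \<sim> r * b * r" by (simp add: right_diff_distrib)
 then show ?thesis using eqv_cz conj_cz cz_trans by (metis eqv_trans[OF eqv_sym[OF r(2)]] r(1))
qed

lemma rp_power: "rp (p ^ n) x = rp p x ^ n" by (induction n) (simp_all add: rp_mult one_pCons)

text \<open>Bernoulli's inequality \<open>1 - t ^ n \<le> n * (1 - t)\<close> on the spectrum. The
  tracial condition controls \<open>1 - h\<close>, while products of matrix units produce powers of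
  \<open>h\<close>; the remainder grows only by the factor \<open>n\<close>, plus one
  \<open>e\<close> of slack for the two strict inequalities.\<close>

lemma sub_power:
 assumes s: "st s = s" and h: "pos h" "N h \<le> 1" and d: "pos d"
  and X: "sub e (s * s - s * h * s) d" and e: "e > 0"
 shows "sub (real (Suc n) * e) (s * s - s * h ^ n * s) d"
proof -
 note sh = pos_st[OF h(1)]
 define E K where "E = complex_of_real e" and "K = complex_of_real (real n)"
 obtain v where v: "N (v * d * st v - (s * s - s * h * s)) \<le> e" using X unfolding sub_def by blast
 have "pos (rsc 1 - h ^ n)" using sh using order_trans[OF N_power power_le_one] h by (intro pos_upper) simp_all
 from pos_conj[OF this, of s] have Q: "pos (s * s - s * h ^ n * s)" by (simp add: s algebra_simps)
 define p where "p = Polynomial.smult (real n) [:1, -1:] - (1 - [:0, 1:] ^ n)"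
 have "pos (fc (poly p) h)"
 proof (intro fc_pos sh)
  fix t assume "t \<in> spr h"
  then show "0 \<le> poly p t" using Bernoulli_inequality[of "t - 1" n] using pos_spr[OF h(1)] by (simp add: p_def algebra_simps)
 qed (intro continuous_intros)
 moreover have "fc (poly p) h \<sim> rp p h" by (intro fc_rp sh continuous_intros refl)
 ultimately have "pos (rp p h)" using rp_st[OF sh] by (rule pos_eqv)
 moreover have "rp p h = K * 1 - K * h - (1 - h ^ n)" if "K = (rsc (real n) :: 'g fa)" for K
  unfolding p_def by (simp add: rp_diff rp_power that sc_neg one_pCons sc_comm[of _ h])
 ultimately have "pos (s * (sc K * 1 - sc K * h - (1 - h ^ n)) * st s)"
  unfolding K_def by (metis pos_conj)
 moreover have "s * (sc K * 1 - sc K * h - (1 - h ^ n)) * st s = sc K * (s * s - s * h * s) - (s * s - s * h ^ n * s)"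
  by (simp add: s left_diff_distrib right_diff_distrib sc_left_comm mult.assoc)
 moreover have "pos (sc K * (sc E - ((s * s - s * h * s) - v * d * st v)))"
  unfolding K_def E_def using v by (intro pos_scale pos_upper) (simp_all add: N_minus_commute s sh pos_st[OF d] mult.assoc)
 ultimately have "pos ((sc K * (s * s - s * h * s) - (s * s - s * h ^ n * s)) + sc K * (sc E - ((s * s - s * h * s) - v * d * st v)))"
  by (intro pos_add) simp_all
 moreover have "rsc (real n * e) = (sc K * sc E :: 'g fa)" by (simp add: K_def E_def flip: sc_mult)
 ultimately have "pos (sc K * (v * d * st v) + rsc (real n * e) - (s * s - s * h ^ n * s))" by (simp add: algebra_simps)
 then have "sub (real n * e + 1/2 * e) (s * s - s * h ^ n * s) (sc K * (v * d * st v))"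
  unfolding K_def using e by (intro pos_le_sub[OF Q, of _ "real n * e"] pos_scale pos_conj d) auto
 moreover have "cz (sc K * (v * d * st v)) d"
  unfolding K_def using scale_cz[of "real n" "v * d * st v"] conj_cz cz_trans by (metis of_nat_0_le_iff)
 ultimately have "sub (real n * e + 1/2 * e + 1/2 * e) (s * s - s * h ^ n * s) d" by (rule sub_trans) (use e in simp)
 then show ?thesis by (simp add: algebra_simps)
qed

lemma oz_rules:
 assumes "oz k f"
 shows "i < k \<Longrightarrow> j < k \<Longrightarrow> ch (f i j) = 0" "i < k \<Longrightarrow> j < k \<Longrightarrow> st (f i j) = f j i"
  "i < k \<Longrightarrow> j < k \<Longrightarrow> N (f i j) \<le> 1" "i < k \<Longrightarrow> j < k \<Longrightarrow> p < k \<Longrightarrow> l < k \<Longrightarrow> j \<noteq> p \<Longrightarrow> f i j * f p l \<sim> 0"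
  "i < k \<Longrightarrow> j < k \<Longrightarrow> l < k \<Longrightarrow> f i j * f j l \<sim> f i i * f i l"
  "pos (\<Sum>i<k. f i i)" "N (\<Sum>i<k. f i i) \<le> 1" using assms unfolding oz_def by blast+

lemma N_sum_le: "(\<And>i. i \<in> I \<Longrightarrow> N (f i) \<le> e) \<Longrightarrow> N (sum f I) \<le> real (card I) * e" using order_trans[OF N_sum sum_mono, of I f "\<lambda>_. e"] by simp

lemma comm_sum:
 assumes "\<And>i. i < k \<Longrightarrow> N (f i * b - b * f i) \<le> e"
 shows "N ((\<Sum>i<k. f i) * b - b * (\<Sum>i<k. f i)) \<le> real k * e"
proof -
 show ?thesis using N_sum_le[of "{..<k}" "\<lambda>i. f i * b - b * f i" e] assms by (simp add: sum_distrib_left sum_distrib_right sum_subtractf)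
qed

end

context tz
begin

text \<open>With \<open>C = \<Sum> c\<^sub>i\<^sub>j f\<^sub>i\<^sub>j\<close> the element \<open>C b C\<^sup>*\<close> is close to \<open>a h\<^sup>2\<close>, where \<open>h = \<Sum> f\<^sub>i\<^sub>i\<close>; the
 remaining part of \<open>a\<close> is small in the tracial sense.\<close>

lemma tracial_comparison:
 assumes a: "PS a" and b: "PS b" and d: "PS d" "N d > 0" and bd: "b * d \<sim> 0" and k: "k \<ge> 1"
  and c: "dsub \<delta> (replicate k a) (replicate k b)" and r: "\<rho> > 0"
 shows "sub (real k * (real k * \<delta>) + \<rho>) a (b + d)"
proof -
 obtain c0 where "\<forall>i<k. \<forall>l<k. N ((\<Sum>j<k. c0 i j * replicate k b ! j * st (c0 l j)) - (if i = l then replicate k a ! i else 0)) \<le> \<delta>"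
  using c unfolding dsub_def length_replicate by blast
 then have c0: "N ((\<Sum>j<k. c0 i j * b * st (c0 l j)) - (if i = l then a else 0)) \<le> \<delta>" if "i < k" "l < k" for i l
  using that by (cases "i = l") fastforce+
 define h where "h = \<rho> / (8 * real k * real k)"
 have h: "h > 0" "real k * (real k * (h + h)) = \<rho> / 4" using r k by (simp_all add: h_def)
 \<comment> \<open>Multiplying by an approximate unit of \<open>a\<close> puts the coefficients into
   the kernel of \<open>ch\<close>, as the tracial condition requires of the elements to be almost
   commuted with.\<close>
 define u where "u = au h a"
 note u = au[OF PS_pos[OF a] h(1), folded u_def]
 define c where "c i j = u * c0 i j" for i j
 have chc: "ch (c i j) = 0" for i j using u(3)[OF PS_ch[OF a]] by (simp add: c_def)
 have c: "N ((\<Sum>j<k. c i j * b * st (c l j)) - (if i = l then a else 0)) \<le> \<delta> + (h + h)" if "i < k" "l < k" for i l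
 proof -
  have "(\<Sum>j<k. c i j * b * st (c l j)) - u * (if i = l then a else 0) * u =
    u * ((\<Sum>j<k. c0 i j * b * st (c0 l j)) - (if i = l then a else 0)) * u"
   by (simp only: c_def st_mult u(1) sum_distrib_left sum_distrib_right right_diff_distrib left_diff_distrib mult.assoc)
  also have "N ... \<le> 1 * \<delta> * 1" by (intro N_mult3_le u c0 that)
  finally have 1: "N ((\<Sum>j<k. c i j * b * st (c l j)) - u * (if i = l then a else 0) * u) \<le> \<delta>" by simp
  have 2: "N (u * (if i = l then a else 0) * u - (if i = l then a else 0)) \<le> h + h" using u(6) h(1) by (cases "i = l") simp_all
  show ?thesis by (rule N_trans[OF 1 2])
 qed
 define s where "s = rt a"
 have s: "st s = s" "s * s \<sim> a" "PS s" using rt[OF PS_pos[OF a]] PS_ch[OF a] by (simp_all add: s_def PS_def)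
 define F where "F = {s, b} \<union> (\<lambda>(i, j). st (c i j)) ` ({..<k} \<times> {..<k})"
 define C where "C = (\<Sum>i<k. \<Sum>j<k. N (c i j))"
 have C0: "C \<ge> 0" by (auto simp: C_def intro!: sum_nonneg)
 have C: "N (c i j) \<le> C" if "i < k" "j < k" for i j
 proof -
  have "N (c i j) \<le> (\<Sum>j<k. N (c i j))" using that by (intro member_le_sum) auto
  also have "... \<le> C"
   unfolding C_def using that by (intro member_le_sum[of i "{..<k}" "\<lambda>i. \<Sum>j<k. N (c i j)"] sum_nonneg) auto
  finally show ?thesis .
 qed
 define K where "K = real k"
 \<comment> \<open>Collects the factors by which commutators get multiplied: the quadruple sum in
   \<open>D * b * st D\<close>, moving \<open>H\<close> past \<open>s\<close>, and
   \<open>3 * e\<close> from \<open>sub_power\<close>.\<close>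
 define M where "M = K * (K * (K * (K * (C * C + 2 * (C * N b))))) + N s * (2 * K) + 3"
 have M: "M > 0" unfolding M_def K_def using C0 by (intro add_nonneg_pos add_nonneg_nonneg mult_nonneg_nonneg) auto
 define e where "e = \<rho> / (4 * M)"
 have e: "e > 0" "M * e = \<rho> / 4" using r M by (simp_all add: e_def)
 have "\<exists>f. oz k f \<and> (\<forall>i<k. \<forall>j<k. \<forall>b\<in>F. N (f i j * b - b * f i j) \<le> e) \<and> sub e (s * s - s * (\<Sum>i<k. f i i) * s) d"
  using k d s(3) e(1) chc PS_ch[OF s(3)] PS_ch[OF b] by (intro tracial) (auto simp: F_def)
 then obtain f where f: "oz k f" "\<And>i j b. i < k \<Longrightarrow> j < k \<Longrightarrow> b \<in> F \<Longrightarrow> N (f i j * b - b * f i j) \<le> e"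
  "sub e (s * s - s * (\<Sum>i<k. f i i) * s) d" by blast
 note oz = oz_rules[OF f(1)]
 define H where "H = (\<Sum>i<k. f i i)"
 define g where "g i l = f i i * f i l" for i l
 have Ng: "N (g i l) \<le> 1" if "i < k" "l < k" for i l using N_mult_le[OF oz(3)[of i i] oz(3)[of i l]] that by (simp add: g_def)
 define D where "D = (\<Sum>i<k. \<Sum>j<k. c i j * f i j)"
 \<comment> \<open>The terms of the expansion of \<open>D * b * st D\<close>. After moving the
   matrix units to the right, orthogonality kills those with \<open>p \<noteq> j\<close>;
   \<open>R\<close> is what survives, and summing it over \<open>j\<close> reproduces the given
   comparison matrix.\<close>
 define T where "T i j l p = c i j * f i j * b * (f p l * st (c l p))" for i j l p
 define R where "R i j l p = (if p = j then c i j * b * st (c l j) * g i l else 0)" for i j l p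
 have TR: "N (T i j l p - R i j l p) \<le> (C * C + 2 * (C * N b)) * e" if ij: "i < k" "j < k" and lp: "l < k" "p < k" for i j l p
 proof -
  have "N (c i j * (f i j * b - b * f i j) * (f p l * st (c l p))) \<le> C * e * (1 * C)"
   using f(2)[OF ij, of b] oz(3) C ij lp by (intro N_mult_le) (auto simp: F_def)
  then have 1: "N (T i j l p - c i j * b * (f i j * f p l) * st (c l p)) \<le> C * C * e" by (simp add: T_def algebra_simps)
  show ?thesis
  proof (cases "p = j")
   case False
   then have "N (c i j * b * (f i j * f p l) * st (c l p) - R i j l p) \<le> 0"
    using False using oz(4) ij lp eqv_0_multl[OF eqv_0_multr] by (simp add: R_def eqv_0_iff)
   from N_trans[OF 1 this] show ?thesis using C0 e(1) by (auto simp: intro: order_trans)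
  next
   case True
   have 2: "N (c i j * b * (f i j * f p l) * st (c l p) - c i j * b * g i l * st (c l j)) \<le> 0"
    using True using g_def eqv_mult oz ij lp by (simp add: eqv_def)
   have F: "st (c l j) \<in> F" using ij lp by (auto simp: F_def)
   have "g i l * st (c l j) - st (c l j) * g i l =
     f i i * (f i l * st (c l j) - st (c l j) * f i l) + (f i i * st (c l j) - st (c l j) * f i i) * f i l"
    by (simp add: g_def algebra_simps)
   also have "N ... \<le> 1 * e + e * 1" using ij lp by (intro N_add_le N_mult_le f(2) F oz)
   finally have "N (c i j * b * (g i l * st (c l j) - st (c l j) * g i l)) \<le> C * N b * (1 * e + e * 1)"
    using C ij by (intro N_mult3_le) auto
   then have 3: "N (c i j * b * g i l * st (c l j) - R i j l p) \<le> 2 * (C * N b) * e" using True by (simp add: R_def algebra_simps)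
   from N_trans3[OF 1 2 3] show ?thesis by (simp add: algebra_simps)
  qed
 qed
 have "D * b * st D = (\<Sum>i<k. \<Sum>j<k. \<Sum>l<k. \<Sum>p<k. T i j l p)"
 proof -
  have stD: "st D = (\<Sum>l<k. \<Sum>p<k. f p l * st (c l p))"
   unfolding D_def st_sum by (intro sum.cong refl) (simp add: oz(2))
  have "D * b * st D = (\<Sum>i<k. \<Sum>j<k. c i j * f i j * b * st D)" by (subst D_def) (simp only: sum_distrib_right)
  also have "... = (\<Sum>i<k. \<Sum>j<k. \<Sum>l<k. \<Sum>p<k. T i j l p)" by (simp only: stD T_def sum_distrib_left)
  finally show ?thesis .
 qed
 then have "D * b * st D - (\<Sum>i<k. \<Sum>j<k. \<Sum>l<k. \<Sum>p<k. R i j l p) = (\<Sum>i<k. \<Sum>j<k. \<Sum>l<k. \<Sum>p<k. T i j l p - R i j l p)"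
  by (simp only: sum_subtractf)
 also have "N ... \<le> real (card {..<k}) * (real (card {..<k}) * (real (card {..<k}) * (real (card {..<k}) * ((C * C + 2 * (C * N b)) * e))))"
  by (intro N_sum_le TR) simp_all
 finally have 1: "N (D * b * st D - (\<Sum>i<k. \<Sum>j<k. \<Sum>l<k. \<Sum>p<k. R i j l p)) \<le> K * (K * (K * (K * ((C * C + 2 * (C * N b)) * e))))"
  by (simp add: K_def)
 have "(\<Sum>j<k. \<Sum>l<k. \<Sum>p<k. R i j l p) = (\<Sum>l<k. (\<Sum>j<k. c i j * b * st (c l j)) * g i l)" for i
 proof -
  have "(\<Sum>j<k. \<Sum>l<k. \<Sum>p<k. R i j l p) = (\<Sum>j<k. \<Sum>l<k. c i j * b * st (c l j) * g i l)" by (simp add: R_def)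
  also have "... = (\<Sum>l<k. \<Sum>j<k. c i j * b * st (c l j) * g i l)" by (rule sum.swap)
  finally show ?thesis by (simp only: sum_distrib_right)
 qed
 then have "(\<Sum>i<k. \<Sum>j<k. \<Sum>l<k. \<Sum>p<k. R i j l p) - (\<Sum>i<k. \<Sum>l<k. (if i = l then a else 0) * g i l)
   = (\<Sum>i<k. \<Sum>l<k. ((\<Sum>j<k. c i j * b * st (c l j)) - (if i = l then a else 0)) * g i l)" by (simp only: left_diff_distrib sum_subtractf)
 also have "N ... \<le> real (card {..<k}) * (real (card {..<k}) * ((\<delta> + (h + h)) * 1))" by (intro N_sum_le N_mult_le c Ng) simp_all
 finally have 2: "N ((\<Sum>i<k. \<Sum>j<k. \<Sum>l<k. \<Sum>p<k. R i j l p) - (\<Sum>i<k. \<Sum>l<k. (if i = l then a else 0) * g i l)) \<le> K * (K * \<delta>) + \<rho> / 4"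
  using h(2) by (simp add: K_def algebra_simps)
 have "(\<Sum>i<k. \<Sum>l<k. (if i = l then a else 0) * g i l) = (\<Sum>i<k. a * g i i)" by (simp add: if_distrib[of "\<lambda>x. x * _"] cong: if_cong)
 also have "... = a * (\<Sum>i<k. f i i * f i i)" by (simp add: sum_distrib_left g_def)
 \<comment> \<open>Distinct diagonal units are orthogonal, so the sum of their squares is the square
   of their sum.\<close>
 also have "... \<sim> (s * s) * (H * H)"
 proof (rule eqv_mult[OF eqv_sym[OF s(2)]])
  have "H * H = (\<Sum>i<k. \<Sum>j<k. f i i * f j j)" by (simp add: H_def sum_product)
  also have "... \<sim> (\<Sum>i<k. \<Sum>j<k. if i = j then f i i * f i i else 0)" by (intro eqv_sum) (auto intro: oz(4))
  finally have "H * H \<sim> (\<Sum>i<k. f i i * f i i)" by simp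
  then show "(\<Sum>i<k. f i i * f i i) \<sim> H * H" by (rule eqv_sym)
 qed
 finally have 3: "N ((\<Sum>i<k. \<Sum>l<k. (if i = l then a else 0) * g i l) - s * s * (H * H)) \<le> 0" by (simp add: eqv_def)
 have Hs: "N (s * H - H * s) \<le> K * e" using comm_sum[of k "\<lambda>i. f i i" s e] f(2) by (simp add: H_def K_def F_def N_minus_commute)
 have "s * s * (H * H) - s * (H * H) * s = s * ((s * H - H * s) * H + H * (s * H - H * s))" by (simp add: algebra_simps)
 also have "N ... \<le> N s * (K * e * 1 + 1 * (K * e))" by (intro N_mult_le N_add_le Hs order_refl) (simp_all add: H_def oz(7))
 finally have 4: "N (s * s * (H * H) - s * (H * H) * s) \<le> N s * (2 * K) * e" by simp
 from N_trans[OF N_trans3[OF 1 2 3] 4]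
 have 5: "sub (K * (K * (K * (K * ((C * C + 2 * (C * N b)) * e)))) + (K * (K * \<delta>) + \<rho> / 4) + 0 + N s * (2 * K) * e) (s * (H * H) * s) b"
  unfolding sub_def by blast
 \<comment> \<open>The part of \<open>a\<close> missed by \<open>s * (H * H) * s\<close> is the
   remainder for the exponent two, hence still below \<open>d\<close>.\<close>
 have 6: "sub (3 * e) (s * s - s * (H * H) * s) d"
  using sub_power[OF s(1) oz(6,7) PS_pos[OF d(1)] f(3) e(1), of 2] by (simp add: H_def power2_eq_square)
 have "sub ((K * (K * (K * (K * ((C * C + 2 * (C * N b)) * e)))) + (K * (K * \<delta>) + \<rho> / 4) + 0 + N s * (2 * K) * e) + 3 * e + \<rho> / 4)
   (s * (H * H) * s + (s * s - s * (H * H) * s)) (b + d)" using r by (intro sub_orth 5 6 PS_pos b d bd) simp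
 then have "sub (K * (K * \<delta>) + \<rho> / 4 + M * e + \<rho> / 4) (s * s) (b + d)" by (simp add: M_def algebra_simps)
 from sub_eqv[OF this, of a 0] have "sub (K * (K * \<delta>) + \<rho> / 4 + M * e + \<rho> / 4 + 0) a (b + d)" using eqv_sym[OF s(2)] by (simp add: eqv_def)
 then show ?thesis by (rule sub_mono) (use r e(2) in \<open>simp add: K_def\<close>)
qed

text \<open>The coefficients stay the same; as they are bounded, a sufficiently small cut of
  \<open>b\<close> changes each entry by at most \<open>e\<close>.\<close>

lemma bounded_perturbation:
 assumes c: "dsub \<delta> (replicate k a) (replicate n b)" and e: "e > 0" and b: "PS b"
 obtains g where "g > 0" "dsub (\<delta> + e) (replicate k a) (replicate n (cut b g))"
proof -
 obtain c0 where "\<forall>i<k. \<forall>l<k. N ((\<Sum>j<n. c0 i j * replicate n b ! j * st (c0 l j)) - (if i = l then replicate k a ! i else 0)) \<le> \<delta>"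
  using c unfolding dsub_def length_replicate by blast
 then have c0: "N ((\<Sum>j<n. c0 i j * b * st (c0 l j)) - (if i = l then a else 0)) \<le> \<delta>" if "i < k" "l < k" for i l
  using that by (cases "i = l") fastforce+
 define C where "C = (\<Sum>i<k. \<Sum>j<n. N (c0 i j))"
 have C0: "C \<ge> 0" by (auto simp: C_def intro!: sum_nonneg)
 have C: "N (c0 i j) \<le> C" if "i < k" "j < n" for i j
 proof -
  have "N (c0 i j) \<le> (\<Sum>j<n. N (c0 i j))" using that by (intro member_le_sum) auto
  also have "... \<le> C"
   unfolding C_def using that by (intro member_le_sum[of i "{..<k}" "\<lambda>i. \<Sum>j<n. N (c0 i j)"] sum_nonneg) auto
  finally show ?thesis .
 qed
 define M where "M = real n * (C * C) + 1"
 have M: "M > 0" unfolding M_def using C0 by (intro add_nonneg_pos mult_nonneg_nonneg) auto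
 define g where "g = e / M"
 have g: "g > 0" "real n * (C * g * C) \<le> e"
 proof -
  show "g > 0" using e M by (simp add: g_def)
  then have "real n * (C * g * C) \<le> M * g" by (simp add: M_def)
  then show "real n * (C * g * C) \<le> e" using M by (simp add: g_def)
 qed
 have "N ((\<Sum>j<n. c0 i j * cut b g * st (c0 l j)) - (if i = l then a else 0)) \<le> \<delta> + e" if il: "i < k" "l < k" for i l
 proof -
  have "(\<Sum>j<n. c0 i j * cut b g * st (c0 l j)) - (\<Sum>j<n. c0 i j * b * st (c0 l j)) = (\<Sum>j<n. c0 i j * (cut b g - b) * st (c0 l j))"
   by (simp only: sum_subtractf right_diff_distrib left_diff_distrib)
  also have "N ... \<le> real (card {..<n}) * (C * g * C)"
   using C il cut_close[OF PS_pos[OF b], of g] g(1) by (intro N_sum_le N_mult3_le) (auto simp: N_minus_commute)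
  also have "... \<le> e" using g(2) by simp
  finally have "N ((\<Sum>j<n. c0 i j * cut b g * st (c0 l j)) - (\<Sum>j<n. c0 i j * b * st (c0 l j))) \<le> e" .
  from N_trans[OF this c0[OF il]] show ?thesis by simp
 qed
 then have "N ((\<Sum>j<n. c0 i j * replicate n (cut b g) ! j * st (c0 l j)) - (if i = l then replicate k a ! i else 0)) \<le> \<delta> + e"
  if "i < k" "l < k" for i l using that by (cases "i = l") fastforce+
 then have "dsub (\<delta> + e) (replicate k a) (replicate n (cut b g))"
  unfolding dsub_def length_replicate by blast
 then show ?thesis using that g(1) by blast
qed

text \<open>Below any \<open>b\<close> with a gap \<open>(b - g)\<^sub>+ \<noteq> 0\<close> there is room for a nonzero element orthogonal to an
 element that still dominates \<open>b\<close> after adding one more copy.\<close>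

lemma exists_complement:
 assumes b: "PS b" and g: "g > 0" "N (cut b g) > 0"
 obtains b' d where "PS b'" "PS d" "N d > 0" "b' * d \<sim> 0" "cz (b' + d) b"
  "mle (copies n (cut b g)) (copies (n + 1) b')"
proof -
 note sb = PS_st[OF b]
 define c0 where "c0 = cut b g"
 have c0: "PS c0" "N c0 > 0" using PS_cut[OF b] g by (simp_all add: c0_def)
 obtain x y where xy: "her c0 x" "her c0 y" "N x > 0" "N y > 0" "x * y \<sim> 0" using exists_orth_pair[OF c0] .
 have PSxy: "PS x" "PS y" using xy by (auto simp: her_def)
 \<comment> \<open>\<open>G\<close> equals one from \<open>g\<close> on and is at most
   \<open>t / g\<close>. So \<open>b1\<close> acts as a unit on \<open>cut b g\<close> and yet lies
   below a multiple of \<open>b\<close>.\<close>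
 define G where "G t = min 1 (max 0 (t * (1/g)))" for t :: real
 have G: "continuous_on UNIV G" unfolding G_def by (intro continuous_intros)
 define b1 where "b1 = fc G b"
 have b1: "st b1 = b1" "ch b1 = 0" "pos b1"
  unfolding b1_def using G PS_ch[OF b] by (auto intro!: st_fc sb ch_fc_0 fc_pos simp: G_def)
 have "b1 * c0 \<sim> fc (\<lambda>t. G t * max (t - g) 0) b"
  unfolding b1_def c0_def cut_def by (intro eqv_sym[OF fc_mult] sb G cont_cut)
 also have "... \<sim> c0"
  unfolding c0_def cut_def using g(1) by (intro fc_cong sb continuous_intros G) (auto simp: G_def max_def)
 finally have b1c0: "b1 * c0 \<sim> c0" .
 have b1_her: "b1 * z \<sim> z" if "her c0 z" for z
 proof -
  obtain w where w: "z \<sim> c0 * w * c0" using \<open>her c0 z\<close> unfolding her_def by blast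
  have "b1 * z \<sim> b1 * (c0 * w * c0)" by (rule eqv_mult[OF eqv_refl w])
  also have "... = (b1 * c0) * w * c0" by (simp add: mult.assoc)
  also have "... \<sim> c0 * w * c0" by (intro eqv_mult eqv_refl b1c0)
  also have "... \<sim> z" by (rule eqv_sym[OF w])
  finally show ?thesis .
 qed
 have "pos (rsc (1/g) * b - b1)"
 proof (rule pos_le_eqv)
  show "pos (fc (\<lambda>t. 1/g * t) b - b1)"
   unfolding b1_def
  proof (intro fc_diff_pos sb G continuous_intros)
   fix t assume "t \<in> spr b"
   then show "G t \<le> 1/g * t" using g(1) using pos_spr[OF PS_pos[OF b]] by (auto simp: G_def)
  qed
  have "fc (\<lambda>t. 1/g * t) b \<sim> rsc (1/g) * fc (\<lambda>t. t) b" by (intro fc_cmult sb continuous_intros)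
  also have "... \<sim> rsc (1/g) * b" by (intro eqv_mult eqv_refl fc_id sb)
  finally show "fc (\<lambda>t. 1/g * t) b \<sim> rsc (1/g) * b" .
 qed (auto simp: b1 sb st_scale simp del: st_mult)
 then have b1b: "cz b1 b" using pos_le_cz[OF b1(3)] scale_cz[of "1/g" b] cz_trans g(1) by (meson divide_nonneg_pos zero_le_one)
 \<comment> \<open>\<open>x\<close> is the place where \<open>d\<close> will live, \<open>y\<close>
   is kept untouched. The element taken inside \<open>x\<close> is so small that \<open>n\<close>
   copies of it fit below \<open>y\<close>.\<close>
 obtain h where h: "PS h" "N h > 0" "mle (copies n h) {#y#}" using exists_small[OF PSxy(2) xy(4)] .
 obtain x0 where x0: "her x x0" "cz x0 h" "N x0 > 0" using common_below[OF PSxy(1) xy(3) h(1,2)] .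
 define x' where "x' = rsc (1 / N x0) * x0"
 have x': "PS x'" "N x' = 1" "cz x' h"
 proof -
  show "PS x'" using x0 pos_scale[of x0 "1 / N x0"] by (simp add: x'_def PS_def her_def)
  show "N x' = 1" using x0(3) by (simp add: x'_def norm_divide)
  show "cz x' h" unfolding x'_def using scale_cz[of "1 / N x0" x0] x0 cz_trans by (meson divide_nonneg_pos zero_le_one)
 qed
 note sx' = PS_st[OF x'(1)]
 obtain w where w: "x0 \<sim> x * w * x" using x0(1) unfolding her_def by blast
 have "x0 * y \<sim> x * w * x * y" by (rule eqv_mult[OF w eqv_refl])
 also have "... = x * w * (x * y)" by (simp add: mult.assoc)
 also have "... \<sim> 0" by (rule eqv_0_multr[OF xy(5)])
 finally have x'y: "x' * y \<sim> 0" using eqv_0_multr by (simp add: x'_def mult.assoc)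
 have "b1 * x0 \<sim> b1 * (x * w * x)" by (rule eqv_mult[OF eqv_refl w])
 also have "... = (b1 * x) * w * x" by (simp add: mult.assoc)
 also have "... \<sim> x * w * x" by (intro eqv_mult eqv_refl b1_her xy)
 also have "... \<sim> x0" by (rule eqv_sym[OF w])
 finally have "rsc (1 / N x0) * (b1 * x0) \<sim> x'"
  unfolding x'_def by (rule eqv_mult[OF eqv_refl])
 then have b1x': "b1 * x' \<sim> x'" by (simp only: x'_def sc_left_comm)
 have x'b1: "x' * (1 - b1) \<sim> 0"
  using eqv_st[OF eqv_diff[OF eqv_sym[OF b1x'] eqv_refl, of "b1 * x'"]] by (simp add: sx' b1 right_diff_distrib)
 \<comment> \<open>\<open>f\<close> is one from \<open>1/2\<close> on, where \<open>k\<close> lives,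
   so \<open>1 - \<phi>\<close> annihilates \<open>d\<close>. The function
   \<open>p = 1 - (1 - f)\<^sup>2\<close> measures what conjugation by \<open>1 - \<phi>\<close>
   removes from the unit.\<close>
 define f where "f t = min 1 (2 * max 0 t)" for t :: real
 define k where "k t = max 0 (t - 1/2)" for t :: real
 define p where "p t = f t + f t - f t * f t" for t
 have f: "continuous_on UNIV f" unfolding f_def by (intro continuous_intros)
 have k: "continuous_on UNIV k" unfolding k_def by (intro continuous_intros)
 have p: "continuous_on UNIV p" unfolding p_def by (intro continuous_intros f)
 have spr': "0 \<le> t \<and> t \<le> 1" if "t \<in> spr x'" for t using pos_spr[OF PS_pos[OF x'(1)] that] x'(2) by simp
 define \<phi> d P where "\<phi> = fc f x'" and "d = fc k x'" and "P = fc p x'"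
 have P: "P \<sim> \<phi> + \<phi> - \<phi> * \<phi>"
 proof -
  have "P \<sim> fc (\<lambda>t. f t + f t) x' - fc (\<lambda>t. f t * f t) x'"
   unfolding P_def p_def by (intro fc_diff sx' continuous_intros f)
  also have "... \<sim> \<phi> + \<phi> - \<phi> * \<phi>"
   unfolding \<phi>_def by (intro eqv_diff fc_add fc_mult sx' f)
  finally show ?thesis .
 qed
 have \<phi>: "st \<phi> = \<phi>" unfolding \<phi>_def by (intro st_fc sx' f)
 have "\<phi> * (1 - b1) \<sim> 0"
  unfolding \<phi>_def using x'b1 by (intro fc_ann sx' f) (simp_all add: f_def)
 then have \<phi>b: "\<phi> * b1 \<sim> \<phi>" using eqv_add[OF _ eqv_refl, of "\<phi> * (1 - b1)" 0 "\<phi> * b1"] eqv_sym by (simp add: right_diff_distrib)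
 have b\<phi>: "b1 * \<phi> \<sim> \<phi>" using eqv_st[OF \<phi>b] by (simp add: \<phi> b1)
 \<comment> \<open>What is taken away from \<open>b1\<close> is exactly \<open>P\<close>, since
   \<open>b1\<close> acts as a unit on \<open>\<phi>\<close>; and \<open>d \<le> P\<close> keeps
   \<open>b' + d\<close> below \<open>b1\<close>.\<close>
 define b' where "b' = (1 - \<phi>) * b1 * (1 - \<phi>)"
 have "b' = b1 - \<phi> * b1 - (b1 * \<phi> - \<phi> * b1 * \<phi>)" by (simp add: b'_def algebra_simps)
 also have "... \<sim> b1 - \<phi> - (\<phi> - \<phi> * \<phi>)" by (rule eqv_diff[OF eqv_diff[OF eqv_refl \<phi>b] eqv_diff[OF b\<phi> eqv_mult[OF \<phi>b eqv_refl]]])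
 finally have "b' + P \<sim> b1 - \<phi> - (\<phi> - \<phi> * \<phi>) + (\<phi> + \<phi> - \<phi> * \<phi>)" using P by (rule eqv_add)
 then have b'P: "b' + P \<sim> b1" by simp
 have PSb': "PS b'" using pos_conj[OF b1(3), of "1 - \<phi>"] b1(2) by (simp add: PS_def b'_def \<phi>)
 have posP: "pos P" unfolding P_def
 proof (intro fc_pos sx' p)
  fix t assume "t \<in> spr x'"
  have "0 \<le> f t * (1 - f t) + f t" using f_def by (intro add_nonneg_nonneg mult_nonneg_nonneg) auto
  then show "0 \<le> p t" by (simp add: p_def algebra_simps)
 qed
 have PSd: "PS d"
  unfolding d_def PS_def using PS_ch[OF x'(1)] by (intro conjI fc_pos ch_fc_0 sx' k) (auto simp: k_def)
 have Nd: "N d > 0"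
 proof -
  obtain t where t: "t \<in> spr x'" "\<bar>t\<bar> = 1" using norm_in_spr[OF sx'] x'(2) by metis
  then show ?thesis using fc_lower[OF sx' k t(1)] using spr'[OF t(1)] by (simp add: d_def k_def)
 qed
 have "(1 - \<phi>) * d \<sim> 0"
 proof -
  have "\<phi> * d \<sim> fc (\<lambda>t. f t * k t) x'" unfolding \<phi>_def d_def by (intro eqv_sym[OF fc_mult] sx' f k)
  also have "... \<sim> d" unfolding d_def by (intro fc_cong sx' continuous_intros f k) (auto simp: f_def k_def)
  finally have "d - \<phi> * d \<sim> d - d" by (intro eqv_diff eqv_refl)
  then show ?thesis by (simp add: left_diff_distrib)
 qed
 then have b'd: "b' * d \<sim> 0" unfolding b'_def mult.assoc by (rule eqv_0_multr[OF eqv_0_multr])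
 have "pos (P - d)"
  unfolding P_def d_def
 proof (intro fc_diff_pos sx' p k)
  fix t assume "t \<in> spr x'"
  then have t: "0 \<le> t" "t \<le> 1" using spr' by auto
  show "k t \<le> p t"
  proof (cases "t \<le> 1/2")
   case True
   have "0 \<le> f t * (1 - f t) + f t" using f_def by (intro add_nonneg_nonneg mult_nonneg_nonneg) auto
   then show ?thesis using True by (simp add: p_def k_def algebra_simps)
  next
   case False
   then show ?thesis using t using f_def by (simp add: p_def k_def)
  qed
 qed
 then have "pos ((b' + P) - (b' + d))" by simp
 then have "pos (b1 - (b' + d))" by (rule pos_le_eqv[OF _ eqv_refl b'P]) (use PSb' PSd b1 in \<open>simp_all add: PS_st\<close>)
 then have b'd_cz: "cz (b' + d) b" using pos_le_cz[OF pos_add[OF PS_pos[OF PSb'] PS_pos[OF PSd]]] b1b cz_trans by blast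
 have Px': "cz P x'"
 proof -
  have "pos (fc (\<lambda>t. 4 * t) x' - P)"
   unfolding P_def
  proof (intro fc_diff_pos sx' p continuous_intros)
   fix t assume "t \<in> spr x'"
   then have "f t \<le> 2 * t" "0 \<le> f t * f t" using spr' by (auto simp: f_def)
   then show "p t \<le> 4 * t" unfolding p_def by linarith
  qed
  then have "cz P (fc (\<lambda>t. 4 * t) x')" by (rule pos_le_cz[OF posP])
  moreover have "fc (\<lambda>t. 4 * t) x' \<sim> rsc 4 * fc (\<lambda>t. t) x'" by (intro fc_cmult sx' continuous_intros)
  then have "fc (\<lambda>t. 4 * t) x' \<sim> rsc 4 * x'" using eqv_trans[OF _ eqv_mult[OF eqv_refl fc_id[OF sx']]] by blast
  ultimately show ?thesis using eqv_cz scale_cz[of 4 x'] cz_trans by (metis zero_le_numeral)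
 qed
 \<comment> \<open>Being orthogonal to \<open>x'\<close>, the element \<open>y\<close> survives the
   carving; thus \<open>b'\<close> is a unit for it and \<open>y\<close> lies below
   \<open>b'\<close>.\<close>
 have \<phi>y: "(1 - \<phi>) * y \<sim> y" using eqv_diff[OF eqv_refl, of "\<phi> * y" 0 y] using \<phi>_def x'y fc_ann sx' f f_def by (simp add: left_diff_distrib)
 have "b' * y = (1 - \<phi>) * (b1 * ((1 - \<phi>) * y))" by (simp add: b'_def mult.assoc)
 also have "... \<sim> (1 - \<phi>) * (b1 * y)" by (intro eqv_mult eqv_refl \<phi>y)
 also have "... \<sim> (1 - \<phi>) * y" by (intro eqv_mult eqv_refl b1_her xy)
 also have "... \<sim> y" by (rule \<phi>y)
 finally have yb': "cz y b'" by (intro unit_cz PS_pos PSxy PS_st PSb')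
 have rep: "repeat_mset m {#z#} = copies m z" "repeat_mset m {#z, z'#} = copies m z + copies m z'" for m and z z' :: "'g fa" by simp_all
 have "cz c0 b1" by (rule unit_cz[OF PS_pos[OF c0(1)] b1(1) b1c0])
 moreover have "cz b1 (b' + P)" by (rule eqv_cz[OF eqv_sym[OF b'P]])
 ultimately have "mle {#c0#} {#b' + P#}" unfolding mle_single by (rule cz_trans)
 from mle_replicate[OF mle_trans[OF this mle_plus]]
 have 1: "mle (copies n c0) (copies n b' + copies n P)"
  unfolding rep .
 \<comment> \<open>The \<open>n\<close> lost pieces fit together below \<open>y\<close>, hence below
   the one additional copy of \<open>b'\<close>.\<close>
 have "mle (repeat_mset n {#P#}) (repeat_mset n {#h#})" by (intro mle_replicate) (simp only: mle_single cz_trans[OF Px' x'(3)])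
 then have "mle (copies n b' + copies n P) (copies n b' + {#b'#})"
  by (metis rep mle_trans[OF _ h(3)] mle_trans mle_single yb' mle_add[OF mle_refl])
 from mle_trans[OF 1 this] have "mle (copies n c0) (copies (n + 1) b')" by simp
 then show ?thesis using that[OF PSb' PSd Nd b'd b'd_cz] by (simp add: c0_def)
qed

text \<open>If a small cut of \<open>b\<close> is not null, \<open>exists_complement\<close> turns
  its \<open>n\<close> copies into \<open>n + 1\<close> copies of some \<open>b'\<close> with an
  orthogonal \<open>d\<close>, and \<open>tracial_comparison\<close> gives \<open>a\<close> below
  \<open>b' + d\<close>, hence below \<open>b\<close>. If it is null, \<open>a\<close> itself is
  small in norm.\<close>

theorem almost_unperforated:
 assumes a: "PS a" and b: "PS b" and le: "mle (copies (Suc n) a) (copies n b)"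
 shows "cz a b"
 unfolding cz_def
proof (intro allI impI)
 fix r :: real assume r: "r > 0"
 define k where "k = Suc n"
 \<comment> \<open>Three errors of size \<open>e\<close>, multiplied by \<open>k * k\<close>, amount
   to \<open>3 * r / 8\<close> and leave room for two slacks of \<open>r / 4\<close>.\<close>
 define e where "e = r / (8 * real k * real k)"
 have k: "k \<ge> 1" "real k \<ge> 1" by (simp_all add: k_def)
 have e: "e > 0" "real k * (real k * (e + e + e)) + r / 4 + r / 4 \<le> r" "e + e \<le> r"
 proof -
  show "e > 0" using r k by (simp add: e_def)
  have *: "real k * (real k * (e + e + e)) = 3 * r / 8" using k by (simp add: e_def)
  show "real k * (real k * (e + e + e)) + r / 4 + r / 4 \<le> r" unfolding * using r by simp
  have "1 * (1 * (e + e)) \<le> real k * (real k * (e + e + e))" using k \<open>e > 0\<close> by (intro mult_mono) auto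
  then show "e + e \<le> r" unfolding * using r by simp
 qed
 have "dsub e (replicate k a) (replicate n b)" using e(1) using le mle_mset[of "replicate k a" "replicate n b"] k_def by (simp add: dle_def)
 then obtain g where g: "g > 0" "dsub (e + e) (replicate k a) (replicate n (cut b g))" using bounded_perturbation e(1) b by metis
 show "sub r a b"
 proof (cases "N (cut b g) > 0")
  case False
  then have "N (cut b g) = 0" using N_nonneg[of "cut b g"] by linarith
  from dsub_trans[OF g(2) _ e(1)] g(2) obtain c where
   c: "\<forall>i<k. \<forall>l<k. N ((\<Sum>j<n. c i j * replicate n (cut b g) ! j * st (c l j)) - (if i = l then replicate k a ! i else 0)) \<le> e + e"
   unfolding dsub_def length_replicate by blast
  have "(\<Sum>j<n. c 0 j * replicate n (cut b g) ! j * st (c 0 j)) \<sim> (\<Sum>j<n. 0)"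
   using \<open>N (cut b g) = 0\<close> by (intro eqv_sum eqv_0_multl eqv_0_multr) (simp add: eqv_0_iff)
  then have "N ((\<Sum>j<n. c 0 j * replicate n (cut b g) ! j * st (c 0 j)) - a) = N (0 - a)" by (intro N_cong) simp_all
  then have "N (0 * b * st 0 - a) \<le> e + e" using c[rule_format, of 0 0] k by simp
  then show ?thesis unfolding sub_def using e(3) order_trans by blast
 next
  case True
  obtain b' d where *: "PS b'" "PS d" "N d > 0" "b' * d \<sim> 0" "cz (b' + d) b"
   "mle (copies n (cut b g)) (copies (n + 1) b')" using exists_complement[OF b g(1) True] .
  then have "dle (replicate n (cut b g)) (replicate k b')"
   using mle_mset[of "replicate n (cut b g)" "replicate k b'"] by (simp add: k_def)
  from dsub_trans[OF g(2) this e(1)] have "dsub (e + e + e) (replicate k a) (replicate k b')" .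
  then have "sub (real k * (real k * (e + e + e)) + r / 4 + r / 4) a b"
   using r using tracial_comparison[OF a *(1-4) k(1)] by (intro sub_trans[OF _ *(5)]) auto
  then show ?thesis using e(2) by (rule sub_mono)
 qed
qed

end

section \<open>Weak almost divisibility\<close>

context lcs
begin

lemmas mle_trans_rule [trans] = mle_trans

lemma comm_mult:
 assumes "N (x * b - b * x) \<le> e" "N (y * b - b * y) \<le> e'" "N x \<le> 1" "N y \<le> 1"
 shows "N (x * y * b - b * (x * y)) \<le> e + e'"
proof -
 have "x * y * b - b * (x * y) = x * (y * b - b * y) + (x * b - b * x) * y" by (simp add: algebra_simps)
 also have "N ... \<le> 1 * e' + e * 1" by (intro N_add_le N_mult_le assms)
 finally show ?thesis by simp
qed

lemma N_power_le_1: "N x \<le> 1 \<Longrightarrow> N (x ^ n) \<le> 1" using order_trans[OF N_power power_le_one] by simp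

lemma comm_power:
 assumes "N (x * b - b * x) \<le> e" "N x \<le> 1"
 shows "N (x ^ n * b - b * x ^ n) \<le> real n * e"
proof (induction n)
 case (Suc n)
 show ?case using comm_mult[OF assms(1) Suc assms(2) N_power_le_1[OF assms(2)]] by (simp add: algebra_simps)
qed simp

lemma rp_orth:
 assumes "x * y \<sim> 0"
 shows "x * rp q (x + y) \<sim> x * rp q x"
proof (induction q)
 case (pCons a q)
 have "x * rp (pCons a q) (x + y) = x * rsc a + (x * (x * rp q (x + y)) + x * y * rp q (x + y))" by (simp add: algebra_simps)
 also have "... \<sim> x * rsc a + (x * (x * rp q x) + 0)" by (intro eqv_add eqv_refl eqv_mult[OF eqv_refl pCons.IH] eqv_0_multl assms)
 finally show ?case by (simp add: algebra_simps)
qed simp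

text \<open>For a polynomial without constant term the mixed products vanish; the general case
  follows by approximation on an interval that contains all three spectra.\<close>

lemma fc_orth_add:
 assumes x: "st x = x" and y: "st y = y" and xy: "x * y \<sim> 0" and f: "continuous_on UNIV f" "f 0 = 0"
 shows "fc f (x + y) \<sim> fc f x + fc f y"
proof (rule eqv_le)
 fix e :: real assume e: "e > 0"
 define K where "K = N x + N y"
 obtain p where p: "\<And>t. t \<in> {-K..K} \<Longrightarrow> \<bar>poly p t - f t\<bar> < e / 6"
  using Weierstrass_poly[of "-K" K f "e/6"] f(1) e continuous_on_subset[of UNIV f] by auto
 \<comment> \<open>Dropping the constant term costs at most the error at 0, because
   \<open>f 0 = 0\<close>; the bound \<open>e / 6\<close> doubles to \<open>e / 3\<close>.\<close>
 define q where "q = p - [:poly p 0:]"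
 have K0: "K \<ge> 0" by (simp add: K_def)
 then have p0: "\<bar>poly p 0\<bar> < e / 6" using p[of 0] f(2) by simp
 have q: "\<bar>poly q t - f t\<bar> \<le> e / 3" if "t \<in> {-K..K}" for t
 proof -
  have "poly q t = poly p t - poly p 0" by (simp add: q_def)
  then show ?thesis using p[OF that] p0 by linarith
 qed
 have inK: "t \<in> {-K..K}" if "t \<in> spr z" "N z \<le> K" for z t using spr_bound[OF that(1)] that(2) by auto
 obtain a q' where q': "q = pCons a q'" by (cases q)
 have "poly q 0 = 0" by (simp add: q_def)
 then have "a = 0" by (simp add: q')
 have "rp q (x + y) = x * rp q' (x + y) + y * rp q' (y + x)" by (simp add: q' \<open>a = 0\<close> algebra_simps)
 also have "... \<sim> x * rp q' x + y * rp q' y" by (intro eqv_add rp_orth xy orth_sym x y)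
 also have "... = rp q x + rp q y" by (simp add: q' \<open>a = 0\<close>)
 finally have 1: "N (rp q (x + y) - (rp q x + rp q y)) \<le> 0" by (simp add: eqv_def)
 have 2: "N (fc f (x + y) - rp q (x + y)) \<le> e / 3"
  using fc_approx[OF _ f(1), of "x + y" q "e/3"] q inK[of _ "x + y"] x y N_triangle[of x y] by (subst N_minus_commute) (auto simp: K_def)
 have "N (rp q x - fc f x) \<le> e / 3" "N (rp q y - fc f y) \<le> e / 3"
  using fc_approx[OF x f(1), of q "e/3"] fc_approx[OF y f(1), of q "e/3"] q inK[of _ x] inK[of _ y] by (auto simp: K_def)
 from N_add_le[OF this] have 3: "N ((rp q x + rp q y) - (fc f x + fc f y)) \<le> e / 3 + e / 3" by (simp add: algebra_simps)
 from N_trans3[OF 2 1 3] show "N (fc f (x + y) - (fc f x + fc f y)) \<le> e" by simp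
qed

lemma fc_orth:
 assumes "st x = x" "st y = y" "x * y \<sim> 0" "continuous_on UNIV f" "f 0 = 0"
 shows "fc f x * fc f y \<sim> 0"
by (simp add: fc_ann[OF assms(2,4,5) orth_sym[OF assms(1-3)]] orth_sym[OF st_fc[OF assms(2,4)] assms(1)] fc_ann assms)

text \<open>For orthogonal elements the cut of the sum is the sum of the cuts, and the cuts remain
  orthogonal.\<close>

lemma mle_cut_orth:
 fixes n :: nat
 assumes "\<And>i. i < n \<Longrightarrow> pos (f i)" "\<And>i j. i < n \<Longrightarrow> j < n \<Longrightarrow> i \<noteq> j \<Longrightarrow> f i * f j \<sim> 0" "e \<ge> 0"
 shows "mle (\<Sum>i<n. {#cut (f i) e#}) {#cut (\<Sum>i<n. f i) e#}"
proof -
 note st = pos_st[OF assms(1)]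
 have "cut (\<Sum>i<m. f i) e \<sim> (\<Sum>i<m. cut (f i) e)" if "m \<le> n" for m using that
 proof (induction m)
  case 0
  have "cut 0 e * 1 \<sim> 0"
   unfolding cut_def by (rule fc_ann) (use assms(3) in \<open>auto intro: cont_cut\<close>)
  then show ?case by simp
 next
  case (Suc m)
  have "(\<Sum>i<m. f i) * f m \<sim> (\<Sum>i<m. 0)"
   unfolding sum_distrib_right using Suc.prems by (intro eqv_sum assms) auto
  then have "cut ((\<Sum>i<m. f i) + f m) e \<sim> cut (\<Sum>i<m. f i) e + cut (f m) e"
   unfolding cut_def using Suc.prems st assms(3) by (intro fc_orth_add cont_cut) auto
  also have "... \<sim> (\<Sum>i<m. cut (f i) e) + cut (f m) e" using Suc by (intro eqv_add eqv_refl Suc.IH) simp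
  finally show ?case by simp
 qed
 from eqv_cz[OF eqv_sym[OF this[OF order_refl]]] have "mle {#\<Sum>i<n. cut (f i) e#} {#cut (\<Sum>i<n. f i) e#}" by (simp add: mle_single)
 moreover have "mle (\<Sum>i<n. {#cut (f i) e#}) {#\<Sum>i<n. cut (f i) e#}"
  using st assms by (intro mle_orth_sum cut_pos) (auto simp: cut_def intro!: fc_orth cont_cut)
 ultimately show ?thesis using mle_trans by blast
qed

lemma sum_single: "(\<Sum>i<n. {#x#}) = copies n x" for n :: nat by (induction n) simp_all

end

context tz
begin

text \<open>With \<open>g = f 0 0\<close>, the element \<open>e\<close> is a cut of
  \<open>g\<^sup>2 * a * g\<^sup>2\<close>. The off-diagonal units carry it below each of the
  orthogonal elements \<open>Z i\<close>, whose sum is close to \<open>H * a * H\<close>. In the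
  other direction the conjugates of \<open>e\<close> add up to about \<open>a * H ^ 6\<close>, and
  the rest of \<open>a\<close> is tracially small.\<close>

lemma divisible_up_to_small:
 assumes a: "PS a" and d: "PS d" "N d > 0" and n: "n \<ge> 1" and eps: "\<epsilon> > 0"
 obtains e where "PS e" "mle (copies n e) {#a#}" "mle {#cut a \<epsilon>#} (copies n e + {#d#})"
proof -
 define s where "s = rt a"
 have s: "st s = s" "s * s \<sim> a" "PS s" using rt[OF PS_pos[OF a]] PS_ch[OF a] by (simp_all add: s_def PS_def)
 define K where "K = real n"
 have K: "K \<ge> 1" using n by (simp add: K_def)
 define \<rho> where "\<rho> = \<epsilon> / (4 * K)"
 define \<tau> where "\<tau> = \<rho> / 4"
 define M where "M = 6 * (K * N s) + 3 * K + 7"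
 have M: "M > 0" unfolding M_def using K by (intro add_nonneg_pos add_nonneg_nonneg mult_nonneg_nonneg) auto
 \<comment> \<open>The three bounds serve, in this order, the \<open>n * n\<close> off-diagonal
   terms of \<open>H * a * H\<close>, the transport of \<open>e\<close> into \<open>Z i\<close>, and
   the total error in approximating \<open>a\<close>.\<close>
 define \<delta> where "\<delta> = min (\<tau> / (2 * (K * K))) (min (\<tau> / 2) (\<epsilon> / (4 * M)))"
 have \<rho>: "\<rho> > 0" "K * \<rho> = \<epsilon> / 4" using eps K by (simp_all add: \<rho>_def)
 have \<tau>: "\<tau> > 0" using \<rho> by (simp add: \<tau>_def)
 have \<delta>: "\<delta> > 0" "K * (K * \<delta>) < \<tau>" "\<tau> + (\<delta> + \<delta>) < \<rho>" "M * \<delta> \<le> \<epsilon> / 4"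
 proof -
  show "\<delta> > 0" using \<tau> K eps M by (simp add: \<delta>_def)
  have "\<delta> \<le> \<tau> / (2 * (K * K))" "\<delta> \<le> \<tau> / 2" "\<delta> \<le> \<epsilon> / (4 * M)" by (simp_all add: \<delta>_def)
  moreover from this have "K * K * \<delta> \<le> K * K * (\<tau> / (2 * (K * K)))" "M * \<delta> \<le> M * (\<epsilon> / (4 * M))" using M by (intro mult_left_mono; simp)+
  ultimately have "K * K * \<delta> \<le> K * K * (\<tau> / (2 * (K * K)))" "M * \<delta> \<le> M * (\<epsilon> / (4 * M))" "\<delta> + \<delta> \<le> \<tau>" by linarith+
  then show "K * (K * \<delta>) < \<tau>" "\<tau> + (\<delta> + \<delta>) < \<rho>" "M * \<delta> \<le> \<epsilon> / 4" using K M \<tau> by (simp_all add: \<tau>_def)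
 qed
 have "\<exists>f. oz n f \<and> (\<forall>i<n. \<forall>j<n. \<forall>b\<in>{s, a}. N (f i j * b - b * f i j) \<le> \<delta>) \<and> sub \<delta> (s * s - s * (\<Sum>i<n. f i i) * s) d"
  using n d s(3) \<delta>(1) PS_ch[OF a] by (intro tracial) (auto simp: PS_ch)
 then obtain f where f: "oz n f" "\<And>i j b. i < n \<Longrightarrow> j < n \<Longrightarrow> b \<in> {s, a} \<Longrightarrow> N (f i j * b - b * f i j) \<le> \<delta>"
  "sub \<delta> (s * s - s * (\<Sum>i<n. f i i) * s) d" by blast
 note oz = oz_rules[OF f(1)]
 define H where "H = (\<Sum>i<n. f i i)"
 have H: "pos H" "N H \<le> 1" "st H = H" using oz(6,7) pos_st[OF oz(6)] by (simp_all only: H_def)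
 define g where "g = f 0 0"
 have n0: "0 < n" using n by simp
 have g: "N g \<le> 1" "st g = g" "N (g * a - a * g) \<le> \<delta>" using n0 oz f(2) by (simp_all add: g_def)
 define Y where "Y = g\<^sup>2 * a * g\<^sup>2"
 have Y: "PS Y" using PS_conj[OF a, of "g\<^sup>2"] by (simp add: Y_def g)
 define e where "e = cut Y \<rho>"
 have PSe: "PS e" unfolding e_def using Y \<rho> by (intro PS_cut) auto
 define Z where "Z i = f i i * a * f i i" for i
 have Z: "PS (Z i)" if "i < n" for i using PS_conj[OF a, of "f i i"] that by (simp add: Z_def oz)
 have ZZ: "Z i * Z j \<sim> 0" if "i < n" "j < n" "i \<noteq> j" for i j by (metis Z_def mult.assoc eqv_0_multl[OF eqv_0_multr[OF oz(4)]] that)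
 have lower: "mle (copies n e) {#a#}"
 proof -
  \<comment> \<open>Conjugating \<open>Z i\<close> by \<open>f 0 i\<close> gives, by the relations
    of the units, \<open>g * (f 0 i * a * f i 0) * g\<close>; moving \<open>a\<close> out of the
    middle produces \<open>g * a * g\<^sup>2 * g\<close>, hence about \<open>Y\<close>. This
    explains the squares in \<open>Y\<close>.\<close>
  have "cz e (cut (Z i) \<tau>)" if i: "i < n" for i
  proof -
   have "N (f 0 i * (cut (Z i) \<tau> - Z i) * f i 0) \<le> 1 * \<tau> * 1"
    using i oz cut_close[OF PS_pos[OF Z[OF i]], of \<tau>] \<tau> by (intro N_mult3_le) (auto simp: N_minus_commute)
   then have 1: "N (f 0 i * cut (Z i) \<tau> * f i 0 - f 0 i * Z i * f i 0) \<le> \<tau>" by (simp add: algebra_simps)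
   have "f 0 i * Z i * f i 0 = (f 0 i * f i i) * a * (f i i * f i 0)" by (simp add: Z_def mult.assoc)
   also have "... \<sim> (g * f 0 i) * a * (f i 0 * g)"
    unfolding g_def using i by (intro eqv_mult eqv_refl oz eqv_sym[OF oz(5)]) auto
   finally have 2: "N (f 0 i * Z i * f i 0 - g * (f 0 i * a * f i 0) * g) \<le> 0" by (simp add: eqv_def mult.assoc)
   have "N (g * ((f 0 i * a - a * f 0 i) * f i 0) * g) \<le> 1 * (\<delta> * 1) * 1" using i oz f(2) g by (intro N_mult3_le N_mult_le) auto
   then have 3: "N (g * (f 0 i * a * f i 0) * g - g * a * (f 0 i * f i 0) * g) \<le> \<delta>" by (simp add: algebra_simps)
   have 4: "N (g * a * (f 0 i * f i 0) * g - g * a * (g * g) * g) \<le> 0" using g_def i eqv_mult oz by (simp add: eqv_def)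
   have "N (g * (a * g - g * a) * (g * g)) \<le> 1 * \<delta> * (1 * 1)" using g by (intro N_mult_le) (simp_all add: N_minus_commute)
   then have 5: "N (g * a * (g * g) * g - Y) \<le> \<delta>" by (simp add: Y_def power2_eq_square algebra_simps)
   from N_trans3[OF N_trans3[OF 1 2 3] 4 5] have "N (f 0 i * cut (Z i) \<tau> * st (f 0 i) - Y) \<le> \<tau> + (\<delta> + \<delta>)" using i by (simp add: oz(2))
   then show ?thesis unfolding e_def using \<delta>(3) PS_st[OF Z[OF i]] by (metis sub_def sub_cut_cz[OF PS_pos[OF Y]] cut_pos)
  qed
  then have "mle (\<Sum>i<n. {#e#}) (\<Sum>i<n. {#cut (Z i) \<tau>#})" by (intro mle_sum) (auto simp: mle_single)
  moreover have "mle (\<Sum>i<n. {#cut (Z i) \<tau>#}) {#cut (\<Sum>i<n. Z i) \<tau>#}" using \<tau> by (intro mle_cut_orth PS_pos[OF Z] ZZ) auto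
  moreover have "cz (cut (\<Sum>i<n. Z i) \<tau>) a"
  proof -
   have "H * a * H = (\<Sum>i<n. \<Sum>j<n. f i i * a * f j j)"
    unfolding H_def by (simp add: sum_distrib_left sum_distrib_right) (rule sum.swap)
   moreover have "(\<Sum>i<n. Z i) = (\<Sum>i<n. \<Sum>j<n. if i = j then Z i else 0)" by simp
   ultimately have "H * a * H - (\<Sum>i<n. Z i) = (\<Sum>i<n. \<Sum>j<n. f i i * a * f j j - (if i = j then Z i else 0))" by (simp only: sum_subtractf)
   also have "N ... \<le> real (card {..<n}) * (real (card {..<n}) * \<delta>)"
   proof (intro N_sum_le)
    fix i j assume "i \<in> {..<n}" "j \<in> {..<n}"
    then have i: "i < n" "j < n" by auto
    show "N (f i i * a * f j j - (if i = j then Z i else 0)) \<le> \<delta>"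
    proof (cases "i = j")
     case False
     then have "a * (f i i * f j j) \<sim> 0" using i by (intro eqv_0_multr oz)
     then have "N (f i i * a * f j j - 0) = N (f i i * a * f j j - a * (f i i * f j j))" by (intro N_cong eqv_refl) (rule eqv_sym)
     also have "... = N ((f i i * a - a * f i i) * f j j)" by (simp add: algebra_simps)
     also have "... \<le> \<delta> * 1" using i by (intro N_mult_le f(2) oz) auto
     finally show ?thesis using False by simp
    qed (use \<delta>(1) in \<open>simp add: Z_def\<close>)
   qed
   finally have "sub (K * (K * \<delta>)) (\<Sum>i<n. Z i) a"
    unfolding sub_def using H(3) by (intro exI[of _ H]) (simp add: K_def)
   moreover have "pos (\<Sum>i<n. Z i)" by (intro pos_sum PS_pos Z) simp
   ultimately show ?thesis using sub_cut_cz[OF _ PS_pos[OF a] _ \<delta>(2)] by blast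
  qed
  ultimately show ?thesis
   unfolding sum_single using mle_trans by (metis mle_single)
 qed
 \<comment> \<open>The exponent 6 comes from \<open>f i 0 * g ^ 4 * f 0 i \<sim> f i i ^ 6\<close>;
   accordingly \<open>sub_power\<close> contributes the factor 7.\<close>
 obtain v where v: "N (v * d * st v - (s * s - s * H ^ 6 * s)) \<le> 7 * \<delta>"
  using sub_power[OF s(1) oz(6,7) PS_pos[OF d(1)] f(3) \<delta>(1), of 6] unfolding sub_def H_def by auto
 define V where "V = (\<Sum>i<n. f i 0 * e * st (f i 0)) + v * d * st v"
 have "N (H * s - s * H) \<le> K * \<delta>"
  unfolding H_def K_def using f(2) by (intro comm_sum) auto
 then have "N (H ^ 6 * s - s * H ^ 6) \<le> real 6 * (K * \<delta>)" by (intro comm_power H)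
 then have "N (s * (H ^ 6 * s - s * H ^ 6)) \<le> N s * (real 6 * (K * \<delta>))" by (intro N_mult_le) auto
 then have 1: "N (s * H ^ 6 * s - s * s * H ^ 6) \<le> 6 * (K * N s) * \<delta>" by (simp add: algebra_simps)
 have Hp: "H ^ Suc m \<sim> (\<Sum>i<n. f i i ^ Suc m)" for m
 proof (induction m)
  case (Suc m)
  have "H ^ Suc (Suc m) \<sim> H * (\<Sum>i<n. f i i ^ Suc m)"
   unfolding power_Suc[of H "Suc m"] by (rule eqv_mult[OF eqv_refl Suc])
  also have "... = (\<Sum>i<n. \<Sum>j<n. f i i * f j j ^ Suc m)"
   unfolding H_def by (rule sum_product)
  also have "... \<sim> (\<Sum>i<n. \<Sum>j<n. if i = j then f i i ^ Suc (Suc m) else 0)"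
  proof (intro eqv_sum)
   fix i j assume "i \<in> {..<n}" "j \<in> {..<n}"
   then show "f i i * f j j ^ Suc m \<sim> (if i = j then f i i ^ Suc (Suc m) else 0)"
    using eqv_0_multl[OF oz(4)[of i i j j], of "f j j ^ m"] by (cases "i = j") (auto simp: mult.assoc)
  qed
  finally show ?case by simp
 qed (simp add: H_def)
 have "s * s * H ^ 6 \<sim> a * (\<Sum>i<n. f i i ^ 6)" using Hp[of 5] by (intro eqv_mult s) simp
 then have 2: "N (s * s * H ^ 6 - (\<Sum>i<n. a * f i i ^ 6)) \<le> 0" by (simp add: eqv_def sum_distrib_left)
 have 3: "N ((\<Sum>i<n. a * f i i ^ 6) - (\<Sum>i<n. f i 0 * e * st (f i 0))) \<le> K * (3 * \<delta> + \<rho>)"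
 proof -
  have "N (a * f i i ^ 6 - f i 0 * e * st (f i 0)) \<le> 3 * \<delta> + \<rho>" if i: "i < n" for i
  proof -
   have gp: "f i 0 * g ^ m \<sim> f i i ^ m * f i 0" for m
   proof (induction m)
    case (Suc m)
    have "f i 0 * g ^ Suc m = (f i 0 * g ^ m) * g" by (simp add: power_commutes mult.assoc)
    also have "... \<sim> f i i ^ m * f i 0 * g" by (rule eqv_mult[OF Suc eqv_refl])
    also have "... = f i i ^ m * (f i 0 * f 0 0)" by (simp add: g_def mult.assoc)
    also have "... \<sim> f i i ^ m * (f i i * f i 0)" using i n0 by (intro eqv_mult eqv_refl oz)
    finally show ?case by (simp only: power_Suc2 mult.assoc)
   qed simp
   have "f i 0 * g ^ 4 * f 0 i \<sim> f i i ^ 4 * f i 0 * f 0 i" by (rule eqv_mult[OF gp eqv_refl])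
   also have "... = f i i ^ 4 * (f i 0 * f 0 i)" by (simp add: mult.assoc)
   also have "... \<sim> f i i ^ 4 * (f i i * f i i)" using i n0 by (intro eqv_mult eqv_refl oz)
   also have "... = f i i ^ 6" by (simp add: eval_nat_numeral mult.assoc)
   finally have "a * (f i 0 * g ^ 4 * f 0 i) \<sim> a * f i i ^ 6" by (rule eqv_mult[OF eqv_refl])
   then have A: "N (a * f i i ^ 6 - a * (f i 0 * g ^ 4 * f 0 i)) \<le> 0" using N_minus_commute by (simp add: eqv_def)
   have "N (f i 0 * g\<^sup>2 * a - a * (f i 0 * g\<^sup>2)) \<le> \<delta> + real 2 * \<delta>" using i g by (intro comm_mult comm_power f(2) oz N_power_le_1) auto
   then have "N ((a * (f i 0 * g\<^sup>2) - f i 0 * g\<^sup>2 * a) * (g\<^sup>2 * f 0 i)) \<le> 3 * \<delta> * (1 * 1)"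
    using i g by (intro N_mult_le N_power_le_1 oz) (auto simp: N_minus_commute)
   moreover have "(a * (f i 0 * g\<^sup>2) - f i 0 * g\<^sup>2 * a) * (g\<^sup>2 * f 0 i) = a * (f i 0 * g ^ 4 * f 0 i) - f i 0 * Y * f 0 i"
    by (simp add: Y_def left_diff_distrib mult.assoc)
   ultimately have B: "N (a * (f i 0 * g ^ 4 * f 0 i) - f i 0 * Y * f 0 i) \<le> 3 * \<delta>" by simp
   have "N (f i 0 * (Y - e) * f 0 i) \<le> 1 * \<rho> * 1" using i oz cut_close[OF PS_pos[OF Y], of \<rho>] \<rho> by (intro N_mult3_le) (auto simp: e_def)
   then have C: "N (f i 0 * Y * f 0 i - f i 0 * e * f 0 i) \<le> \<rho>" by (simp add: algebra_simps)
   from N_trans3[OF A B C] show ?thesis using i by (simp add: oz(2))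
  qed
  then show ?thesis
   using N_sum_le[of "{..<n}" "\<lambda>i. a * f i i ^ 6 - f i 0 * e * st (f i 0)" "3 * \<delta> + \<rho>"] by (simp add: sum_subtractf K_def)
 qed
 have "N ((s * H ^ 6 * s - (\<Sum>i<n. f i 0 * e * st (f i 0))) + ((s * s - s * H ^ 6 * s) - v * d * st v))
   \<le> (6 * (K * N s) * \<delta> + 0 + K * (3 * \<delta> + \<rho>)) + 7 * \<delta>" using v by (intro N_add_le N_trans3[OF 1 2 3]) (simp add: N_minus_commute)
 also have "... = M * \<delta> + K * \<rho>" by (simp add: M_def algebra_simps)
 also have "... \<le> \<epsilon> / 2" using \<delta>(4) \<rho>(2) by simp
 finally have "N (s * s - V) \<le> \<epsilon> / 2" by (simp add: V_def algebra_simps)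
 then have aV: "N (a - V) \<le> \<epsilon> / 2" using N_cong[OF s(2) eqv_refl, of V] by simp
 have V: "pos V" unfolding V_def using PSe d by (intro pos_add pos_sum pos_conj PS_pos)
 have "pos (rsc (\<epsilon> / 2) - (a - V))" using aV pos_st[OF V] PS_st[OF a] by (intro pos_upper) simp_all
 then have "cz (cut a \<epsilon>) V" using eps by (intro pos_le_cut_cz[OF PS_pos[OF a] V, of "\<epsilon> / 2"]) (simp_all add: algebra_simps)
 then have "mle {#cut a \<epsilon>#} {#V#}" by (simp add: mle_single)
 also have "mle {#V#} ({#\<Sum>i<n. f i 0 * e * st (f i 0)#} + {#v * d * st v#})"
  using mle_plus[of "\<Sum>i<n. f i 0 * e * st (f i 0)" "v * d * st v"] by (simp add: V_def add_mset_commute)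
 also have "mle ... (copies n e + {#d#})" by (intro mle_add mle_row[where u = "\<lambda>i. f i 0"]) (simp_all add: mle_single conj_cz)
 finally show ?thesis by (rule that[OF PSe lower])
qed

lemma rep_add: "copies m x + copies n x = copies (m + n) (x :: 'g fa)" by (simp add: multiset_eq_iff)

lemma mle_replicate_le: "m \<le> n \<Longrightarrow> mle (copies m x) (copies n x)" by (intro mle_subset) (simp add: subseteq_mset_def)

lemma mle_replicate_mono: "mle {#x#} {#y#} \<Longrightarrow> mle (copies n x) (copies n y)"
proof (induction n)
 case (Suc n)
 then show ?case using mle_add[of "{#x#}" "{#y#}" "copies n x" "copies n y"] by simp
qed simp

text \<open>Choose \<open>d\<close> so small that \<open>n + 2\<close> copies fit below
  \<open>c = cut a \<epsilon>\<close>, and divide up to \<open>d\<close>. Then \<open>n + 2\<close>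
  copies of \<open>d\<close> lie below \<open>n\<close> copies of \<open>e\<close> and one
  \<open>d\<close>; iterating and using almost unperforation puts \<open>d\<close> below
  \<open>e\<close>, so that \<open>e\<close> absorbs the remainder as copy number
  \<open>n + 1\<close>.\<close>

theorem weakly_divisible:
 assumes a: "PS a" and n: "n \<ge> 1" and eps: "\<epsilon> > 0"
 obtains e where "PS e" "mle (copies n e) {#a#}" "mle {#cut a \<epsilon>#} (copies (n + 1) e)"
proof (cases "N (cut a \<epsilon>) > 0")
 case False
 then have "mle {#cut a \<epsilon>#} {#0#}" using N_nonneg[of "cut a \<epsilon>"] by (simp add: mle_single null_cz)
 also have "mle {#0#} (copies (n + 1) 0)" using mle_replicate_le[of 1 "n + 1" 0] by simp
 finally have 1: "mle {#cut a \<epsilon>#} (copies (n + 1) 0)" .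
 have "mle {#0#} {#}" using mle_mset[of "[0]" "[]"] using dle_row[where u = "\<lambda>_. 1"] by simp
 from mle_replicate[OF this, of n] have "mle (repeat_mset n {#0#}) {#}" by simp
 moreover have "repeat_mset n {#0#} = copies n (0 :: 'g fa)" by simp
 ultimately have "mle (copies n 0) {#a#}" using mle_trans mle_subset by (metis empty_le)
 then show ?thesis using 1 by (intro that[of 0]) (auto simp: PS_def)
next
 case True
 define c where "c = cut a \<epsilon>"
 have c: "PS c" "N c > 0" "mle {#c#} {#a#}"
  using True PS_cut[OF a, of \<epsilon>] eps cut_cz[OF PS_pos[OF a], of \<epsilon>] by (simp_all add: c_def mle_single)
 obtain d0 where d0: "PS d0" "N d0 > 0" "mle (copies (n + 2) d0) {#c#}" using exists_small[OF c(1,2)] .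
 \<comment> \<open>Cutting makes \<open>d\<close> dominated by finitely many copies of any nonzero
   \<open>e\<close>: \<open>d0\<close> is approximated in the ideal of \<open>e\<close> within a
   quarter of its norm, less than the half cut off.\<close>
 define d where "d = cut d0 (N d0 / 2)"
 have d: "PS d" "N d > 0" "cz d d0" using d0 by (simp_all add: d_def PS_cut cut_norm cut_cz PS_pos)
 have dc: "mle (copies (n + 2) d) {#c#}" using mle_replicate_mono[of d d0 "n + 2"] d(3) d0(3) mle_trans by (simp only: mle_single) blast
 obtain e where e: "PS e" "mle (copies n e) {#a#}" "mle {#c#} (copies n e + {#d#})"
  using divisible_up_to_small[OF a d(1,2) n eps] unfolding c_def .
 show ?thesis
 proof (cases "N e > 0")
  \<comment> \<open>If \<open>e\<close> is null, \<open>c\<close> is below the single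
    \<open>d\<close>, and \<open>d\<close> itself divides \<open>a\<close>.\<close>
  case False
  have Ne: "N e = 0" using False N_nonneg[of e] by linarith
  have "mle (copies n d) (copies (n + 2) d)" by (rule mle_replicate_le) simp
  also have "mle ... {#c#}" by (rule dc)
  also have "mle {#c#} {#a#}" by (rule c)
  finally have 1: "mle (copies n d) {#a#}" .
  have "mle (copies n e) (copies n d)" by (rule mle_replicate_mono) (simp add: mle_single null_cz Ne)
  from mle_trans[OF e(3) mle_add[OF this mle_refl]] have "mle {#c#} (copies (n + 1) d)" by simp
  with d(1) 1 show ?thesis unfolding c_def by rule
 next
  case True
  have "\<exists>n u w. N (d0 - (\<Sum>i<(n::nat). u i * e * w i)) \<le> N d0 / 4" using d0 e True by (intro simple) (auto simp: PS_ch)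
  then obtain m u w where m: "N (d0 - (\<Sum>i<(m::nat). u i * e * w i)) \<le> N d0 / 4" by blast
  define l where "l = 2 * m"
  have dl: "mle {#d#} (copies l e)"
   unfolding d_def l_def by (rule ideal_cut_mle[OF PS_pos[OF d0(1)] PS_pos[OF e(1)] m]) (use d0(2) in simp)
  have dc': "mle (copies (n + 2) d) (copies n e + {#d#})" by (rule mle_trans[OF dc e(3)])
  \<comment> \<open>Each round trades \<open>n + 2\<close> copies of \<open>d\<close> for
    \<open>n\<close> copies of \<open>e\<close> and one \<open>d\<close>, a net use of
    \<open>n + 1\<close> copies. After \<open>l\<close> rounds the last \<open>d\<close> costs
    \<open>l\<close> copies of \<open>e\<close>, and there is still one more copy on the left than
    on the right.\<close>
  have iter: "mle (copies (j * (n + 1) + 1) d) (copies (j * n) e + {#d#})" for j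
  proof (induction j)
   case (Suc j)
   have "copies (Suc j * (n + 1) + 1) d = copies (j * (n + 1) + 1) d + copies (n + 1) d" by (simp add: multiset_eq_iff)
   also have "mle ... (copies (j * n) e + {#d#} + copies (n + 1) d)" by (intro mle_add Suc mle_refl)
   also have "copies (j * n) e + {#d#} + copies (n + 1) d = copies (j * n) e + copies (n + 2) d" by simp
   also have "mle ... (copies (j * n) e + (copies n e + {#d#}))" by (intro mle_add dc' mle_refl)
   also have "copies (j * n) e + (copies n e + {#d#}) = copies (Suc j * n) e + {#d#}" by (simp add: multiset_eq_iff)
   finally show ?case .
  qed simp
  have "mle (copies (l * (n + 1) + 1) d) (copies (l * n) e + {#d#})" by (rule iter)
  also have "mle ... (copies (l * n) e + copies l e)" by (intro mle_add dl mle_refl)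
  also have "... = copies (l * (n + 1)) e" by (simp add: rep_add add.commute)
  finally have "cz d e" using almost_unperforated[OF d(1) e(1)] by simp
  then have "mle (copies n e + {#d#}) (copies n e + {#e#})" by (intro mle_add mle_refl) (simp add: mle_single)
  from mle_trans[OF e(3) this] have "mle {#c#} (copies (n + 1) e)" by simp
  with e(1,2) show ?thesis unfolding c_def by rule
 qed
qed

end

section \<open>States on preordered monoids\<close>

definition nm :: "nat \<Rightarrow> 'm::comm_monoid_add \<Rightarrow> 'm" where
 "nm n a = (\<Sum>i<n. a)"

lemma nm_simps [simp]: "nm 0 a = 0" "nm (Suc n) a = nm n a + a" by (simp_all add: nm_def)

lemma nm_add: "nm (m + n) a = nm m a + nm n a" by (induction n) (simp_all add: add_ac)

lemma nm_distrib: "nm n (a + b) = nm n a + nm n b" by (simp add: nm_def sum.distrib)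

lemma nm_mult: "nm (m * n) a = nm m (nm n a)" by (induction m) (simp_all add: nm_add add_ac)

lemma nm_nm_commute: "nm m (nm n a) = nm n (nm m a)" by (metis mult.commute nm_mult)

lemma nm_0 [simp]: "nm n 0 = 0" by (simp add: nm_def)

locale preordered_monoid =
 fixes le :: "'m::comm_monoid_add \<Rightarrow> 'm \<Rightarrow> bool"
 assumes le_refl [simp]: "le a a"
  and le_trans: "le a b \<Longrightarrow> le b c \<Longrightarrow> le a c"
  and le_add: "le a b \<Longrightarrow> le c d \<Longrightarrow> le (a + c) (b + d)"
  and le_0 [simp]: "le 0 a"
begin

lemma le_add_right: "le a (a + b)" using le_add[of a a 0 b] by simp

lemma le_nm: "le a b \<Longrightarrow> le (nm n a) (nm n b)" by (induction n) (auto intro: le_add)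

lemma nm_mono: "m \<le> n \<Longrightarrow> le (nm m a) (nm n a)" by (metis le_add_right nm_add le_add_diff_inverse)

text \<open>The order ideal generated by \<open>y\<close>, and cones of differences \<open>b - a\<close>, written as pairs \<open>(a, b)\<close>,
 in its Grothendieck group.\<close>

definition oideal :: "'m \<Rightarrow> 'm set" where
 "oideal y = {z. \<exists>L. le z (nm L y)}"

definition cone :: "'m \<Rightarrow> ('m \<times> 'm) set \<Rightarrow> bool" where
 "cone y T \<longleftrightarrow> T \<subseteq> oideal y \<times> oideal y \<and> (\<forall>a b. b \<in> oideal y \<longrightarrow> le a b \<longrightarrow> (a, b) \<in> T) \<and>
   (\<forall>a b c d. (a, b) \<in> T \<longrightarrow> (c, d) \<in> T \<longrightarrow> (a + c, b + d) \<in> T) \<and>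
   (\<forall>a b w. (a + w, b + w) \<in> T \<longrightarrow> (a, b) \<in> T) \<and> (y, 0) \<notin> T"

lemma cone_add:
 assumes "cone y T" "(a, b) \<in> T" "(c, d) \<in> T"
 shows "(a + c, b + d) \<in> T" by (metis assms(1) cone_def assms(2,3))

lemma oideal_down: "b \<in> oideal y \<Longrightarrow> le a b \<Longrightarrow> a \<in> oideal y"
 unfolding oideal_def using le_trans by blast

lemma oideal_add_iff [simp]: "a + b \<in> oideal y \<longleftrightarrow> a \<in> oideal y \<and> b \<in> oideal y"
proof
 assume "a \<in> oideal y \<and> b \<in> oideal y"
 then obtain L M where "le a (nm L y)" "le b (nm M y)" unfolding oideal_def by blast
 then have "le (a + b) (nm (L + M) y)" using le_add by (simp add: nm_add)
 then show "a + b \<in> oideal y" unfolding oideal_def by blast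
next
 assume "a + b \<in> oideal y"
 then show "a \<in> oideal y \<and> b \<in> oideal y" using oideal_down le_add_right by (metis add.commute)
qed

lemma oideal_0 [simp]: "0 \<in> oideal y"
 unfolding oideal_def by auto

lemma oideal_nm: "a \<in> oideal y \<Longrightarrow> nm n a \<in> oideal y" by (induction n) auto

lemma oideal_self [simp]: "y \<in> oideal y"
 unfolding oideal_def by (rule CollectI, rule exI[of _ 1]) simp

context
 fixes x y :: 'm and L :: nat
 assumes x: "le x (nm L y)" and unperf: "\<And>m n. m < n \<Longrightarrow> le (nm n x) (nm m y) \<Longrightarrow> le x y"
  and not_le: "\<not> le x y"
begin

text \<open>Declaring \<open>y \<le> x\<close> is consistent. If it forced \<open>y\<close> below
  zero, then iterating often enough to swallow \<open>w\<close>, which is below \<open>M\<close>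
  copies of \<open>y\<close>, would put some multiple of \<open>x\<close> below a strictly smaller
  multiple of \<open>y\<close>, and \<open>unperf\<close> would give \<open>le x y\<close>.\<close>

lemma base_cone_proper:
 assumes w: "w \<in> oideal y" and le: "le (y + nm n x + w) (nm n y + w)"
 shows False
proof -
 obtain M where M: "le w (nm M y)" using w unfolding oideal_def by blast
 have it: "le (nm j a + w) (nm j b + w)" if "le (a + w) (b + w)" for j a b w
 proof (induction j)
  case (Suc j)
  have "le (nm (Suc j) a + w) (nm j b + w + a)" using le_add[OF Suc le_refl, of a] by (simp add: add_ac)
  moreover have "le (nm j b + w + a) (nm (Suc j) b + w)" using le_add[OF le_refl[of "nm j b"] that] by (simp add: add_ac)
  ultimately show ?case by (rule le_trans)
 qed simp
 have "le (nm (Suc M) (y + nm n x) + w) (nm (Suc M) (nm n y) + w)" by (rule it[OF le])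
 moreover have "le (nm (Suc M) (y + nm n x)) (nm (Suc M) (y + nm n x) + w)" by (rule le_add_right)
 moreover have "le (nm (Suc M) (nm n y) + w) (nm (Suc M) (nm n y) + nm M y)" by (intro le_add M le_refl)
 ultimately have *: "le (nm (Suc M) (y + nm n x)) (nm (Suc M) (nm n y) + nm M y)" using le_trans by blast
 define K where "K = Suc M * n"
 have A: "le (nm K x + nm (Suc M) y) (nm (K + M) y)" using * by (simp only: nm_distrib nm_mult[symmetric] nm_add K_def add.commute)
 show False
 proof (cases "K = 0")
  \<comment> \<open>Here \<open>y\<close> is absorbed by \<open>M\<close> copies of itself, so all
    multiples of \<open>y\<close>, and with them \<open>M + 1\<close> copies of \<open>x\<close>,
    lie below \<open>nm M y\<close>.\<close>
  case True
  then have "le (y + nm M y) (0 + nm M y)" using A by (simp add: add_ac)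
  then have 1: "le (nm j y + nm M y) (nm M y)" for j using it[of y "nm M y" 0 j] by simp
  have "le (nm (Suc M) x) (nm (Suc M * L) y)" unfolding nm_mult by (rule le_nm[OF x])
  moreover have "le (nm (Suc M * L) y) (nm (Suc M * L) y + nm M y)" by (rule le_add_right)
  ultimately have "le (nm (Suc M) x) (nm M y)" using 1 le_trans by blast
  then show False using unperf[of M "Suc M"] not_le by blast
 next
  case False
  then obtain k where k: "K = Suc k" by (cases K) auto
  have "le (nm K x + nm (Suc M) y) (nm k y + nm (Suc M) y)"
  proof -
   have "nm (K + M) y = nm k y + nm (Suc M) y" unfolding k nm_add[symmetric] by simp
   then show ?thesis using A by simp
  qed
  \<comment> \<open>One copy of \<open>y\<close> is gained per round, so \<open>M + 2\<close> rounds
    outweigh the \<open>M + 1\<close> copies retained on the right.\<close>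
  from it[OF this, of "M + 2"] have "le (nm (M + 2) (nm K x) + nm (Suc M) y) (nm (M + 2) (nm k y) + nm (Suc M) y)" .
  then have "le (nm ((M + 2) * K) x) (nm ((M + 2) * k + Suc M) y)" using le_trans[OF le_add_right] by (simp only: nm_mult nm_add)
  moreover have "(M + 2) * k + Suc M < (M + 2) * K" by (simp add: k)
  ultimately show False using unperf not_le by blast
 qed
qed

text \<open>By Zorn's lemma the cone generated by declaring \<open>y \<le> x\<close> extends to a
  maximal cone in which \<open>y\<close> stays strictly positive. Maximality makes the associated
  preorder total, so that a state can be read off from rational comparisons.\<close>

lemma exists_total_cone:
 obtains T where "cone y T" "(y, x) \<in> T" "\<And>a b. a \<in> oideal y \<Longrightarrow> b \<in> oideal y \<Longrightarrow> (a, b) \<in> T \<or> (b, a) \<in> T"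
proof -
 have xI: "x \<in> oideal y" using x unfolding oideal_def by blast
 define T0 where "T0 = {(a, b). a \<in> oideal y \<and> b \<in> oideal y \<and> (\<exists>n w. w \<in> oideal y \<and> le (a + nm n x + w) (b + nm n y + w))}"
 have T0_iff: "(a, b) \<in> T0 \<longleftrightarrow> a \<in> oideal y \<and> b \<in> oideal y \<and> (\<exists>n w. w \<in> oideal y \<and> le (a + nm n x + w) (b + nm n y + w))" for a b
  by (simp add: T0_def)
 have T0: "cone y T0"
  unfolding cone_def
 proof (intro conjI allI impI)
  show "T0 \<subseteq> oideal y \<times> oideal y" by (auto simp: T0_def)
  show "(y, 0) \<notin> T0" using base_cone_proper by (auto simp: T0_def)
  show "(a, b) \<in> T0" if "b \<in> oideal y" "le a b" for a b using that oideal_down unfolding T0_def by (auto intro!: exI[of _ 0])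
  show "(a + c, b + d) \<in> T0" if h: "(a, b) \<in> T0" "(c, d) \<in> T0" for a b c d
  proof -
   obtain n w where n: "w \<in> oideal y" "le (a + nm n x + w) (b + nm n y + w)" using h unfolding T0_iff by blast
   obtain m v where m: "v \<in> oideal y" "le (c + nm m x + v) (d + nm m y + v)" using h unfolding T0_iff by blast
   have "le ((a + c) + nm (n + m) x + (w + v)) ((b + d) + nm (n + m) y + (w + v))"
    using le_add[OF n(2) m(2)] by (simp add: nm_add add_ac)
   then show ?thesis using h n(1) m(1) unfolding T0_iff by (intro conjI exI[of _ "n + m"] exI[of _ "w + v"]) auto
  qed
  show "(a, b) \<in> T0" if h: "(a + w, b + w) \<in> T0" for a b w
  proof -
   obtain n v where n: "v \<in> oideal y" "le (a + w + nm n x + v) (b + w + nm n y + v)" using h unfolding T0_iff by blast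
   then show ?thesis using h n(1) unfolding T0_iff by (simp add: add_ac exI[of _ n] exI[of _ "w + v"])
  qed
 qed
 have yx: "(y, x) \<in> T0"
  unfolding T0_iff using xI by (intro conjI exI[of _ "Suc 0"] exI[of _ 0]) (simp_all add: add.commute)
 define A where "A = {T. cone y T \<and> T0 \<subseteq> T}"
 have "\<exists>M\<in>A. \<forall>R\<in>A. M \<subseteq> R \<longrightarrow> R = M"
 proof (rule subset_Zorn_nonempty)
  show "A \<noteq> {}" using T0 by (auto simp: A_def)
  fix C assume C: "C \<noteq> {}" "subset.chain A C"
  then have CA: "\<And>T. T \<in> C \<Longrightarrow> cone y T \<and> T0 \<subseteq> T" and ch: "\<And>S T. S \<in> C \<Longrightarrow> T \<in> C \<Longrightarrow> S \<subseteq> T \<or> T \<subseteq> S"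
   unfolding subset_chain_def A_def by auto
  have "cone y (\<Union>C)"
   unfolding cone_def
  proof (intro conjI allI impI)
   show "\<Union>C \<subseteq> oideal y \<times> oideal y" using CA unfolding cone_def by blast
   show "(y, 0) \<notin> \<Union>C" using CA unfolding cone_def by blast
   show "(a, b) \<in> \<Union>C" if "b \<in> oideal y" "le a b" for a b using that CA C(1) unfolding cone_def by blast
   show "(a + c, b + d) \<in> \<Union>C" if "(a, b) \<in> \<Union>C" "(c, d) \<in> \<Union>C" for a b c d
   proof -
    obtain S T where ST: "S \<in> C" "(a, b) \<in> S" "T \<in> C" "(c, d) \<in> T" using \<open>(a, b) \<in> \<Union>C\<close> \<open>(c, d) \<in> \<Union>C\<close> by blast
    then obtain R where R: "R \<in> C" "(a, b) \<in> R" "(c, d) \<in> R" using ch[of S T] by blast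
    then show ?thesis using R(1) using CA[of R] cone_add by blast
   qed
   show "(a, b) \<in> \<Union>C" if "(a + w, b + w) \<in> \<Union>C" for a b w using that CA unfolding cone_def by blast
  qed
  then show "\<Union>C \<in> A" using CA C(1) by (auto simp: A_def)
 qed
 then obtain T where TA: "T \<in> A" and maxA: "\<And>R. R \<in> A \<Longrightarrow> T \<subseteq> R \<Longrightarrow> R = T" by blast
 then have T: "cone y T" "T0 \<subseteq> T" by (simp_all add: A_def)
 have max: "R = T" if "cone y R" "T \<subseteq> R" for R using that T(2) by (intro maxA) (auto simp: A_def)
 have sub: "T \<subseteq> oideal y \<times> oideal y" and Tle: "\<And>a b. b \<in> oideal y \<Longrightarrow> le a b \<Longrightarrow> (a, b) \<in> T"
  and add: "\<And>a b c d. (a, b) \<in> T \<Longrightarrow> (c, d) \<in> T \<Longrightarrow> (a + c, b + d) \<in> T"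
  and canc: "\<And>a b w. (a + w, b + w) \<in> T \<Longrightarrow> (a, b) \<in> T" and y0: "(y, 0) \<notin> T" using T(1) unfolding cone_def by blast+
 have nmT: "(nm n a, nm n b) \<in> T" if "(a, b) \<in> T" for n a b using Tle[of 0 0] by (induction n) (auto intro: add that)
 \<comment> \<open>Adjoining a missing pair enlarges the cone; by maximality the enlargement
   contains \<open>(y, 0)\<close>, and this is what membership of \<open>(y, 0)\<close> amounts
   to.\<close>
 have adj: "\<exists>n. (y + nm n b, nm n a) \<in> T" if ab: "a \<in> oideal y" "b \<in> oideal y" "(a, b) \<notin> T" for a b
 proof (rule ccontr)
  assume no: "\<not> ?thesis"
  define T' where "T' = {(u, v). u \<in> oideal y \<and> v \<in> oideal y \<and> (\<exists>n. (u + nm n b, v + nm n a) \<in> T)}"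
  have "cone y T'"
   unfolding cone_def
  proof (intro conjI allI impI)
   show "T' \<subseteq> oideal y \<times> oideal y" by (auto simp: T'_def)
   show "(y, 0) \<notin> T'" using no by (auto simp: T'_def)
   show "(u, v) \<in> T'" if "v \<in> oideal y" "le u v" for u v using that oideal_down Tle unfolding T'_def by (auto intro!: exI[of _ 0])
   show "(u + u', v + v') \<in> T'" if h: "(u, v) \<in> T'" "(u', v') \<in> T'" for u v u' v'
   proof -
    obtain n m where "(u + nm n b, v + nm n a) \<in> T" "(u' + nm m b, v' + nm m a) \<in> T" using h by (auto simp: T'_def)
    from add[OF this] have "((u + u') + nm (n + m) b, (v + v') + nm (n + m) a) \<in> T" by (simp add: nm_add add_ac)
    then show ?thesis using h unfolding T'_def by auto
   qed
   show "(u, v) \<in> T'" if h: "(u + w, v + w) \<in> T'" for u v w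
   proof -
    obtain n where "(u + w + nm n b, v + w + nm n a) \<in> T" using h by (auto simp: T'_def)
    then have "((u + nm n b) + w, (v + nm n a) + w) \<in> T" by (simp add: add_ac)
    from canc[OF this] show ?thesis using h unfolding T'_def by auto
   qed
  qed
  moreover have "T \<subseteq> T'" using sub unfolding T'_def by (auto intro!: exI[of _ 0])
  moreover have "(a, b) \<in> T'" using ab Tle[of "b + a" "a + b"] unfolding T'_def by (auto intro!: exI[of _ 1] simp: add.commute)
  ultimately show False using max ab(3) by blast
 qed
 \<comment> \<open>If both pairs were missing, suitable multiples of the two relations would cancel
   to \<open>nm (m + n) y\<close> below zero, hence \<open>y\<close> below zero.\<close>
 have total: "(a, b) \<in> T \<or> (b, a) \<in> T" if ab: "a \<in> oideal y" "b \<in> oideal y" for a b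
 proof (rule ccontr)
  assume no: "\<not> ?thesis"
  obtain n where n: "(y + nm n b, nm n a) \<in> T" using adj[OF ab] no by blast
  obtain m where m: "(y + nm m a, nm m b) \<in> T" using adj[OF ab(2,1)] no by blast
  have "(nm m (y + nm n b) + nm n (y + nm m a), nm m (nm n a) + nm n (nm m b)) \<in> T" by (intro add nmT n m)
  then have "(nm (m + n) y + (nm m (nm n a) + nm n (nm m b)), 0 + (nm m (nm n a) + nm n (nm m b))) \<in> T"
   by (simp add: nm_distrib nm_add nm_nm_commute[of n m] add_ac)
  then have 1: "(nm (m + n) y, 0) \<in> T" by (rule canc)
  obtain k where "m + n = Suc k" using n y0 by (cases "m + n") auto
  then have "(y + nm k y, 0) \<in> T" using 1 by (simp add: add.commute)
  moreover have "(0, nm k y) \<in> T" by (intro Tle oideal_nm oideal_self le_0)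
  ultimately have "(y + nm k y + 0, 0 + nm k y) \<in> T" by (rule add)
  then have "(y + nm k y, 0 + nm k y) \<in> T" by simp
  from canc[OF this] show False using y0 by simp
 qed
 show ?thesis using that[OF T(1) _ total] T(2) yx by blast
qed

text \<open>The state is the infimum of the fractions \<open>m / n\<close> with \<open>n\<close>
  copies of \<open>z\<close> below \<open>m\<close> copies of \<open>y\<close> in the total cone.
  Since the cone contains \<open>(y, x)\<close>, no fraction for \<open>x\<close> is below
  one.\<close>

theorem exists_state:
 obtains d :: "'m \<Rightarrow> ennreal" where "\<And>a b. d (a + b) = d a + d b" "\<And>a b. le a b \<Longrightarrow> d a \<le> d b" "d y = 1" "d x \<ge> 1"
proof -
 obtain T where T: "cone y T" "(y, x) \<in> T" and total: "\<And>a b. a \<in> oideal y \<Longrightarrow> b \<in> oideal y \<Longrightarrow> (a, b) \<in> T \<or> (b, a) \<in> T"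
  using exists_total_cone by blast
 have sub: "T \<subseteq> oideal y \<times> oideal y" and Tle: "\<And>a b. b \<in> oideal y \<Longrightarrow> le a b \<Longrightarrow> (a, b) \<in> T"
  and add: "\<And>a b c d. (a, b) \<in> T \<Longrightarrow> (c, d) \<in> T \<Longrightarrow> (a + c, b + d) \<in> T"
  and canc: "\<And>a b w. (a + w, b + w) \<in> T \<Longrightarrow> (a, b) \<in> T" and y0: "(y, 0) \<notin> T" using T(1) unfolding cone_def by blast+
 have nmT: "(nm n a, nm n b) \<in> T" if "(a, b) \<in> T" for n a b using Tle[of 0 0] by (induction n) (auto intro: add that)
 have tr: "(a, c) \<in> T" if "(a, b) \<in> T" "(b, c) \<in> T" for a b c using canc[of a b c] add[OF that] by (simp add: add.commute)
 have nondeg: "i \<le> j" if ij: "(nm i y, nm j y) \<in> T" for i j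
 proof (rule ccontr)
  assume "\<not> i \<le> j"
  then obtain k where k: "i = j + Suc k" using less_iff_Suc_add[of j i] by auto
  have "(nm (Suc k) y + nm j y, 0 + nm j y) \<in> T" using ij by (simp add: k nm_add add_ac)
  then have "(nm (Suc k) y, 0) \<in> T" by (rule canc)
  moreover have "(y, nm (Suc k) y) \<in> T" using le_add_right[of y "nm k y"] by (intro Tle oideal_nm oideal_self) (simp add: add.commute)
  ultimately show False using tr y0 by blast
 qed
 have xI: "x \<in> oideal y" using x unfolding oideal_def by blast
 define S where "S z = {real m / real n | m n. n > 0 \<and> (nm n z, nm m y) \<in> T}" for z
 define r where "r z = Inf (S z)" for z
 have S0: "bdd_below (S z)" for z by (rule bdd_belowI[of _ 0]) (auto simp: S_def)
 have Sne: "S z \<noteq> {}" if z: "z \<in> oideal y" for z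
 proof -
  obtain L where "le z (nm L y)" using z unfolding oideal_def by blast
  then have "(nm 1 z, nm L y) \<in> T" by (auto intro!: Tle oideal_nm)
  then show ?thesis unfolding S_def by (metis (mono_tags, lifting) empty_iff mem_Collect_eq zero_less_one)
 qed
 have r0: "0 \<le> r z" if "z \<in> oideal y" for z
  unfolding r_def using Sne[OF that] by (intro cInf_greatest) (auto simp: S_def)
 have sub_add: "r (a + b) \<le> r a + r b" if ab: "a \<in> oideal y" "b \<in> oideal y" for a b
 proof -
  have H: "r (a + b) \<le> s + t" if "s \<in> S a" "t \<in> S b" for s t
  proof -
   obtain m n where s: "s = real m / real n" "n > 0" "(nm n a, nm m y) \<in> T" using \<open>s \<in> S a\<close> unfolding S_def by blast
   obtain p q where t: "t = real p / real q" "q > 0" "(nm q b, nm p y) \<in> T" using \<open>t \<in> S b\<close> unfolding S_def by blast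
   have "(nm q (nm n a) + nm n (nm q b), nm q (nm m y) + nm n (nm p y)) \<in> T" by (intro add nmT s t)
   then have "(nm (n * q) (a + b), nm (q * m + n * p) y) \<in> T" by (simp add: nm_distrib nm_add nm_mult nm_nm_commute[of q n])
   moreover have "s + t = real (q * m + n * p) / real (n * q)" "n * q > 0" using s t by (simp_all add: field_simps)
   ultimately have "s + t \<in> S (a + b)" unfolding S_def by blast
   then show ?thesis unfolding r_def by (intro cInf_lower S0)
  qed
  have H': "r (a + b) - s \<le> r b" if "s \<in> S a" for s
   unfolding r_def[of b] using H[OF that] by (intro cInf_greatest Sne[OF ab(2)]) (auto simp: diff_le_eq add.commute)
  have "r (a + b) - r b \<le> r a"
   unfolding r_def[of a]
  proof (rule cInf_greatest[OF Sne[OF ab(1)]])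
   fix s assume "s \<in> S a"
   then show "r (a + b) - r b \<le> s" using H'[of s] by simp
  qed
  then show ?thesis by simp
 qed
 \<comment> \<open>For the least \<open>q\<close> with \<open>nm k z\<close> below
   \<open>nm q y\<close>, totality gives the opposite comparison for \<open>q - 1\<close>. So the
   infimum is matched from below up to \<open>1 / k\<close>.\<close>
 have grid: "\<exists>p. (nm p y, nm k z) \<in> T \<and> r z \<le> (real p + 1) / real k" if z: "z \<in> oideal y" and k: "k > 0" for z k
 proof -
  obtain M where "le z (nm M y)" using z unfolding oideal_def by blast
  then have ex: "(nm k z, nm (k * M) y) \<in> T" by (simp add: nm_mult le_nm Tle oideal_nm)
  define q where "q = (LEAST q. (nm k z, nm q y) \<in> T)"
  have q: "(nm k z, nm q y) \<in> T" unfolding q_def using ex by (rule LeastI)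
  then have rq: "r z \<le> real q / real k" unfolding r_def using k by (intro cInf_lower S0) (auto simp: S_def)
  show ?thesis
  proof (cases q)
   case 0
   then show ?thesis using rq z by (intro exI[of _ 0]) (auto intro!: Tle oideal_nm intro: order_trans)
  next
   case (Suc p)
   then have "(nm p y, nm k z) \<in> T" using total[OF oideal_nm[OF z] oideal_nm[OF oideal_self]] by (metis q_def not_less_Least lessI)
   then show ?thesis using rq Suc by (intro exI[of _ p]) (simp add: add.commute)
  qed
 qed
 \<comment> \<open>Lower grid bounds for both summands are added and compared with an upper fraction
   for the sum; the loss is at most \<open>2 / k\<close> and disappears in the limit.\<close>
 have super_add: "r a + r b \<le> r (a + b)" if ab: "a \<in> oideal y" "b \<in> oideal y" for a b
  unfolding r_def[of "a + b"]
 proof (rule cInf_greatest)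
  show "S (a + b) \<noteq> {}" using ab by (intro Sne) simp
  fix t assume "t \<in> S (a + b)"
  then obtain m n where t: "t = real m / real n" "n > 0" "(nm n (a + b), nm m y) \<in> T" unfolding S_def by blast
  have "r a + r b \<le> t + 2 / real (Suc j)" for j
  proof -
   define k where "k = Suc j"
   obtain p q where p: "(nm p y, nm k a) \<in> T" "r a \<le> (real p + 1) / real k" and q: "(nm q y, nm k b) \<in> T" "r b \<le> (real q + 1) / real k"
    using grid ab by (metis k_def zero_less_Suc)
   have "(nm n (nm (p + q) y), nm n (nm k (a + b))) \<in> T" using nmT[OF add[OF p(1) q(1)], of n] by (simp add: nm_add nm_distrib)
   moreover have "(nm n (nm k (a + b)), nm k (nm m y)) \<in> T"
    unfolding nm_nm_commute[of n k] by (rule nmT[OF t(3)])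
   ultimately have "(nm (n * (p + q)) y, nm (k * m) y) \<in> T" unfolding nm_mult by (rule tr)
   then have "real n * (real p + real q) \<le> real k * real m" using nondeg by (metis of_nat_add of_nat_le_iff of_nat_mult)
   also have "real k * real m = real n * (real k * t)" using t(1,2) by simp
   finally have "real p + real q \<le> real k * t" using t(2) by simp
   then have "(real p + real q) / real k \<le> t" by (simp add: k_def pos_divide_le_eq mult.commute)
   moreover have "r a + r b \<le> (real p + real q) / real k + 2 / real k" using p(2) q(2) by (simp add: add_divide_distrib)
   ultimately show ?thesis by (simp add: k_def)
  qed
  moreover have "(\<lambda>j. t + 2 / real (Suc j)) \<longlonglongrightarrow> t + 0" by (intro tendsto_intros LIMSEQ_Suc[OF lim_const_over_n])
  ultimately show "r a + r b \<le> t" using LIMSEQ_le_const by fastforce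
 qed
 \<comment> \<open>The value infinity outside the order ideal respects additivity because a sum lies
   in the ideal exactly if both summands do.\<close>
 define d where "d z = (if z \<in> oideal y then ennreal (r z) else Orderings.top_class.top)" for z
 show ?thesis
 proof (rule that[of d])
  show "d (a + b) = d a + d b" for a b using sub_add[of a b] super_add[of a b] r0 by (auto simp: d_def simp flip: ennreal_plus)
  show "d a \<le> d b" if ab: "le a b" for a b
  proof (cases "b \<in> oideal y")
   case True
   then have aI: "a \<in> oideal y" using ab oideal_down by blast
   have "S b \<subseteq> S a"
   proof
    fix t assume "t \<in> S b"
    then obtain m n where t: "t = real m / real n" "n > 0" "(nm n b, nm m y) \<in> T" unfolding S_def by blast
    have "(nm n a, nm n b) \<in> T" using True by (intro nmT Tle ab)
    from tr[OF this t(3)] show "t \<in> S a" unfolding S_def using t by blast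
   qed
   then show ?thesis using aI by (simp add: r_def Sne[OF True] S0 cInf_superset_mono d_def ennreal_leI)
  qed (simp add: d_def)
  have "1 \<in> S y" unfolding S_def using Tle[of y y] by auto
  moreover have "1 \<le> t" if "t \<in> S y" for t by (use \<open>t \<in> S y\<close> S_def nondeg in auto)
  ultimately have "r y = 1" unfolding r_def by (intro cInf_eq_minimum) auto
  then show "d y = 1" by (simp add: d_def)
  have "1 \<le> r x"
   unfolding r_def
  proof (rule cInf_greatest[OF Sne[OF xI]])
   fix t assume "t \<in> S x"
   then obtain m n where t: "t = real m / real n" "n > 0" "(nm n x, nm m y) \<in> T" unfolding S_def by blast
   show "1 \<le> t" using nondeg t using tr[OF nmT[OF T(2)] t(3)] by simp
  qed
  then show "1 \<le> d x" by (simp add: d_def)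
 qed
qed

end

end

section \<open>Operator norms\<close>

definition opn :: "'v set \<Rightarrow> ('v \<Rightarrow> real) \<Rightarrow> ('v \<Rightarrow> 'v) \<Rightarrow> real" where
 "opn V nu f = (SUP v\<in>{v \<in> V. nu v \<le> 1}. nu (f v))"

text \<open>Used twice: for the unitization acting on the algebra by left multiplication, and for
  matrices acting on columns.\<close>

locale seminormed_space =
 fixes V :: "'v set" and nu :: "'v \<Rightarrow> real" and cs :: "complex \<Rightarrow> 'v \<Rightarrow> 'v" and ops :: "('v \<Rightarrow> 'v) set"
 assumes nu_nonneg: "v \<in> V \<Longrightarrow> 0 \<le> nu v" and ex_0: "\<exists>v\<in>V. nu v = 0"
  and cs: "v \<in> V \<Longrightarrow> cs c v \<in> V" "v \<in> V \<Longrightarrow> nu (cs c v) = cmod c * nu v"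
  and ops: "f \<in> ops \<Longrightarrow> v \<in> V \<Longrightarrow> f v \<in> V" "f \<in> ops \<Longrightarrow> v \<in> V \<Longrightarrow> f (cs c v) = cs c (f v)"
  and bounded: "f \<in> ops \<Longrightarrow> \<exists>K\<ge>0. \<forall>v\<in>V. nu (f v) \<le> K * nu v"
begin

abbreviation on where "on \<equiv> opn V nu"

lemma on_upper:
 assumes "f \<in> ops" "v \<in> V" "nu v \<le> 1"
 shows "nu (f v) \<le> on f"
proof -
 obtain K where K: "K \<ge> 0" "\<forall>v\<in>V. nu (f v) \<le> K * nu v" using bounded[OF assms(1)] by blast
 then have "nu (f w) \<le> K" if "w \<in> V" "nu w \<le> 1" for w using that mult_left_le[of "nu w" K] by force
 then show ?thesis
  unfolding opn_def using assms by (intro cSUP_upper bdd_aboveI2[of _ _ K]) auto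
qed

lemma on_least: "(\<And>v. v \<in> V \<Longrightarrow> nu v \<le> 1 \<Longrightarrow> nu (f v) \<le> c) \<Longrightarrow> on f \<le> c"
 unfolding opn_def using ex_0 by (intro cSUP_least) force+

lemma on_nonneg: "f \<in> ops \<Longrightarrow> 0 \<le> on f" using ex_0 on_upper nu_nonneg ops(1) by (metis order_trans zero_le_one)

lemma on_act:
 assumes f: "f \<in> ops" and v: "v \<in> V"
 shows "nu (f v) \<le> on f * nu v"
proof (cases "nu v = 0")
 case True
 then show ?thesis using bounded[OF f] v by force
next
 case False
 then have p: "nu v > 0" using nu_nonneg[OF v] by simp
 then have "nu (f (cs (1 / nu v) v)) \<le> on f" by (intro on_upper) (use f v in \<open>auto simp: cs norm_divide\<close>)
 then show ?thesis using p v f by (simp add: cs ops norm_divide field_simps)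
qed

lemma on_comp:
 assumes "f \<in> ops" "g \<in> ops" "\<And>v. v \<in> V \<Longrightarrow> h v = f (g v)"
 shows "on h \<le> on f * on g"
proof (rule on_least)
 fix v assume "v \<in> V" "nu v \<le> 1"
 then show "nu (h v) \<le> on f * on g" using on_act[of f "g v"] mult_left_mono[OF on_upper[of g v] on_nonneg[of f]] ops(1) assms by force
qed

lemma on_add:
 assumes "f \<in> ops" "g \<in> ops" "\<And>v. v \<in> V \<Longrightarrow> nu (h v) \<le> nu (f v) + nu (g v)"
 shows "on h \<le> on f + on g" using assms by (intro on_least) (meson add_mono on_upper order_trans)

lemma on_scale:
 assumes f: "f \<in> ops" and h: "h \<in> ops" "\<And>v. v \<in> V \<Longrightarrow> h v = cs c (f v)"
 shows "on h = cmod c * on f"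
proof (rule antisym)
 show "on h \<le> cmod c * on f" using f h(2) by (intro on_least) (simp add: cs ops mult_left_mono on_upper)
 show "cmod c * on f \<le> on h"
 proof (cases "c = 0")
  case False
  have "on f \<le> on h / cmod c" using on_upper[OF h(1)] f h(2) False by (intro on_least) (simp add: cs ops field_simps)
  then show ?thesis using False by (simp add: field_simps)
 qed (simp add: on_nonneg h(1))
qed

text \<open>Here \<open>g\<close> plays the adjoint of \<open>f\<close>. The hypotheses bound the
  squared norm of each by that of a product of the two, which forces equal norms and then the
  C*-identity.\<close>

lemma on_cstar:
 assumes ops: "f \<in> ops" "g \<in> ops" "fg \<in> ops" "gf \<in> ops"
  and comp: "\<And>v. v \<in> V \<Longrightarrow> fg v = f (g v)" "\<And>v. v \<in> V \<Longrightarrow> gf v = g (f v)"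
  and le: "\<And>v. v \<in> V \<Longrightarrow> nu v \<le> 1 \<Longrightarrow> (nu (f v))\<^sup>2 \<le> on gf"
   "\<And>v. v \<in> V \<Longrightarrow> nu v \<le> 1 \<Longrightarrow> (nu (g v))\<^sup>2 \<le> on fg"
 shows "on gf = (on f)\<^sup>2"
proof -
 have *: "on h \<le> on k" "on h * on h \<le> on r"
  if hk: "h \<in> ops" "k \<in> ops" "r \<in> ops" "\<And>v. v \<in> V \<Longrightarrow> r v = k (h v)"
   and "\<And>v. v \<in> V \<Longrightarrow> nu v \<le> 1 \<Longrightarrow> (nu (h v))\<^sup>2 \<le> on r" for h k r
 proof -
  have "on h \<le> sqrt (on r)" by (rule on_least) (simp add: real_le_rsqrt that)
  then show h: "on h * on h \<le> on r" using on_nonneg[OF hk(1)] on_nonneg[OF hk(3)] mult_mono[of "on h" _ "on h"] by fastforce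
  then show "on h \<le> on k" using order_trans[OF h on_comp[OF hk(2,1,4)]] on_nonneg[OF hk(1)] on_nonneg[OF hk(2)]
   by (cases "on h = 0") (auto)
 qed
 show ?thesis
  using *(2)[OF ops(1,2,4) comp(2) le(1)] on_comp[OF ops(2,1) comp(2)] using *(1)[OF ops(1,2,4) comp(2) le(1)] *(1)[OF ops(2,1,3) comp(1) le(2)] by (simp add: power2_eq_square)
qed

end

section \<open>Record algebras\<close>

definition full_sub :: "('a, 'm) calg_scheme \<Rightarrow> 'a set \<Rightarrow> bool" where
 "full_sub A U \<longleftrightarrow> U \<subseteq> carrier A \<and>
   (\<forall>x\<in>U. \<forall>y\<in>U. x \<oplus>\<^bsub>A\<^esub> y \<in> U \<and> x \<otimes>\<^bsub>A\<^esub> y \<in> U) \<and> (\<forall>x\<in>U. star A x \<in> U \<and> (\<forall>c. c \<odot>\<^bsub>A\<^esub> x \<in> U)) \<and>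
   (\<forall>s. (\<forall>n. s n \<in> U) \<and> (\<forall>e>0. \<exists>K. \<forall>m\<ge>K. \<forall>n\<ge>(K::nat). nrm A (s m \<ominus>\<^bsub>A\<^esub> s n) < e)
    \<longrightarrow> (\<exists>y\<in>U. (\<lambda>n. nrm A (s n \<ominus>\<^bsub>A\<^esub> y)) \<longlonglongrightarrow> 0))"

text \<open>Completeness is only required locally, so that the union of all matrix algebras qualifies.\<close>

locale pcs = abelian_group A for A :: "('a, 'm) calg_scheme" (structure) +
 assumes smult_closed [simp]: "x \<in> carrier A \<Longrightarrow> c \<odot> x \<in> carrier A"
  and smult_ldist: "x \<in> carrier A \<Longrightarrow> (c + d) \<odot> x = c \<odot> x \<oplus> d \<odot> x"
  and smult_rdist: "\<lbrakk>x \<in> carrier A; y \<in> carrier A\<rbrakk> \<Longrightarrow> c \<odot> (x \<oplus> y) = c \<odot> x \<oplus> c \<odot> y"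
  and smult_smult: "x \<in> carrier A \<Longrightarrow> c \<odot> (d \<odot> x) = (c * d) \<odot> x"
  and smult_1 [simp]: "x \<in> carrier A \<Longrightarrow> 1 \<odot> x = x"
  and mult_closed [simp]: "\<lbrakk>x \<in> carrier A; y \<in> carrier A\<rbrakk> \<Longrightarrow> x \<otimes> y \<in> carrier A"
  and mult_assoc: "\<lbrakk>x \<in> carrier A; y \<in> carrier A; z \<in> carrier A\<rbrakk> \<Longrightarrow> (x \<otimes> y) \<otimes> z = x \<otimes> (y \<otimes> z)"
  and mult_add_left: "\<lbrakk>x \<in> carrier A; y \<in> carrier A; z \<in> carrier A\<rbrakk>
   \<Longrightarrow> (x \<oplus> y) \<otimes> z = x \<otimes> z \<oplus> y \<otimes> z"
  and mult_add_right: "\<lbrakk>x \<in> carrier A; y \<in> carrier A; z \<in> carrier A\<rbrakk>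
   \<Longrightarrow> x \<otimes> (y \<oplus> z) = x \<otimes> y \<oplus> x \<otimes> z"
  and smult_mult_left: "\<lbrakk>x \<in> carrier A; y \<in> carrier A\<rbrakk> \<Longrightarrow> (c \<odot> x) \<otimes> y = c \<odot> (x \<otimes> y)"
  and smult_mult_right: "\<lbrakk>x \<in> carrier A; y \<in> carrier A\<rbrakk> \<Longrightarrow> x \<otimes> (c \<odot> y) = c \<odot> (x \<otimes> y)"
  and star_closed [simp]: "x \<in> carrier A \<Longrightarrow> star A x \<in> carrier A"
  and star_star [simp]: "x \<in> carrier A \<Longrightarrow> star A (star A x) = x"
  and star_add: "\<lbrakk>x \<in> carrier A; y \<in> carrier A\<rbrakk> \<Longrightarrow> star A (x \<oplus> y) = star A x \<oplus> star A y"
  and star_smult: "x \<in> carrier A \<Longrightarrow> star A (c \<odot> x) = cnj c \<odot> star A x"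
  and star_mult: "\<lbrakk>x \<in> carrier A; y \<in> carrier A\<rbrakk> \<Longrightarrow> star A (x \<otimes> y) = star A y \<otimes> star A x"
  and nrm_nonneg: "x \<in> carrier A \<Longrightarrow> 0 \<le> nrm A x"
  and nrm_eq_0: "x \<in> carrier A \<Longrightarrow> nrm A x = 0 \<longleftrightarrow> x = \<zero>"
  and nrm_triangle: "\<lbrakk>x \<in> carrier A; y \<in> carrier A\<rbrakk> \<Longrightarrow> nrm A (x \<oplus> y) \<le> nrm A x + nrm A y"
  and nrm_smult: "x \<in> carrier A \<Longrightarrow> nrm A (c \<odot> x) = cmod c * nrm A x"
  and nrm_mult: "\<lbrakk>x \<in> carrier A; y \<in> carrier A\<rbrakk> \<Longrightarrow> nrm A (x \<otimes> y) \<le> nrm A x * nrm A y"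
  and cstar_identity: "x \<in> carrier A \<Longrightarrow> nrm A (star A x \<otimes> x) = (nrm A x)\<^sup>2"
  and locally_complete: "x \<in> carrier A \<Longrightarrow> \<exists>U. x \<in> U \<and> full_sub A U"

lemma cstar_algebra_pcs:
 assumes "cstar_algebra A"
 shows "pcs A"
proof -
 interpret cstar_algebra A by fact
 have c: "carrier (ring_of_type_algebra :: complex ring) = UNIV" by (simp add: ring_of_type_algebra_def)
 show ?thesis
 proof unfold_locales
  fix x and c d :: complex assume x: "x \<in> carrier A"
  show "c \<odot>\<^bsub>A\<^esub> x \<in> carrier A" using smult_closed[OF _ x] c by simp
  show "(c + d) \<odot>\<^bsub>A\<^esub> x = c \<odot>\<^bsub>A\<^esub> x \<oplus>\<^bsub>A\<^esub> d \<odot>\<^bsub>A\<^esub> x" using smult_l_distr[OF _ _ x, of c d] by (simp add: ring_of_type_algebra_def)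
  show "c \<odot>\<^bsub>A\<^esub> (d \<odot>\<^bsub>A\<^esub> x) = (c * d) \<odot>\<^bsub>A\<^esub> x" using smult_assoc1[OF _ _ x, of c d] by (simp add: ring_of_type_algebra_def)
  show "1 \<odot>\<^bsub>A\<^esub> x = x" using smult_one[OF x] by (simp add: ring_of_type_algebra_def)
  show "\<exists>U. x \<in> U \<and> full_sub A U"
  proof (intro exI conjI)
   show "full_sub A (carrier A)"
    unfolding full_sub_def using mult_closed star_closed c complete by auto
  qed fact
 next
  fix x y and c :: complex assume x: "x \<in> carrier A" "y \<in> carrier A"
  show "c \<odot>\<^bsub>A\<^esub> (x \<oplus>\<^bsub>A\<^esub> y) = c \<odot>\<^bsub>A\<^esub> x \<oplus>\<^bsub>A\<^esub> c \<odot>\<^bsub>A\<^esub> y" using smult_r_distr[OF _ x, of c] c by simp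
 qed (use mult_closed mult_assoc mult_add_left mult_add_right smult_mult_left smult_mult_right star_closed star_star
   star_add star_smult star_mult nrm_nonneg nrm_eq_0 nrm_triangle nrm_smult nrm_mult cstar_identity in auto)
qed

context pcs
begin

lemma smult_0 [simp]: "x \<in> carrier A \<Longrightarrow> 0 \<odot> x = \<zero>" using smult_ldist[of x 0 0] by (metis add.l_cancel_one' smult_closed add_0)

lemma smult_zero [simp]: "c \<odot> \<zero> = \<zero>" using smult_rdist[of \<zero> \<zero> c] by (metis add.l_cancel_one' smult_closed zero_closed)

lemma smult_neg: "x \<in> carrier A \<Longrightarrow> (- 1) \<odot> x = \<ominus> x" using smult_ldist[of x 1 "- 1"] minus_equality[of "(- 1) \<odot> x" x] by (simp add: a_comm)

lemma neg_0 [simp]: "\<ominus> \<zero> = \<zero>" by simp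

lemma smult_minus: "x \<in> carrier A \<Longrightarrow> (- c) \<odot> x = \<ominus> (c \<odot> x)" using smult_neg[of "c \<odot> x"] by (simp add: smult_smult)

lemma mult_0 [simp]: "x \<in> carrier A \<Longrightarrow> x \<otimes> \<zero> = \<zero>"  "x \<in> carrier A \<Longrightarrow> \<zero> \<otimes> x = \<zero>"
 by (metis smult_0 smult_mult_right mult_closed) (metis smult_0 smult_mult_left mult_closed)

lemma star_0 [simp]: "star A \<zero> = \<zero>" by (metis star_smult smult_0 star_closed zero_closed complex_cnj_zero)

lemma minus_smult: "x \<in> carrier A \<Longrightarrow> y \<in> carrier A \<Longrightarrow> x \<ominus> y = x \<oplus> (- 1) \<odot> y" by (simp add: smult_neg a_minus_def)

lemma nrm_0 [simp]: "nrm A \<zero> = 0" by (simp add: nrm_eq_0)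

definition uadd where "uadd = (\<lambda>(x, r) (y, s :: complex). (x \<oplus> y, r + s))"
definition umul where "umul = (\<lambda>(x, r) (y, s). (x \<otimes> y \<oplus> (s \<odot> x \<oplus> r \<odot> y), r * s))"
definition uneg where "uneg = (\<lambda>(x, r::complex). (\<ominus> x, - r))"
definition ust where "ust = (\<lambda>(x, r). (star A x, cnj r))"

text \<open>Evaluation in the unitization. It is made total by sending generators outside the
  carrier to zero.\<close>

primrec evr :: "'a fterm \<Rightarrow> 'a \<times> complex" where
 "evr (FGen x) = (if x \<in> carrier A then x else \<zero>, 0)"
| "evr (FSc c) = (\<zero>, c)"
| "evr (FAdd s t) = uadd (evr s) (evr t)"
| "evr (FMul s t) = umul (evr s) (evr t)"
| "evr (FNeg s) = uneg (evr s)"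
| "evr (FSt s) = ust (evr s)"

lemma evr_carrier [simp]: "fst (evr t) \<in> carrier A" by (induction t) (auto simp: uadd_def umul_def uneg_def ust_def split: prod.split)

lemma feq_evr: "feq s t \<Longrightarrow> evr s = evr t"
 by (induction rule: feq.induct) (simp_all add: uadd_def umul_def uneg_def ust_def split_beta a_ac r_neg mult_assoc mult_add_left mult_add_right smult_mult_left smult_mult_right smult_rdist smult_ldist smult_smult star_add star_mult star_smult mult.commute distrib_left)

definition ev :: "'a fa \<Rightarrow> 'a \<times> complex" where
 "ev q = evr (rep_fa q)"

abbreviation pr :: "'a fa \<Rightarrow> 'a" where "pr q \<equiv> fst (ev q)"

lemma ev_abs: "ev (abs_fa t) = evr t"
 unfolding ev_def by (rule feq_evr) (metis Quotient_fa Quotient_rep_abs feq.f_refl)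

lemma fa_abs: obtains t where "q = abs_fa t" by (metis Quotient_fa Quotient_abs_rep)

lemma ev_hom: "ev (p + q) = uadd (ev p) (ev q)" "ev (p * q) = umul (ev p) (ev q)" "ev (- p) = uneg (ev p)"
 "ev (st p) = ust (ev p)" "ev (sc c) = (\<zero>, c)"
proof -
 obtain s t where "p = abs_fa s" "q = abs_fa t" by (metis fa_abs)
 then show "ev (p + q) = uadd (ev p) (ev q)" "ev (p * q) = umul (ev p) (ev q)" "ev (- p) = uneg (ev p)"
  "ev (st p) = ust (ev p)" "ev (sc c) = (\<zero>, c)"
  by (simp_all add: ev_abs plus_fa.abs_eq times_fa.abs_eq uminus_fa.abs_eq st_fa.abs_eq sc_fa_def)
qed

lemma ev_gen [simp]: "x \<in> carrier A \<Longrightarrow> ev (gen x) = (x, 0)" by (simp add: gen_def ev_abs)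

lemma pr_carrier [simp]: "pr q \<in> carrier A"
 unfolding ev_def by (rule evr_carrier)

lemma snd_ev [simp]: "snd (ev q) = ch q"
proof -
 obtain t where q: "q = abs_fa t" by (rule fa_abs)
 have "snd (evr t) = fch t" by (induction t) (auto simp: uadd_def umul_def uneg_def ust_def split: prod.split)
 then show ?thesis by (simp add: q ev_abs ch.abs_eq)
qed

lemma pr_add [simp]: "pr (p + q) = pr p \<oplus> pr q" by (simp add: ev_hom uadd_def split_beta)

lemma pr_mult: "pr (p * q) = pr p \<otimes> pr q \<oplus> (ch q \<odot> pr p \<oplus> ch p \<odot> pr q)" by (simp add: ev_hom umul_def split_beta)

lemma pr_st [simp]: "pr (st p) = star A (pr p)" by (simp add: ev_hom ust_def split_beta)

lemma pr_neg [simp]: "pr (- p) = \<ominus> pr p" by (simp add: ev_hom uneg_def split_beta)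

lemma pr_diff [simp]: "pr (p - q) = pr p \<ominus> pr q" using pr_add[of p "- q"] by (simp add: a_minus_def)

lemma pr_sc [simp]: "pr (sc c) = \<zero>" by (simp add: ev_hom)

lemma pr_0 [simp]: "pr 0 = \<zero>" using pr_sc[of 0] by simp

lemma pr_scale [simp]: "pr (sc c * q) = c \<odot> pr q" by (simp add: pr_mult)

lemma pr_mult0 [simp]: "ch p = 0 \<Longrightarrow> ch q = 0 \<Longrightarrow> pr (p * q) = pr p \<otimes> pr q" by (simp add: pr_mult)

definition act :: "'a fa \<Rightarrow> 'a \<Rightarrow> 'a" where
 "act p a = pr p \<otimes> a \<oplus> ch p \<odot> a"

lemma act_closed [simp]: "a \<in> carrier A \<Longrightarrow> act p a \<in> carrier A" by (simp add: act_def)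

lemma act_mult: "a \<in> carrier A \<Longrightarrow> act (p * q) a = act p (act q a)"
 by (simp add: act_def pr_mult mult_add_left mult_add_right mult_assoc smult_mult_left smult_mult_right smult_rdist
   smult_smult a_ac)

lemma act_add: "a \<in> carrier A \<Longrightarrow> act (p + q) a = act p a \<oplus> act q a" by (simp add: act_def mult_add_left smult_ldist a_ac)

lemma act_scale: "a \<in> carrier A \<Longrightarrow> act (sc c * q) a = c \<odot> act q a" by (simp add: act_def smult_mult_left smult_rdist smult_smult)

lemma act_star: "a \<in> carrier A \<Longrightarrow> b \<in> carrier A \<Longrightarrow> star A (act q a) \<otimes> b = star A a \<otimes> act (st q) b"
 by (simp add: act_def star_add star_mult star_smult mult_add_left mult_add_right mult_assoc smult_mult_left
   smult_mult_right)

lemma nrm_act_le: "a \<in> carrier A \<Longrightarrow> nrm A (act q a) \<le> (nrm A (pr q) + cmod (ch q)) * nrm A a"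
 unfolding act_def by (rule order_trans[OF nrm_triangle]) (simp_all add: nrm_smult distrib_right nrm_mult)

definition S :: "'a fa \<Rightarrow> real" where
 "S q = opn (carrier A) (nrm A) (act q)"

interpretation sn: seminormed_space "carrier A" "nrm A" "(\<odot>)" "range act"
proof
 fix f assume "f \<in> range act"
 then obtain q where "f = act q" by blast
 then show "\<exists>K\<ge>0. \<forall>v\<in>carrier A. nrm A (f v) \<le> K * nrm A v"
  using nrm_act_le[of _ q] by (intro exI[of _ "nrm A (pr q) + cmod (ch q)"]) (simp add: nrm_nonneg)
qed (auto simp: nrm_nonneg nrm_smult act_def smult_mult_right smult_rdist smult_smult mult.commute intro!: bexI[of _ \<zero>])

lemma S_nonneg: "0 \<le> S q"
 unfolding S_def by (rule sn.on_nonneg) simp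

lemma S_act: "a \<in> carrier A \<Longrightarrow> nrm A (act q a) \<le> S q * nrm A a"
 unfolding S_def by (rule sn.on_act) simp

lemma S_mult: "S (p * q) \<le> S p * S q"
 unfolding S_def by (rule sn.on_comp) (simp_all add: act_mult)

lemma S_cstar: "S (st q * q) = (S q)\<^sup>2"
proof -
 have *: "(nrm A (act q a))\<^sup>2 \<le> S (st q * q)" if a: "a \<in> carrier A" "nrm A a \<le> 1" for a q
 proof -
  have "(nrm A (act q a))\<^sup>2 = nrm A (star A a \<otimes> act (st q * q) a)" using a by (simp add: cstar_identity[symmetric] act_star act_mult)
  also have "... \<le> nrm A (star A a) * (S (st q * q) * nrm A a)"
   using a by (intro order_trans[OF nrm_mult] mult_left_mono S_act nrm_nonneg) auto
  also have "nrm A (star A a) \<le> 1" using a cstar_identity[of "star A a"] nrm_mult[of a "star A a"] nrm_nonneg[of "star A a"]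
   by (cases "nrm A (star A a) = 0") (auto simp: power2_eq_square)
  then have "nrm A (star A a) * (S (st q * q) * nrm A a) \<le> 1 * (S (st q * q) * 1)"
   using a by (intro mult_mono mult_nonneg_nonneg S_nonneg nrm_nonneg) auto
  finally show ?thesis by simp
 qed
 show ?thesis
  using *[of _ q] *[of _ "st q"] unfolding S_def by (intro sn.on_cstar[where g = "act (st q)" and fg = "act (q * st q)"]) (simp_all add: act_mult)
qed

text \<open>Left multiplication by \<open>pr q\<close> is tested on the adjoint of
  \<open>pr q\<close>.\<close>

lemma nrm_le_S:
 assumes "ch q = 0"
 shows "nrm A (pr q) \<le> S q"
proof -
 have "(nrm A (star A (pr q)))\<^sup>2 \<le> S q * nrm A (star A (pr q))"
  using S_act[of "star A (pr q)" q] cstar_identity[of "star A (pr q)"] assms by (simp add: act_def)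
 moreover have "(nrm A (pr q))\<^sup>2 \<le> nrm A (star A (pr q)) * nrm A (pr q)"
  using nrm_mult[of "star A (pr q)" "pr q"] cstar_identity[of "pr q"] by simp
 ultimately show ?thesis using nrm_nonneg[of "pr q"] S_nonneg[of q]
  by (cases "nrm A (pr q) = 0"; cases "nrm A (star A (pr q)) = 0") (auto simp: power2_eq_square mult_le_0_iff)
qed

lemma S_ch_0:
 assumes "ch q = 0"
 shows "S q = nrm A (pr q)"
proof (rule antisym)
 show "S q \<le> nrm A (pr q)"
  unfolding S_def by (rule sn.on_least) (use nrm_act_le[of _ q] nrm_nonneg[of "pr q"] in \<open>auto simp: assms intro: order_trans[OF _ mult_left_le]\<close>)
qed (rule nrm_le_S[OF assms])

text \<open>If the algebra already has a unit, left multiplication does not see the difference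
  between it and the adjoined one. The maximum with the character repairs this; a maximum of two
  C*-seminorms is again one.\<close>

definition N :: "'a fa \<Rightarrow> real" where
 "N q = max (S q) (cmod (ch q))"

lemma N_ch_0: "ch q = 0 \<Longrightarrow> N q = nrm A (pr q)" by (simp add: N_def S_ch_0 nrm_nonneg)

lemma S_sc_le: "S (sc c) \<le> cmod c"
 unfolding S_def by (rule sn.on_least) (simp add: act_def nrm_smult mult_left_le)

lemma S_triangle: "S (p + q) \<le> S p + S q"
 unfolding S_def by (rule sn.on_add) (simp_all add: act_add nrm_triangle)

lemma S_scale: "S (sc c * q) = cmod c * S q"
 unfolding S_def by (rule sn.on_scale) (simp_all add: act_scale)

lemma N_triangle': "N (p + q) \<le> N p + N q"
 unfolding N_def by (rule max.boundedI) (auto intro: order_trans[OF S_triangle] order_trans[OF norm_triangle_ineq])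

lemma N_le: "N q \<le> nrm A (pr q) + cmod (ch q)"
proof -
 have "N ((q - sc (ch q)) + sc (ch q)) \<le> N (q - sc (ch q)) + N (sc (ch q))" by (rule N_triangle')
 then show ?thesis using S_sc_le[of "ch q"] by (simp add: N_ch_0 a_minus_def) (simp add: N_def)
qed

lemma nrm_pr_le: "nrm A (pr q) \<le> 2 * N q"
proof -
 have "nrm A (pr q) = N (q + sc (- ch q))" by (subst N_ch_0) simp_all
 also have "... \<le> N q + N (sc (- ch q))" by (rule N_triangle')
 also have "N (sc (- ch q)) \<le> N q"
  unfolding N_def using S_sc_le[of "- ch q"] by simp
 finally show ?thesis by simp
qed

text \<open>A Cauchy sequence is split into its scalar part and its part in the algebra, which is
  Cauchy by \<open>nrm_pr_le\<close>; the limit is lifted by \<open>gen\<close>.\<close>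

lemma N_local_complete: "\<exists>U. q \<in> U \<and> csub N U"
proof -
 obtain U0 where U0: "pr q \<in> U0" "full_sub A U0" using locally_complete[OF pr_carrier] by blast
 define U where "U = {p. pr p \<in> U0}"
 have cl: "x \<in> U0 \<Longrightarrow> y \<in> U0 \<Longrightarrow> x \<oplus> y \<in> U0" "x \<in> U0 \<Longrightarrow> y \<in> U0 \<Longrightarrow> x \<otimes> y \<in> U0" "x \<in> U0 \<Longrightarrow> star A x \<in> U0"
   "x \<in> U0 \<Longrightarrow> c \<odot> x \<in> U0" "x \<in> U0 \<Longrightarrow> x \<in> carrier A" for x y c using U0(2) unfolding full_sub_def by blast+
 have z: "\<zero> \<in> U0" using cl(4)[OF U0(1), of 0] by simp
 have lim: "\<exists>y\<in>U. (\<lambda>n. N (s n - y)) \<longlonglongrightarrow> 0"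
  if s: "range s \<subseteq> U" "\<forall>e>0. \<exists>K. \<forall>m\<ge>K. \<forall>n\<ge>(K::nat). N (s m - s n) < e" for s :: "nat \<Rightarrow> 'a fa"
 proof -
  have "Cauchy (\<lambda>n. ch (s n))" using s(2) unfolding Cauchy_def dist_norm N_def by simp meson
  then obtain r where r: "(\<lambda>n. ch (s n)) \<longlonglongrightarrow> r" using Cauchy_convergent convergentD by blast
  have "\<exists>K. \<forall>m\<ge>K. \<forall>n\<ge>K. nrm A (pr (s m) \<ominus> pr (s n)) < e" if "e > 0" for e
  proof -
   obtain K where K: "\<forall>m\<ge>K. \<forall>n\<ge>(K::nat). N (s m - s n) < e / 2" using s(2) \<open>e > 0\<close> half_gt_zero by blast
   have "nrm A (pr (s m) \<ominus> pr (s n)) < e" if "m \<ge> K" "n \<ge> K" for m n using nrm_pr_le[of "s m - s n"] K that by fastforce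
   then show ?thesis by blast
  qed
  moreover have "\<forall>n. pr (s n) \<in> U0" using s by (auto simp: U_def)
  ultimately have "\<exists>y\<in>U0. (\<lambda>n. nrm A (pr (s n) \<ominus> y)) \<longlonglongrightarrow> 0" using U0(2) unfolding full_sub_def by auto
  then obtain y where y: "y \<in> U0" "(\<lambda>n. nrm A (pr (s n) \<ominus> y)) \<longlonglongrightarrow> 0" by blast
  have "norm (N (s n - (gen y + sc r))) \<le> nrm A (pr (s n) \<ominus> y) + cmod (ch (s n) - r)" for n
   using N_le[of "s n - (gen y + sc r)"] cl(5)[OF y(1)] by (simp add: N_def le_max_iff_disj)
  moreover have "(\<lambda>n. nrm A (pr (s n) \<ominus> y) + cmod (ch (s n) - r)) \<longlonglongrightarrow> 0"
   using tendsto_add[OF y(2) tendsto_norm_zero[OF LIM_zero[OF r]]] by simp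
  ultimately have "(\<lambda>n. N (s n - (gen y + sc r))) \<longlonglongrightarrow> 0" by (rule Lim_null_comparison[OF always_eventually[OF allI]])
  then show ?thesis using y cl(5)[OF y(1)] by (intro bexI[of _ "gen y + sc r"]) (simp_all add: U_def)
 qed
 have "csub N U"
  unfolding csub_def by (use z U_def cl pr_mult lim in auto)
 moreover have "q \<in> U" using U0 by (simp add: U_def)
 ultimately show ?thesis by blast
qed

sublocale lcs N
proof
 fix p q :: "'a fa" and c
 show "N (p + q) \<le> N p + N q" by (rule N_triangle')
 have "S p * S q \<le> max (S p) (cmod (ch p)) * max (S q) (cmod (ch q))" by (intro mult_mono S_nonneg) (auto simp: le_max_iff_disj)
 moreover have "cmod (ch p) * cmod (ch q) \<le> max (S p) (cmod (ch p)) * max (S q) (cmod (ch q))"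
  by (intro mult_mono) (auto simp: le_max_iff_disj)
 ultimately show "N (p * q) \<le> N p * N q"
  unfolding N_def by (auto simp: norm_mult intro: order_trans[OF S_mult])
 show "N (sc c * q) = cmod c * N q" by (simp add: N_def S_scale norm_mult max_mult_distrib_left)
 show "N (st q * q) = (N q)\<^sup>2"
 proof -
  have "max (a\<^sup>2) (b\<^sup>2) = (max a b)\<^sup>2" if "0 \<le> a" "0 \<le> b" for a b :: real using that by (auto simp: max_def)
  then show ?thesis using S_nonneg by (simp add: N_def S_cstar norm_mult power2_eq_square)
 qed
 show "cmod (ch q) \<le> N q" by (simp add: N_def)
 show "\<exists>U. q \<in> U \<and> csub N U" by (rule N_local_complete)
qed

end

lemma rp_sum: "Polynomial.degree p \<le> n \<Longrightarrow> rp p x = (\<Sum>i\<le>n. rsc (poly.coeff p i) * x ^ i)"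
proof (induction p arbitrary: n)
 case 0
 then show ?case by simp
next
 case (pCons a p)
 show ?case
 proof (cases n)
  case 0
  then have "p = 0" using pCons.prems by (metis degree_pCons_eq not_less_eq_eq zero_le)
  then show ?thesis using 0 by simp
 next
  case (Suc m)
  then have "Polynomial.degree p \<le> m" using pCons.prems by (cases "p = 0") auto
  then have "x * rp p x = (\<Sum>i\<le>m. rsc (poly.coeff p i) * x ^ Suc i)" using pCons.IH by (simp add: sum_distrib_left sc_left_comm)
  then show ?thesis by (simp add: Suc sum.atMost_Suc_shift del: sum.atMost_Suc)
 qed
qed

section \<open>Ideals, and translation between record algebras and the free algebra\<close>

context lcs
begin

text \<open>Membership in the closed two-sided ideal of \<open>y\<close>. The coefficients may come
  from the unitization, so \<open>y\<close> belongs to it trivially.\<close>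

definition spn :: "'g fa \<Rightarrow> 'g fa \<Rightarrow> bool" where
 "spn y x \<longleftrightarrow> (\<forall>e>0. \<exists>n u w. N (x - (\<Sum>i<(n::nat). u i * y * w i)) \<le> e)"

lemma spn_self: "spn y y"
 unfolding spn_def by (intro allI impI exI[of _ "Suc 0"] exI[of _ "\<lambda>_. 1"]) simp

lemma spn_0: "spn y 0"
 unfolding spn_def by (intro allI impI exI[of _ 0]) simp

lemma spn_limit: "(\<And>e. e > 0 \<Longrightarrow> \<exists>x'. spn y x' \<and> N (x - x') \<le> e) \<Longrightarrow> spn y x"
 unfolding spn_def
proof (intro allI impI)
 fix e :: real assume e: "e > 0"
  and l: "\<And>e. e > 0 \<Longrightarrow> \<exists>x'. (\<forall>e>0. \<exists>n u w. N (x' - (\<Sum>i<(n::nat). u i * y * w i)) \<le> e) \<and> N (x - x') \<le> e"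
 have e2: "e / 2 > 0" using e by simp
 obtain x' n u w where "N (x - x') \<le> e / 2" "N (x' - (\<Sum>i<(n::nat). u i * y * w i)) \<le> e / 2" using l[OF e2] e2 by blast
 from N_trans[OF this] show "\<exists>n u w. N (x - (\<Sum>i<(n::nat). u i * y * w i)) \<le> e" by auto
qed

lemma spn_eqv: "spn y x \<Longrightarrow> x \<sim> x' \<Longrightarrow> spn y x'" by (rule spn_limit) (metis N_minus_commute eqv_def less_imp_le)

lemma spn_mult:
 assumes "spn y x"
 shows "spn y (p * x * q)"
 unfolding spn_def
proof (intro allI impI)
 fix e :: real assume e: "e > 0"
 define P where "P = N p * N q + 1"
 have P: "P > 0" "N p * N q \<le> P" by (simp_all add: P_def add_nonneg_pos)
 then obtain n u w where n: "N (x - (\<Sum>i<(n::nat). u i * y * w i)) \<le> e / P" using assms e unfolding spn_def by (meson divide_pos_pos)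
 have "p * x * q - (\<Sum>i<n. (p * u i) * y * (w i * q)) = p * (x - (\<Sum>i<n. u i * y * w i)) * q"
  by (simp add: algebra_simps sum_distrib_left sum_distrib_right)
 also have "N ... \<le> N p * (e / P) * N q" by (intro N_mult3_le n) auto
 also have "... = (N p * N q) * (e / P)" by simp
 also have "... \<le> P * (e / P)" using P e by (intro mult_right_mono) auto
 finally show "\<exists>n u w. N (p * x * q - (\<Sum>i<(n::nat). u i * y * w i)) \<le> e"
  using P by (intro exI[of _ n] exI[of _ "\<lambda>i. p * u i"] exI[of _ "\<lambda>i. w i * q"]) simp
qed

lemma spn_add:
 assumes "spn y x" "spn y z"
 shows "spn y (x + z)"
 unfolding spn_def
proof (intro allI impI)
 fix e :: real assume e: "e > 0"
 then have e2: "e / 2 > 0" by simp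
 obtain n u w where n: "N (x - (\<Sum>i<(n::nat). u i * y * w i)) \<le> e / 2" using assms(1) e2 unfolding spn_def by blast
 obtain n' u' w' where n': "N (z - (\<Sum>i<(n'::nat). u' i * y * w' i)) \<le> e / 2" using assms(2) e2 unfolding spn_def by blast
 define U where "U = (\<lambda>i. if i < n then u i else u' (i - n))"
 define V where "V = (\<lambda>i. if i < n then w i else w' (i - n))"
 have "x + z - (\<Sum>i<n + n'. U i * y * V i) = (x - (\<Sum>i<n. u i * y * w i)) + (z - (\<Sum>i<n'. u' i * y * w' i))"
  by (simp add: sum_lessThan_add U_def V_def)
 also have "N ... \<le> e / 2 + e / 2" by (intro N_add_le n n')
 finally show "\<exists>n u w. N (x + z - (\<Sum>i<(n::nat). u i * y * w i)) \<le> e" by auto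
qed

text \<open>Sandwiching \<open>v\<close> between approximate units of \<open>x\<close> and
  \<open>y\<close>, both of which factor through these elements, gives an implementing element of
  the form \<open>x * w * y\<close>. It lies in the algebra itself, and in any matrix size that
  contains \<open>x\<close> and \<open>y\<close>.\<close>

lemma cz_corner:
 assumes x: "PS x" and y: "PS y" and cz: "cz x y" and e: "e > 0"
 shows "\<exists>w. N (x * w * y * y * st (x * w * y) - x) \<le> e"
proof -
 obtain v where v: "N (v * y * st v - x) \<le> e / 4" using cz e unfolding cz_def sub_def by (meson divide_pos_pos zero_less_numeral)
 define P where "P = 1 + (N v)\<^sup>2"
 have P: "P > 0" "(N v)\<^sup>2 \<le> P" by (simp_all add: P_def add_pos_nonneg)
 \<comment> \<open>The first bound pays for the unit of \<open>x\<close>, the second for the unit of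
   \<open>y\<close>, whose error is conjugated by \<open>v\<close>.\<close>
 define d where "d = min (e / 4) (e / (8 * P))"
 have d: "d > 0" using e P by (simp add: d_def)
 define p q where "p = au d x" and "q = au d y"
 note ax = au[OF PS_pos[OF x] d, folded p_def] and ay = au[OF PS_pos[OF y] d, folded q_def]
 obtain g h where g: "p \<sim> x * g" and h: "q \<sim> y * h" using ax(9) ay(9) by blast
 have w: "p * v * q \<sim> x * (g * v * st h) * y"
  using eqv_mult[OF eqv_mult[OF g eqv_refl[of v]]] using eqv_st[OF h] ay(1) PS_st[OF y] by (simp add: mult.assoc)
 have 1: "p * v * q * y * st (p * v * q) - x = p * v * (q * y * q - y) * st v * p + p * (v * y * st v - x) * p + (p * x * p - x)"
  by (simp add: ax(1) ay(1) algebra_simps)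
 have "N (p * v * (q * y * q - y) * st v * p) \<le> 1 * N v * (d + d) * N v * 1" by (intro N_mult_le ax(2) ay(6)) simp_all
 also have "... = (2 * d) * (N v)\<^sup>2" by (simp add: power2_eq_square)
 also have "... \<le> (2 * (e / (8 * P))) * P" using P e by (intro mult_mono) (auto simp: d_def)
 also have "... = e / 4" using P by simp
 finally have 2: "N (p * v * (q * y * q - y) * st v * p) \<le> e / 4" .
 have 3: "N (p * (v * y * st v - x) * p) \<le> 1 * (e / 4) * 1" by (intro N_mult_le v ax(2))
 have 4: "N (p * x * p - x) \<le> e / 4 + e / 4" using ax(6) by (simp add: d_def split:)
 have "N (p * v * q * y * st (p * v * q) - x) \<le> e"
  unfolding 1 using N_add_le[OF N_add_le[OF 2 3] 4] by simp
 then show ?thesis using N_cong[OF eqv_mult[OF eqv_mult[OF w eqv_refl[of y]] eqv_st[OF w]] eqv_refl[of x]]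
  by (intro exI[of _ "g * v * st h"]) simp
qed

end

context pcs
begin

notation eqv (infix "\<sim>" 50)

lemma a_minus_zero: "x \<in> carrier A \<Longrightarrow> y \<in> carrier A \<Longrightarrow> x \<ominus> y = \<zero> \<longleftrightarrow> x = y" by (metis a_minus_def minus_equality r_neg a_inv_closed)

lemma eqv_iff: "x \<sim> y \<longleftrightarrow> ch x = ch y \<and> pr x = pr y" by (use eqv_ch N_ch_0[of "x - y"] eqv_def nrm_eq_0 a_minus_zero in auto)

lemma ev_surj: "y \<in> carrier A \<Longrightarrow> ev (gen y + sc s) = (y, s)" by (simp add: prod_eq_iff)

lemma umul_eq: "monoid.mult (unitization A) = umul" by (simp add: unitization_def umul_def)

lemma invert_Units: "invert x \<longleftrightarrow> ev x \<in> Units (unitization A)"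
proof
 have one: "\<one>\<^bsub>unitization A\<^esub> = ev 1" by (simp add: unitization_def prod_eq_iff) (metis pr_sc sc_1)
 have car: "carrier (unitization A) = range ev"
 proof (intro Set.set_eqI iffI)
  fix z assume "z \<in> carrier (unitization A)"
  then have "fst z \<in> carrier A" by (auto simp: unitization_def)
  then show "z \<in> range ev" using ev_surj[of "fst z" "snd z"] by (metis prod.collapse rangeI)
 qed (auto simp: unitization_def mem_Times_iff)
 have eq: "ev (x * y) = ev 1 \<longleftrightarrow> x * y \<sim> 1" for x y
  unfolding eqv_iff by (auto simp: prod_eq_iff)
 {
  assume "invert x"
  then obtain y where "x * y \<sim> 1" "y * x \<sim> 1"
   unfolding invert_def by blast
  then show "ev x \<in> Units (unitization A)"
   unfolding Units_def car one umul_eq by (auto simp: ev_hom(2)[symmetric] eq)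
 next
  assume "ev x \<in> Units (unitization A)"
  then obtain y where "umul (ev y) (ev x) = ev 1" "umul (ev x) (ev y) = ev 1"
   unfolding Units_def car one umul_eq by auto
  then show "invert x"
   unfolding invert_def by (intro exI[of _ y]) (simp add: ev_hom(2)[symmetric] eq)
 }
qed

text \<open>A lift that is self-adjoint in the free algebra itself and not only modulo the kernel of the seminorm.\<close>

definition hg :: "'a \<Rightarrow> 'a fa" where
 "hg a = sc (1 / 2) * (gen a + st (gen a))"

lemma hg [simp]: "ch (hg a) = 0" "st (hg a) = hg a" by (simp_all add: hg_def sc_comm[of "1/2"] add.commute)

lemma half_add: "x \<in> carrier A \<Longrightarrow> (1 / 2) \<odot> (x \<oplus> x) = x" by (simp add: smult_rdist smult_ldist[symmetric])

lemma pr_hg [simp]: "selfadjoint A a \<Longrightarrow> pr (hg a) = a" by (simp add: hg_def selfadjoint_def half_add)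

lemma hg_pr: "st x = x \<Longrightarrow> ch x = 0 \<Longrightarrow> hg (pr x) \<sim> x" by (metis eqv_iff hg(1) pr_carrier pr_hg pr_st selfadjoint_def)

lemma invert_neg: "invert (- x) \<longleftrightarrow> invert x" using invert_scale[of "- 1" x] by (simp add: sc_neg)

lemma spectrum_iff: "ch x = 0 \<Longrightarrow> r \<in> spectrum A (pr x) \<longleftrightarrow> \<not> invert (x - sc r)"
proof -
 assume "ch x = 0"
 then have "ev (- (x - sc r)) = (\<ominus> pr x, r)" by (simp add: prod_eq_iff a_minus_def)
 then show ?thesis using invert_Units[of "- (x - sc r)"] unfolding spectrum_def invert_neg by simp
qed

lemma spr_eq: "ch x = 0 \<Longrightarrow> spr x = {t. complex_of_real t \<in> spectrum A (pr x)}" by (simp add: spr_def spectrum_iff)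

lemma positive_elem_iff: "positive_elem A a \<longleftrightarrow> selfadjoint A a \<and> pos (hg a)"
proof (cases "selfadjoint A a")
 case True
 have real: "r \<in> \<real>" if "r \<in> spectrum A a" for r
 by (use selfadjoint_invert complex_is_Real_iff that spectrum_iff[of "hg a" r] True in force)
 have "spectrum A a \<subseteq> \<real>\<^sub>\<ge>\<^sub>0 \<longleftrightarrow> spr (hg a) \<subseteq> {0..}"
 proof
  assume "spectrum A a \<subseteq> \<real>\<^sub>\<ge>\<^sub>0"
  then show "spr (hg a) \<subseteq> {0..}" using True spr_eq[of "hg a"] by auto
 next
  assume s: "spr (hg a) \<subseteq> {0..}"
  show "spectrum A a \<subseteq> \<real>\<^sub>\<ge>\<^sub>0"
  proof
   fix r assume r: "r \<in> spectrum A a"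
   then obtain t where t: "r = complex_of_real t" using real Reals_cases by blast
   then show "r \<in> \<real>\<^sub>\<ge>\<^sub>0" using s t using r True spr_eq by auto
  qed
 qed
 then show ?thesis by (simp add: positive_elem_def pos_def)
qed (simp add: positive_elem_def)

lemma positive_PS: "positive_elem A a \<Longrightarrow> PS (hg a)" by (simp add: positive_elem_iff PS_def)

lemma positive_pr_hg [simp]: "positive_elem A a \<Longrightarrow> pr (hg a) = a" by (simp add: positive_elem_iff)

lemma PS_positive: "PS x \<Longrightarrow> positive_elem A (pr x)"
 unfolding positive_elem_iff selfadjoint_def by (metis PS_ch PS_pos PS_st hg(2) hg_pr eqv_sym pos_eqv pr_carrier pr_st)

lemma positive_carrier [simp]: "positive_elem A a \<Longrightarrow> a \<in> carrier A" by (simp add: positive_elem_def selfadjoint_def)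

lemma pr_sum: "finite I \<Longrightarrow> pr (sum f I) = (\<Oplus>i\<in>I. pr (f i))" by (induction rule: finite_induct) (auto)

lemma pow_Suc_pr: "ch x = 0 \<Longrightarrow> pow_Suc A (pr x) n = pr (x ^ Suc n)"
proof (induction n)
 case (Suc n)
 then show ?case by (metis ch_simps(2) mult_zero_left power_Suc power_Suc2 pow_Suc.simps(2) pr_mult0)
qed simp

lemma poly_at_pr:
 assumes "ch x = 0" "poly p 0 = 0"
 shows "poly_at A p (pr x) = pr (rp p x)"
proof -
 let ?f = "\<lambda>i. rsc (poly.coeff p i) * x ^ i"
 have "rp p x = sum ?f {..Polynomial.degree p}" by (rule rp_sum) simp
 also have "... = sum ?f {1..Polynomial.degree p}" using assms by (intro sum.mono_neutral_right) (auto simp: poly_0_coeff_0 not_less_eq_eq)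
 also have "pr ... = (\<Oplus>i\<in>{1..Polynomial.degree p}. pr (?f i))" by (rule pr_sum) simp
 also have "... = poly_at A p (pr x)"
  unfolding poly_at_def
 proof (intro finsum_cong')
  fix i assume "i \<in> {1..Polynomial.degree p}"
  then show "pr (?f i) = complex_of_real (poly.coeff p i) \<odot> pow_Suc A (pr x) (i - 1)" by (simp add: pow_Suc_pr[OF assms(1)])
 qed (use pow_Suc_pr[OF assms(1)] in auto)
 finally show ?thesis by simp
qed

text \<open>As the unit is always adjoined, no element of the algebra proper is invertible. This
  lets approximating polynomials be corrected to vanish at 0.\<close>

lemma zero_spr: "ch x = 0 \<Longrightarrow> 0 \<in> spr x" using eqv_ch[of "x * _" 1] by (auto simp: spr_def invert_def)

lemma fc_poly_0:
 assumes "ch x = 0" "continuous_on UNIV f" "f 0 = 0" "e > 0"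
 obtains p where "poly p 0 = 0" "\<And>t. t \<in> spr x \<Longrightarrow> \<bar>poly p t - f t\<bar> \<le> e"
proof -
 obtain p where p: "\<And>t. t \<in> spr x \<Longrightarrow> \<bar>poly p t - f t\<bar> \<le> e / 2" using fc_poly[of f "e / 2" x] assms by auto
 have "\<bar>poly (p - [:poly p 0:]) t - f t\<bar> \<le> e" if "t \<in> spr x" for t
  using p[OF that] unfolding poly_diff using p[OF zero_spr[OF assms(1)]] assms(3) by (simp add: abs_if split: if_splits)
 then show ?thesis by (intro that[of "p - [:poly p 0:]"]) auto
qed

text \<open>All admissible polynomial sequences converge to the value of \<open>fc\<close>.
  Uniqueness holds because at least one such sequence exists, obtained from approximations with
  errors \<open>1 / Suc n\<close>.\<close>

lemma fun_calc_eq: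
 assumes x: "ch x = 0" "st x = x" and f: "continuous_on UNIV f" "f 0 = 0"
 shows "fun_calc A f (pr x) = pr (fc f x)"
 unfolding fun_calc_def spr_eq[OF x(1), symmetric]
proof (rule the_equality)
 have nd: "nrm A (poly_at A p (pr x) \<ominus> pr (fc f x)) = N (rp p x - fc f x)" if "poly p 0 = 0" for p
  using that x f by (subst N_ch_0) (simp_all add: poly_at_pr ch_rp[where t = 0] ch_fc_0)
 have lim: "(\<lambda>n. nrm A (poly_at A (p n) (pr x) \<ominus> pr (fc f x))) \<longlonglongrightarrow> 0"
  if p: "\<forall>n. poly (p n) 0 = 0" "uniform_limit (spr x) (\<lambda>n. poly (p n)) f sequentially" for p
 proof (rule tendstoI)
  fix e :: real assume e: "e > 0"
  then have "\<forall>\<^sub>F n in sequentially. \<forall>t\<in>spr x. dist (poly (p n) t) (f t) < e / 2" using uniform_limitD[OF p(2), of "e / 2"] by simp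
  then show "\<forall>\<^sub>F n in sequentially. dist (nrm A (poly_at A (p n) (pr x) \<ominus> pr (fc f x))) 0 < e"
  proof eventually_elim
   case (elim n)
   then have "N (rp (p n) x - fc f x) \<le> e / 2" by (intro fc_approx f) (auto simp: dist_real_def x)
   then show ?case using e p(1) by (simp add: nd)
  qed
 qed
 then show "pr (fc f x) \<in> carrier A \<and> (\<forall>p. (\<forall>n. poly (p n) 0 = 0) \<and>
   uniform_limit (spr x) (\<lambda>n. poly (p n)) f sequentially \<longrightarrow>
   (\<lambda>n. nrm A (poly_at A (p n) (pr x) \<ominus> pr (fc f x))) \<longlonglongrightarrow> 0)" by simp
 fix y assume y: "y \<in> carrier A \<and> (\<forall>p. (\<forall>n. poly (p n) 0 = 0) \<and>
   uniform_limit (spr x) (\<lambda>n. poly (p n)) f sequentially \<longrightarrow>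
   (\<lambda>n. nrm A (poly_at A (p n) (pr x) \<ominus> y)) \<longlonglongrightarrow> 0)"
 have "\<exists>p. poly p 0 = 0 \<and> (\<forall>t\<in>spr x. \<bar>poly p t - f t\<bar> \<le> 1 / real (Suc n))" for n
  using fc_poly_0[OF x(1) f, of "1 / real (Suc n)"] by (metis of_nat_0_less_iff zero_less_Suc zero_less_divide_1_iff)
 then obtain p where p: "\<And>n. poly (p n) 0 = 0" "\<And>n t. t \<in> spr x \<Longrightarrow> \<bar>poly (p n) t - f t\<bar> \<le> 1 / real (Suc n)" by metis
 have "uniform_limit (spr x) (\<lambda>n. poly (p n)) f sequentially"
  unfolding uniform_limit_iff
 proof (intro allI impI)
  fix e :: real assume "e > 0"
  then have "\<forall>\<^sub>F n in sequentially. 1 / real (Suc n) < e"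
   using order_tendstoD(2)[OF LIMSEQ_Suc[OF lim_1_over_n[where 'a = real]], of e] by simp
  then show "\<forall>\<^sub>F n in sequentially. \<forall>t\<in>spr x. dist (poly (p n) t) (f t) < e"
  proof eventually_elim
   case (elim n)
   then show ?case using p(2)[of _ n] by (auto simp: dist_real_def intro: le_less_trans)
  qed
 qed
 then have l: "(\<lambda>n. nrm A (poly_at A (p n) (pr x) \<ominus> y)) \<longlonglongrightarrow> 0"
  "(\<lambda>n. nrm A (poly_at A (p n) (pr x) \<ominus> pr (fc f x))) \<longlonglongrightarrow> 0" using y lim p(1) by blast+
 have "N (gen y - gen (pr (fc f x))) \<le> 0"
 proof (rule LIMSEQ_le_const[OF tendsto_add_zero[OF l]], intro exI allI impI)
  fix n
  show "N (gen y - gen (pr (fc f x))) \<le> nrm A (poly_at A (p n) (pr x) \<ominus> y) + nrm A (poly_at A (p n) (pr x) \<ominus> pr (fc f x))"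
   using y p(1) x using N_triangle2[of "gen y" "gen (pr (fc f x))" "rp (p n) x"] N_minus_commute[of "gen y" "rp (p n) x"] by (simp add: N_ch_0 poly_at_pr ch_rp[where t = 0])
 qed
 then have "gen y \<sim> gen (pr (fc f x))" using N_nonneg antisym unfolding eqv_def by blast
 then show "y = pr (fc f x)" using y by (simp add: eqv_iff)
qed

lemma cutdown_eq:
 assumes "ch x = 0" "st x = x" "e \<ge> 0"
 shows "cutdown A (pr x) e = pr (cut x e)"
 unfolding cutdown_def cut_def by (rule fun_calc_eq) (use assms in \<open>auto intro: cont_cut\<close>)

lemma cuntz_leI:
 assumes ab: "a \<in> carrier A" "b \<in> carrier A" and v: "\<And>e. e > 0 \<Longrightarrow> \<exists>v\<in>carrier A. nrm A (a \<ominus> v \<otimes> b \<otimes> star A v) \<le> e"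
 shows "cuntz_le A a b"
proof -
 have "\<exists>v\<in>carrier A. nrm A (a \<ominus> v \<otimes> b \<otimes> star A v) \<le> 1 / real (Suc k)" for k by (rule v) simp
 then obtain v where v: "\<And>k. v k \<in> carrier A" "\<And>k. nrm A (a \<ominus> v k \<otimes> b \<otimes> star A (v k)) \<le> 1 / real (Suc k)" by metis
 have "(\<lambda>n. nrm A (a \<ominus> v n \<otimes> b \<otimes> star A (v n))) \<longlonglongrightarrow> 0" by (rule tendsto_sandwich[OF _ _ tendsto_const LIMSEQ_Suc[OF lim_1_over_n]])
    (use v ab in \<open>auto intro!: always_eventually nrm_nonneg\<close>)
 then show ?thesis
  unfolding cuntz_le_def using v(1) by blast
qed

lemma nrm_conj:
 assumes "ch x = 0" "ch y = 0" "ch v = 0"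
 shows "nrm A (pr x \<ominus> pr v \<otimes> pr y \<otimes> star A (pr v)) = N (v * y * st v - x)" using assms by (subst N_minus_commute, subst N_ch_0) simp_all

text \<open>Coefficients from the unitization do not enlarge the relation: \<open>cz_corner\<close>
  replaces them by elements of the algebra.\<close>

lemma cuntz_le_iff:
 assumes x: "PS x" and y: "PS y"
 shows "cuntz_le A (pr x) (pr y) \<longleftrightarrow> cz x y"
proof
 assume "cuntz_le A (pr x) (pr y)"
 then obtain v where v: "\<And>n. v n \<in> carrier A" "(\<lambda>n. nrm A (pr x \<ominus> v n \<otimes> pr y \<otimes> star A (v n))) \<longlonglongrightarrow> 0"
  unfolding cuntz_le_def by blast
 show "cz x y"
  unfolding cz_def sub_def
 proof (intro allI impI)
  fix e :: real assume "e > 0"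
  then obtain n where "nrm A (pr x \<ominus> v n \<otimes> pr y \<otimes> star A (v n)) < e"
   using eventually_happens trivial_limit_sequentially using order_tendstoD(2)[OF v(2)] by blast
  then show "\<exists>v. N (v * y * st v - x) \<le> e"
   using nrm_conj[OF PS_ch[OF x] PS_ch[OF y], of "gen (v n)"] v(1)[of n] by (intro exI[of _ "gen (v n)"]) simp
 qed
next
 assume c: "cz x y"
 show "cuntz_le A (pr x) (pr y)"
 proof (rule cuntz_leI)
  fix e :: real assume "e > 0"
  then obtain w where "N (x * w * y * y * st (x * w * y) - x) \<le> e" using cz_corner[OF x y c] by blast
  then show "\<exists>v\<in>carrier A. nrm A (pr x \<ominus> v \<otimes> pr y \<otimes> star A v) \<le> e" using nrm_conj[OF PS_ch[OF x] PS_ch[OF y], of "x * w * y"] PS_ch[OF x]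
   by (intro bexI[of _ "pr (x * w * y)"]) (simp_all del:)
 qed simp_all
qed

lemma closed_ideal_span: "closed_ideal A {x \<in> carrier A. spn y (gen x)}" (is "closed_ideal A ?I")
 unfolding closed_ideal_def
proof (intro conjI ballI allI impI)
 have gadd: "gen x + gen z \<sim> gen (x \<oplus> z)" if "x \<in> carrier A" "z \<in> carrier A" for x z using that by (simp add: eqv_iff)
 have gmul: "p * gen x * q \<sim> gen (pr (p * gen x * q))" for p x q by (simp add: eqv_iff)
 have mulI: "pr (p * gen x * q) \<in> ?I" if x: "x \<in> ?I" for p q x using spn_eqv[OF spn_mult gmul] x by simp
 have sm: "c \<odot> x \<in> ?I" if "x \<in> ?I" for c x using mulI[OF that, of "sc c" 1] that by simp
 have addI: "x \<oplus> z \<in> ?I" if "x \<in> ?I" "z \<in> ?I" for x z using spn_eqv[OF spn_add gadd] that by simp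
 have z: "\<zero> \<in> ?I" using spn_eqv[OF spn_0, of "gen \<zero>"] by (simp add: eqv_iff)
 show "submodule ?I (ring_of_type_algebra :: complex ring) A"
 proof (rule submodule.intro)
  show "subgroup ?I (add_monoid A)"
  proof (rule add.subgroupI)
   show "?I \<noteq> {}" using z by blast
   show "\<ominus> x \<in> ?I" if "x \<in> ?I" for x using sm[OF that, of "- 1"] that by (simp add: smult_neg)
  qed (use addI in auto)
  show "submodule_axioms ?I (ring_of_type_algebra :: complex ring) A" using sm by unfold_locales
 qed
 fix x z assume x: "x \<in> carrier A" and z: "z \<in> ?I"
 show "x \<otimes> z \<in> ?I" using mulI[OF z, of "gen x" 1] x z by simp
 show "z \<otimes> x \<in> ?I" using mulI[OF z, of 1 "gen x"] x z by simp
next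
 fix s and x assume x: "x \<in> carrier A" and s: "(\<forall>n::nat. s n \<in> ?I) \<and> (\<lambda>n. nrm A (s n \<ominus> x)) \<longlonglongrightarrow> 0"
 have "spn y (gen x)"
 proof (rule spn_limit)
  fix e :: real assume e: "e > 0"
  obtain n where n: "nrm A (s n \<ominus> x) < e"
   using eventually_happens trivial_limit_sequentially using order_tendstoD(2)[of "\<lambda>n. nrm A (s n \<ominus> x)" 0 sequentially e] s e by blast
  have sn: "spn y (gen (s n))" "s n \<in> carrier A" using s by auto
  have "N (gen x - gen (s n)) \<le> e" using n sn x by (subst N_minus_commute) (simp add: N_ch_0)
  then show "\<exists>x'. spn y x' \<and> N (gen x - x') \<le> e" using sn by blast
 qed
 then show "x \<in> ?I" using x by simp
qed

lemma ideal_span: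
 assumes y: "ch y = 0" and x: "ch x = 0"
  and I: "\<And>I. closed_ideal A I \<Longrightarrow> pr y \<in> I \<Longrightarrow> pr x \<in> I"
 shows "spn y x"
proof -
 have g: "x \<sim> gen (pr x)" if "ch x = 0" for x using that by (simp add: eqv_iff)
 have "pr x \<in> {x \<in> carrier A. spn y (gen x)}" by (intro I closed_ideal_span) (use spn_eqv[OF spn_self g[OF y]] in auto)
 then show ?thesis using spn_eqv[OF _ eqv_sym[OF g[OF x]]] by blast
qed

lemma simple_span:
 assumes s: "simple_calg A" and y: "PS y" "N y > 0" and x: "ch x = 0"
 shows "spn y x"
proof (rule ideal_span[OF PS_ch[OF y(1)] x])
 fix I assume "closed_ideal A I" "pr y \<in> I"
 moreover have "pr y \<noteq> \<zero>" using y PS_ch[OF y(1)] N_ch_0[of y] by auto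
 ultimately have "I = carrier A" using s unfolding simple_calg_def by blast
 then show "pr x \<in> I" by simp
qed

end

section \<open>Matrix algebras\<close>

context lcs
begin

definition ip :: "nat \<Rightarrow> (nat \<Rightarrow> 'g fa) \<Rightarrow> (nat \<Rightarrow> 'g fa) \<Rightarrow> 'g fa" where
 "ip n x y = (\<Sum>i<n. st (x i) * y i)"

definition cn :: "nat \<Rightarrow> (nat \<Rightarrow> 'g fa) \<Rightarrow> real" where
 "cn n x = sqrt (N (ip n x x))"

lemma ip_pos: "pos (ip n x x)"
 unfolding ip_def by (intro pos_sum pos_star)

lemma st_ip: "st (ip n x y) = ip n y x" by (simp add: ip_def)

lemma cn_nonneg [simp]: "0 \<le> cn n x" by (simp add: cn_def)

lemma cn_sq: "(cn n x)\<^sup>2 = N (ip n x x)" by (simp add: cn_def)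

text \<open>For \<open>K\<close> above the norm of \<open>p = ip n x x\<close>, positivity of the
  inner square of \<open>y - x * (q / K)\<close> gives \<open>st q * q \<le> K * ip n y y\<close>;
  then \<open>K\<close> decreases to the norm of \<open>p\<close>.\<close>

lemma Cauchy_Schwarz: "N (ip n x y) \<le> cn n x * cn n y"
proof -
 define p q where "p = ip n x x" and "q = ip n x y"
 have *: "(N q)\<^sup>2 \<le> K * N (ip n y y)" if K: "K > N p" for K
 proof -
  have K0: "K > 0" using K N_nonneg[of p] by linarith
  define k :: "'g fa" where "k = rsc (1 / K)"
  have k: "st k = k" "\<And>z. z * k = k * z" by (simp_all add: k_def sc_comm)
  have kk: "k * rsc K = 1" using K0 by (simp add: k_def sc_mult[symmetric] del:)
  have kl: "z * (k * w) = k * (z * w)" for z w by (simp add: k_def sc_left_comm)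
  define z where "z = (\<lambda>i. y i - x i * (k * q))"
  have "ip n z z = ip n y y - ip n y x * (k * q) - st (k * q) * ip n x y + st (k * q) * ip n x x * (k * q)"
   by (simp add: z_def ip_def sum_subtractf sum_distrib_left sum_distrib_right right_diff_distrib left_diff_distrib mult.assoc)
  also have "... = ip n y y - k * (st q * q) - k * (st q * q) + k * (st q * p * q) * k"
   using k(1) by (simp add: p_def q_def st_ip k(2)[of "ip n x y"] kl[of "ip n y x"] mult.assoc)
  finally have 1: "pos (ip n y y - k * (st q * q) - k * (st q * q) + k * (st q * p * q) * k)" using ip_pos[of n z] by simp
  have "pos (rsc K - p)" using K by (intro pos_upper) (auto simp: p_def st_ip)
  then have "pos ((k * st q) * (rsc K - p) * st (k * st q))" by (rule pos_conj)
  also have "(k * st q) * (rsc K - p) * st (k * st q) = (k * rsc K) * (k * (st q * q)) - k * (st q * p * q) * k"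
  by (simp add: k mult.assoc sc_left_comm right_diff_distrib left_diff_distrib kl[of "st q"] kl[of p])
  finally have 2: "pos (k * (st q * q) - k * (st q * p * q) * k)" by (simp add: kk)
  have "pos (ip n y y - k * (st q * q))" using pos_add[OF 1 2] by simp
  moreover have "pos (k * (st q * q))"
   unfolding k_def using K0 by (intro pos_scale pos_star) auto
  ultimately have "N (k * (st q * q)) \<le> N (ip n y y)" by (intro pos_mono)
  then show ?thesis using K0 by (simp add: k_def N_cstar norm_divide field_simps)
 qed
 have "(N q)\<^sup>2 \<le> N p * N (ip n y y) + e" if e: "e > 0" for e
 proof -
  define d where "d = e / (N (ip n y y) + 1)"
  have nn: "N (ip n y y) + 1 > 0" by (simp add: add_nonneg_pos)
  have "(N q)\<^sup>2 \<le> (N p + d) * N (ip n y y)" using e nn by (intro *) (simp add: d_def)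
  also have "d * N (ip n y y) \<le> e" using e nn by (simp add: d_def field_simps)
  then have "(N p + d) * N (ip n y y) \<le> N p * N (ip n y y) + e" by (simp add: distrib_right)
  finally show ?thesis .
 qed
 then have "(N q)\<^sup>2 \<le> (cn n x * cn n y)\<^sup>2"
  unfolding power_mult_distrib cn_sq p_def[symmetric] by (rule field_le_epsilon)
 then show ?thesis
  unfolding q_def by (rule power2_le_imp_le) simp
qed

lemma cn_triangle: "cn n (\<lambda>i. x i + y i) \<le> cn n x + cn n y"
proof (rule power2_le_imp_le)
 have "ip n (\<lambda>i. x i + y i) (\<lambda>i. x i + y i) = (ip n x x + ip n x y) + (ip n y x + ip n y y)"
  by (simp add: ip_def sum.distrib distrib_left distrib_right)
 moreover have "N ((ip n x x + ip n x y) + (ip n y x + ip n y y))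
   \<le> ((cn n x)\<^sup>2 + cn n x * cn n y) + (cn n y * cn n x + (cn n y)\<^sup>2)"
  unfolding cn_sq by (intro N_add_le Cauchy_Schwarz) auto
 moreover have "... = (cn n x + cn n y)\<^sup>2" by (simp add: power2_sum)
 ultimately show "(cn n (\<lambda>i. x i + y i))\<^sup>2 \<le> (cn n x + cn n y)\<^sup>2" by (simp only: cn_sq)
qed simp

lemma cn_cong: "(\<And>i. i < n \<Longrightarrow> x i \<sim> y i) \<Longrightarrow> cn n x = cn n y"
 unfolding cn_def ip_def by (intro arg_cong[of _ _ sqrt] eqv_N eqv_sum eqv_mult eqv_st) auto

lemma cn_scale: "cn n (\<lambda>i. sc c * x i) = cmod c * cn n x"
proof -
 have "st (sc c * z) * (sc c * z) = sc (cnj c * c) * (st z * z)" for z :: "'g fa"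
  by (simp only: st_mult st_sc sc_comm[of "cnj c" "st z", symmetric] mult.assoc sc_left_comm[of "st z" c z] sc_mult)
 then have "ip n (\<lambda>i. sc c * x i) (\<lambda>i. sc c * x i) = sc (cnj c * c) * ip n x x"
  unfolding ip_def sum_distrib_left by (intro sum.cong) auto
 then show ?thesis
  unfolding cn_def by (simp add: norm_mult real_sqrt_mult)
qed

lemma cn_mono:
 assumes "n \<le> m"
 shows "cn n x \<le> cn m x" by (simp add: ip_def assms lessThan_atLeast0 sum_diff_nat_ivl pos_sum pos_star cn_def pos_mono)

lemma cn_single: "j < n \<Longrightarrow> cn n (\<lambda>i. if i = j then u else 0) = N u"
proof -
 assume "j < n"
 then have "ip n (\<lambda>i. if i = j then u else 0) (\<lambda>i. if i = j then u else 0) = st u * u"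
  by (simp add: ip_def if_distrib[of "(*) _"] cong: if_cong)
 then show ?thesis by (simp add: cn_def N_cstar)
qed

lemma cn_entry:
 assumes "i < n"
 shows "N (x i) \<le> cn n x"
proof -
 have "ip n x x = st (x i) * x i + (\<Sum>k\<in>{..<n} - {i}. st (x k) * x k)"
  unfolding ip_def using assms by (intro sum.remove) auto
 then have "N (st (x i) * x i) \<le> N (ip n x x)" by (simp add: pos_sum pos_star pos_mono)
 then show ?thesis
  unfolding cn_def by (simp add: N_cstar real_le_rsqrt)
qed

lemma cn_le_sum: "cn n x \<le> (\<Sum>i<n. N (x i))"
proof -
 have *: "m \<le> n \<Longrightarrow> cn n (\<lambda>i. if i < m then x i else 0) \<le> (\<Sum>i<m. N (x i))" for m
 proof (induction m)
  case 0
  then show ?case by (simp add: cn_def ip_def)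
 next
  case (Suc m)
  have "(\<lambda>i. if i < Suc m then x i else 0) = (\<lambda>i. (if i < m then x i else 0) + (if i = m then x m else 0))" by auto
  then have "cn n (\<lambda>i. if i < Suc m then x i else 0) \<le> cn n (\<lambda>i. if i < m then x i else 0) + cn n (\<lambda>i. if i = m then x m else 0)"
   by (simp add: cn_triangle del:)
  also have "cn n (\<lambda>i. if i = m then x m else 0) = N (x m)" using Suc by (intro cn_single) auto
  finally show ?case using Suc by simp
 qed
 have "cn n x = cn n (\<lambda>i. if i < n then x i else 0)" by (intro cn_cong) auto
 then show ?thesis using *[of n] by simp
qed

definition mv :: "nat \<Rightarrow> (nat \<Rightarrow> nat \<Rightarrow> 'g fa) \<Rightarrow> (nat \<Rightarrow> 'g fa) \<Rightarrow> nat \<Rightarrow> 'g fa" where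
 "mv n a x i = (\<Sum>k<n. a i k * x k)"

definition mm :: "nat \<Rightarrow> (nat \<Rightarrow> nat \<Rightarrow> 'g fa) \<Rightarrow> (nat \<Rightarrow> nat \<Rightarrow> 'g fa) \<Rightarrow> nat \<Rightarrow> nat \<Rightarrow> 'g fa" where
 "mm n a b i j = (\<Sum>k<n. a i k * b k j)"

definition mst :: "(nat \<Rightarrow> nat \<Rightarrow> 'g fa) \<Rightarrow> nat \<Rightarrow> nat \<Rightarrow> 'g fa" where
 "mst a i j = st (a j i)"

lemma mv_mm: "mv n (mm n a b) x = mv n a (mv n b x)"
proof
 fix i show "mv n (mm n a b) x i = mv n a (mv n b x) i"
  unfolding mv_def mm_def by (simp add: sum_distrib_left sum_distrib_right mult.assoc) (rule sum.swap)
qed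

lemma ip_mv: "ip n (mv n a x) y = ip n x (mv n (mst a) y)"
 unfolding ip_def mv_def mst_def by (simp add: sum_distrib_left sum_distrib_right mult.assoc) (rule sum.swap)

lemma mv_bound: "cn n (mv n a x) \<le> (\<Sum>i<n. \<Sum>k<n. N (a i k)) * cn n x"
proof -
 have "cn n (mv n a x) \<le> (\<Sum>i<n. N (mv n a x i))" by (rule cn_le_sum)
 also have "... \<le> (\<Sum>i<n. \<Sum>k<n. N (a i k) * cn n x)"
  unfolding mv_def by (intro sum_mono order_trans[OF N_sum] N_mult_le cn_entry order_refl) auto
 finally show ?thesis by (simp add: sum_distrib_right)
qed

text \<open>The columns are restricted to the kernel of \<open>ch\<close>, so that this is the norm
  of \<open>matrix_calg\<close>, whose columns have entries in the algebra.\<close>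

definition on :: "nat \<Rightarrow> (nat \<Rightarrow> nat \<Rightarrow> 'g fa) \<Rightarrow> real" where
 "on n a = opn {x. \<forall>i. ch (x i) = 0} (cn n) (mv n a)"

lemma ch_mv: "(\<And>i. ch (x i) = 0) \<Longrightarrow> ch (mv n a x i) = 0"
proof -
 assume "\<And>i. ch (x i) = 0"
 then have "ch (\<Sum>k\<in>K. a i k * x k) = 0" for K by (induction K rule: infinite_finite_induct) auto
 then show ?thesis by (simp add: mv_def)
qed

interpretation sn: seminormed_space "{x. \<forall>i. ch (x i) = 0}" "cn n" "\<lambda>c x i. sc c * x i" "range (mv n)" for n
proof
 fix f assume "f \<in> range (mv n)"
 then obtain a where "f = mv n a" by blast
 then show "\<exists>K\<ge>0. \<forall>v\<in>{x. \<forall>i. ch (x i) = 0}. cn n (f v) \<le> K * cn n v"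
  by (intro exI[of _ "\<Sum>i<n. \<Sum>k<n. N (a i k)"]) (simp add: mv_bound sum_nonneg)
qed (auto simp: cn_scale ch_mv[unfolded mv_def] mv_def fun_eq_iff sum_distrib_left sc_left_comm intro!: exI[of _ "\<lambda>_. 0"] simp: cn_def ip_def)

lemma on_least: "(\<And>x. (\<And>i. ch (x i) = 0) \<Longrightarrow> cn n x \<le> 1 \<Longrightarrow> cn n (mv n a x) \<le> c) \<Longrightarrow> on n a \<le> c"
 unfolding on_def by (rule sn.on_least) simp

lemma on_nonneg [simp]: "0 \<le> on n a"
 unfolding on_def by (rule sn.on_nonneg) simp

lemma on_act: "(\<And>i. ch (x i) = 0) \<Longrightarrow> cn n (mv n a x) \<le> on n a * cn n x"
 unfolding on_def by (rule sn.on_act) simp_all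

lemma on_add: "on n (\<lambda>i j. a i j + b i j) \<le> on n a + on n b"
 unfolding on_def
proof (rule sn.on_add)
 fix x
 have "mv n (\<lambda>i j. a i j + b i j) x = (\<lambda>i. mv n a x i + mv n b x i)" by (simp add: mv_def fun_eq_iff distrib_right sum.distrib)
 then show "cn n (mv n (\<lambda>i j. a i j + b i j) x) \<le> cn n (mv n a x) + cn n (mv n b x)" by (simp add: cn_triangle)
qed simp_all

lemma on_mm: "on n (mm n a b) \<le> on n a * on n b"
 unfolding on_def by (rule sn.on_comp) (simp_all add: mv_mm)

lemma on_scale: "on n (\<lambda>i j. sc c * a i j) = cmod c * on n a"
 unfolding on_def by (rule sn.on_scale[OF rangeI rangeI]) (simp add: mv_def sum_distrib_left mult.assoc)

lemma on_cstar: "on n (mm n (mst a) a) = (on n a)\<^sup>2"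
proof -
 have *: "(cn n (mv n a x))\<^sup>2 \<le> on n (mm n (mst a) a)" if x: "\<And>i. ch (x i) = 0" "cn n x \<le> 1" for x a
 proof -
  have "(cn n (mv n a x))\<^sup>2 = N (ip n x (mv n (mm n (mst a) a) x))" by (simp add: cn_sq ip_mv mv_mm)
  also have "... \<le> cn n x * cn n (mv n (mm n (mst a) a) x)" by (rule Cauchy_Schwarz)
  also have "... \<le> cn n x * (on n (mm n (mst a) a) * cn n x)" by (intro mult_left_mono on_act x) auto
  also have "... \<le> 1 * (on n (mm n (mst a) a) * 1)" using x by (intro mult_mono) auto
  finally show ?thesis by simp
 qed
 have m: "mst (mst a) = a" by (simp add: mst_def fun_eq_iff)
 show ?thesis
  unfolding on_def by (rule sn.on_cstar[where g = "mv n (mst a)" and fg = "mv n (mm n a (mst a))"])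
    (use *[of _ a] *[of _ "mst a"] m in \<open>auto simp: mv_mm on_def\<close>)
qed

text \<open>Tested on the column whose only entry is the adjoint of the matrix entry in
  question.\<close>

lemma on_entry:
 assumes ij: "i < n" "j < n" and c: "ch (a i j) = 0"
 shows "N (a i j) \<le> on n a"
proof -
 define x where "x = (\<lambda>k. if k = j then st (a i j) else 0)"
 have "mv n a x i = a i j * st (a i j)" using ij by (simp add: mv_def x_def if_distrib[of "(*) _"] cong: if_cong)
 then have "(N (a i j))\<^sup>2 \<le> cn n (mv n a x)" using cn_entry[OF ij(1), of "mv n a x"] by (simp add: N_cstar')
 also have "... \<le> on n a * cn n x" using c by (intro on_act) (simp add: x_def)
 also have "cn n x = N (a i j)" using ij by (simp add: x_def cn_single)
 finally show ?thesis using on_nonneg[of n a] by (cases "N (a i j) = 0") (auto simp: power2_eq_square mult_le_cancel_right)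
qed

lemma on_upper: "(\<And>i. ch (x i) = 0) \<Longrightarrow> cn n x \<le> 1 \<Longrightarrow> cn n (mv n a x) \<le> on n a"
 using on_act[of x n a] mult_left_le[of "cn n x" "on n a"] by simp

lemma on_le_sum: "on n a \<le> (\<Sum>i<n. \<Sum>k<n. N (a i k))" by (rule on_least) (auto intro!: order_trans[OF mv_bound] mult_left_le sum_nonneg)

text \<open>The corner embedding is isometric: outside the corner the product is null and the
  columns can be truncated. The norm on the union of all sizes depends on this.\<close>

lemma on_extend:
 assumes nm: "n \<le> m" and a: "\<And>i j. i \<ge> n \<or> j \<ge> n \<Longrightarrow> a i j \<sim> 0"
 shows "on m a = on n a"
proof (rule antisym)
 have mv: "cn m (mv m a x) = cn n (mv n a x)" for x
 proof -
  have e: "mv m a x i \<sim> mv n a x i" for i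
  proof -
   have "mv m a x i = mv n a x i + (\<Sum>k\<in>{n..<m}. a i k * x k)"
    unfolding mv_def using sum.atLeastLessThan_concat[of 0 n m "\<lambda>k. a i k * x k"] nm by (simp add: lessThan_atLeast0)
   moreover have "mv n a x i + (\<Sum>k\<in>{n..<m}. a i k * x k) \<sim> mv n a x i + (\<Sum>k\<in>{n..<m}. 0)"
    by (intro eqv_add eqv_sum eqv_0_multl a eqv_refl) auto
   ultimately show ?thesis by simp
  qed
  have z: "mv n a x i \<sim> 0" if "i \<ge> n" for i
  proof -
   have "mv n a x i \<sim> (\<Sum>k<n. 0)"
    unfolding mv_def by (intro eqv_sum eqv_0_multl a) (use that in auto)
   then show ?thesis by simp
  qed
  have "ip m (mv n a x) (mv n a x) = ip n (mv n a x) (mv n a x) + (\<Sum>k\<in>{n..<m}. st (mv n a x k) * mv n a x k)"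
   unfolding ip_def using sum.atLeastLessThan_concat[of 0 n m "\<lambda>k. st (mv n a x k) * mv n a x k"] nm by (simp add: lessThan_atLeast0)
  moreover have "ip n (mv n a x) (mv n a x) + (\<Sum>k\<in>{n..<m}. st (mv n a x k) * mv n a x k) \<sim> ip n (mv n a x) (mv n a x) + (\<Sum>k\<in>{n..<m}. 0)"
   by (intro eqv_add eqv_sum eqv_0_multr z eqv_refl) auto
  ultimately have "N (ip m (mv n a x) (mv n a x)) = N (ip n (mv n a x) (mv n a x))" using eqv_N by simp
  then show ?thesis using cn_cong[of m, OF e] by (simp add: cn_def)
 qed
 show "on m a \<le> on n a"
 proof (rule on_least)
  fix x assume x: "\<And>i. ch (x i) = 0" "cn m x \<le> 1"
  then have "cn n x \<le> 1" using cn_mono[OF nm, of x] by linarith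
  then show "cn m (mv m a x) \<le> on n a"
   unfolding mv by (intro on_upper x)
 qed
 show "on n a \<le> on m a"
 proof (rule on_least)
  fix x assume x: "\<And>i. ch (x i) = 0" "cn n x \<le> 1"
  define y where "y = (\<lambda>i. if i < n then x i else 0)"
  have "ip m y y = ip n y y"
   unfolding ip_def y_def using nm by (intro sum.mono_neutral_cong_right) auto
  moreover have "cn n y = cn n x" by (intro cn_cong) (simp add: y_def)
  ultimately have "cn m y \<le> 1" using x by (simp add: cn_def)
  then have "cn m (mv m a y) \<le> on m a" using x by (intro on_upper) (simp_all add: y_def)
  also have "mv n a y = mv n a x" by (simp add: mv_def y_def fun_eq_iff)
  then have "cn m (mv m a y) = cn n (mv n a x)" by (simp add: mv)
  finally show "cn n (mv n a x) \<le> on m a" .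
 qed
qed

end

lemma full_subD:
 assumes "full_sub A U" "\<And>n. s n \<in> U"
  "\<And>e. e > 0 \<Longrightarrow> \<exists>K. \<forall>m\<ge>K. \<forall>n\<ge>(K::nat). nrm A (s m \<ominus>\<^bsub>A\<^esub> s n) < e"
 shows "\<exists>y\<in>U. (\<lambda>n. nrm A (s n \<ominus>\<^bsub>A\<^esub> y)) \<longlonglongrightarrow> 0" using assms unfolding full_sub_def by simp

text \<open>Fully complete algebras. Matrix algebras inherit this property, while their union is
  only locally complete.\<close>

locale bcs = pcs +
 assumes full: "full_sub A (carrier A)"

lemma cstar_algebra_bcs:
 assumes "cstar_algebra A"
 shows "bcs A"
proof -
 interpret pcs A by (rule cstar_algebra_pcs) fact
 show ?thesis using cstar_algebra.complete[OF assms] by unfold_locales (auto simp: full_sub_def)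
qed

lemma complex_calg_bcs: "bcs complex_calg"
proof -
 let ?C = "complex_calg"
 have ab: "abelian_group ?C" by (rule abelian_groupI) (auto simp: complex_calg_def intro: exI[of _ "- _"])
 interpret C: abelian_group ?C by (rule ab)
 have "\<ominus>\<^bsub>?C\<^esub> y = - y" for y by (rule C.minus_equality) (simp_all add: complex_calg_def)
 then have minus: "x \<ominus>\<^bsub>?C\<^esub> y = x - y" for x y by (simp add: a_minus_def) (simp add: complex_calg_def)
 have full: "full_sub ?C (carrier ?C)"
  unfolding full_sub_def
 proof (intro conjI allI impI)
  fix s assume s: "(\<forall>n. s n \<in> carrier ?C) \<and> (\<forall>e>0. \<exists>K. \<forall>m\<ge>K. \<forall>n\<ge>(K::nat). nrm ?C (s m \<ominus>\<^bsub>?C\<^esub> s n) < e)"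
  then have "Cauchy s"
   unfolding Cauchy_def dist_norm minus by (simp add: complex_calg_def)
  then obtain x where "s \<longlonglongrightarrow> x" using Cauchy_convergent convergentD by blast
  then show "\<exists>y\<in>carrier ?C. (\<lambda>n. nrm ?C (s n \<ominus>\<^bsub>?C\<^esub> y)) \<longlonglongrightarrow> 0"
   unfolding minus by (auto simp: complex_calg_def intro!: tendsto_norm_zero LIM_zero)
 qed (auto simp: complex_calg_def)
 then have "pcs ?C" by (intro pcs.intro ab, unfold_locales)
    (auto simp: complex_calg_def algebra_simps norm_mult norm_triangle_ineq power2_eq_square)
 then show ?thesis by (intro bcs.intro bcs_axioms.intro full)
qed

section \<open>Matrices over the record algebra, computed through lifts\<close>

context pcs
begin

abbreviation "Mn n \<equiv> matrix_calg n A"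

definition pm :: "(nat \<Rightarrow> nat \<Rightarrow> 'a fa) \<Rightarrow> nat \<Rightarrow> nat \<Rightarrow> 'a" where
 "pm x = (\<lambda>i j. pr (x i j))"

text \<open>Entrywise lifts of elements of the matrix algebra; the entries outside the corner are
  literally zero and not just null.\<close>

definition Xn :: "nat \<Rightarrow> (nat \<Rightarrow> nat \<Rightarrow> 'a fa) set" where
 "Xn n = {x. \<forall>i j. ch (x i j) = 0 \<and> (i \<ge> n \<or> j \<ge> n \<longrightarrow> x i j = 0)}"

lemma Xn: "x \<in> Xn n \<Longrightarrow> ch (x i j) = 0" "x \<in> Xn n \<Longrightarrow> i \<ge> n \<or> j \<ge> n \<Longrightarrow> x i j = 0" by (auto simp: Xn_def)

lemma carrier_Mn: "carrier (Mn n) = pm ` Xn n"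
proof (intro Set.set_eqI iffI)
 fix a assume a: "a \<in> carrier (Mn n)"
 define x where "x = (\<lambda>i j. if i < n \<and> j < n then gen (a i j) else 0)"
 have "x \<in> Xn n" by (auto simp: x_def Xn_def)
 moreover have "a = pm x" using a by (auto simp: matrix_calg_def pm_def x_def fun_eq_iff)
 ultimately show "a \<in> pm ` Xn n" by blast
qed (auto simp: matrix_calg_def pm_def Xn)

lemma ch_sum_0: "(\<And>i. i \<in> I \<Longrightarrow> ch (f i) = 0) \<Longrightarrow> ch (sum f I) = 0" by (induction I rule: infinite_finite_induct) auto

lemma Mn_mult: "(\<And>i j. ch (x i j) = 0) \<Longrightarrow> (\<And>i j. ch (y i j) = 0) \<Longrightarrow> pm x \<otimes>\<^bsub>Mn n\<^esub> pm y = pm (mm n x y)"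
 by (simp add: matrix_calg_def pm_def mm_def pr_sum)

lemma Mn_add: "pm x \<oplus>\<^bsub>Mn n\<^esub> pm y = pm (\<lambda>i j. x i j + y i j)" by (simp add: matrix_calg_def pm_def)

lemma Mn_smult: "c \<odot>\<^bsub>Mn n\<^esub> pm x = pm (\<lambda>i j. sc c * x i j)" by (simp add: matrix_calg_def pm_def)

lemma Mn_star: "star (Mn n) (pm x) = pm (mst x)" by (simp add: matrix_calg_def pm_def mst_def)

lemma Mn_zero: "\<zero>\<^bsub>Mn n\<^esub> = pm (\<lambda>i j. 0)" by (simp add: matrix_calg_def pm_def)

lemma col_nrm_pr: "(\<And>i. ch (y i) = 0) \<Longrightarrow> col_nrm n A (\<lambda>i. pr (y i)) = cn n y"
proof -
 assume y: "\<And>i. ch (y i) = 0"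
 then have "nrm A (pr (ip n y y)) = N (ip n y y)"
  unfolding ip_def by (intro N_ch_0[symmetric] ch_sum_0) simp
 then show ?thesis using y by (simp add: col_nrm_def cn_def ip_def pr_sum)
qed

lemma Mn_nrm:
 assumes "\<And>i j. ch (x i j) = 0"
 shows "nrm (Mn n) (pm x) = on n x"
proof -
 have 1: "{\<xi>. (\<forall>i. \<xi> i \<in> carrier A) \<and> col_nrm n A \<xi> \<le> 1} = (\<lambda>y i. pr (y i)) ` {y. (\<forall>i. ch (y i) = 0) \<and> cn n y \<le> 1}"
  (is "?L = ?R")
 proof (intro Set.set_eqI iffI)
  fix \<xi> assume x: "\<xi> \<in> ?L"
  then show "\<xi> \<in> ?R" using col_nrm_pr[of "\<lambda>i. gen (\<xi> i)" n] by (intro image_eqI[of _ _ "\<lambda>i. gen (\<xi> i)"]) auto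
 qed (auto simp: col_nrm_pr)
 have 2: "col_nrm n A (\<lambda>i. \<Oplus>k\<in>{..<n}. pm x i k \<otimes> pr (y k)) = cn n (mv n x y)" if y: "\<forall>i. ch (y i) = 0" for y
 proof -
  have "(\<Oplus>k\<in>{..<n}. pm x i k \<otimes> pr (y k)) = pr (mv n x y i)" for i using assms y by (simp add: mv_def pm_def pr_sum)
  then show ?thesis using y by (simp add: col_nrm_pr ch_mv)
 qed
 show ?thesis
  unfolding on_def opn_def by (simp add: matrix_calg_def 1 image_image) (intro SUP_cong refl, auto simp: 2)
qed

lemma Xn_mm: "x \<in> Xn n \<Longrightarrow> y \<in> Xn n \<Longrightarrow> mm m x y \<in> Xn n"
 and Xn_add: "x \<in> Xn n \<Longrightarrow> y \<in> Xn n \<Longrightarrow> (\<lambda>i j. x i j + y i j) \<in> Xn n"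
 and Xn_smult: "x \<in> Xn n \<Longrightarrow> (\<lambda>i j. sc c * x i j) \<in> Xn n"
 and Xn_mst: "x \<in> Xn n \<Longrightarrow> mst x \<in> Xn n"
 and Xn_zero: "(\<lambda>i j. 0) \<in> Xn n" by (auto simp: Xn_def mm_def mst_def intro!: ch_sum_0)

lemma Xn_mono: "x \<in> Xn n \<Longrightarrow> n \<le> m \<Longrightarrow> x \<in> Xn m" by (auto simp: Xn_def)

lemma carrier_Mn_mono: "n \<le> m \<Longrightarrow> carrier (Mn n) \<subseteq> carrier (Mn m)"
 unfolding carrier_Mn using Xn_mono by blast

lemma mm_assoc: "mm n (mm n x y) z = mm n x (mm n y z)"
 unfolding mm_def fun_eq_iff by (intro allI, simp add: sum_distrib_left sum_distrib_right mult.assoc, rule sum.swap)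

lemma Mn_abelian_group: "abelian_group (Mn n)"
proof (rule abelian_groupI)
 fix a assume "a \<in> carrier (Mn n)"
 then obtain x where x: "x \<in> Xn n" "a = pm x"
  unfolding carrier_Mn by blast
 have "pm (\<lambda>i j. sc (- 1) * x i j) \<oplus>\<^bsub>Mn n\<^esub> a = \<zero>\<^bsub>Mn n\<^esub>" by (simp only: x Mn_add Mn_zero) (simp add: sc_neg)
 then show "\<exists>b\<in>carrier (Mn n). b \<oplus>\<^bsub>Mn n\<^esub> a = \<zero>\<^bsub>Mn n\<^esub>"
  unfolding carrier_Mn using Xn_smult[OF x(1)] by blast
qed (auto simp: carrier_Mn Mn_add Mn_zero Xn_add Xn_zero add.assoc add.commute add.left_commute)

lemma Mn_minus:
 assumes "x \<in> Xn n" "y \<in> Xn n"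
 shows "pm x \<ominus>\<^bsub>Mn n\<^esub> pm y = pm (\<lambda>i j. x i j - y i j)"
proof -
 interpret M: abelian_group "Mn n" by (rule Mn_abelian_group)
 have "\<ominus>\<^bsub>Mn n\<^esub> pm y = pm (\<lambda>i j. sc (- 1) * y i j)" using assms Xn_smult[OF assms(2), of "- 1"]
  by (intro M.minus_equality) (simp_all add: Mn_add Mn_zero carrier_Mn sc_neg)
 then show ?thesis by (simp add: a_minus_def Mn_add sc_neg)
qed

end

context bcs
begin

text \<open>Each entry is bounded by the norm, so entries of a Cauchy sequence converge; the norm is
  bounded by the sum of the entry norms, so entrywise limits are limits in norm.\<close>

lemma Mn_full: "full_sub (Mn n) (carrier (Mn n))"
 unfolding full_sub_def
proof (intro conjI ballI allI impI)
 fix s assume s: "(\<forall>k. s k \<in> carrier (Mn n)) \<and> (\<forall>e>0. \<exists>K. \<forall>k\<ge>K. \<forall>l\<ge>(K::nat). nrm (Mn n) (s k \<ominus>\<^bsub>Mn n\<^esub> s l) < e)"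
 then have "\<forall>k. \<exists>x. x \<in> Xn n \<and> s k = pm x"
  unfolding carrier_Mn by blast
 then obtain x where x: "\<And>k. x k \<in> Xn n" "\<And>k. s k = pm (x k)" by metis
 have nd: "nrm (Mn n) (s k \<ominus>\<^bsub>Mn n\<^esub> pm y) = on n (\<lambda>i j. x k i j - y i j)" if "y \<in> Xn n" for k y
  using that x(1) by (simp add: x(2) Mn_minus Mn_nrm Xn(1)[OF that] Xn(1)[OF x(1)])
 have "\<exists>y. ch y = 0 \<and> (\<lambda>k. N (x k i j - y)) \<longlonglongrightarrow> 0" if ij: "i < n" "j < n" for i j
 proof -
  have nn: "nrm A (pr (x k i j) \<ominus> pr y) = N (x k i j - y)" if "ch y = 0" for k y using that by (simp add: N_ch_0 Xn(1)[OF x(1)])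
  have "\<exists>K. \<forall>k\<ge>K. \<forall>l\<ge>K. nrm A (pr (x k i j) \<ominus> pr (x l i j)) < e" if "e > 0" for e
  proof -
   obtain K where K: "\<forall>k\<ge>K. \<forall>l\<ge>(K::nat). nrm (Mn n) (s k \<ominus>\<^bsub>Mn n\<^esub> s l) < e" using s \<open>e > 0\<close> by blast
   show ?thesis
   proof (intro exI allI impI)
    fix k l assume "k \<ge> K" "l \<ge> K"
    then have "on n (\<lambda>i j. x k i j - x l i j) < e" using K nd[OF x(1), of k l] unfolding x(2) by metis
    moreover have "N (x k i j - x l i j) \<le> on n (\<lambda>i j. x k i j - x l i j)" using ij by (intro on_entry) (simp_all add: Xn(1)[OF x(1)])
    ultimately show "nrm A (pr (x k i j) \<ominus> pr (x l i j)) < e" by (simp add: nn Xn(1)[OF x(1)])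
   qed
  qed
  then obtain z where z: "z \<in> carrier A" "(\<lambda>k. nrm A (pr (x k i j) \<ominus> z)) \<longlonglongrightarrow> 0" using full_subD[OF full, of "\<lambda>k. pr (x k i j)"] by auto
  then show ?thesis using nn[of "gen z"] by (intro exI[of _ "gen z"]) simp
 qed
 then obtain y0 where y0: "\<And>i j. i < n \<Longrightarrow> j < n \<Longrightarrow> ch (y0 i j) = 0 \<and> (\<lambda>k. N (x k i j - y0 i j)) \<longlonglongrightarrow> 0" by metis
 define y where "y = (\<lambda>i j. if i < n \<and> j < n then y0 i j else 0)"
 have y: "y \<in> Xn n" using y0 by (auto simp: y_def Xn_def)
 have "(\<lambda>k. \<Sum>i<n. \<Sum>j<n. N (x k i j - y i j)) \<longlonglongrightarrow> 0" using y0 by (intro tendsto_null_sum) (auto simp: y_def)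
 then have "(\<lambda>k. nrm (Mn n) (s k \<ominus>\<^bsub>Mn n\<^esub> pm y)) \<longlonglongrightarrow> 0"
  unfolding nd[OF y] by (rule Lim_null_comparison[rotated]) (auto intro!: always_eventually on_le_sum)
 then show "\<exists>b\<in>carrier (Mn n). (\<lambda>k. nrm (Mn n) (s k \<ominus>\<^bsub>Mn n\<^esub> b)) \<longlonglongrightarrow> 0"
  unfolding carrier_Mn using y by blast
qed (auto simp: carrier_Mn Mn_mult Mn_add Mn_smult Mn_star Xn Xn_mm Xn_add Xn_smult Xn_mst)

lemma Mn_bcs: "bcs (Mn n)"
proof -
 have mm: "mm n (\<lambda>i j. x i j + y i j) z = (\<lambda>i j. mm n x z i j + mm n y z i j)"
  "mm n z (\<lambda>i j. x i j + y i j) = (\<lambda>i j. mm n z x i j + mm n z y i j)"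
  "mm n (\<lambda>i j. sc c * x i j) y = (\<lambda>i j. sc c * mm n x y i j)"
  "mm n x (\<lambda>i j. sc c * y i j) = (\<lambda>i j. sc c * mm n x y i j)" for x y z :: "nat \<Rightarrow> nat \<Rightarrow> 'a fa" and c
  by (simp_all add: mm_def fun_eq_iff distrib_right distrib_left sum.distrib sum_distrib_left mult.assoc sc_left_comm)
 have mst: "mst (mm n x y) = mm n (mst y) (mst x)" "mst (\<lambda>i j. sc c * x i j) = (\<lambda>i j. sc (cnj c) * mst x i j)"
  "mst (\<lambda>i j. x i j + y i j) = (\<lambda>i j. mst x i j + mst y i j)" "mst (mst x) = x" for x y :: "nat \<Rightarrow> nat \<Rightarrow> 'a fa" and c
  by (simp_all add: mm_def mst_def fun_eq_iff sc_comm[of "cnj c"])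
 have ch: "x \<in> Xn n \<Longrightarrow> y \<in> Xn n \<Longrightarrow> ch (mm n x y i j) = 0" "x \<in> Xn n \<Longrightarrow> ch (mst x i j) = 0" for x y i j
  using Xn(1)[OF Xn_mm] Xn(1)[OF Xn_mst] by blast+
 have 00: "on n (\<lambda>i j. 0) = 0" by (rule antisym) (use on_le_sum[of n "\<lambda>i j. 0"] in auto)
 have z: "on n x = 0 \<longleftrightarrow> pm x = pm (\<lambda>i j. 0)" if x: "x \<in> Xn n" for x
 proof
  assume 0: "on n x = 0"
  have "pr (x i j) = \<zero>" for i j
  proof (cases "i < n \<and> j < n")
   case True
   then show ?thesis using antisym[OF _ N_nonneg] eqv_0_iff using on_entry[of i n j x] Xn(1)[OF x] 0 by (fastforce simp: eqv_iff)
  qed (use Xn(2)[OF x] in auto)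
  then show "pm x = pm (\<lambda>i j. 0)" by (simp add: pm_def)
 next
  assume "pm x = pm (\<lambda>i j. 0)"
  then show "on n x = 0" using Mn_nrm[of x n] Mn_nrm[of "\<lambda>i j. 0" n] Xn(1)[OF x] 00 by simp
 qed
 have ex: "\<exists>U. pm x \<in> U \<and> full_sub (Mn n) U" if "x \<in> Xn n" for x
  by (intro exI[of _ "carrier (Mn n)"] conjI Mn_full) (simp add: carrier_Mn that)
 have "pcs (Mn n)" by (intro pcs.intro[OF Mn_abelian_group], unfold_locales)
    (auto simp: carrier_Mn Mn_mult Mn_add Mn_smult Mn_star Mn_zero Mn_nrm Xn(1) Xn_mm Xn_add Xn_smult Xn_mst
     ch mm mst mm_assoc sc_add sc_mult distrib_right distrib_left mult.assoc on_scale on_cstar on_add on_mm z 00 intro: ex)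
 then show ?thesis by (intro bcs.intro bcs_axioms.intro Mn_full)
qed

end

text \<open>Product and norm refer to a matrix size. The least admissible one is taken; any larger
  one gives the same result, by \<open>MI_mult\<close> and \<open>MI_nrm\<close>.\<close>

definition Minf :: "('a, 'm) calg_scheme \<Rightarrow> (nat \<Rightarrow> nat \<Rightarrow> 'a) calg" where
 "Minf A = \<lparr>carrier = \<Union>n. carrier (matrix_calg n A),
   monoid.mult = (\<lambda>a b. a \<otimes>\<^bsub>matrix_calg (LEAST n. a \<in> carrier (matrix_calg n A) \<and> b \<in> carrier (matrix_calg n A)) A\<^esub> b),
   one = (\<lambda>i j. \<zero>\<^bsub>A\<^esub>),
   zero = (\<lambda>i j. \<zero>\<^bsub>A\<^esub>),
   add = (\<lambda>a b i j. a i j \<oplus>\<^bsub>A\<^esub> b i j),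
   smult = (\<lambda>c a i j. c \<odot>\<^bsub>A\<^esub> a i j),
   star = (\<lambda>a i j. star A (a j i)),
   nrm = (\<lambda>a. nrm (matrix_calg (LEAST n. a \<in> carrier (matrix_calg n A)) A) a)\<rparr>"

section \<open>The union of all matrix algebras\<close>

context bcs
begin

abbreviation "MI \<equiv> Minf A"

lemma MI_carrier: "carrier MI = (\<Union>n. carrier (Mn n))" by (simp add: Minf_def)

lemma Mn_in_MI: "a \<in> carrier (Mn n) \<Longrightarrow> a \<in> carrier MI" by (auto simp: MI_carrier)

lemma Mn_mult_mono:
 assumes "a \<in> carrier (Mn n)" "b \<in> carrier (Mn n)" "n \<le> m"
 shows "a \<otimes>\<^bsub>Mn m\<^esub> b = a \<otimes>\<^bsub>Mn n\<^esub> b"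
proof -
 obtain x y where x: "x \<in> Xn n" "a = pm x" and y: "y \<in> Xn n" "b = pm y" using assms unfolding carrier_Mn by blast
 have "mm m x y = mm n x y"
  unfolding mm_def fun_eq_iff using assms(3) by (intro allI sum.mono_neutral_right) (auto simp: Xn(2)[OF x(1)])
 then show ?thesis using x y by (simp add: Mn_mult Xn)
qed

lemma Mn_nrm_mono:
 assumes "a \<in> carrier (Mn n)" "n \<le> m"
 shows "nrm (Mn m) a = nrm (Mn n) a"
proof -
 obtain x where x: "x \<in> Xn n" "a = pm x" using assms unfolding carrier_Mn by blast
 then show ?thesis using on_extend[OF assms(2), of x] by (simp add: Mn_nrm Xn)
qed

lemma MI_mult: "a \<in> carrier (Mn n) \<Longrightarrow> b \<in> carrier (Mn n) \<Longrightarrow> a \<otimes>\<^bsub>MI\<^esub> b = a \<otimes>\<^bsub>Mn n\<^esub> b"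
proof -
 assume *: "a \<in> carrier (Mn n)" "b \<in> carrier (Mn n)"
 define k where "k = (LEAST n. a \<in> carrier (Mn n) \<and> b \<in> carrier (Mn n))"
 have "a \<in> carrier (Mn k) \<and> b \<in> carrier (Mn k)" "k \<le> n"
  unfolding k_def by (rule LeastI[of _ n], use * in simp) (rule Least_le, use * in simp)
 then show ?thesis using Mn_mult_mono[of a k b n] by (simp add: Minf_def k_def)
qed

lemma MI_nrm: "a \<in> carrier (Mn n) \<Longrightarrow> nrm MI a = nrm (Mn n) a"
proof -
 assume *: "a \<in> carrier (Mn n)"
 define k where "k = (LEAST n. a \<in> carrier (Mn n))"
 have "nrm (Mn k) a = nrm (Mn n) a" using Mn_nrm_mono[of a k n] by (metis k_def LeastI[of _ n] * Least_le)
 then show ?thesis by (simp add: Minf_def k_def)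
qed

lemma MI_ops: "a \<oplus>\<^bsub>MI\<^esub> b = a \<oplus>\<^bsub>Mn n\<^esub> b" "c \<odot>\<^bsub>MI\<^esub> a = c \<odot>\<^bsub>Mn n\<^esub> a" "star MI a = star (Mn n) a" "\<zero>\<^bsub>MI\<^esub> = \<zero>\<^bsub>Mn n\<^esub>"
 by (simp_all add: Minf_def matrix_calg_def)

lemma MI_obtain2:
 assumes "a \<in> carrier MI" "b \<in> carrier MI"
 obtains n where "a \<in> carrier (Mn n)" "b \<in> carrier (Mn n)"
proof -
 obtain k l where "a \<in> carrier (Mn k)" "b \<in> carrier (Mn l)" using assms by (auto simp: MI_carrier)
 then show ?thesis using that[of "max k l"] carrier_Mn_mono[of k "max k l"] carrier_Mn_mono[of l "max k l"] by auto
qed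

lemma MI_obtain3:
 assumes "a \<in> carrier MI" "b \<in> carrier MI" "c \<in> carrier MI"
 obtains n where "a \<in> carrier (Mn n)" "b \<in> carrier (Mn n)" "c \<in> carrier (Mn n)"
proof -
 obtain k where k: "a \<in> carrier (Mn k)" "b \<in> carrier (Mn k)" using MI_obtain2[OF assms(1,2)] by blast
 moreover obtain l where "c \<in> carrier (Mn l)" using assms(3) by (auto simp: MI_carrier)
 ultimately show ?thesis using that[of "max k l"] carrier_Mn_mono[of k "max k l"] carrier_Mn_mono[of l "max k l"] by auto
qed

lemma MI_abelian_group: "abelian_group MI"
proof (rule abelian_groupI)
 show "\<zero>\<^bsub>MI\<^esub> \<in> carrier MI" using Mn_in_MI[of "\<zero>\<^bsub>Mn 0\<^esub>" 0] Mn_abelian_group[of 0]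
  by (simp add: MI_ops(4)[where n = 0] abelian_monoid.zero_closed[OF abelian_group.axioms(1)])
 fix a b assume ab: "a \<in> carrier MI" "b \<in> carrier MI"
 then obtain n where n: "a \<in> carrier (Mn n)" "b \<in> carrier (Mn n)" by (rule MI_obtain2)
 interpret M: abelian_group "Mn n" by (rule Mn_abelian_group)
 show "a \<oplus>\<^bsub>MI\<^esub> b \<in> carrier MI" using n by (intro Mn_in_MI[of _ n]) (simp add: MI_ops[where n = n])
 show "a \<oplus>\<^bsub>MI\<^esub> b = b \<oplus>\<^bsub>MI\<^esub> a" using n by (simp add: MI_ops[where n = n] M.a_comm)
 show "\<zero>\<^bsub>MI\<^esub> \<oplus>\<^bsub>MI\<^esub> a = a" using n by (simp add: MI_ops[where n = n])
 show "\<exists>b\<in>carrier MI. b \<oplus>\<^bsub>MI\<^esub> a = \<zero>\<^bsub>MI\<^esub>" using Mn_in_MI[OF M.a_inv_closed[OF n(1)]] by (metis n MI_ops[where n = n] M.l_neg)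
 fix c assume "c \<in> carrier MI"
 then obtain n where n: "a \<in> carrier (Mn n)" "b \<in> carrier (Mn n)" "c \<in> carrier (Mn n)" using ab MI_obtain3 by blast
 interpret M3: abelian_group "Mn n" by (rule Mn_abelian_group)
 show "a \<oplus>\<^bsub>MI\<^esub> b \<oplus>\<^bsub>MI\<^esub> c = a \<oplus>\<^bsub>MI\<^esub> (b \<oplus>\<^bsub>MI\<^esub> c)" using n by (simp add: MI_ops[where n = n] M3.a_assoc)
qed

lemma MI_minus:
 assumes "a \<in> carrier (Mn n)" "b \<in> carrier (Mn n)"
 shows "a \<ominus>\<^bsub>MI\<^esub> b = a \<ominus>\<^bsub>Mn n\<^esub> b"
proof -
 interpret M: abelian_group "Mn n" by (rule Mn_abelian_group)
 interpret I: abelian_group MI by (rule MI_abelian_group)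
 show ?thesis by (metis assms Mn_in_MI[OF M.a_inv_closed[OF assms(2)]] Mn_in_MI I.minus_equality MI_ops[where n = n] M.l_neg a_minus_def)
qed

text \<open>Each axiom involves at most three elements, which lie in a common matrix algebra; that
  algebra also serves as the complete subalgebra around a given element.\<close>

lemma MI_pcs: "pcs MI"
proof (rule pcs.intro[OF MI_abelian_group], unfold_locales)
 fix a b assume ab: "a \<in> carrier MI" "b \<in> carrier MI"
 then obtain n where n: "a \<in> carrier (Mn n)" "b \<in> carrier (Mn n)" by (rule MI_obtain2)
 interpret M: bcs "Mn n" by (rule Mn_bcs)
 note o [simp] = MI_ops[where n = n] MI_mult[of _ n] MI_nrm[of _ n]
 note n [simp]
 show "c \<odot>\<^bsub>MI\<^esub> a \<in> carrier MI" "star MI a \<in> carrier MI" "a \<otimes>\<^bsub>MI\<^esub> b \<in> carrier MI" for c by (auto intro: Mn_in_MI[of _ n])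
 show "(c + d) \<odot>\<^bsub>MI\<^esub> a = c \<odot>\<^bsub>MI\<^esub> a \<oplus>\<^bsub>MI\<^esub> d \<odot>\<^bsub>MI\<^esub> a"
  "c \<odot>\<^bsub>MI\<^esub> (d \<odot>\<^bsub>MI\<^esub> a) = (c * d) \<odot>\<^bsub>MI\<^esub> a"
  "1 \<odot>\<^bsub>MI\<^esub> a = a" "star MI (star MI a) = a"
  "star MI (c \<odot>\<^bsub>MI\<^esub> a) = cnj c \<odot>\<^bsub>MI\<^esub> star MI a"
  "0 \<le> nrm MI a"
  "nrm MI a = 0 \<longleftrightarrow> a = \<zero>\<^bsub>MI\<^esub>"
  "nrm MI (c \<odot>\<^bsub>MI\<^esub> a) = cmod c * nrm MI a"
  "nrm MI (star MI a \<otimes>\<^bsub>MI\<^esub> a) = (nrm MI a)\<^sup>2"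
  "c \<odot>\<^bsub>MI\<^esub> (a \<oplus>\<^bsub>MI\<^esub> b) = c \<odot>\<^bsub>MI\<^esub> a \<oplus>\<^bsub>MI\<^esub> c \<odot>\<^bsub>MI\<^esub> b"
  "(c \<odot>\<^bsub>MI\<^esub> a) \<otimes>\<^bsub>MI\<^esub> b = c \<odot>\<^bsub>MI\<^esub> (a \<otimes>\<^bsub>MI\<^esub> b)"
  "a \<otimes>\<^bsub>MI\<^esub> (c \<odot>\<^bsub>MI\<^esub> b) = c \<odot>\<^bsub>MI\<^esub> (a \<otimes>\<^bsub>MI\<^esub> b)"
  "star MI (a \<oplus>\<^bsub>MI\<^esub> b) = star MI a \<oplus>\<^bsub>MI\<^esub> star MI b"
  "star MI (a \<otimes>\<^bsub>MI\<^esub> b) = star MI b \<otimes>\<^bsub>MI\<^esub> star MI a"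
  "nrm MI (a \<oplus>\<^bsub>MI\<^esub> b) \<le> nrm MI a + nrm MI b"
  "nrm MI (a \<otimes>\<^bsub>MI\<^esub> b) \<le> nrm MI a * nrm MI b" for c d
  by (simp_all add: M.smult_ldist M.smult_smult M.star_smult M.nrm_nonneg M.nrm_eq_0 M.nrm_smult M.cstar_identity M.smult_rdist
    M.smult_mult_left M.smult_mult_right M.star_add M.star_mult M.nrm_triangle M.nrm_mult)
 have "full_sub MI (carrier (Mn n))"
  unfolding full_sub_def
 proof (intro conjI)
  show "\<forall>s. (\<forall>k. s k \<in> carrier (Mn n)) \<and> (\<forall>e>0. \<exists>K. \<forall>k\<ge>K. \<forall>l\<ge>(K::nat). nrm MI (s k \<ominus>\<^bsub>MI\<^esub> s l) < e)
    \<longrightarrow> (\<exists>y\<in>carrier (Mn n). (\<lambda>k. nrm MI (s k \<ominus>\<^bsub>MI\<^esub> y)) \<longlonglongrightarrow> 0)"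
  proof (intro allI impI)
   fix s assume s: "(\<forall>k. s k \<in> carrier (Mn n)) \<and> (\<forall>e>0. \<exists>K. \<forall>k\<ge>K. \<forall>l\<ge>(K::nat). nrm MI (s k \<ominus>\<^bsub>MI\<^esub> s l) < e)"
   have eq: "nrm MI (s k \<ominus>\<^bsub>MI\<^esub> y) = nrm (Mn n) (s k \<ominus>\<^bsub>Mn n\<^esub> y)" if "y \<in> carrier (Mn n)" for k y
    using that s by (simp add: MI_minus[where n = n])
   show "\<exists>y\<in>carrier (Mn n). (\<lambda>k. nrm MI (s k \<ominus>\<^bsub>MI\<^esub> y)) \<longlonglongrightarrow> 0"
   proof -
    have sc: "s k \<in> carrier (Mn n)" for k using s by blast
    have "\<exists>y\<in>carrier (Mn n). (\<lambda>k. nrm (Mn n) (s k \<ominus>\<^bsub>Mn n\<^esub> y)) \<longlonglongrightarrow> 0"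
    proof (rule full_subD[OF M.full sc])
     fix e :: real assume "e > 0"
     then obtain K where "\<forall>k\<ge>K. \<forall>l\<ge>(K::nat). nrm MI (s k \<ominus>\<^bsub>MI\<^esub> s l) < e" using s by blast
     then show "\<exists>K. \<forall>k\<ge>K. \<forall>l\<ge>K. nrm (Mn n) (s k \<ominus>\<^bsub>Mn n\<^esub> s l) < e" using eq[OF sc] by auto
    qed
    then show ?thesis using eq by (metis (no_types, lifting) ext)
   qed
  qed
 qed (auto intro: Mn_in_MI[of _ n])
 then show "\<exists>U. a \<in> U \<and> full_sub MI U" by (intro exI[of _ "carrier (Mn n)"]) simp
next
 fix a b c assume ab: "a \<in> carrier MI" "b \<in> carrier MI" "c \<in> carrier MI"
 then obtain n where n: "a \<in> carrier (Mn n)" "b \<in> carrier (Mn n)" "c \<in> carrier (Mn n)" by (rule MI_obtain3)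
 interpret M: bcs "Mn n" by (rule Mn_bcs)
 note o [simp] = MI_ops[where n = n] MI_mult[of _ n] MI_nrm[of _ n]
 note n [simp]
 show "a \<otimes>\<^bsub>MI\<^esub> b \<otimes>\<^bsub>MI\<^esub> c = a \<otimes>\<^bsub>MI\<^esub> (b \<otimes>\<^bsub>MI\<^esub> c)"
  "(a \<oplus>\<^bsub>MI\<^esub> b) \<otimes>\<^bsub>MI\<^esub> c = a \<otimes>\<^bsub>MI\<^esub> c \<oplus>\<^bsub>MI\<^esub> b \<otimes>\<^bsub>MI\<^esub> c"
  "a \<otimes>\<^bsub>MI\<^esub> (b \<oplus>\<^bsub>MI\<^esub> c) = a \<otimes>\<^bsub>MI\<^esub> b \<oplus>\<^bsub>MI\<^esub> a \<otimes>\<^bsub>MI\<^esub> c" by (simp_all add: M.mult_assoc M.mult_add_left M.mult_add_right)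
qed

end

context pcs
begin

lemma positive_sqrt:
 assumes "positive_elem A a"
 obtains r where "selfadjoint A r" "r \<otimes> r = a"
proof -
 have p: "PS (hg a)" by (rule positive_PS) fact
 note rt = rt[OF PS_pos[OF p]]
 have "selfadjoint A (pr (rt (hg a)))"
  unfolding selfadjoint_def by (metis pr_carrier pr_st rt(1))
 moreover have "pr (rt (hg a)) \<otimes> pr (rt (hg a)) = a" using rt(2,4) assms by (simp add: eqv_iff pr_mult0[symmetric] del: pr_mult0)
 ultimately show ?thesis by rule
qed

text \<open>A test for positivity without spectra, hence transferable between algebras. The scalar
  accommodates rank one matrices, whose squares are multiples of themselves.\<close>

lemma positive_scaled_square:
 assumes "selfadjoint A r" "r \<otimes> r = complex_of_real s \<odot> a" "s > 0" "a \<in> carrier A"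
 shows "positive_elem A a"
proof -
 define x where "x = rsc (1 / s) * (hg r * hg r)"
 have "PS x"
  unfolding x_def PS_def using assms by (intro conjI pos_scale pos_sq) simp_all
 moreover have "pr x = a" using assms by (simp add: x_def smult_smult)
 ultimately show ?thesis using PS_positive by blast
qed

lemma positive_square: "selfadjoint A r \<Longrightarrow> positive_elem A (r \<otimes> r)" by (rule positive_scaled_square[of r 1]) (simp_all add: selfadjoint_def)

lemma finsum_2: "f 0 \<in> carrier A \<Longrightarrow> f 1 \<in> carrier A \<Longrightarrow> (\<Oplus>k\<in>{..<2::nat}. f k) = f 0 \<oplus> f 1"
proof -
 assume f: "f 0 \<in> carrier A" "f 1 \<in> carrier A"
 have "{..<2::nat} = {0, 1}" by auto
 then show ?thesis using f by simp
qed

end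

context bcs
begin

lemma MI_positive:
 assumes "positive_elem (Mn n) a"
 shows "positive_elem MI a"
proof -
 interpret M: bcs "Mn n" by (rule Mn_bcs)
 interpret I: pcs MI by (rule MI_pcs)
 obtain r where r: "selfadjoint (Mn n) r" "r \<otimes>\<^bsub>Mn n\<^esub> r = a" using M.positive_sqrt[OF assms] .
 then show ?thesis using I.positive_square by (metis selfadjoint_def MI_mult[of _ n] MI_ops(3)[where n = n] Mn_in_MI)
qed

lemma MI_positive_iff: "positive_elem MI a \<longleftrightarrow> a \<in> minf_pos A"
proof
 assume a: "positive_elem MI a"
 interpret I: pcs MI by (rule MI_pcs)
 obtain r where r: "selfadjoint MI r" "r \<otimes>\<^bsub>MI\<^esub> r = a" using I.positive_sqrt[OF a] .
 then obtain n where n: "r \<in> carrier (Mn n)" by (auto simp: selfadjoint_def MI_carrier)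
 interpret M: bcs "Mn n" by (rule Mn_bcs)
 have "positive_elem (Mn n) (r \<otimes>\<^bsub>Mn n\<^esub> r)" using r n by (intro M.positive_square) (simp add: selfadjoint_def MI_ops(3)[where n = n])
 then show "a \<in> minf_pos A" using r n by (auto simp: minf_pos_def MI_mult[of _ n])
qed (auto simp: minf_pos_def MI_positive)

text \<open>Polynomials without constant term have the same values in both algebras. One polynomial
  approximates the cut function on an interval containing both spectra, so the two results are
  arbitrarily close.\<close>

lemma MI_cutdown:
 assumes a: "positive_elem (Mn m) a" and e: "e \<ge> 0"
 shows "cutdown (Mn m) a e = cutdown MI a e"
proof -
 interpret M: bcs "Mn m" by (rule Mn_bcs)
 interpret I: pcs MI by (rule MI_pcs)
 define x y where "x = M.hg a" and "y = I.hg a"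
 have x: "ch x = 0" "st x = x" "M.pr x = a" and y: "ch y = 0" "st y = y" "I.pr y = a"
  using a MI_positive[OF a] by (simp_all add: x_def y_def)
 define z z' where "z = M.pr (M.cut x e)" and "z' = I.pr (I.cut y e)"
 have zz: "z \<in> carrier (Mn m)" "z \<in> carrier MI" "z' \<in> carrier MI" using Mn_in_MI[of z m] by (simp_all add: z_def z'_def)
 have z: "ch (M.cut x e) = 0" "ch (I.cut y e) = 0" using x y e by (simp_all add: M.cut_ch I.cut_ch)
 have eq: "M.pr (rp p x) = I.pr (rp p y) \<and> ch (rp p x) = ch (rp p y)" for p
 proof (induction p)
  case (pCons b p)
  have "M.pr (rp p x) \<in> carrier (Mn m)" "a \<in> carrier (Mn m)" using a by simp_all
  then show ?case using pCons x y by (simp add: M.pr_mult I.pr_mult MI_mult[of _ m] MI_ops[where n = m])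
 qed (simp add: MI_ops(4)[where n = m])
 have "I.N (gen z - gen z') \<le> d" if d: "d > 0" for d
 proof -
  define R where "R = max (M.N x) (I.N y)"
  obtain q where q: "\<And>t. t \<in> {-R..R} \<Longrightarrow> \<bar>poly q t - max (t - e) 0\<bar> < d / 4" using Weierstrass_poly[of "-R" R "\<lambda>t. max (t - e) 0" "d / 4"] d
   by (metis cont_cut continuous_on_subset subset_UNIV divide_pos_pos zero_less_numeral)
  define p where "p = q - [:poly q 0:]"
  have R: "R \<ge> 0" by (simp add: R_def le_max_iff_disj)
  have p: "\<bar>poly p t - max (t - e) 0\<bar> \<le> d / 2" if "\<bar>t\<bar> \<le> R" for t
   using q[of t] q[of 0] that e by (auto simp: p_def abs_if split: if_splits)
  have p0: "poly p 0 = 0" by (simp add: p_def)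
  define w where "w = M.pr (rp p x)"
  have w: "w \<in> carrier (Mn m)" "w = I.pr (rp p y)"
   unfolding w_def by simp (simp add: eq)
  have "M.N (rp p x - M.cut x e) \<le> d / 2"
   unfolding M.cut_def by (intro M.fc_approx cont_cut p order_trans[OF M.spr_bound]) (auto simp: R_def x)
  then have 1: "nrm (Mn m) (w \<ominus>\<^bsub>Mn m\<^esub> z) \<le> d / 2" using z x p0 by (subst (asm) M.N_ch_0) (simp_all add: w_def z_def ch_rp[where t = 0])
  have "I.N (rp p y - I.cut y e) \<le> d / 2"
   unfolding I.cut_def by (intro I.fc_approx cont_cut p order_trans[OF I.spr_bound]) (auto simp: R_def y)
  then have 2: "nrm MI (w \<ominus>\<^bsub>MI\<^esub> z') \<le> d / 2" using z y p0 by (subst (asm) I.N_ch_0) (simp_all add: w(2) z'_def ch_rp[where t = 0])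
  have wI: "w \<in> carrier MI" using w Mn_in_MI by blast
  have "I.N (gen z - gen w) \<le> d / 2"
   using 1 zz w by (subst I.N_minus_commute, subst I.N_ch_0) (simp_all add: MI_minus[of _ m] MI_nrm[of _ m])
  moreover have "I.N (gen w - gen z') \<le> d / 2" using 2 wI zz by (subst I.N_ch_0) simp_all
  ultimately have "I.N (gen z - gen z') \<le> d / 2 + d / 2" by (rule I.N_trans)
  then show ?thesis by simp
 qed
 then have "I.eqv (gen z) (gen z')" by (rule I.eqv_le)
 then show ?thesis using M.cutdown_eq[OF x(1,2) e] I.cutdown_eq[OF y(1,2) e] using zz I.eqv_iff by (simp add: x y z_def z'_def)
qed

end

section \<open>Order zero maps\<close>

definition rk1 :: "nat \<Rightarrow> (nat \<Rightarrow> complex) \<Rightarrow> (nat \<Rightarrow> complex) \<Rightarrow> nat \<Rightarrow> nat \<Rightarrow> complex" where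
 "rk1 k v w = (\<lambda>a b. if a < k \<and> b < k then v a * cnj (w b) else 0)"

definition cip :: "nat \<Rightarrow> (nat \<Rightarrow> complex) \<Rightarrow> (nat \<Rightarrow> complex) \<Rightarrow> complex" where
 "cip k v w = (\<Sum>a<k. cnj (v a) * w a)"

definition unv :: "nat \<Rightarrow> nat \<Rightarrow> complex" where
 "unv i = (\<lambda>a. if a = i then 1 else 0)"

text \<open>The block matrix of the column \<open>(v, w)\<close> times its adjoint. Its positivity
  is where complete positivity of the order zero map, at size two, is used.\<close>

definition blk :: "nat \<Rightarrow> (nat \<Rightarrow> complex) \<Rightarrow> (nat \<Rightarrow> complex) \<Rightarrow> nat \<Rightarrow> nat \<Rightarrow> nat \<Rightarrow> nat \<Rightarrow> complex" where
 "blk k v w = (\<lambda>a b. if a < 2 \<and> b < 2 then rk1 k (if a = 0 then v else w) (if b = 0 then v else w) else (\<lambda>i j. 0))"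

lemma complex_calg_simps [simp]: "carrier complex_calg = UNIV" "x \<otimes>\<^bsub>complex_calg\<^esub> y = x * y"
 "x \<oplus>\<^bsub>complex_calg\<^esub> y = x + y" "\<zero>\<^bsub>complex_calg\<^esub> = 0" "\<one>\<^bsub>complex_calg\<^esub> = 1"
 "c \<odot>\<^bsub>complex_calg\<^esub> x = c * x" "star complex_calg x = cnj x" "nrm complex_calg x = cmod x" by (simp_all add: complex_calg_def)

lemma finsum_complex: "finite I \<Longrightarrow> (\<Oplus>\<^bsub>complex_calg\<^esub>i\<in>I. f i) = sum f I"
proof -
 interpret C: bcs complex_calg by (rule complex_calg_bcs)
 show "finite I \<Longrightarrow> (\<Oplus>\<^bsub>complex_calg\<^esub>i\<in>I. f i) = sum f I" by (induction rule: finite_induct) (auto)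
qed

lemma rk1_carrier [simp]: "rk1 k v w \<in> carrier (Mat k)" by (auto simp: matrix_calg_def rk1_def)

lemma rk1_mult: "rk1 k v w \<otimes>\<^bsub>Mat k\<^esub> rk1 k x y = cip k w x \<odot>\<^bsub>Mat k\<^esub> rk1 k v y"
 by (auto simp: matrix_calg_def finsum_complex rk1_def cip_def fun_eq_iff sum_distrib_right mult_ac)

lemma rk1_star: "star (Mat k) (rk1 k v w) = rk1 k w v" by (auto simp: matrix_calg_def rk1_def fun_eq_iff)

lemma rk1_add: "rk1 k v (\<lambda>a. w a + x a) = rk1 k v w \<oplus>\<^bsub>Mat k\<^esub> rk1 k v x"
 "rk1 k (\<lambda>a. w a + x a) v = rk1 k w v \<oplus>\<^bsub>Mat k\<^esub> rk1 k x v" by (auto simp: matrix_calg_def rk1_def fun_eq_iff algebra_simps)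

lemma rk1_minus: "rk1 k (\<lambda>a. - w a) v = (- 1) \<odot>\<^bsub>Mat k\<^esub> rk1 k w v" by (auto simp: matrix_calg_def rk1_def fun_eq_iff)

lemma cip_self: "cip k v v = complex_of_real (\<Sum>a<k. (cmod (v a))\<^sup>2)"
 unfolding cip_def of_real_sum by (intro sum.cong refl) (metis complex_norm_square mult.commute)

lemma cip_unv: "i < k \<Longrightarrow> cip k (unv i) v = v i" "i < k \<Longrightarrow> cip k v (unv i) = cnj (v i)"
 by (auto simp: cip_def unv_def if_distrib[of cnj] if_distrib[of "\<lambda>x. x * _"] if_distrib[of "(*) _"] cong: if_cong)

lemma rk1_positive:
 assumes "cip k v v \<noteq> 0"
 shows "positive_elem (Mat k) (rk1 k v v)"
proof -
 interpret C: bcs complex_calg by (rule complex_calg_bcs)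
 interpret M: bcs "Mat k" by (rule C.Mn_bcs)
 show ?thesis
 proof (rule M.positive_scaled_square[of "rk1 k v v" "\<Sum>a<k. (cmod (v a))\<^sup>2"])
  show "0 < (\<Sum>a<k. (cmod (v a))\<^sup>2)" using assms cip_self[of k v] by (metis less_le of_real_0 sum_nonneg zero_le_power2)
 qed (simp_all add: selfadjoint_def rk1_star rk1_mult cip_self)
qed

lemma blk_positive:
 assumes "cip k v v \<noteq> 0"
 shows "positive_elem (matrix_calg 2 (Mat k)) (blk k v w)"
proof -
 interpret C: bcs complex_calg by (rule complex_calg_bcs)
 interpret M: bcs "Mat k" by (rule C.Mn_bcs)
 interpret M2: bcs "matrix_calg 2 (Mat k)" by (rule M.Mn_bcs)
 have z: "(\<lambda>i j. 0) = \<zero>\<^bsub>Mat k\<^esub>" by (simp add: matrix_calg_def)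
 define u where "u = (\<lambda>a::nat. if a = 0 then v else w)"
 have b: "blk k v w a b = (if a < 2 \<and> b < 2 then rk1 k (u a) (u b) else \<zero>\<^bsub>Mat k\<^esub>)" for a b by (simp add: blk_def z u_def)
 define s where "s = (\<Sum>a<k. (cmod (v a))\<^sup>2) + (\<Sum>a<k. (cmod (w a))\<^sup>2)"
 have s: "complex_of_real s = cip k v v + cip k w w" by (simp add: s_def cip_self)
 have car: "blk k v w \<in> carrier (matrix_calg 2 (Mat k))" by (simp add: matrix_calg_def[of 2] b)
 show ?thesis
 proof (rule M2.positive_scaled_square[of "blk k v w" s])
  show "selfadjoint (matrix_calg 2 (Mat k)) (blk k v w)"
   by (auto simp: selfadjoint_def matrix_calg_def[of 2] b rk1_star fun_eq_iff[of _ "blk k v w"] del:)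
  show "blk k v w \<otimes>\<^bsub>matrix_calg 2 (Mat k)\<^esub> blk k v w = complex_of_real s \<odot>\<^bsub>matrix_calg 2 (Mat k)\<^esub> blk k v w"
  proof (intro ext)
   fix a b
   have "(\<Oplus>\<^bsub>Mat k\<^esub>c\<in>{..<2}. blk k v w a c \<otimes>\<^bsub>Mat k\<^esub> blk k v w c b) =
     blk k v w a 0 \<otimes>\<^bsub>Mat k\<^esub> blk k v w 0 b \<oplus>\<^bsub>Mat k\<^esub> blk k v w a 1 \<otimes>\<^bsub>Mat k\<^esub> blk k v w 1 b" by (rule M.finsum_2) (simp_all add: b)
   also have "... = complex_of_real s \<odot>\<^bsub>Mat k\<^esub> blk k v w a b" by (simp add: b rk1_mult s u_def M.smult_ldist)
   finally have "(blk k v w \<otimes>\<^bsub>matrix_calg 2 (Mat k)\<^esub> blk k v w) a b = (complex_of_real s \<odot>\<^bsub>matrix_calg 2 (Mat k)\<^esub> blk k v w) a b"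
    by (simp add: matrix_calg_def[of 2])
   then show "(blk k v w \<otimes>\<^bsub>matrix_calg 2 (Mat k)\<^esub> blk k v w) a b i j = (complex_of_real s \<odot>\<^bsub>matrix_calg 2 (Mat k)\<^esub> blk k v w) a b i j" for i j
    by simp
  qed
  show "s > 0"
   unfolding s_def
  proof (rule add_pos_nonneg)
   show "0 < (\<Sum>a<k. (cmod (v a))\<^sup>2)" using assms cip_self[of k v] by (metis less_le of_real_0 sum_nonneg zero_le_power2)
  qed (simp add: sum_nonneg)
 qed (rule car)
qed

lemma rk1_nrm:
 assumes "cip k v v = 1" "cip k w w = 1"
 shows "nrm (Mat k) (rk1 k v w) \<le> 1"
proof -
 interpret C: bcs complex_calg by (rule complex_calg_bcs)
 interpret M: bcs "Mat k" by (rule C.Mn_bcs)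
 have 1: "(nrm (Mat k) (rk1 k v w))\<^sup>2 = nrm (Mat k) (rk1 k w w)"
  using M.cstar_identity[of "rk1 k v w"] assms by (simp add: rk1_star rk1_mult)
 have "nrm (Mat k) (rk1 k w w) \<le> 1"
  using M.cstar_identity[of "rk1 k w w"] assms rk1_star rk1_mult by (cases "nrm (Mat k) (rk1 k w w) = 0") (auto simp: power2_eq_square)
 then show ?thesis using 1 by (metis abs_le_square_iff abs_one abs_le_D1 one_power2)
qed

lemma one_nrm: "nrm (Mat k) \<one>\<^bsub>Mat k\<^esub> \<le> 1" and one_carrier: "\<one>\<^bsub>Mat k\<^esub> \<in> carrier (Mat k)"
proof -
 interpret C: bcs complex_calg by (rule complex_calg_bcs)
 interpret M: bcs "Mat k" by (rule C.Mn_bcs)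
 show c: "\<one>\<^bsub>Mat k\<^esub> \<in> carrier (Mat k)" by (auto simp: matrix_calg_def)
 have "star (Mat k) \<one>\<^bsub>Mat k\<^esub> \<otimes>\<^bsub>Mat k\<^esub> \<one>\<^bsub>Mat k\<^esub> = \<one>\<^bsub>Mat k\<^esub>"
  by (auto simp: matrix_calg_def finsum_complex fun_eq_iff if_distrib[of cnj] if_distrib[of "\<lambda>x. x * _"] cong: if_cong)
 then show "nrm (Mat k) \<one>\<^bsub>Mat k\<^esub> \<le> 1" using M.cstar_identity[OF c] by (cases "nrm (Mat k) \<one>\<^bsub>Mat k\<^esub> = 0") (auto simp: power2_eq_square)
qed

context bcs
begin

text \<open>Write \<open>V\<close> as the square of a self-adjoint \<open>R\<close>. If the corner
  of \<open>V\<close> kills \<open>z\<close>, then \<open>st z * V 0 0 * z\<close> is a vanishing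
  sum of positive elements, so the first column of \<open>R\<close> kills \<open>z\<close>, and with
  it \<open>V 1 0\<close>.\<close>

lemma block_positive:
 assumes V: "positive_elem (Mn 2) V"
 shows "star A (V 0 1) = V 1 0" "star A (V 0 0) = V 0 0" "positive_elem A (V 0 0)"
  "\<lbrakk>z \<in> carrier A; V 0 0 \<otimes> z = \<zero>\<rbrakk> \<Longrightarrow> V 1 0 \<otimes> z = \<zero>"
proof -
 interpret M: bcs "Mn 2" by (rule Mn_bcs)
 have "star (Mn 2) V = V" using V by (simp add: positive_elem_def selfadjoint_def)
 then have "star A (V j i) = V i j" for i j by (simp add: matrix_calg_def) metis
 then show "star A (V 0 1) = V 1 0" "star A (V 0 0) = V 0 0" by blast+
 obtain R where R: "selfadjoint (Mn 2) R" "R \<otimes>\<^bsub>Mn 2\<^esub> R = V" using M.positive_sqrt[OF V] .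
 have Rc [simp]: "R i j \<in> carrier A" for i j using R by (simp add: selfadjoint_def matrix_calg_def)
 have "star (Mn 2) R = R" using R by (simp add: selfadjoint_def)
 then have Rs: "star A (R j i) = R i j" for i j by (simp add: matrix_calg_def) metis
 have V: "V i j = R i 0 \<otimes> R 0 j \<oplus> R i 1 \<otimes> R 1 j" for i j
  unfolding R(2)[symmetric] by (simp add: matrix_calg_def finsum_2)
 define r where "r = (\<lambda>i. gen (R i 0))"
 have "gen (V 0 0) \<sim> st (r 0) * r 0 + st (r 1) * r 1" by (simp add: eqv_iff r_def Rs V)
 moreover have "PS (st (r 0) * r 0 + st (r 1) * r 1)" by (simp add: PS_def r_def pos_add pos_star)
 ultimately show "positive_elem A (V 0 0)" using PS_positive[of "st (r 0) * r 0 + st (r 1) * r 1"] by (simp add: eqv_iff V)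
 assume z: "z \<in> carrier A" "V 0 0 \<otimes> z = \<zero>"
 define p where "p = (\<lambda>i. st (r i * gen z) * (r i * gen z))"
 have "p 0 + p 1 \<sim> st (gen z) * (gen (V 0 0) * gen z)" by (simp add: eqv_iff p_def r_def Rs V mult_assoc mult_add_left mult_add_right)
 also have "... \<sim> 0" using z by (simp add: eqv_iff V)
 finally have s: "N (p 0 + p 1) = 0" by (simp add: eqv_0_iff)
 have pp: "pos (p i)" for i by (simp add: p_def pos_star del: st_mult)
 have "N (p 0) \<le> 0" "N (p 1) \<le> 0" using pos_mono[OF pp[of 0], of "p 0 + p 1"] pos_mono[OF pp[of 1], of "p 0 + p 1"] pp s by simp_all
 then have "p 0 \<sim> 0" "p 1 \<sim> 0"
  unfolding eqv_0_iff using N_nonneg by (blast intro: antisym)+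
 then have "r 0 * gen z \<sim> 0" "r 1 * gen z \<sim> 0"
  unfolding p_def by (blast intro: st_mult_0)+
 then show "V 1 0 \<otimes> z = \<zero>" using z using eqv_iff r_def by (simp add: V mult_add_left mult_assoc)
qed

lemma order_zero_block:
 assumes \<phi>: "cpc_order_zero (Mat k) A \<phi>" and v: "cip k v v \<noteq> 0"
 shows "star A (\<phi> (rk1 k v w)) = \<phi> (rk1 k w v)"
  "positive_elem A (\<phi> (rk1 k v v))"
  "\<lbrakk>z \<in> carrier A; \<phi> (rk1 k v v) \<otimes> z = \<zero>\<rbrakk> \<Longrightarrow> \<phi> (rk1 k w v) \<otimes> z = \<zero>"
proof -
 have "positive_elem (Mn 2) (\<lambda>a b. \<phi> (blk k v w a b))" using \<phi> blk_positive[OF v] unfolding cpc_order_zero_def by blast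
 note bp = block_positive[OF this]
 show "star A (\<phi> (rk1 k v w)) = \<phi> (rk1 k w v)" "positive_elem A (\<phi> (rk1 k v v))" using bp(1,3) by (simp_all add: blk_def)
 show "\<phi> (rk1 k w v) \<otimes> z = \<zero>" if "z \<in> carrier A" "\<phi> (rk1 k v v) \<otimes> z = \<zero>" using bp(4)[OF that(1)] that(2) by (simp add: blk_def)
qed

text \<open>Order zero gives orthogonality only for the positive matrices \<open>rk1 k y y\<close>
  and \<open>rk1 k x x\<close>; \<open>order_zero_block\<close> extends it to the off-diagonal
  factors, once on each side.\<close>

lemma order_zero_prod:
 assumes \<phi>: "cpc_order_zero (Mat k) A \<phi>" and x: "cip k x x \<noteq> 0" and y: "cip k y y \<noteq> 0" and xy: "cip k y x = 0"
 shows "\<phi> (rk1 k v x) \<otimes> \<phi> (rk1 k y w) = \<zero>"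
proof -
 have c [simp]: "\<phi> (rk1 k v w) \<in> carrier A" for v w using \<phi> unfolding cpc_order_zero_def calg_linear_def by simp
 interpret C: bcs complex_calg by (rule complex_calg_bcs)
 interpret M: bcs "Mat k" by (rule C.Mn_bcs)
 have "\<phi> (rk1 k y y) \<otimes> \<phi> (rk1 k x x) = \<zero>"
  using \<phi> rk1_positive[OF x] rk1_positive[OF y] unfolding cpc_order_zero_def by (simp add: rk1_mult xy)
 then have "star A (\<phi> (rk1 k w y) \<otimes> \<phi> (rk1 k x x)) = \<zero>" using order_zero_block(3)[OF \<phi> y, rotated] by simp
 then show ?thesis
  by (metis order_zero_block(1)[OF \<phi> x, of x] order_zero_block(1)[OF \<phi> y, of w] star_mult c star_star order_zero_block(3)[OF \<phi> x, rotated])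
qed

text \<open>Orthogonality of the vectors \<open>e_i + e_j\<close> and \<open>e_i - e_j\<close>
  yields a vanishing product; after expansion, two of its four terms vanish and the remaining two
  give the second relation.\<close>

lemma order_zero_units:
 assumes \<phi>: "cpc_order_zero (Mat k) A \<phi>" and i: "i < k" "j < k" "p < k" "l < k"
 defines "g \<equiv> \<lambda>i j. \<phi> (rk1 k (unv i) (unv j))"
 shows "j \<noteq> p \<Longrightarrow> g i j \<otimes> g p l = \<zero>" "g i j \<otimes> g j l = g i i \<otimes> g i l"
proof -
 have c [simp]: "\<phi> (rk1 k v w) \<in> carrier A" for v w using \<phi> unfolding cpc_order_zero_def calg_linear_def by simp
 have lin: "x \<in> carrier (Mat k) \<Longrightarrow> y \<in> carrier (Mat k) \<Longrightarrow> \<phi> (x \<oplus>\<^bsub>Mat k\<^esub> y) = \<phi> x \<oplus> \<phi> y"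
  "x \<in> carrier (Mat k) \<Longrightarrow> \<phi> (c \<odot>\<^bsub>Mat k\<^esub> x) = c \<odot> \<phi> x" for x y c using \<phi> unfolding cpc_order_zero_def calg_linear_def by simp_all
 interpret C: bcs complex_calg by (rule complex_calg_bcs)
 interpret M: bcs "Mat k" by (rule C.Mn_bcs)
 have orth: "g i j \<otimes> g p l = \<zero>" if "i < k" "j < k" "p < k" "l < k" "j \<noteq> p" for i j p l
  unfolding g_def using that by (intro order_zero_prod[OF \<phi>]) (simp_all add: cip_unv, simp_all add: unv_def)
 then show "j \<noteq> p \<Longrightarrow> g i j \<otimes> g p l = \<zero>" using i by blast
 show "g i j \<otimes> g j l = g i i \<otimes> g i l"
 proof (cases "i = j")
  case False
  define x y where "x = (\<lambda>a. unv i a + unv j a)" and "y = (\<lambda>a. unv i a + - unv j a)"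
  have e: "cip k x v = v i + v j" "cip k y v = v i - v j" for v using cip_unv(1)[OF i(1), of v] cip_unv(1)[OF i(2), of v]
   by (simp_all add: x_def y_def cip_def distrib_right left_diff_distrib sum.distrib sum_subtractf)
  have "\<phi> (rk1 k (unv i) x) \<otimes> \<phi> (rk1 k y (unv l)) = \<zero>"
   using False by (intro order_zero_prod[OF \<phi>]; simp only: e) (simp_all add: x_def y_def unv_def)
  then have "(g i i \<oplus> g i j) \<otimes> (g i l \<oplus> (- 1) \<odot> g j l) = \<zero>"
   unfolding x_def y_def rk1_add rk1_minus by (simp add: lin g_def)
  moreover have "g i i \<otimes> g j l = \<zero>" "g i j \<otimes> g i l = \<zero>" using False i by (auto intro: orth)
  moreover have gc: "g a b \<in> carrier A" for a b by (simp add: g_def)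
  ultimately have "g i i \<otimes> g i l \<ominus> g i j \<otimes> g j l = \<zero>" by (simp add: mult_add_left mult_add_right smult_mult_right minus_smult)
  then show ?thesis using a_minus_zero gc by (metis mult_closed)
 qed simp
qed

end

context pcs
begin

text \<open>A lift of \<open>u\<close> tied to a lift of its adjoint \<open>v\<close>:
  \<open>st\<close> exchanges them as an equation in the ring, as the relations \<open>oz\<close>
  demand.\<close>

definition hs :: "'a \<Rightarrow> 'a \<Rightarrow> 'a fa" where
 "hs u v = sc (1 / 2) * (gen u + st (gen v))"

lemma hs [simp]: "ch (hs u v) = 0" "st (hs u v) = hs v u" by (simp_all add: hs_def sc_comm[of "1/2"] add.commute)

lemma pr_hs [simp]: "u \<in> carrier A \<Longrightarrow> v \<in> carrier A \<Longrightarrow> star A v = u \<Longrightarrow> pr (hs u v) = u" by (simp add: hs_def half_add)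

end

context bcs
begin

lemma order_zero_oz:
 assumes \<phi>: "cpc_order_zero (Mat k) A \<phi>"
 obtains f where "oz k f" "\<And>i j. i < k \<Longrightarrow> j < k \<Longrightarrow> pr (f i j) = \<phi> (rk1 k (unv i) (unv j))"
  "pr (\<Sum>i<k. f i i) = \<phi> \<one>\<^bsub>Mat k\<^esub>"
proof -
 define g where "g = (\<lambda>i j. \<phi> (rk1 k (unv i) (unv j)))"
 define f where "f = (\<lambda>i j. hs (g i j) (g j i))"
 have gc [simp]: "g i j \<in> carrier A" for i j using \<phi> unfolding g_def cpc_order_zero_def calg_linear_def by simp
 have cip: "cip k (unv i) (unv i) = 1" if "i < k" for i using that by (simp add: cip_unv) (simp add: unv_def)
 have gs: "star A (g j i) = g i j" if "i < k" "j < k" for i j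
  unfolding g_def using order_zero_block(1)[OF \<phi>, of "unv j" "unv i"] cip[OF that(2)] by simp
 have fpr [simp]: "pr (f i j) = g i j" if "i < k" "j < k" for i j using that by (simp add: f_def gs)
 have nle: "nrm A (\<phi> y) \<le> nrm (Mat k) y" if "y \<in> carrier (Mat k)" for y using \<phi> that unfolding cpc_order_zero_def by blast
 have N1: "N (f i j) \<le> 1" if "i < k" "j < k" for i j
 proof -
  have "N (f i j) = nrm A (g i j)" using that by (subst N_ch_0) (simp_all add: f_def gs)
  also have "... \<le> nrm (Mat k) (rk1 k (unv i) (unv j))"
   unfolding g_def by (rule nle) simp
  also have "... \<le> 1" using that by (intro rk1_nrm cip)
  finally show ?thesis .
 qed
 have posf: "pos (f i i)" if "i < k" for i
 proof -
  have "PS (hg (g i i))" "pr (hg (g i i)) = g i i"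
   using g_def order_zero_block(2)[OF \<phi>, of "unv i"] cip[OF that] by (auto intro: positive_PS)
  moreover have "ch (f i i) = 0" "st (f i i) = f i i" by (simp_all add: f_def)
  ultimately have "hg (g i i) \<sim> f i i"
   unfolding eqv_iff using fpr[OF that that] by simp
  then show ?thesis by (rule pos_eqv[OF PS_pos[OF \<open>PS (hg (g i i))\<close>]]) fact
 qed
 \<comment> \<open>Partial diagonal unit matrices, for adding up the images of the diagonal units
   until the unit matrix is reached.\<close>
 define D where "D = (\<lambda>m a b::nat. if a = b \<and> a < m then 1 else 0 :: complex)"
 have Dc: "m \<le> k \<Longrightarrow> D m \<in> carrier (Mat k)" for m by (auto simp: D_def matrix_calg_def)
 have "m \<le> k \<Longrightarrow> pr (\<Sum>i<m. f i i) = \<phi> (D m)" for m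
 proof (induction m)
  case 0
  interpret C: bcs complex_calg by (rule complex_calg_bcs)
  interpret M: bcs "Mat k" by (rule C.Mn_bcs)
  have "D 0 = 0 \<odot>\<^bsub>Mat k\<^esub> D 0" by (auto simp: D_def matrix_calg_def)
  then have "\<phi> (D 0) = 0 \<odot> \<phi> (D 0)" "\<phi> (D 0) \<in> carrier A"
   using \<phi> Dc[of 0] unfolding cpc_order_zero_def calg_linear_def by (metis zero_le)+
  then show ?case by simp
 next
  case (Suc m)
  have "D (Suc m) = D m \<oplus>\<^bsub>Mat k\<^esub> rk1 k (unv m) (unv m)" using Suc.prems by (auto simp: D_def matrix_calg_def rk1_def unv_def fun_eq_iff)
  then have "\<phi> (D (Suc m)) = \<phi> (D m) \<oplus> g m m" using \<phi> Dc[of m] Suc.prems unfolding g_def cpc_order_zero_def calg_linear_def by simp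
  then show ?case using Suc by simp
 qed
 moreover have "D k = \<one>\<^bsub>Mat k\<^esub>" by (simp add: D_def matrix_calg_def fun_eq_iff)
 ultimately have pr1: "pr (\<Sum>i<k. f i i) = \<phi> \<one>\<^bsub>Mat k\<^esub>" by simp
 have N1': "N (\<Sum>i<k. f i i) \<le> 1" using nle[OF one_carrier] one_nrm[of k] by (simp add: pr1[symmetric] N_ch_0 f_def ch_sum_0)
 have chf: "ch (f i j) = 0" for i j by (simp add: f_def)
 have "oz k f"
  unfolding oz_def
 proof (intro conjI allI impI N1 N1' pos_sum posf)
  fix i j p l assume ij: "i < k" "j < k" "p < k" "l < k" "j \<noteq> p"
  then show "f i j * f p l \<sim> 0" using order_zero_units(1)[OF \<phi> ij] chf by (simp add: eqv_iff) (simp add: g_def)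
 next
  fix i j l assume ij: "i < k" "j < k" "l < k"
  then show "f i j * f j l \<sim> f i i * f i l" using order_zero_units(2)[OF \<phi> ij(1,2,1,3)] chf by (simp add: eqv_iff) (simp add: g_def)
 qed (auto simp: f_def)
 then show ?thesis using that[of f] pr1 fpr unfolding g_def by blast
qed

lemma calg_iso_complex:
 assumes p: "p \<in> carrier A" "p \<noteq> \<zero>" "p \<otimes> p = p" "star A p = p" and all: "\<And>x. x \<in> carrier A \<Longrightarrow> \<exists>c. x = c \<odot> p"
 shows "calg_iso A complex_calg"
proof -
 have inj: "c = d" if "c \<odot> p = d \<odot> p" for c d
 by (use smult_ldist[OF p(1), of c "- d"] that smult_minus r_neg nrm_smult[OF p(1), of "c - d"] p nrm_eq_0[of p] in simp)
 define f where "f x = (THE c. x = c \<odot> p)" for x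
 have f: "f (c \<odot> p) = c" for c
  unfolding f_def by (rule the_equality) (auto dest: inj)
 have fx: "x = f x \<odot> p" if "x \<in> carrier A" for x using all[OF that] f by auto
 have "bij_betw f (carrier A) UNIV"
  unfolding bij_betw_def by (metis inj_onI fx f p(1) smult_closed UNIV_eq_I image_eqI)
 moreover have "f (x \<oplus> y) = f x + f y" "f (x \<otimes> y) = f x * f y" if xy: "x \<in> carrier A" "y \<in> carrier A" for x y
 proof -
  show "f (x \<oplus> y) = f x + f y" by (metis fx[OF xy(1)] fx[OF xy(2)] smult_ldist[OF p(1)] f)
  have "(f x \<odot> p) \<otimes> (f y \<odot> p) = (f x * f y) \<odot> p" using p by (simp add: smult_mult_left smult_mult_right smult_smult mult.commute)
  then show "f (x \<otimes> y) = f x * f y" using fx[OF xy(1)] fx[OF xy(2)] by (simp add: f)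
 qed
 moreover have "f (star A x) = cnj (f x)" "f (c \<odot> x) = c * f x" if x: "x \<in> carrier A" for x c
 proof -
  show "f (star A x) = cnj (f x)" "f (c \<odot> x) = c * f x" using fx[OF x] f using p star_smult smult_smult by metis+
 qed
 ultimately show ?thesis
  unfolding calg_iso_def by (intro exI[of _ f]) simp
qed

text \<open>The tracial condition is used with \<open>e / 2\<close>: cutting down by
  \<open>e / 2\<close> changes the remainder by at most \<open>e / 2\<close>, so the tolerance form
  follows. If all elements were multiples of a projection, the algebra would be the complex
  numbers.\<close>

lemma tz_A:
 assumes s: "simple_calg A" and t: "tracially_Z_absorbing A"
 shows "tz N"
proof
 fix k :: nat and F :: "'a fa set" and x d and e :: real
 assume k: "k \<ge> 1" and F: "finite F" "\<And>b. b \<in> F \<Longrightarrow> ch b = 0" and x: "PS x" and d: "PS d" "N d > 0" and e: "e > 0"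
 have "pr d \<noteq> \<zero>" using d PS_ch[OF d(1)] N_ch_0[of d] by auto
 moreover have "pr ` F \<subseteq> carrier A" by auto
 ultimately have "\<exists>\<phi>. cpc_order_zero (Mat k) A \<phi> \<and>
     cuntz_le A (cutdown A (pr x \<otimes> pr x \<ominus> pr x \<otimes> \<phi> \<one>\<^bsub>Mat k\<^esub> \<otimes> pr x) (e / 2)) (pr d) \<and>
     (\<forall>z\<in>carrier (Mat k). nrm (Mat k) z \<le> 1 \<longrightarrow>
      (\<forall>b\<in>pr ` F. nrm A (\<phi> z \<otimes> b \<ominus> b \<otimes> \<phi> z) < e / 2))"
  using t[unfolded tracially_Z_absorbing_def, THEN conjunct2, rule_format, of "pr x" "pr d" "pr ` F" "e / 2" k]
   PS_positive[OF x] PS_positive[OF d(1)] F(1) e k by auto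
 then obtain \<phi> where \<phi>: "cpc_order_zero (Mat k) A \<phi>"
     "cuntz_le A (cutdown A (pr x \<otimes> pr x \<ominus> pr x \<otimes> \<phi> \<one>\<^bsub>Mat k\<^esub> \<otimes> pr x) (e / 2)) (pr d)"
     "\<And>z b. z \<in> carrier (Mat k) \<Longrightarrow> nrm (Mat k) z \<le> 1 \<Longrightarrow> b \<in> F \<Longrightarrow> nrm A (\<phi> z \<otimes> pr b \<ominus> pr b \<otimes> \<phi> z) < e / 2" by blast
 obtain f where f: "oz k f" "\<And>i j. i < k \<Longrightarrow> j < k \<Longrightarrow> pr (f i j) = \<phi> (rk1 k (unv i) (unv j))"
  "pr (\<Sum>i<k. f i i) = \<phi> \<one>\<^bsub>Mat k\<^esub>" using order_zero_oz[OF \<phi>(1)] by blast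
 define h where "h = (\<Sum>i<k. f i i)"
 have h: "pos h" "N h \<le> 1" "ch h = 0" using f(1) unfolding oz_def h_def by (auto intro!: ch_sum_0)
 have cx: "ch x = 0" "st x = x" using x by (simp_all add: PS_ch PS_st)
 show "\<exists>f. oz k f \<and> (\<forall>i<k. \<forall>j<k. \<forall>b\<in>F. N (f i j * b - b * f i j) \<le> e) \<and> sub e (x * x - x * (\<Sum>i<k. f i i) * x) d"
 proof (intro exI[of _ f] conjI allI impI ballI)
  fix i j b assume ij: "i < k" "j < k" and b: "b \<in> F"
  have "N (f i j * b - b * f i j) = nrm A (\<phi> (rk1 k (unv i) (unv j)) \<otimes> pr b \<ominus> pr b \<otimes> \<phi> (rk1 k (unv i) (unv j)))"
   using F(2)[OF b] using f(1) ij oz_def by (subst N_ch_0) (simp_all add: f(2)[OF ij, symmetric])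
  also have "... < e / 2"
  proof (rule \<phi>(3)[OF _ _ b])
   have "cip k (unv i) (unv i) = 1" if h: "i < k" for i using h by (simp add: cip_unv) (simp add: unv_def)
   from this[OF ij(1)] this[OF ij(2)] show "nrm (Mat k) (rk1 k (unv i) (unv j)) \<le> 1" by (rule rk1_nrm)
  qed simp
  finally show "N (f i j * b - b * f i j) \<le> e" using e by simp
 next
  define c where "c = x * x - x * h * x"
  have c: "ch c = 0" "st c = c" using cx pos_st[OF h(1)] by (simp_all add: c_def mult.assoc)
  have "pos (1 - h)" using pos_upper[OF pos_st[OF h(1)] h(2)] by simp
  then have "pos (x * (1 - h) * st x)" by (rule pos_conj)
  then have pc: "pos c" by (simp add: cx c_def left_diff_distrib right_diff_distrib)
  have "cuntz_le A (pr (cut c (e / 2))) (pr d)"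
   using \<phi>(2) cutdown_eq[OF c, of "e / 2"] e using cx h c_def f(3)[symmetric] h_def[symmetric] by simp
  then have "cz (cut c (e / 2)) d" using e c pc by (subst (asm) cuntz_le_iff[OF PS_cut d(1)]) (simp_all add: PS_def)
  then have "sub (e / 2 + e / 2) c d" using e using cz_def by (intro sub_eqv[OF _ cut_close[OF pc]]) auto
  then show "sub e (x * x - x * (\<Sum>i<k. f i i) * x) d" by (simp add: c_def h_def)
 qed (rule f(1))
next
 fix b a :: "'a fa" and e :: real assume "PS b" "N b > 0" "ch a = 0" "e > 0"
 then show "\<exists>n u w. N (a - (\<Sum>i<(n::nat). u i * b * w i)) \<le> e" using simple_span[OF s, of b a] unfolding spn_def by blast
next
 fix p assume p: "PS p" "p * p \<sim> p" "N p > 0"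
 show "\<exists>y. ch y = 0 \<and> (\<forall>r. \<not> y \<sim> sc r * p)"
 proof (rule ccontr)
  assume n: "\<not> ?thesis"
  have "calg_iso A complex_calg"
  proof (rule calg_iso_complex[of "pr p"])
   show "pr p \<noteq> \<zero>" using p PS_ch[OF p(1)] N_ch_0[of p] by auto
   show "pr p \<otimes> pr p = pr p" using p(2) PS_ch[OF p(1)] by (simp add: eqv_iff)
   show "star A (pr p) = pr p" using PS_st[OF p(1)] by (metis pr_st)
   fix x assume x: "x \<in> carrier A"
   then obtain r where "gen x \<sim> sc r * p" using n by (metis ch_simps(7))
   then show "\<exists>c. x = c \<odot> pr p" using x by (auto simp: eqv_iff)
  qed simp
  then show False using t unfolding tracially_Z_absorbing_def by blast
 qed
qed

end

section \<open>Passage of the tracial condition to all matrices\<close>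

context lcs
begin

text \<open>Elements outside the kernel of the character can be replaced by multiplying with an approximate unit.\<close>

lemma dsub_ch_0:
 assumes s: "dsub e xs [c]" and c: "PS c" and d: "d > 0"
 obtains v where "\<And>i. ch (v i) = 0" "\<And>i l. i < length xs \<Longrightarrow> l < length xs \<Longrightarrow>
  N (v i * c * st (v l) - (if i = l then xs ! i else 0)) \<le> e + d"
proof -
 obtain cc where "\<forall>i<length xs. \<forall>l<length xs. N ((\<Sum>j<length [c]. cc i j * [c] ! j * st (cc l j)) - (if i = l then xs ! i else 0)) \<le> e"
  using s unfolding dsub_def by blast
 then have cc: "N (cc i 0 * c * st (cc l 0) - (if i = l then xs ! i else 0)) \<le> e" if "i < length xs" "l < length xs" for i l
  using that by simp
 define u where "u = (\<lambda>i. cc i (0::nat))"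
 define B where "B = (\<Sum>i<length xs. N (u i)) + 1"
 have B: "B \<ge> 1" "\<And>i. i < length xs \<Longrightarrow> N (u i) \<le> B"
 proof -
  show "B \<ge> 1" by (simp add: B_def sum_nonneg)
  fix i assume i: "i < length xs"
  then have "N (u i) \<le> (\<Sum>i<length xs. N (u i))" by (intro member_le_sum) auto
  then show "N (u i) \<le> B" by (simp add: B_def)
 qed
 define t where "t = d / (2 * B * B)"
 have t: "t > 0" using d B by (simp add: t_def)
 note au = au[OF PS_pos[OF c] t]
 show ?thesis
 proof (rule that[of "\<lambda>i. u i * au t c"])
  show "ch (u i * au t c) = 0" for i using au(3) PS_ch[OF c] by simp
  fix i l assume il: "i < length xs" "l < length xs"
  have "u i * au t c * c * st (u l * au t c) - u i * c * st (u l) = u i * (au t c * c * au t c - c) * st (u l)"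
   by (simp add: au(1) algebra_simps)
  also have "N ... \<le> B * (t + t) * B" using il B by (intro N_mult3_le au(6)) auto
  also have "... = d" using B by (simp add: t_def)
  finally show "N (u i * au t c * c * st (u l * au t c) - (if i = l then xs ! i else 0)) \<le> e + d"
   using N_trans[OF _ cc[OF il], of _ d] by (simp add: u_def add.commute)
 qed
qed

text \<open>An approximate unit of the sum \<open>a\<close> of all \<open>y * st y\<close> serves
  each \<open>y\<close>, because \<open>(1 - w) * (y * st y) * (1 - w)\<close> is dominated by the
  same expression with \<open>a\<close>.\<close>

lemma approximate_unit:
 assumes G: "finite G" "\<And>y. y \<in> G \<Longrightarrow> ch y = 0" and e: "e > 0"
 obtains w where "PS w" "N w \<le> 1" "\<And>y. y \<in> G \<Longrightarrow> N (y - w * y) \<le> e"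
proof -
 define a where "a = (\<Sum>y\<in>G. y * st y)"
 have a: "pos a" "ch a = 0"
  unfolding a_def using G(2) by (auto intro!: pos_sum pos_star') (induction G rule: infinite_finite_induct, auto)
 \<comment> \<open>The squared error is at most \<open>2 * t\<close>.\<close>
 define t where "t = e\<^sup>2 / 2"
 have t: "t > 0" using e by (simp add: t_def)
 define w where "w = au t a"
 note au = au[OF a(1) t, folded w_def]
 show ?thesis
 proof (rule that)
  show "PS w" "N w \<le> 1" using au(2,3,10) a by (simp_all add: PS_def)
  fix y assume y: "y \<in> G"
  have "a - y * st y = (\<Sum>y\<in>G - {y}. y * st y)"
   unfolding a_def using G(1) y by (simp add: sum_diff1)
  then have le: "pos ((1 - w) * a * st (1 - w) - (1 - w) * (y * st y) * st (1 - w))" by (metis pos_sum pos_star' pos_conj_le)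
  have "(N (y - w * y))\<^sup>2 = N ((1 - w) * (y * st y) * st (1 - w))"
   using N_cstar'[of "(1 - w) * y"] by (simp add: left_diff_distrib right_diff_distrib mult.assoc)
  also have "... \<le> N ((1 - w) * a * st (1 - w))" by (intro pos_mono le pos_conj pos_star')
  also have "... \<le> t * 2"
  proof (rule N_mult_le)
   show "N ((1 - w) * a) \<le> t" using au(4) by (simp add: left_diff_distrib N_minus_commute)
   show "N (st (1 - w)) \<le> 2" using N_diff_le[of 1 1 w 1] au(2) unfolding N_st by simp
  qed
  finally show "N (y - w * y) \<le> e" using e by (simp add: t_def)
 qed
qed

lemma sub_conj: "sub e a b \<Longrightarrow> sub ((N x)\<^sup>2 * e) (x * a * st x) b"
 unfolding sub_def
proof -
 assume "\<exists>v. N (v * b * st v - a) \<le> e"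
 then obtain v where v: "N (v * b * st v - a) \<le> e" by blast
 have "x * v * b * st (x * v) - x * a * st x = x * (v * b * st v - a) * st x" by (simp add: algebra_simps)
 also have "N ... \<le> N x * e * N x" by (intro N_mult3_le v) auto
 finally show "\<exists>v. N (v * b * st v - x * a * st x) \<le> (N x)\<^sup>2 * e" by (intro exI[of _ "x * v"]) (simp add: power2_eq_square mult_ac)
qed

text \<open>The amplification of \<open>u\<close> to a diagonal matrix; it commutes with a matrix as
  well as \<open>u\<close> commutes with its entries.\<close>

definition dg :: "nat \<Rightarrow> 'g fa \<Rightarrow> nat \<Rightarrow> nat \<Rightarrow> 'g fa" where
 "dg m u = (\<lambda>i j. if i = j \<and> i < m then u else 0)"

lemma mm_dg:
 "i < m \<Longrightarrow> mm m (dg m u) x i j = u * x i j" "j < m \<Longrightarrow> mm m x (dg m u) i j = x i j * u"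
 by (simp_all add: mm_def dg_def if_distrib[of "(*) _"] if_distrib[of "\<lambda>x. x * _"] cong: if_cong)

lemma mm_dg_dg: "mm m (dg m u) (dg m v) = dg m (u * v)"
proof (intro ext)
 fix i j show "mm m (dg m u) (dg m v) i j = dg m (u * v) i j"
 proof (cases "i < m")
  case False
  then show ?thesis by (simp add: mm_def dg_def)
 qed (simp add: mm_dg, simp add: dg_def)
qed

lemma mst_dg: "mst (dg m u) = dg m (st u)" by (auto simp: mst_def dg_def fun_eq_iff)

lemma on_dg: "on m (dg m u) \<le> N u"
proof (rule on_least)
 fix x assume x: "cn m x \<le> 1"
 define y where "y = mv m (dg m u) x"
 have y: "y i = u * x i" if "i < m" for i using that by (simp add: y_def mv_def dg_def if_distrib[of "\<lambda>x. x * _"] cong: if_cong)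
 have "pos (rsc ((N u)\<^sup>2) - st u * u)" by (intro pos_upper) (simp_all add: N_cstar)
 then have "pos (\<Sum>i<m. st (x i) * (rsc ((N u)\<^sup>2) - st u * u) * st (st (x i)))" by (intro pos_sum pos_conj)
 also have "(\<Sum>i<m. st (x i) * (rsc ((N u)\<^sup>2) - st u * u) * st (st (x i))) = rsc ((N u)\<^sup>2) * ip m x x - ip m y y"
  by (simp add: ip_def y right_diff_distrib left_diff_distrib sum_subtractf sum_distrib_left mult.assoc sc_left_comm[of "st (x _)"])
 finally have "N (ip m y y) \<le> N (rsc ((N u)\<^sup>2) * ip m x x)" by (intro pos_mono ip_pos)
 then have "(cn m y)\<^sup>2 \<le> (N u)\<^sup>2 * (cn m x)\<^sup>2" by (simp add: cn_sq norm_power)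
 also have "... \<le> (N u)\<^sup>2" using x by (intro mult_left_le) (simp_all add: power_le_one)
 finally show "cn m (mv m (dg m u) x) \<le> N u"
  unfolding y_def by (rule power2_le_imp_le) simp
qed

end

sublocale bcs \<subseteq> I: pcs "Minf A" by (rule MI_pcs)

context bcs
begin

notation I.eqv (infix "\<sim>\<^sub>I" 50)

text \<open>Passes from a matrix of elements of the free algebra over \<open>A\<close> to an element
  of the free algebra over the matrices. The operations are respected only modulo the
  kernel.\<close>

definition L :: "(nat \<Rightarrow> nat \<Rightarrow> 'a fa) \<Rightarrow> (nat \<Rightarrow> nat \<Rightarrow> 'a) fa" where
 "L x = gen (pm x)"

lemma ch_L [simp]: "ch (L x) = 0" by (simp add: L_def)

lemma pm_MI: "x \<in> Xn m \<Longrightarrow> pm x \<in> carrier MI" by (intro Mn_in_MI[of _ m]) (simp add: carrier_Mn)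

lemma pr_L: "x \<in> Xn m \<Longrightarrow> I.pr (L x) = pm x" by (simp add: L_def pm_MI)

lemma Xn_diff: "x \<in> Xn m \<Longrightarrow> y \<in> Xn m \<Longrightarrow> (\<lambda>i j. x i j - y i j) \<in> Xn m" by (auto simp: Xn_def)

lemma pm_ops:
 assumes "x \<in> Xn m" "y \<in> Xn m"
 shows "pm x \<otimes>\<^bsub>MI\<^esub> pm y = pm (mm m x y)" "pm x \<ominus>\<^bsub>MI\<^esub> pm y = pm (\<lambda>i j. x i j - y i j)"
 using assms Xn(1) by (auto simp: MI_mult[of _ m] MI_minus[of _ m] carrier_Mn Mn_minus intro!: Mn_mult)

lemma pm_ops': "pm x \<oplus>\<^bsub>MI\<^esub> pm y = pm (\<lambda>i j. x i j + y i j)" "c \<odot>\<^bsub>MI\<^esub> pm x = pm (\<lambda>i j. sc c * x i j)"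
 "star MI (pm x) = pm (mst x)" by (simp_all add: MI_ops[where n = 0] Mn_add Mn_smult Mn_star)

lemmas L_simps = I.eqv_iff pm_ops' Xn_mm Xn_add Xn_diff Xn_smult Xn_mst
lemmas L_ops = pr_L pm_ops

lemma L_mult: "x \<in> Xn m \<Longrightarrow> y \<in> Xn m \<Longrightarrow> L x * L y \<sim>\<^sub>I L (mm m x y)"
 and L_add: "x \<in> Xn m \<Longrightarrow> y \<in> Xn m \<Longrightarrow> L x + L y \<sim>\<^sub>I L (\<lambda>i j. x i j + y i j)"
 and L_diff: "x \<in> Xn m \<Longrightarrow> y \<in> Xn m \<Longrightarrow> L x - L y \<sim>\<^sub>I L (\<lambda>i j. x i j - y i j)"
 and L_st: "x \<in> Xn m \<Longrightarrow> st (L x) \<sim>\<^sub>I L (mst x)" by (simp_all add: L_simps L_ops[where m = m])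

lemma L_cong: "(\<And>i j. x i j \<sim> y i j) \<Longrightarrow> L x = L y" by (simp add: L_def pm_def eqv_iff)

lemma L_N: "x \<in> Xn m \<Longrightarrow> I.N (L x) = on m x"
proof -
 assume x: "x \<in> Xn m"
 then have "I.N (L x) = nrm MI (pm x)" by (subst I.N_ch_0) (simp_all add: pr_L[of _ m])
 also have "... = on m x" using x Xn(1)[OF x] by (subst MI_nrm[of _ m]) (auto simp: carrier_Mn Mn_nrm)
 finally show ?thesis .
qed

lemma L_le: "x \<in> Xn m \<Longrightarrow> I.N (L x) \<le> (\<Sum>i<m. \<Sum>j<m. N (x i j))"
 unfolding L_N by (rule on_le_sum)

lemma L_le_uniform:
 assumes "x \<in> Xn m" "\<And>i j. i < m \<Longrightarrow> j < m \<Longrightarrow> N (x i j) \<le> t"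
 shows "I.N (L x) \<le> (real m)\<^sup>2 * t"
proof -
 have "(\<Sum>i<m. \<Sum>j<m. N (x i j)) \<le> (\<Sum>i<m. \<Sum>j<m. t)" by (intro sum_mono assms) auto
 then show ?thesis using L_le[OF assms(1)] by (simp add: power2_eq_square)
qed

lemma L_surj:
 assumes "finite F" "\<And>p. p \<in> F \<Longrightarrow> ch p = 0"
 obtains m where "\<And>p. p \<in> F \<Longrightarrow> \<exists>x\<in>Xn m. p \<sim>\<^sub>I L x"
proof -
 have "\<exists>m. \<forall>p\<in>F. \<exists>x\<in>Xn m. p \<sim>\<^sub>I L x" using assms
 proof (induction F rule: finite_induct)
  case (insert p F)
  then obtain m where m: "\<forall>p\<in>F. \<exists>x\<in>Xn m. p \<sim>\<^sub>I L x" by blast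
  obtain l where "I.pr p \<in> carrier (Mn l)" using I.pr_carrier[of p] unfolding MI_carrier by blast
  then obtain x where "x \<in> Xn l" "I.pr p = pm x"
   unfolding carrier_Mn by blast
  then have "x \<in> Xn l" "p \<sim>\<^sub>I L x" using insert.prems by (simp_all add: I.eqv_iff pr_L[of x l])
  then show ?case using m Xn_mono[of _ l "max l m"] Xn_mono[of _ m "max l m"] by (intro exI[of _ "max l m"]) force
 qed simp
 then show ?thesis using that by blast
qed

lemma Xn_dg: "ch u = 0 \<Longrightarrow> dg m u \<in> Xn m" by (auto simp: Xn_def dg_def)

lemma N_L_dg: "ch u = 0 \<Longrightarrow> I.N (L (dg m u)) \<le> N u" by (simp add: L_N[OF Xn_dg] on_dg)

lemma L_dg_mult: "ch u = 0 \<Longrightarrow> ch v = 0 \<Longrightarrow> L (dg m u) * L (dg m v) \<sim>\<^sub>I L (dg m (u * v))"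
 using L_mult[OF Xn_dg Xn_dg, of u v m] by (simp add: mm_dg_dg)

lemma L_dg_cong: "u \<sim> v \<Longrightarrow> L (dg m u) = L (dg m v)" by (intro L_cong) (simp add: dg_def)

lemma L_dg_diff: "ch u = 0 \<Longrightarrow> ch v = 0 \<Longrightarrow> L (dg m u) - L (dg m v) \<sim>\<^sub>I L (dg m (u - v))"
 using L_diff[OF Xn_dg Xn_dg, of u v m] by (simp add: dg_def if_distrib cong: if_cong)

lemma L_dg_st: "ch u = 0 \<Longrightarrow> st (L (dg m u)) \<sim>\<^sub>I L (dg m (st u))" using L_st[OF Xn_dg, of u m] by (simp add: mst_dg)

lemma L_dg_0: "L (dg m 0) \<sim>\<^sub>I 0" using N_L_dg[of 0 m] I.N_nonneg[of "L (dg m 0)"] by (simp add: I.eqv_0_iff del:)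

text \<open>A lift \<open>r\<close> of the square root represents \<open>d\<close> by
  \<open>st r * r\<close>, whose diagonal entries are sums of squares over the columns of
  \<open>r\<close>; if all were null, so would be \<open>r\<close>.\<close>

lemma diag_nonzero:
 assumes d: "I.PS d" "I.N d > 0"
 obtains m z j where "z \<in> Xn m" "d \<sim>\<^sub>I L z" "j < m" "PS (z j j)" "N (z j j) > 0"
proof -
 note rt = I.rt[OF I.PS_pos[OF d(1)]]
 obtain m where "\<exists>x\<in>Xn m. I.rt d \<sim>\<^sub>I L x" using L_surj[of "{I.rt d}"] using rt(4) I.PS_ch[OF d(1)] by auto
 then obtain r where r: "r \<in> Xn m" "I.rt d \<sim>\<^sub>I L r" by blast
 define z where "z = mm m (mst r) r"
 have z: "z \<in> Xn m"
  unfolding z_def by (intro Xn_mm Xn_mst r)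
 have "d \<sim>\<^sub>I st (I.rt d) * I.rt d" using I.eqv_sym[OF rt(2)] by (simp add: rt(1))
 also have "... \<sim>\<^sub>I st (L r) * L r" by (intro I.eqv_mult I.eqv_st r)
 also have "... \<sim>\<^sub>I L z"
  unfolding z_def using r(1) by (simp add: L_simps L_ops[where m = m])
 finally have dz: "d \<sim>\<^sub>I L z" .
 have PS: "PS (z j j)" for j
  unfolding PS_def using Xn(1)[OF z] by (simp add: z_def mm_def mst_def pos_sum pos_star)
 have "\<exists>j<m. N (z j j) > 0"
 proof (rule ccontr)
  assume n: "\<not> ?thesis"
  have r0: "N (r k j) = 0" if kj: "k < m" "j < m" for k j
  proof -
   have "z j j - st (r k j) * r k j = (\<Sum>i\<in>{..<m} - {k}. st (r i j) * r i j)"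
    unfolding z_def mm_def mst_def using kj by (simp add: sum_diff1)
   then have "N (st (r k j) * r k j) \<le> N (z j j)" by (simp add: pos_sum pos_star pos_mono)
   also have "... \<le> 0" using n kj by (metis not_less)
   finally show ?thesis by (simp add: N_cstar)
  qed
  have "I.N (L r) \<le> 0" using L_le[OF r(1)] r0 by simp
  then have "d \<sim>\<^sub>I 0"
   by (metis I.N_nonneg[of "L r"] I.eqv_0_iff antisym I.eqv_trans[OF r(2)] I.eqv_0_multl I.eqv_trans[OF I.eqv_sym[OF rt(2)]])
  then show False using d(2) by (simp add: I.eqv_0_iff)
 qed
 then show ?thesis using that z dz PS by blast
qed

end

locale zs = bcs +
 assumes tz_N: "tz N"
begin

sublocale tz N by (rule tz_N)

lemma L_subI:
 assumes V: "V \<in> Xn m" and z: "z \<in> Xn m" and y: "y \<in> Xn m"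
  and le: "I.N (L (\<lambda>i j. mm m (mm m V z) (mst V) i j - y i j)) \<le> e"
 shows "I.sub e (L y) (L z)"
proof -
 have "L V * L z * st (L V) - L y \<sim>\<^sub>I L (\<lambda>i j. mm m (mm m V z) (mst V) i j - y i j)" using V z y by (simp add: L_simps L_ops[where m = m])
 then show ?thesis
  unfolding I.sub_def using le by (intro exI[of _ "L V"]) (simp add: I.eqv_N)
qed

text \<open>The comparison of \<open>m\<close> copies of \<open>h\<close> with the entry
  \<open>z j j\<close> provides a column \<open>v\<close>; as column \<open>j\<close> of an
  otherwise zero matrix \<open>V\<close> it carries \<open>z\<close> to the diagonal matrix of
  \<open>h\<close>.\<close>

lemma diag_cz:
 assumes z: "z \<in> Xn m" and j: "j < m" and c: "PS (z j j)" and h: "ch h = 0"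
  and le: "mle (copies m h) {#z j j#}"
 shows "I.cz (L (dg m h)) (L z)"
 unfolding I.cz_def
proof (intro allI impI)
 fix e :: real assume e: "e > 0"
 define t where "t = e / (2 * (real m)\<^sup>2)"
 have m: "m > 0" using j by simp
 have t: "t > 0" using e m by (simp add: t_def)
 have "dle (replicate m h) [z j j]" using le mle_mset[of "replicate m h" "[z j j]"] by simp
 then obtain v where v1: "\<And>i. ch (v i) = 0" "\<And>i l. i < length (replicate m h) \<Longrightarrow> l < length (replicate m h) \<Longrightarrow>
   N (v i * z j j * st (v l) - (if i = l then replicate m h ! i else 0)) \<le> t + t" by (metis t dle_def dsub_ch_0[OF _ c t])
 have v: "\<And>i. ch (v i) = 0" "\<And>i l. i < m \<Longrightarrow> l < m \<Longrightarrow> N (v i * z j j * st (v l) - (if i = l then h else 0)) \<le> t + t"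
  using v1(1) v1(2)[simplified length_replicate] by (blast, metis nth_replicate)
 define V where "V = (\<lambda>i b. if i < m \<and> b = j then v i else 0)"
 have V: "V \<in> Xn m" using v(1) j by (auto simp: V_def Xn_def)
 have VzV: "mm m (mm m V z) (mst V) i l = v i * z j j * st (v l)" if "i < m" "l < m" for i l
  using that j by (simp add: mm_def mst_def V_def if_distrib[of st] if_distrib[of "(*) _"] if_distrib[of "\<lambda>x. x * _"] cong: if_cong)
 show "I.sub e (L (dg m h)) (L z)"
 proof (rule L_subI[OF V z Xn_dg[OF h]])
  have "I.N (L (\<lambda>i j. mm m (mm m V z) (mst V) i j - dg m h i j)) \<le> (real m)\<^sup>2 * (t + t)"
  proof (rule L_le_uniform)
   show "(\<lambda>i j. mm m (mm m V z) (mst V) i j - dg m h i j) \<in> Xn m" using V z by (intro Xn_diff Xn_mm Xn_mst Xn_dg h)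
   show "N (mm m (mm m V z) (mst V) i l - dg m h i l) \<le> t + t" if "i < m" "l < m" for i l
    using v(2)[OF that] that by (simp add: VzV) (simp add: dg_def)
  qed
  also have "... = e" using m by (simp add: t_def)
  finally show "I.N (L (\<lambda>i j. mm m (mm m V z) (mst V) i j - dg m h i j)) \<le> e" .
 qed
qed

lemma sub_dg:
 assumes s: "sub e a c" and a: "ch a = 0" and c: "PS c" and d: "d > 0"
 shows "I.sub (e + d) (L (dg m a)) (L (dg m c))"
proof -
 obtain v where v: "\<And>i. ch (v i) = 0" "\<And>i l. i < length [a] \<Longrightarrow> l < length [a] \<Longrightarrow> N (v i * c * st (v l) - (if i = l then [a] ! i else 0)) \<le> e + d"
  by (metis s dsub_single dsub_ch_0[OF _ c d])
 have cc: "ch c = 0" by (rule PS_ch[OF c])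
 show ?thesis
 proof (rule L_subI)
  show "dg m (v 0) \<in> Xn m" "dg m c \<in> Xn m" "dg m a \<in> Xn m" by (intro Xn_dg v a cc)+
  have "(\<lambda>i j. mm m (mm m (dg m (v 0)) (dg m c)) (mst (dg m (v 0))) i j - dg m a i j) = dg m (v 0 * c * st (v 0) - a)"
   by (simp add: mm_dg_dg mst_dg) (simp add: dg_def fun_eq_iff)
  then show "I.N (L (\<lambda>i j. mm m (mm m (dg m (v 0)) (dg m c)) (mst (dg m (v 0))) i j - dg m a i j)) \<le> e + d"
   using v(2)[of 0 0] N_L_dg[of "v 0 * c * st (v 0) - a" m] a cc by simp
 qed
qed

text \<open>The amplified map remains of order zero; the lifts are chosen by \<open>I.hs\<close> to
  keep the star relation exact.\<close>

lemma oz_dg: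
 assumes f: "oz k f"
 obtains F where "I.oz k F" "\<And>i j. i < k \<Longrightarrow> j < k \<Longrightarrow> F i j \<sim>\<^sub>I L (dg m (f i j))"
  "(\<Sum>i<k. F i i) \<sim>\<^sub>I L (dg m (\<Sum>i<k. f i i))"
proof -
 define F where "F = (\<lambda>i j. I.hs (pm (dg m (f i j))) (pm (dg m (f j i))))"
 have fc: "ch (f i j) = 0" "st (f i j) = f j i" "N (f i j) \<le> 1" if "i < k" "j < k" for i j using f that unfolding oz_def by blast+
 have F: "F i j \<sim>\<^sub>I L (dg m (f i j))" if "i < k" "j < k" for i j
 by (simp add: MI_ops(3)[where n = m] Mn_star mst_dg that I.eqv_iff F_def pr_L[OF Xn_dg] fc pm_MI[OF Xn_dg])
 have sum: "(\<Sum>i\<in>J. F i i) \<sim>\<^sub>I L (dg m (\<Sum>i\<in>J. f i i)) \<and> ch (\<Sum>i\<in>J. f i i) = 0" if "finite J" "J \<subseteq> {..<k}" for J using that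
 proof (induction J rule: finite_induct)
  case empty
  then show ?case using I.eqv_sym[OF L_dg_0] by simp
 next
  case (insert j J)
  define s where "s = (\<Sum>i\<in>J. f i i)"
  have s: "ch s = 0" "(\<Sum>i\<in>J. F i i) \<sim>\<^sub>I L (dg m s)" and j: "j < k" using insert by (simp_all add: s_def)
  have "F j j + (\<Sum>i\<in>J. F i i) \<sim>\<^sub>I L (dg m (f j j)) + L (dg m s)" by (rule I.eqv_add[OF F[OF j j] s(2)])
  also have "... \<sim>\<^sub>I L (\<lambda>a b. dg m (f j j) a b + dg m s a b)" using fc(1)[OF j j] s(1) by (intro L_add[where m = m] Xn_dg)
  also have "(\<lambda>a b. dg m (f j j) a b + dg m s a b) = dg m (f j j + s)" by (auto simp: dg_def fun_eq_iff)
  finally show ?case using insert fc(1)[OF j j] by (simp add: s_def)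
 qed
 define h where "h = (\<Sum>i<k. f i i)"
 have h: "pos h" "N h \<le> 1" "ch h = 0" "(\<Sum>i<k. F i i) \<sim>\<^sub>I L (dg m h)" using f sum[of "{..<k}"] unfolding oz_def h_def by auto
 have mult: "F i j * F p l \<sim>\<^sub>I L (dg m (f i j * f p l))" if "i < k" "j < k" "p < k" "l < k" for i j p l
  by (rule I.eqv_trans[OF I.eqv_mult[OF F F] L_dg_mult]) (use that fc in auto)
 have "I.oz k F"
  unfolding I.oz_def
 proof (intro conjI allI impI)
  fix i j assume ij: "i < k" "j < k"
  show "ch (F i j) = 0" "st (F i j) = F j i" by (simp_all add: F_def)
  show "I.N (F i j) \<le> 1" using I.eqv_N[OF F[OF ij]] N_L_dg[OF fc(1)[OF ij], of m] fc(3)[OF ij] by simp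
  fix p l assume pl: "p < k" "l < k" "j \<noteq> p"
  then show "F i j * F p l \<sim>\<^sub>I 0"
   using mult[OF ij pl(1,2)] L_dg_cong[of "f i j * f p l" 0 m] I.eqv_trans[OF _ L_dg_0] using f ij oz_def by simp
 next
  fix i j l assume ij: "i < k" "j < k" "l < k"
  then have "f i j * f j l \<sim> f i i * f i l" using f unfolding oz_def by blast
  then have "L (dg m (f i j * f j l)) = L (dg m (f i i * f i l))" by (rule L_dg_cong)
  then show "F i j * F j l \<sim>\<^sub>I F i i * F i l" using mult[OF ij(1,2,2,3)] mult[OF ij(1,1,1,3)] I.eqv_trans I.eqv_sym by metis
 next
  show "I.N (\<Sum>i<k. F i i) \<le> 1" using I.eqv_N[OF h(4)] N_L_dg[OF h(3), of m] h(2) by simp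
  note rt = rt[OF h(1)]
  define r where "r = rt h"
  have r: "st r = r" "r * r \<sim> h" "ch r = 0" using rt h by (simp_all add: r_def)
  have "st (L (dg m r)) * L (dg m r) \<sim>\<^sub>I L (dg m r) * L (dg m r)" using L_dg_st[OF r(3), of m] r(1) by (intro I.eqv_mult) auto
  also have "... \<sim>\<^sub>I L (dg m (r * r))" by (rule L_dg_mult[OF r(3,3)])
  also have "... = L (dg m h)" by (rule L_dg_cong[OF r(2)])
  also have "... \<sim>\<^sub>I (\<Sum>i<k. F i i)" by (rule I.eqv_sym[OF h(4)])
  finally show "I.pos (\<Sum>i<k. F i i)" by (rule I.pos_eqv[OF I.pos_star]) (simp add: F_def)
 qed
 then show ?thesis using that F h(4) unfolding h_def by blast
qed

text \<open>The tracial condition of \<open>A\<close> is applied to the finitely many entries of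
  \<open>F\<close> and \<open>x\<close>, with an approximate unit \<open>w\<close> of these entries
  in the place of \<open>x\<close>, and with a target so small that its diagonal amplification lies
  below \<open>d\<close>. Amplifying the resulting units and conjugating by \<open>x\<close> gives
  the claim.\<close>

lemma tracial_MI:
 assumes k: "k \<ge> 1" and F: "finite F" "\<And>b. b \<in> F \<Longrightarrow> ch b = 0" and x: "I.PS x" and d: "I.PS d" "I.N d > 0" and e: "e > 0"
 shows "\<exists>f. I.oz k f \<and> (\<forall>i<k. \<forall>j<k. \<forall>b\<in>F. I.N (f i j * b - b * f i j) \<le> e) \<and>
    I.sub e (x * x - x * (\<Sum>i<k. f i i) * x) d"
proof -
 obtain m1 z j where z: "z \<in> Xn m1" "d \<sim>\<^sub>I L z" "j < m1" "PS (z j j)" "N (z j j) > 0" using diag_nonzero[OF d] .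
 obtain m2 where m2: "\<And>p. p \<in> insert x F \<Longrightarrow> \<exists>y\<in>Xn m2. p \<sim>\<^sub>I L y" using L_surj[of "insert x F"] F I.PS_ch[OF x] by auto
 define m where "m = max m1 m2"
 have "\<forall>p\<in>insert x F. \<exists>y. y \<in> Xn m \<and> p \<sim>\<^sub>I L y" using m2 Xn_mono[of _ m2 m] unfolding m_def by fastforce
 then obtain Y where Y: "\<And>p. p \<in> insert x F \<Longrightarrow> Y p \<in> Xn m" "\<And>p. p \<in> insert x F \<Longrightarrow> p \<sim>\<^sub>I L (Y p)" by metis
 have zm: "z \<in> Xn m" "j < m" using z Xn_mono[of z m1 m] by (auto simp: m_def)
 obtain h' where h': "PS h'" "N h' > 0" "mle (copies m h') {#z j j#}" using exists_small[OF z(4,5)] by blast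
 have cz: "I.cz (L (dg m h')) d" using diag_cz[OF zm z(4) PS_ch[OF h'(1)] h'(3)] I.cz_trans[OF _ I.eqv_cz[OF I.eqv_sym[OF z(2)]]] by blast
 define B where "B = I.N x + 1"
 have B: "B \<ge> 1" by (simp add: B_def)
 \<comment> \<open>The 7 is the sum of 3, from three tolerances in the conjugated comparison, and 4,
   from replacing \<open>w' * x\<close> and \<open>x * w'\<close> by \<open>x\<close>.\<close>
 define t where "t = e / (7 * B\<^sup>2 * ((real m)\<^sup>2 + 1))"
 have m1: "(real m)\<^sup>2 + 1 > 0" "B\<^sup>2 > 0" "B\<^sup>2 \<ge> 1" using B by (simp_all add: add_nonneg_pos)
 then have t: "t > 0" using e by (simp add: t_def)
 have te: "7 * B\<^sup>2 * ((real m)\<^sup>2 + 1) * t = e" using m1 by (simp add: t_def)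
 define G where "G = (\<lambda>(p, i, j). Y p i j) ` (insert x F \<times> {..<m} \<times> {..<m})"
 have G: "finite G" "\<And>y. y \<in> G \<Longrightarrow> ch y = 0"
  unfolding G_def using F(1) Xn(1)[OF Y(1)] by (blast, force)
 obtain w where w: "PS w" "N w \<le> 1" "\<And>y. y \<in> G \<Longrightarrow> N (y - w * y) \<le> t" using approximate_unit[OF G t] by blast
 have "\<exists>f. oz k f \<and> (\<forall>i<k. \<forall>j<k. \<forall>b\<in>G. N (f i j * b - b * f i j) \<le> t) \<and>
    sub t (w * w - w * (\<Sum>i<k. f i i) * w) h'" by (intro tracial k G w h' t)
 then obtain f where f: "oz k f" "\<And>i j b. i < k \<Longrightarrow> j < k \<Longrightarrow> b \<in> G \<Longrightarrow> N (f i j * b - b * f i j) \<le> t"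
   "sub t (w * w - w * (\<Sum>i<k. f i i) * w) h'" by blast
 define h where "h = (\<Sum>i<k. f i i)"
 have fc: "ch (f i j) = 0" if "i < k" "j < k" for i j using f(1) that unfolding oz_def by blast
 have h: "pos h" "N h \<le> 1" "ch h = 0" using f(1) unfolding oz_def h_def by (auto intro!: ch_sum_0)
 obtain E where E: "I.oz k E" "\<And>i j. i < k \<Longrightarrow> j < k \<Longrightarrow> E i j \<sim>\<^sub>I L (dg m (f i j))"
  "(\<Sum>i<k. E i i) \<sim>\<^sub>I L (dg m h)" using oz_dg[OF f(1), of m] unfolding h_def by blast
 show ?thesis
 proof (intro exI[of _ E] conjI allI impI ballI E(1))
  fix i j b assume ij: "i < k" "j < k" and b: "b \<in> F"
  define y where "y = Y b"
  have y: "y \<in> Xn m" "b \<sim>\<^sub>I L y" using Y b by (simp_all add: y_def)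
  let ?D = "dg m (f i j)"
  have D: "?D \<in> Xn m" by (rule Xn_dg[OF fc[OF ij]])
  have "E i j * b - b * E i j \<sim>\<^sub>I L ?D * L y - L y * L ?D"
   by (rule I.eqv_diff[OF I.eqv_mult[OF E(2)[OF ij] y(2)] I.eqv_mult[OF y(2) E(2)[OF ij]]])
  also have "... \<sim>\<^sub>I L (\<lambda>a b. mm m ?D y a b - mm m y ?D a b)" using D y(1) by (simp add: L_simps L_ops[where m = m])
  finally have "I.N (E i j * b - b * E i j) = I.N (L (\<lambda>a b. mm m ?D y a b - mm m y ?D a b))" by (rule I.eqv_N)
  also have "... \<le> (real m)\<^sup>2 * t"
  proof (rule L_le_uniform)
   show "(\<lambda>a b. mm m ?D y a b - mm m y ?D a b) \<in> Xn m" by (intro Xn_diff Xn_mm D y)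
   fix a c assume ac: "a < m" "c < m"
   then have "y a c \<in> G"
    unfolding G_def y_def using b by force
   then show "N (mm m ?D y a c - mm m y ?D a c) \<le> t" using f(2)[OF ij] ac by (simp add: mm_dg)
  qed
  also have "... \<le> 7 * B\<^sup>2 * ((real m)\<^sup>2 + 1) * t"
  proof (rule mult_right_mono)
   have "(real m)\<^sup>2 \<le> 1 * ((real m)\<^sup>2 + 1)" by simp
   also have "... \<le> 7 * B\<^sup>2 * ((real m)\<^sup>2 + 1)" using m1 by (intro mult_right_mono) auto
   finally show "(real m)\<^sup>2 \<le> 7 * B\<^sup>2 * ((real m)\<^sup>2 + 1)" .
  qed (use t in simp)
  finally show "I.N (E i j * b - b * E i j) \<le> e" using te by simp
 next
  define H where "H = (\<Sum>i<k. E i i)"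
  define w' where "w' = L (dg m w)"
  have wc: "ch w = 0" "st w = w" using w(1) by (simp_all add: PS_ch PS_st)
  have w': "I.N w' \<le> 1" "st w' \<sim>\<^sub>I w'" using N_L_dg[OF wc(1), of m] w(2) L_dg_st[OF wc(1), of m] wc(2) by (simp_all add: w'_def)
  have H1: "I.N (1 - H) \<le> 2" using E(1) I.N_diff_le[of 1 1 H 1] unfolding I.oz_def H_def by simp
  define s where "s = w * w - w * h * w"
  have "L (dg m s) \<sim>\<^sub>I L (dg m (w * w)) - L (dg m (w * h * w))"
   unfolding s_def using wc by (intro I.eqv_sym[OF L_dg_diff]) auto
  also have "... \<sim>\<^sub>I w' * w' - w' * L (dg m h) * w'"
   unfolding w'_def using wc h by (simp add: L_simps L_ops[where m = m] Xn_dg mm_dg_dg)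
  also have "... \<sim>\<^sub>I w' * w' - w' * H * w'"
   unfolding H_def by (rule I.eqv_diff[OF I.eqv_refl I.eqv_mult[OF I.eqv_mult[OF I.eqv_refl I.eqv_sym[OF E(3)]] I.eqv_refl]])
  also have "w' * w' - w' * H * w' = w' * (1 - H) * w'" by (simp add: right_diff_distrib left_diff_distrib)
  finally have sL: "L (dg m s) \<sim>\<^sub>I w' * (1 - H) * w'" .
  have "I.sub (t + t) (L (dg m s)) (L (dg m h'))" using f(3) unfolding s_def h_def by (intro sub_dg) (use wc h' t in \<open>auto simp: h_def\<close>)
  then have sub1: "I.sub ((I.N x)\<^sup>2 * (t + t + t)) (x * L (dg m s) * st x) d" by (metis I.sub_trans[OF _ cz t] I.sub_conj)
  have stx: "st x = x" by (rule I.PS_st[OF x])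
  have xw: "I.N (x - w' * x) \<le> (real m)\<^sup>2 * t"
  proof -
   define y where "y = Y x"
   have y: "y \<in> Xn m" "x \<sim>\<^sub>I L y" using Y by (simp_all add: y_def)
   have D: "dg m w \<in> Xn m" by (rule Xn_dg[OF wc(1)])
   have "x - w' * x \<sim>\<^sub>I L y - w' * L y" by (rule I.eqv_diff[OF y(2) I.eqv_mult[OF I.eqv_refl y(2)]])
   also have "... \<sim>\<^sub>I L (\<lambda>a b. y a b - mm m (dg m w) y a b)"
    unfolding w'_def using D y(1) by (simp add: L_simps L_ops[where m = m])
   finally have "I.N (x - w' * x) = I.N (L (\<lambda>a b. y a b - mm m (dg m w) y a b))" by (rule I.eqv_N)
   also have "... \<le> (real m)\<^sup>2 * t"
   proof (rule L_le_uniform)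
    show "(\<lambda>a b. y a b - mm m (dg m w) y a b) \<in> Xn m" by (intro Xn_diff Xn_mm D y)
    fix a c assume ac: "a < m" "c < m"
    then have "y a c \<in> G"
     unfolding G_def y_def by force
    then show "N (y a c - mm m (dg m w) y a c) \<le> t" using w(3) ac by (simp add: mm_dg)
   qed
   finally show ?thesis .
  qed
  have xw2: "I.N (x - x * w') \<le> (real m)\<^sup>2 * t"
  proof -
   have "I.N (x - x * w') = I.N (x - x * st w')" by (intro I.eqv_N I.eqv_diff I.eqv_refl I.eqv_mult I.eqv_sym[OF w'(2)])
   also have "x - x * st w' = st (x - w' * x)" by (simp add: stx)
   finally show ?thesis using xw by (simp only: I.N_st)
  qed
  have "I.N (x * L (dg m s) * st x - x * (1 - H) * x) \<le> 4 * B * ((real m)\<^sup>2 * t)"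
  proof -
   have "I.N (x * L (dg m s) * st x - x * (1 - H) * x) = I.N (x * (w' * (1 - H) * w') * x - x * (1 - H) * x)"
    by (simp add: stx I.eqv_diff[OF I.eqv_mult[OF I.eqv_mult[OF I.eqv_refl sL] I.eqv_refl] I.eqv_refl] I.eqv_N)
   also have "x * (w' * (1 - H) * w') * x - x * (1 - H) * x = - (x * (1 - H) * (x - w' * x) + (x - x * w') * (1 - H) * (w' * x))"
    by (simp add: algebra_simps)
   also have "I.N ... \<le> I.N x * 2 * ((real m)\<^sup>2 * t) + ((real m)\<^sup>2 * t) * 2 * (1 * I.N x)"
    unfolding I.N_neg by (intro I.N_add_le I.N_mult_le xw xw2 H1 w' order_refl)
   also have "... = 4 * I.N x * ((real m)\<^sup>2 * t)" by simp
   also have "... \<le> 4 * B * ((real m)\<^sup>2 * t)" using t by (intro mult_right_mono) (auto simp: B_def)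
   finally show ?thesis .
  qed
  then have "I.sub ((I.N x)\<^sup>2 * (t + t + t) + 4 * B * ((real m)\<^sup>2 * t)) (x * (1 - H) * x) d"
   by (intro I.sub_eqv[OF sub1]) (simp add: I.N_minus_commute)
  moreover have "(I.N x)\<^sup>2 * (t + t + t) + 4 * B * ((real m)\<^sup>2 * t) \<le> e"
  proof -
   have "(I.N x)\<^sup>2 * (t + t + t) \<le> B\<^sup>2 * (3 * t)" using t using B_def by simp
   moreover have "B \<le> B\<^sup>2" using B by (simp add: power2_eq_square)
   then have "4 * B * ((real m)\<^sup>2 * t) \<le> 4 * B\<^sup>2 * ((real m)\<^sup>2 * t)" using t by (intro mult_right_mono) auto
   moreover have "B\<^sup>2 * (3 * t) + 4 * B\<^sup>2 * ((real m)\<^sup>2 * t) \<le> 7 * B\<^sup>2 * ((real m)\<^sup>2 + 1) * t"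
   proof -
    have "7 * B\<^sup>2 * ((real m)\<^sup>2 + 1) * t - (B\<^sup>2 * (3 * t) + 4 * B\<^sup>2 * ((real m)\<^sup>2 * t)) = B\<^sup>2 * t * (4 + 3 * (real m)\<^sup>2)"
     by (simp add: algebra_simps)
    also have "... \<ge> 0" using t by simp
    finally show ?thesis by simp
   qed
   ultimately show ?thesis
    unfolding te by linarith
  qed
  ultimately have "I.sub e (x * (1 - H) * x) d" by (rule I.sub_mono)
  then show "I.sub e (x * x - x * (\<Sum>i<k. E i i) * x) d" by (simp add: H_def right_diff_distrib left_diff_distrib)
 qed
qed

text \<open>A nonzero diagonal entry of \<open>b\<close> generates \<open>A\<close>, and elementary
  matrices move the approximations to any position; a general matrix is a finite sum of such
  entries.\<close>

lemma simple_MI: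
 assumes b: "I.PS b" "I.N b > 0" and a: "ch a = 0"
 shows "I.spn b a"
proof -
 obtain m1 z q where z: "z \<in> Xn m1" "b \<sim>\<^sub>I L z" "q < m1" "PS (z q q)" "N (z q q) > 0" using diag_nonzero[OF b] .
 obtain m2 where m2: "\<exists>y\<in>Xn m2. a \<sim>\<^sub>I L y" using L_surj[of "{a}"] a by auto
 define m where "m = max m1 m2"
 obtain y where y: "y \<in> Xn m" "a \<sim>\<^sub>I L y" using m2 Xn_mono[of _ m2 m] by (auto simp: m_def)
 have zm: "z \<in> Xn m" "q < m" using z Xn_mono[of z m1 m] by (auto simp: m_def)
 define S where "S = (\<lambda>(i::nat) (j::nat) (u::'a fa) (k::nat) (l::nat). if k = i \<and> l = j then u else 0)"
 have S: "S i j u \<in> Xn m" if "i < m" "j < m" "ch u = 0" for i j u using that by (auto simp: S_def Xn_def)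
 have SS: "mm m (mm m (S i q u) z) (S q j v) = S i j (u * z q q * v)" for i j u v
  using zm(2) by (auto simp: mm_def S_def fun_eq_iff if_distrib[of "(*) _"] if_distrib[of "\<lambda>x. x * _"] cong: if_cong)
 have one: "I.spn b (L (S i j (y i j)))" if ij: "i < m" "j < m" for i j
  unfolding I.spn_def
 proof (intro allI impI)
  fix e :: real assume e: "e > 0"
  define u where "u = y i j"
  have uc: "ch u = 0" using Xn(1)[OF y(1)] by (simp add: u_def)
  \<comment> \<open>The coefficients provided by simplicity may have scalar parts. Multiplying by
    approximate units of \<open>u\<close> on both sides puts them into the algebra, so that they can
    be entries of matrices.\<close>
  obtain s where s: "PS s" "N s \<le> 1" "N (u - s * u) \<le> e / 4" using approximate_unit[of "{u}" "e / 4"] uc e by auto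
  obtain r where r: "PS r" "N r \<le> 1" "N (st u - r * st u) \<le> e / 4" using approximate_unit[of "{st u}" "e / 4"] uc e by auto
  have rs: "ch s = 0" "ch r = 0" "st r = r" using s r by (simp_all add: PS_ch PS_st)
  have e2: "e / 2 > 0" using e by simp
  obtain n c w where n: "N (u - (\<Sum>l<(n::nat). c l * z q q * w l)) \<le> e / 2" using simple[OF z(4,5) uc e2] by blast
  have "N (u - s * u * r) \<le> e / 4 + e / 4"
  proof -
   have "N (u - u * r) = N (st (u - u * r))" by (simp only: N_st)
   then have ur: "N (u - u * r) \<le> e / 4" using r(3) rs by simp
   have "u - s * u * r = (u - s * u) + s * (u - u * r)" by (simp add: algebra_simps)
   moreover have "N ((u - s * u) + s * (u - u * r)) \<le> e / 4 + 1 * (e / 4)" by (rule N_add_le[OF s(3) N_mult_le[OF s(2) ur]])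
   ultimately show ?thesis by (simp only:)
  qed
  moreover have "N (s * u * r - (\<Sum>l<n. (s * c l) * z q q * (w l * r))) \<le> e / 2"
  proof -
   show ?thesis using N_mult3_le[OF s(2) n r(2)] by (simp add: algebra_simps sum_distrib_left sum_distrib_right)
  qed
  ultimately have "N (u - (\<Sum>l<n. (s * c l) * z q q * (w l * r))) \<le> e / 4 + e / 4 + e / 2" by (rule N_trans)
  then have n2: "N (u - (\<Sum>l<n. (s * c l) * z q q * (w l * r))) \<le> e" by simp
  define T where "T = (\<lambda>J. \<Sum>l\<in>J. (s * c l) * z q q * (w l * r))"
  have Tc: "ch (T J) = 0" for J
   unfolding T_def using rs by (intro ch_sum_0) simp
  have "(\<Sum>l\<in>J. L (S i q (s * c l)) * b * L (S q j (w l * r))) \<sim>\<^sub>I L (S i j (T J))" if "finite J" for J using that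
  proof (induction J rule: finite_induct)
   case empty
   have "L (S i j 0) \<sim>\<^sub>I 0" using L_le_uniform[OF S[OF ij, of 0], of 0] I.N_nonneg[of "L (S i j 0)"]
    unfolding I.eqv_0_iff by (intro antisym) (auto simp: S_def)
   then show ?case by (simp add: T_def I.eqv_sym)
  next
   case (insert l J)
   have "L (S i q (s * c l)) * b * L (S q j (w l * r)) \<sim>\<^sub>I L (S i q (s * c l)) * L z * L (S q j (w l * r))"
    by (rule I.eqv_mult[OF I.eqv_mult[OF I.eqv_refl z(2)] I.eqv_refl])
   also have "... \<sim>\<^sub>I L (mm m (mm m (S i q (s * c l)) z) (S q j (w l * r)))" using ij zm rs by (simp add: L_simps L_ops[where m = m] S)
   finally have "L (S i q (s * c l)) * b * L (S q j (w l * r)) + (\<Sum>l\<in>J. L (S i q (s * c l)) * b * L (S q j (w l * r)))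
     \<sim>\<^sub>I L (S i j ((s * c l) * z q q * (w l * r))) + L (S i j (T J))"
    unfolding SS by (intro I.eqv_add insert)
   also have "... \<sim>\<^sub>I L (\<lambda>a d. S i j ((s * c l) * z q q * (w l * r)) a d + S i j (T J) a d)"
    using ij rs Tc by (intro L_add[where m = m] S) auto
   also have "(\<lambda>a d. S i j ((s * c l) * z q q * (w l * r)) a d + S i j (T J) a d) = S i j (T (insert l J))"
    using insert by (auto simp: S_def T_def fun_eq_iff)
   finally show ?case using insert by simp
  qed
  from this[of "{..<n}"]
  have "L (S i j u) - (\<Sum>l<n. L (S i q (s * c l)) * b * L (S q j (w l * r))) \<sim>\<^sub>I L (S i j u) - L (S i j (T {..<n}))"
   by (intro I.eqv_diff) auto
  also have "... \<sim>\<^sub>I L (\<lambda>a d. S i j u a d - S i j (T {..<n}) a d)" using ij uc Tc by (intro L_diff[where m = m] S) auto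
  also have "(\<lambda>a d. S i j u a d - S i j (T {..<n}) a d) = S i j (u - T {..<n})" by (auto simp: S_def fun_eq_iff)
  finally have "I.N (L (S i j u) - (\<Sum>l<n. L (S i q (s * c l)) * b * L (S q j (w l * r)))) = I.N (L (S i j (u - T {..<n})))"
   by (rule I.eqv_N)
  also have "... \<le> (\<Sum>k<m. \<Sum>l<m. N (S i j (u - T {..<n}) k l))" using ij uc Tc by (intro L_le S) auto
  also have "... = (\<Sum>k<m. if k = i then N (u - T {..<n}) else 0)"
   using ij by (intro sum.cong refl) (simp add: S_def if_distrib[of N] cong: if_cong)
  also have "... = N (u - T {..<n})" using ij by simp
  also have "... \<le> e" using n2 by (simp add: T_def)
  finally show "\<exists>n u w. I.N (L (S i j (y i j)) - (\<Sum>l<(n::nat). u l * b * w l)) \<le> e"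
   unfolding u_def by (intro exI[of _ n] exI[of _ "\<lambda>l. L (S i q (s * c l))"] exI[of _ "\<lambda>l. L (S q j (w l * r))"])
 qed
 have "I.spn b (L (\<lambda>k l. if (k, l) \<in> J then y k l else 0))" if "finite J" "J \<subseteq> {..<m} \<times> {..<m}" for J using that
 proof (induction J rule: finite_induct)
  case empty
  have "L (\<lambda>k l. 0) \<sim>\<^sub>I 0" using L_le_uniform[OF Xn_zero, of m 0] I.N_nonneg[of "L (\<lambda>k l. 0)"]
   unfolding I.eqv_0_iff by (intro antisym) auto
  then show ?case using I.spn_eqv[OF I.spn_0 I.eqv_sym] by simp
 next
  case (insert p J)
  obtain i j where p: "p = (i, j)" by (cases p)
  let ?y = "\<lambda>J k l. if (k, l) \<in> J then y k l else 0"
  have ij: "i < m" "j < m" using insert p by auto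
  have yJ: "?y J \<in> Xn m" for J using y(1) by (auto simp: Xn_def)
  have "L (S i j (y i j)) + L (?y J) \<sim>\<^sub>I L (\<lambda>k l. S i j (y i j) k l + ?y J k l)"
   using Xn(1)[OF y(1)] by (intro L_add[where m = m] S ij yJ) auto
  also have "(\<lambda>k l. S i j (y i j) k l + ?y J k l) = ?y (insert p J)" using insert p by (auto simp: S_def fun_eq_iff)
  finally have e: "L (S i j (y i j)) + L (?y J) \<sim>\<^sub>I L (?y (insert p J))" .
  show ?case using I.spn_eqv[OF I.spn_add[OF one[OF ij]] e] insert by blast
 qed
 from this[of "{..<m} \<times> {..<m}"] have "I.spn b (L (\<lambda>k l. if (k, l) \<in> {..<m} \<times> {..<m} then y k l else 0))" by simp
 also have "(\<lambda>k l. if (k, l) \<in> {..<m} \<times> {..<m} then y k l else 0) = y" using Xn(2)[OF y(1)] by (auto simp: fun_eq_iff)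
 finally show ?thesis by (rule I.spn_eqv[OF _ I.eqv_sym[OF y(2)]])
qed

text \<open>Nonzero matrices supported at two different diagonal positions cannot both be multiples
  of the same \<open>p\<close>: the first forces the second diagonal entry of \<open>p\<close> to
  vanish.\<close>

lemma not_scalars_MI:
 assumes p: "I.PS p" "I.N p > 0"
 shows "\<exists>y. ch y = 0 \<and> (\<forall>r. \<not> y \<sim>\<^sub>I sc r * p)"
proof (rule ccontr)
 assume "\<not> ?thesis"
 then have all: "\<exists>r. y \<sim>\<^sub>I sc r * p" if "ch y = 0" for y using that by blast
 obtain m z j where z: "z \<in> Xn m" "p \<sim>\<^sub>I L z" "j < m" "PS (z j j)" "N (z j j) > 0" using diag_nonzero[OF p] .
 define u where "u = z j j"
 define S where "S = (\<lambda>(i::nat) (k::nat) (l::nat). if k = i \<and> l = i then u else 0)"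
 have u: "pr u \<noteq> \<zero>" "ch u = 0" using z(5) PS_ch[OF z(4)] N_ch_0[of u] by (auto simp: u_def)
 have S: "S i \<in> Xn 2" if "i < 2" for i using that u by (auto simp: S_def Xn_def)
 obtain r0 r1 where r: "L (S 0) \<sim>\<^sub>I sc r0 * p" "L (S 1) \<sim>\<^sub>I sc r1 * p" using all[of "L (S 0)"] all[of "L (S 1)"] by auto
 have e: "pm (S 0) = r0 \<odot>\<^bsub>MI\<^esub> I.pr p" "pm (S 1) = r1 \<odot>\<^bsub>MI\<^esub> I.pr p" using r S[of 0] S[of 1] by (simp_all add: I.eqv_iff pr_L[of _ 2])
 then have e: "pm (S 0) k l = r0 \<odot> I.pr p k l" "pm (S 1) k l = r1 \<odot> I.pr p k l" for k l
  by (simp_all add: MI_ops(2)[where n = 0] matrix_calg_def)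
 have pc: "I.pr p k l \<in> carrier A" for k l using I.pr_carrier[of p] by (auto simp: MI_carrier matrix_calg_def)
 have "r0 \<noteq> 0" using e(1)[of 0 0] u pc by (auto simp: pm_def S_def)
 moreover have "r0 \<odot> I.pr p 1 1 = \<zero>" using e(1)[of 1 1] by (simp add: pm_def S_def)
 ultimately have "I.pr p 1 1 = \<zero>" using smult_smult[OF pc, of "1 / r0" r0 1 1] pc by simp
 then show False using u using e(2)[of 1 1] pm_def S_def by auto
qed

sublocale I: tz I.N
proof
 fix k :: nat and F :: "(nat \<Rightarrow> nat \<Rightarrow> 'a) fa set" and x d and e :: real
 assume "k \<ge> 1" "finite F" "\<And>b. b \<in> F \<Longrightarrow> ch b = 0" "I.PS x" "I.PS d" "I.N d > 0" "e > 0"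
 then show "\<exists>f. I.oz k f \<and> (\<forall>i<k. \<forall>j<k. \<forall>b\<in>F. I.N (f i j * b - b * f i j) \<le> e) \<and>
    I.sub e (x * x - x * (\<Sum>i<k. f i i) * x) d" by (rule tracial_MI)
next
 fix b a :: "(nat \<Rightarrow> nat \<Rightarrow> 'a) fa" and e :: real
 assume "I.PS b" "I.N b > 0" "ch a = 0" "e > 0"
 then show "\<exists>n u w. I.N (a - (\<Sum>i<(n::nat). u i * b * w i)) \<le> e" using simple_MI[of b a] unfolding I.spn_def by blast
next
 fix p assume "I.PS p" "I.N p > 0"
 then show "\<exists>y. ch y = 0 \<and> (\<forall>r. \<not> y \<sim>\<^sub>I sc r * p)" by (rule not_scalars_MI)
qed

end

section \<open>The Cuntz semigroup\<close>

context lcs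
begin

text \<open>Completing the square gives \<open>p \<le> p * p / e + e / 4\<close>, so the cut of
  \<open>p\<close> at \<open>e\<close> lies below \<open>p * p\<close>, for every
  \<open>e\<close>.\<close>

lemma cz_square:
 assumes p: "pos p"
 shows "cz p (p * p)"
proof (rule cz_sub_close)
 fix e :: real assume e: "e > 0"
 define s :: "real \<Rightarrow> 'g fa" where "s c = rsc c" for c
 have s: "s a * (s b * z) = s (a * b) * z" "s a * s b = s (a * b)" "z * s a = s a * z" for a b z
  unfolding s_def by (simp_all add: sc_mult mult.assoc sc_comm[of _ z, symmetric])
 have "s (1 / 2) * p + s (1 / 2) * p = (s (1 / 2) + s (1 / 2)) * p" by (simp add: distrib_right)
 also have "s (1 / 2) + s (1 / 2) = 1" by (simp add: s_def sc_add[symmetric])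
 finally have half: "s (1 / 2) * p + s (1 / 2) * p = p" by simp
 have "pos (s (1 / e) * ((p - s (e / 2)) * (p - s (e / 2))))"
  unfolding s_def using e by (intro pos_scale pos_sq) (simp_all add: pos_st[OF p])
 also have "s (1 / e) * ((p - s (e / 2)) * (p - s (e / 2))) = s (1 / e) * (p * p) + s (e / 4) - (s (1 / 2) * p + s (1 / 2) * p)"
  using e by (simp add: right_diff_distrib left_diff_distrib s(1,2) s(3)[of p])
 finally have le: "pos (s (1 / e) * (p * p) + s (e / 4) - p)" by (simp only: half)
 have "pos (s (1 / e) * (p * p))"
  unfolding s_def using e by (intro pos_scale pos_sq pos_st[OF p]) simp
 then have "cz (cut p e) (s (1 / e) * (p * p))" using pos_le_cut_cz[OF p _ le[unfolded s_def(1)[of "e / 4"]]] e by simp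
 then have "cz (cut p e) (p * p)"
  unfolding s_def by (rule cz_trans[OF _ scale_cz]) (use e in simp)
 then show "\<exists>a'. N (p - a') \<le> e \<and> cz a' (p * p)" using cut_close[OF p] e by (meson less_imp_le)
qed

text \<open>The square of \<open>z * st z\<close> is a conjugate of \<open>st z * z\<close>.\<close>

lemma cz_star_swap: "cz (z * st z) (st z * z)" by (metis cz_square[OF pos_star'] mult.assoc cz_trans[OF _ conj_cz])

end

section \<open>The Cuntz semigroup through multisets of positive elements\<close>

context bcs
begin

text \<open>The middle factor may be of larger size and have a scalar part; rows of \<open>a\<close>
  and columns of \<open>b\<close> still confine the product to size \<open>n\<close>.\<close>

lemma corner:
 assumes x: "x \<in> Xn n" "a \<sim>\<^sub>I L x" and y: "y \<in> Xn n" "b \<sim>\<^sub>I L y"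
 shows "I.pr (a * c * b) \<in> carrier (Mn n)"
proof -
 define c' where "c' = c - sc (ch c)"
 have "ch c' = 0" by (simp add: c'_def)
 then obtain m0 where "\<exists>z\<in>Xn m0. c' \<sim>\<^sub>I L z" using L_surj[of "{c'}"] by auto
 then have m0: "\<exists>z\<in>Xn m0. c - sc (ch c) \<sim>\<^sub>I L z" by (simp only: c'_def)
 define m where "m = max n m0"
 obtain z where z: "z \<in> Xn m" "c - sc (ch c) \<sim>\<^sub>I L z" using m0 Xn_mono[of _ m0 m] by (auto simp: m_def)
 have xy: "x \<in> Xn m" "y \<in> Xn m" using x y Xn_mono[of _ n m] by (auto simp: m_def)
 define p where "p = mm m (mm m x z) y"
 define q where "q = (\<lambda>i j. sc (ch c) * mm m x y i j)"
 have pq: "p \<in> Xn m" "q \<in> Xn m"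
  unfolding p_def q_def by (intro Xn_smult Xn_mm xy z)+
 have "a * c * b = a * (c - sc (ch c)) * b + sc (ch c) * (a * b)"
  by (simp add: right_diff_distrib left_diff_distrib mult.assoc sc_left_comm)
 also have "... \<sim>\<^sub>I L x * L z * L y + sc (ch c) * (L x * L y)"
  by (intro I.eqv_add I.eqv_mult[OF I.eqv_mult[OF x(2) z(2)] y(2)] I.eqv_mult[OF I.eqv_refl I.eqv_mult[OF x(2) y(2)]])
 also have "... \<sim>\<^sub>I L (\<lambda>i j. p i j + q i j)"
  unfolding p_def q_def using xy z by (simp add: L_simps L_ops[where m = m])
 finally have "I.pr (a * c * b) = pm (\<lambda>i j. p i j + q i j)" using pq by (simp add: I.eqv_iff pr_L[of _ m] Xn_add)
 moreover have "(\<lambda>i j. p i j + q i j) \<in> Xn n"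
 by (use mm_def Xn(2)[OF y(1)] Xn(2)[OF x(1)] p_def q_def Xn(1)[OF pq(1)] Xn(1)[OF pq(2)] Xn_def in simp)
 ultimately show ?thesis by (auto simp: carrier_Mn)
qed

lemma Mn_carrier_L: "a \<in> carrier (Mn n) \<Longrightarrow> I.pr p = a \<Longrightarrow> ch p = 0 \<Longrightarrow> \<exists>x\<in>Xn n. p \<sim>\<^sub>I L x"
 unfolding carrier_Mn by (auto simp: I.eqv_iff pr_L)

text \<open>Implementing elements of the form \<open>x * w * y\<close> stay within the size of
  \<open>x\<close> and \<open>y\<close>, so comparison does not depend on the size once both
  fit.\<close>

lemma minf_cuntz_le_iff:
 assumes x: "I.PS x" and y: "I.PS y"
 shows "minf_cuntz_le A (I.pr x) (I.pr y) \<longleftrightarrow> I.cz x y"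
proof -
 obtain n where n: "I.pr x \<in> carrier (Mn n)" "I.pr y \<in> carrier (Mn n)" using MI_obtain2[OF I.pr_carrier I.pr_carrier] .
 have "cuntz_le (Mn m) (I.pr x) (I.pr y) \<longleftrightarrow> I.cz x y" if "m \<ge> n" for m
 proof -
  interpret M: bcs "Mn m" by (rule Mn_bcs)
  have m: "I.pr x \<in> carrier (Mn m)" "I.pr y \<in> carrier (Mn m)" using n carrier_Mn_mono[OF that] by blast+
  have eq: "nrm (Mn m) (I.pr x \<ominus>\<^bsub>Mn m\<^esub> v \<otimes>\<^bsub>Mn m\<^esub> I.pr y \<otimes>\<^bsub>Mn m\<^esub> star (Mn m) v) = nrm MI (I.pr x \<ominus>\<^bsub>MI\<^esub> v \<otimes>\<^bsub>MI\<^esub> I.pr y \<otimes>\<^bsub>MI\<^esub> star MI v)"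
   if "v \<in> carrier (Mn m)" for v using that m by (simp add: MI_mult[of _ m] MI_ops(3)[where n = m] MI_minus[of _ m] MI_nrm[of _ m])
  show ?thesis
  proof
   assume "cuntz_le (Mn m) (I.pr x) (I.pr y)"
   then have "cuntz_le MI (I.pr x) (I.pr y)"
    unfolding cuntz_le_def using eq Mn_in_MI by (metis (no_types, lifting) ext)
   then show "I.cz x y" using I.cuntz_le_iff[OF x y] by simp
  next
   assume cz: "I.cz x y"
   show "cuntz_le (Mn m) (I.pr x) (I.pr y)"
   proof (rule M.cuntz_leI[OF m])
    fix e :: real assume "e > 0"
    then obtain w where w: "I.N (x * w * y * y * st (x * w * y) - x) \<le> e" using I.cz_corner[OF x y cz] by blast
    have "I.pr (x * w * y) \<in> carrier (Mn m)"
     using Mn_carrier_L[OF m(1) refl I.PS_ch[OF x]] Mn_carrier_L[OF m(2) refl I.PS_ch[OF y]] corner by blast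
    then show "\<exists>v\<in>carrier (Mn m). nrm (Mn m) (I.pr x \<ominus>\<^bsub>Mn m\<^esub> v \<otimes>\<^bsub>Mn m\<^esub> I.pr y \<otimes>\<^bsub>Mn m\<^esub> star (Mn m) v) \<le> e"
     using w I.nrm_conj[OF I.PS_ch[OF x] I.PS_ch[OF y], of "x * w * y"] I.PS_ch[OF x]
     by (intro bexI[of _ "I.pr (x * w * y)"]) (simp_all add: eq del:)
   qed
  qed
 qed
 then have "\<forall>\<^sub>F m in sequentially. cuntz_le (Mn m) (I.pr x) (I.pr y) \<longleftrightarrow> I.cz x y" by (intro eventually_sequentiallyI)
 then show ?thesis by (simp add: minf_cuntz_le_def eventually_subst)
qed

text \<open>Shifting a matrix along the diagonal, and its rows only.\<close>

definition sh :: "nat \<Rightarrow> (nat \<Rightarrow> nat \<Rightarrow> 'a fa) \<Rightarrow> nat \<Rightarrow> nat \<Rightarrow> 'a fa" where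
 "sh m y = (\<lambda>i j. if m \<le> i \<and> m \<le> j then y (i - m) (j - m) else 0)"

definition rs :: "nat \<Rightarrow> (nat \<Rightarrow> nat \<Rightarrow> 'a fa) \<Rightarrow> nat \<Rightarrow> nat \<Rightarrow> 'a fa" where
 "rs m y = (\<lambda>i j. if m \<le> i then y (i - m) j else 0)"

lemma Xn_sh: "y \<in> Xn n \<Longrightarrow> sh m y \<in> Xn (m + n)" and Xn_rs: "y \<in> Xn n \<Longrightarrow> rs m y \<in> Xn (m + n)" by (auto simp: Xn_def sh_def rs_def)

lemma mm_extend: "x \<in> Xn n \<Longrightarrow> n \<le> k \<Longrightarrow> mm k x y = mm n x y"
 unfolding mm_def fun_eq_iff by (intro allI sum.mono_neutral_right) (auto simp: Xn(2))

lemma rs_mult: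
 assumes "u \<in> Xn n"
 shows "mm (m + n) (rs m u) y = rs m (mm n u y)" "mm (m + n) (rs m u) (mst (rs m v)) = sh m (mm n u (mst v))"
proof -
 have 1: "mm (m + n) (rs m u) y = rs m (mm n u y)" for y
 proof (intro ext)
  fix i j
  have "mm (m + n) (rs m u) y i j = (if m \<le> i then mm (m + n) u y (i - m) j else 0)" by (simp add: mm_def rs_def)
  then show "mm (m + n) (rs m u) y i j = rs m (mm n u y) i j" using mm_extend[OF assms, of "m + n" y] by (simp add: rs_def)
 qed
 show "mm (m + n) (rs m u) y = rs m (mm n u y)" by (rule 1)
 show "mm (m + n) (rs m u) (mst (rs m v)) = sh m (mm n u (mst v))"
  unfolding 1 by (auto simp: rs_def sh_def mm_def mst_def fun_eq_iff)
qed

lemma rs_mult':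
 assumes u: "u \<in> Xn n"
 shows "mm (m + n) (mst (rs m u)) (rs m v) = mm n (mst u) v"
proof (intro ext)
 fix i j
 show "mm (m + n) (mst (rs m u)) (rs m v) i j = mm n (mst u) v i j" by (simp add: sum_lessThan_add mm_def rs_def mst_def)
qed

text \<open>Shifting the rows of the square root of \<open>b\<close> gives an element whose product
  with its adjoint is the shifted matrix in one order and \<open>b\<close> in the other;
  \<open>cz_star_swap\<close> then compares them.\<close>

lemma shift:
 assumes b: "I.PS b" and y: "y \<in> Xn n" "b \<sim>\<^sub>I L y"
 shows "I.PS (I.hg (pm (sh m y)))" "I.hg (pm (sh m y)) \<sim>\<^sub>I L (sh m y)" "I.cz (L (sh m y)) b" "I.cz b (L (sh m y))"
proof -
 have chb: "ch b = 0" by (rule I.PS_ch[OF b])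
 note rt = I.rt[OF I.PS_pos[OF b]]
 define r where "r = I.rt b"
 have r: "st r = r" "r * r \<sim>\<^sub>I b" "ch r = 0" using rt chb by (simp_all add: r_def)
 obtain k0 where k0: "\<exists>x\<in>Xn k0. r \<sim>\<^sub>I L x" using L_surj[of "{r}"] r(3) by auto
 define k where "k = max n k0"
 obtain x where x: "x \<in> Xn k" "r \<sim>\<^sub>I L x" using k0 Xn_mono[of _ k0 k] by (auto simp: k_def)
 have yk: "y \<in> Xn k" using y Xn_mono[of y n k] by (simp add: k_def)
 let ?Z = "L (rs m x)"
 have Z: "rs m x \<in> Xn (m + k)" "mst (rs m x) \<in> Xn (m + k)" by (intro Xn_mst Xn_rs x)+
 have "L (mm k x (mst x)) \<sim>\<^sub>I L x * st (L x)" using x(1) by (simp add: L_simps L_ops[where m = k])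
 also have "... \<sim>\<^sub>I r * st r" by (intro I.eqv_mult I.eqv_st I.eqv_sym[OF x(2)])
 also have "r * st r = r * r" by (simp add: r)
 also have "r * r \<sim>\<^sub>I L y" by (rule I.eqv_trans[OF r(2) y(2)])
 finally have "L (mm k x (mst x)) \<sim>\<^sub>I L y" .
 then have "pm (sh m (mm k x (mst x))) = pm (sh m y)"
  using x yk I.eqv_iff pr_L[of _ k] Xn_mm Xn_mst by (auto simp: pm_def sh_def fun_eq_iff)
 then have ysh: "L (sh m (mm k x (mst x))) = L (sh m y)" by (simp add: L_def)
 have "?Z * st ?Z \<sim>\<^sub>I L (mm (m + k) (rs m x) (mst (rs m x)))" using Z by (simp add: L_simps L_ops[where m = "m + k"])
 then have sZ: "?Z * st ?Z \<sim>\<^sub>I L (sh m y)" by (simp only: rs_mult(2)[OF x(1)] ysh)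
 have "I.PS (?Z * st ?Z)" by (rule I.PS_star) simp
 then have "positive_elem MI (I.pr (?Z * st ?Z))" by (rule I.PS_positive)
 also have "I.pr (?Z * st ?Z) = pm (sh m y)" using sZ pr_L[OF Xn_sh[OF y(1)]] by (simp add: I.eqv_iff)
 finally have p: "positive_elem MI (pm (sh m y))" .
 then show "I.PS (I.hg (pm (sh m y)))" by (rule I.positive_PS)
 show "I.hg (pm (sh m y)) \<sim>\<^sub>I L (sh m y)" using p pr_L[OF Xn_sh[OF y(1)]] by (simp add: I.eqv_iff)
 have "st ?Z * ?Z \<sim>\<^sub>I L (mm (m + k) (mst (rs m x)) (rs m x))" using Z by (simp add: L_simps L_ops[where m = "m + k"])
 also have "... \<sim>\<^sub>I st (L x) * L x"
  unfolding rs_mult'[OF x(1)] using x(1) by (simp add: L_simps L_ops[where m = k])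
 also have "... \<sim>\<^sub>I st r * r" by (intro I.eqv_mult I.eqv_st I.eqv_sym[OF x(2)])
 also have "st r * r = r * r" by (simp add: r)
 also have "r * r \<sim>\<^sub>I b" by (rule r(2))
 finally have bZ: "st ?Z * ?Z \<sim>\<^sub>I b" .
 show "I.cz (L (sh m y)) b" using I.cz_trans[OF I.cz_trans[OF I.eqv_cz[OF I.eqv_sym[OF sZ]] I.cz_star_swap] I.eqv_cz[OF bZ]] .
 show "I.cz b (L (sh m y))"
  using I.cz_trans[OF I.cz_trans[OF I.eqv_cz[OF I.eqv_sym[OF bZ]] I.cz_star_swap[of "st ?Z", unfolded st_st]] I.eqv_cz[OF sZ]] .
qed

text \<open>The direct sum is realized as \<open>a + s\<close> with \<open>s\<close> a shifted copy
  of \<open>b\<close>, orthogonal to \<open>a\<close>.\<close>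

lemma dsum_class:
 assumes a: "I.PS a" and b: "I.PS b" and m: "I.pr a \<in> carrier (Mn m)"
 obtains c where "I.PS c" "I.pr c = dsum A m (I.pr a) (I.pr b)" "I.mle {#c#} {#a, b#}" "I.mle {#a, b#} {#c#}"
proof -
 obtain x where x: "x \<in> Xn m" "a \<sim>\<^sub>I L x" using Mn_carrier_L[OF m refl I.PS_ch[OF a]] by blast
 obtain n where n: "I.pr b \<in> carrier (Mn n)" using I.pr_carrier[of b] unfolding MI_carrier by blast
 obtain y where y: "y \<in> Xn n" "b \<sim>\<^sub>I L y" using Mn_carrier_L[OF n refl I.PS_ch[OF b]] by blast
 define s where "s = I.hg (pm (sh m y))"
 note shift = shift[OF b y, of m, folded s_def]
 have xm: "x \<in> Xn (m + n)" "sh m y \<in> Xn (m + n)" using x y Xn_mono[of x m "m + n"] Xn_sh by auto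
 have "a * s \<sim>\<^sub>I L x * L (sh m y)" by (rule I.eqv_mult[OF x(2) shift(2)])
 also have "... \<sim>\<^sub>I L (mm (m + n) x (sh m y))" by (rule L_mult[OF xm])
 also have "mm (m + n) x (sh m y) = (\<lambda>i j. 0)"
  unfolding mm_def sh_def fun_eq_iff using Xn(2)[OF x(1)] by (auto intro!: sum.neutral)
 also have "L (\<lambda>i j. 0) \<sim>\<^sub>I 0" using L_dg_0[of 0] by (simp add: dg_def)
 finally have o: "a * s \<sim>\<^sub>I 0" .
 show ?thesis
 proof (rule that[of "a + s"])
  show "I.PS (a + s)" using a shift(1) by (simp add: I.PS_def I.pos_add)
  have "a + s \<sim>\<^sub>I L (\<lambda>i j. x i j + sh m y i j)" by (rule I.eqv_trans[OF I.eqv_add[OF x(2) shift(2)] L_add[OF xm]])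
  then have pas: "I.pr (a + s) = pm (\<lambda>i j. x i j + sh m y i j)" using pr_L[OF Xn_add[OF xm]] unfolding I.eqv_iff by metis
  show "I.pr (a + s) = dsum A m (I.pr a) (I.pr b)"
   unfolding pas using Xn(2)[OF x(1)] using x y I.eqv_iff pr_L[of _ m] pr_L[of _ n] by (auto simp: dsum_def pm_def sh_def fun_eq_iff)
  have sb: "I.mle {#a, s#} {#a, b#}" "I.mle {#a, b#} {#a, s#}"
   using I.mle_add[of "{#a#}" "{#a#}" "{#s#}" "{#b#}"] I.mle_add[of "{#a#}" "{#a#}" "{#b#}" "{#s#}"]
   using I.cz_trans[OF I.eqv_cz[OF shift(2)] shift(3)] I.cz_trans[OF shift(4) I.eqv_cz[OF I.eqv_sym[OF shift(2)]]] by (simp_all add: I.mle_single add_mset_commute)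
  show "I.mle {#a + s#} {#a, b#}" by (rule I.mle_trans[OF I.mle_plus sb(1)])
  show "I.mle {#a, b#} {#a + s#}" by (rule I.mle_trans[OF sb(2) I.mle_orth[OF I.PS_pos[OF a] I.PS_pos[OF shift(1)] o]])
 qed
qed

definition cls :: "(nat \<Rightarrow> nat \<Rightarrow> 'a) fa \<Rightarrow> 'a cuntz_class" where
 "cls x = W_class A (I.pr x)"

lemma minf_pos_PS: "a \<in> minf_pos A \<longleftrightarrow> (\<exists>x. I.PS x \<and> I.pr x = a)" using MI_positive_iff I.PS_positive I.positive_PS I.positive_pr_hg by metis

lemma cls_eq:
 assumes "I.PS x"
 shows "cls x = {I.pr y | y. I.PS y \<and> I.cz x y \<and> I.cz y x}"
proof -
 have "a \<in> cls x \<longleftrightarrow> a \<in> {I.pr y | y. I.PS y \<and> I.cz x y \<and> I.cz y x}" for a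
 proof
  assume "a \<in> cls x"
  then have a: "a \<in> minf_pos A" "minf_cuntz_le A (I.pr x) a" "minf_cuntz_le A a (I.pr x)"
   by (auto simp: cls_def W_class_def cuntz_rel_def)
  then obtain y where "I.PS y" "I.pr y = a"
   unfolding minf_pos_PS by blast
  then show "a \<in> {I.pr y | y. I.PS y \<and> I.cz x y \<and> I.cz y x}" using a minf_cuntz_le_iff assms by blast
 next
  assume "a \<in> {I.pr y | y. I.PS y \<and> I.cz x y \<and> I.cz y x}"
  then show "a \<in> cls x" using assms minf_cuntz_le_iff minf_pos_PS by (auto simp: cls_def W_class_def cuntz_rel_def)
 qed
 then show ?thesis by blast
qed

lemma pr_in_cls: "I.PS x \<Longrightarrow> I.PS y \<Longrightarrow> I.pr y \<in> cls x \<longleftrightarrow> I.cz x y \<and> I.cz y x"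
by (auto simp: minf_cuntz_le_iff minf_pos_PS cls_def W_class_def cuntz_rel_def)

lemma cls_cong: "I.PS x \<Longrightarrow> I.PS y \<Longrightarrow> I.cz x y \<Longrightarrow> I.cz y x \<Longrightarrow> cls x = cls y"
 unfolding cls_eq by (auto intro: I.cz_trans)

lemma W_cls: "\<mu> \<in> W A \<longleftrightarrow> (\<exists>x. I.PS x \<and> \<mu> = cls x)"
 unfolding W_def quotient_def cls_def W_class_def using minf_pos_PS by auto

lemma W_clsE:
 assumes "\<mu> \<in> W A"
 obtains x where "I.PS x" "\<mu> = cls x" using assms unfolding W_cls by blast

lemma W_le_cls:
 assumes x: "I.PS x" and y: "I.PS y"
 shows "W_le A (cls x) (cls y) \<longleftrightarrow> I.cz x y"
proof
 assume "W_le A (cls x) (cls y)"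
 then obtain x' y' where x': "I.PS x'" "I.cz x x'" and y': "I.PS y'" "I.cz y' y" and le: "minf_cuntz_le A (I.pr x') (I.pr y')"
  unfolding W_le_def cls_eq[OF x] cls_eq[OF y] by blast
 show "I.cz x y" using x' y' I.cz_trans using le minf_cuntz_le_iff[OF x'(1) y'(1)] by blast
next
 assume "I.cz x y"
 then show "W_le A (cls x) (cls y)"
  unfolding W_le_def using pr_in_cls[OF x x] pr_in_cls[OF y y] using minf_cuntz_le_iff[OF x y] by auto
qed

text \<open>Two-sided comparison with the pair determines the class of a direct sum, so all members
  of the union that defines \<open>W_add\<close> coincide with the class of
  \<open>c\<close>.\<close>

lemma W_add_cls:
 assumes a: "I.PS a" and b: "I.PS b" and c: "I.PS c" "I.mle {#c#} {#a, b#}" "I.mle {#a, b#} {#c#}"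
 shows "W_add A (cls a) (cls b) = cls c"
proof -
 have *: "W_class A (dsum A m (I.pr x) (I.pr y)) = cls c"
  if x: "I.PS x" "I.cz a x" "I.cz x a" and y: "I.PS y" "I.cz b y" "I.cz y b" and m: "I.pr x \<in> carrier (Mn m)" for x y m
 proof -
  obtain d where d: "I.PS d" "I.pr d = dsum A m (I.pr x) (I.pr y)" "I.mle {#d#} {#x, y#}" "I.mle {#x, y#} {#d#}"
   using dsum_class[OF x(1) y(1) m] by blast
  have "I.mle {#x, y#} {#a, b#}" "I.mle {#a, b#} {#x, y#}"
   using I.mle_add[of "{#x#}" "{#a#}" "{#y#}" "{#b#}"] I.mle_add[of "{#a#}" "{#x#}" "{#b#}" "{#y#}"] x y
   by (simp_all add: I.mle_single add_mset_commute)
  then show ?thesis by (metis d c I.mle_trans cls_cong I.mle_single cls_def)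
 qed
 obtain m where m: "I.pr a \<in> carrier (Mn m)" using I.pr_carrier[of a] unfolding MI_carrier by blast
 show ?thesis
 proof (intro Set.set_eqI iffI)
  fix z assume "z \<in> W_add A (cls a) (cls b)"
  then show "z \<in> cls c"
   unfolding W_add_def cls_eq[OF a] cls_eq[OF b] using * by blast
 next
  fix z assume "z \<in> cls c"
  then show "z \<in> W_add A (cls a) (cls b)"
   unfolding W_add_def using pr_in_cls[OF a a] pr_in_cls[OF b b] m using *[OF a _ _ b _ _ m] by auto
 qed
qed

lemma W_multiple_cls:
 assumes a: "I.PS a"
 obtains c where "I.PS c" "W_multiple A k (cls a) = cls c" "I.mle {#c#} (copies k a)" "I.mle (copies k a) {#c#}"
proof -
 have "\<exists>c. I.PS c \<and> W_multiple A k (cls a) = cls c \<and> I.mle {#c#} (copies k a) \<and> I.mle (copies k a) {#c#}"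
 proof (induction k)
  case 0
  have "I.mle {#0#} {#}" using I.mle_mset[of "[0]" "[]"] using I.dle_def I.dsub_def by simp
  moreover have "I.mle {#} {#0#}" by (rule I.mle_subset) simp
  ultimately show ?case by (simp add: cls_def MI_ops(4)[where n = 0] matrix_calg_def exI[of _ 0] I.PS_def)
 next
  case (Suc k)
  then obtain c where c: "I.PS c" "W_multiple A k (cls a) = cls c" "I.mle {#c#} (copies k a)" "I.mle (copies k a) {#c#}" by blast
  obtain m where m: "I.pr c \<in> carrier (Mn m)" using I.pr_carrier[of c] unfolding MI_carrier by blast
  obtain d where d: "I.PS d" "I.mle {#d#} {#c, a#}" "I.mle {#c, a#} {#d#}" using dsum_class[OF c(1) a m] by blast
  have "I.mle {#c, a#} (copies (Suc k) a)" "I.mle (copies (Suc k) a) {#c, a#}"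
   using I.mle_add[OF c(3) I.mle_refl[of "{#a#}"]] I.mle_add[OF c(4) I.mle_refl[of "{#a#}"]] by (simp_all add: add_mset_commute)
  from I.mle_trans[OF d(2) this(1)] I.mle_trans[OF this(2) d(3)] show ?case
   using d(1) W_add_cls[OF c(1) a d] c(2) by (intro exI[of _ d]) simp
 qed
 then show ?thesis using that by blast
qed

text \<open>Ideal membership is given in the finite matrix sizes, while \<open>spn\<close> concerns
  the union. Restricting ideals of the union to a fixed size bridges the two.\<close>

lemma closed_ideal_Mn:
 assumes J: "closed_ideal MI J"
 shows "closed_ideal (Mn n) (J \<inter> carrier (Mn n))"
 unfolding closed_ideal_def
proof (intro conjI ballI allI impI)
 interpret M: bcs "Mn n" by (rule Mn_bcs)
 have sm: "submodule J (ring_of_type_algebra :: complex ring) MI"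
  and ideal: "\<And>x y. x \<in> carrier MI \<Longrightarrow> y \<in> J \<Longrightarrow> x \<otimes>\<^bsub>MI\<^esub> y \<in> J \<and> y \<otimes>\<^bsub>MI\<^esub> x \<in> J" using J unfolding closed_ideal_def by blast+
 have sg: "subgroup J (add_monoid MI)" using sm by (rule submodule.axioms)
 have add: "x \<oplus>\<^bsub>MI\<^esub> y \<in> J" if "x \<in> J" "y \<in> J" for x y using subgroup.m_closed[OF sg that] by simp
 have zero: "\<zero>\<^bsub>MI\<^esub> \<in> J" using subgroup.one_closed[OF sg] by simp
 have smul: "c \<odot>\<^bsub>MI\<^esub> x \<in> J" if "x \<in> J" for x c using submodule.smult_closed[OF sm, of c x] that by (simp add: ring_of_type_algebra_def)
 show "submodule (J \<inter> carrier (Mn n)) (ring_of_type_algebra :: complex ring) (Mn n)"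
 proof (rule submodule.intro)
  show "subgroup (J \<inter> carrier (Mn n)) (add_monoid (Mn n))"
  proof (rule M.add.subgroupI)
   show "J \<inter> carrier (Mn n) \<noteq> {}" using zero by (auto simp: MI_ops(4)[where n = n])
   show "\<ominus>\<^bsub>Mn n\<^esub> x \<in> J \<inter> carrier (Mn n)" if "x \<in> J \<inter> carrier (Mn n)" for x
    using that smul[of x "- 1"] by (simp add: M.smult_neg[symmetric] MI_ops(2)[where n = n])
   show "x \<oplus>\<^bsub>Mn n\<^esub> y \<in> J \<inter> carrier (Mn n)" if "x \<in> J \<inter> carrier (Mn n)" "y \<in> J \<inter> carrier (Mn n)" for x y
    using that add[of x y] by (simp add: MI_ops(1)[where n = n])
  qed simp
  show "submodule_axioms (J \<inter> carrier (Mn n)) (ring_of_type_algebra :: complex ring) (Mn n)"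
   using smul by unfold_locales (simp add: MI_ops(2)[where n = n])
 qed
 fix x y assume x: "x \<in> carrier (Mn n)" and y: "y \<in> J \<inter> carrier (Mn n)"
 show "x \<otimes>\<^bsub>Mn n\<^esub> y \<in> J \<inter> carrier (Mn n)" "y \<otimes>\<^bsub>Mn n\<^esub> x \<in> J \<inter> carrier (Mn n)"
  using ideal[OF Mn_in_MI[OF x], of y] MI_mult[of x n y] MI_mult[of y n x] x y by simp_all
next
 fix s x assume x: "x \<in> carrier (Mn n)" and s: "(\<forall>k::nat. s k \<in> J \<inter> carrier (Mn n)) \<and> (\<lambda>k. nrm (Mn n) (s k \<ominus>\<^bsub>Mn n\<^esub> x)) \<longlonglongrightarrow> 0"
 interpret M: bcs "Mn n" by (rule Mn_bcs)
 have "(\<lambda>k. nrm MI (s k \<ominus>\<^bsub>MI\<^esub> x)) \<longlonglongrightarrow> 0" "\<forall>k. s k \<in> J" using s using x MI_minus[of _ n] MI_nrm[of _ n] by simp_all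
 moreover have "x \<in> J" if "\<forall>k. s k \<in> J" "(\<lambda>k. nrm MI (s k \<ominus>\<^bsub>MI\<^esub> x)) \<longlonglongrightarrow> 0" for s :: "nat \<Rightarrow> _"
  using J Mn_in_MI[OF x] that unfolding closed_ideal_def by blast
 ultimately show "x \<in> J \<inter> carrier (Mn n)" using x by blast
qed

lemma minf_in_ideal_spn:
 assumes y: "I.PS y" and x: "I.PS x" and h: "minf_in_ideal A (I.pr x) (I.pr y)"
 shows "I.spn y x"
proof (rule I.ideal_span[OF I.PS_ch[OF y] I.PS_ch[OF x]])
 fix J assume J: "closed_ideal MI J" "I.pr y \<in> J"
 obtain n0 where n0: "I.pr y \<in> carrier (Mn n0)" using I.pr_carrier[of y] unfolding MI_carrier by blast
 have "\<forall>\<^sub>F n in sequentially. n \<ge> n0 \<and> I.pr x \<in> closed_ideal (Mn n) hull {I.pr y}"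
  using h eventually_ge_at_top[of n0] unfolding minf_in_ideal_def by (simp add: eventually_conj)
 then obtain n where n: "n \<ge> n0" "I.pr x \<in> closed_ideal (Mn n) hull {I.pr y}" using eventually_happens trivial_limit_sequentially by blast
 have "closed_ideal (Mn n) hull {I.pr y} \<subseteq> J \<inter> carrier (Mn n)"
  using J n0 carrier_Mn_mono[OF n(1)] by (intro hull_minimal closed_ideal_Mn) auto
 then show "I.pr x \<in> J" using n(2) by blast
qed

end

section \<open>The three properties of the Cuntz semigroup\<close>

context zs
begin

lemma W_almost_unperforated: "almost_unperforated A"
 unfolding almost_unperforated_def
proof (intro ballI allI impI)
 fix \<mu> \<nu> and k :: nat
 assume \<mu>: "\<mu> \<in> W A" "\<nu> \<in> W A" and k: "2 \<le> k" and le: "W_le A (W_multiple A k \<mu>) (W_multiple A (k - 1) \<nu>)"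
 obtain x where x: "I.PS x" "\<mu> = cls x" using \<mu>(1) by (rule W_clsE)
 obtain y where y: "I.PS y" "\<nu> = cls y" using \<mu>(2) by (rule W_clsE)
 obtain c where c: "I.PS c" "W_multiple A k (cls x) = cls c" "I.mle {#c#} (copies k x)" "I.mle (copies k x) {#c#}"
  using W_multiple_cls[OF x(1)] .
 obtain d where d: "I.PS d" "W_multiple A (k - 1) (cls y) = cls d" "I.mle {#d#} (copies (k - 1) y)" "I.mle (copies (k - 1) y) {#d#}"
  using W_multiple_cls[OF y(1)] .
 have "I.mle (copies k x) (copies (k - 1) y)"
  using I.mle_trans[OF I.mle_trans[OF c(4)] d(3)] using le x y c(1,2) d(1,2) W_le_cls I.mle_single by simp
 moreover have "k = Suc (k - 1)" using k by simp
 ultimately have "I.cz x y" using I.almost_unperforated[OF x(1) y(1), of "k - 1"] by simp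
 then show "W_le A \<mu> \<nu>" using x y by (simp add: W_le_cls)
qed

lemma W_weakly_almost_divisible: "weakly_almost_divisible A"
 unfolding weakly_almost_divisible_def
proof (intro allI impI)
 fix m a and n :: nat and \<epsilon> :: real
 assume a: "positive_elem (Mn m) a" and n: "1 \<le> n" and \<epsilon>: "0 < \<epsilon>"
 define x where "x = I.hg a"
 have x: "I.PS x" "I.pr x = a" using I.positive_PS[OF MI_positive[OF a]] MI_positive[OF a] by (simp_all add: x_def)
 obtain e where e: "I.PS e" "I.mle (copies n e) {#x#}" "I.mle {#I.cut x \<epsilon>#} (copies (n + 1) e)" using I.weakly_divisible[OF x(1) n \<epsilon>] .
 obtain c where c: "I.PS c" "W_multiple A n (cls e) = cls c" "I.mle {#c#} (copies n e)" "I.mle (copies n e) {#c#}"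
  using W_multiple_cls[OF e(1)] .
 obtain d where d: "I.PS d" "W_multiple A (n + 1) (cls e) = cls d" "I.mle {#d#} (copies (n + 1) e)" "I.mle (copies (n + 1) e) {#d#}"
  using W_multiple_cls[OF e(1)] .
 have cut: "I.PS (I.cut x \<epsilon>)" using x \<epsilon> by (intro I.PS_cut) auto
 have cd: "W_class A (cutdown (Mn m) a \<epsilon>) = cls (I.cut x \<epsilon>)" "W_class A a = cls x"
  using MI_cutdown[OF a, of \<epsilon>] I.cutdown_eq[OF I.PS_ch[OF x(1)] I.PS_st[OF x(1)], of \<epsilon>] \<epsilon> x(2) by (simp_all add: cls_def)
 show "\<exists>\<eta>\<in>W A. W_le A (W_multiple A n \<eta>) (W_class A a) \<and> W_le A (W_class A (cutdown (Mn m) a \<epsilon>)) (W_multiple A (n + 1) \<eta>)"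
  unfolding cd using c d e x cut using I.mle_trans[OF c(3) e(2)] I.mle_trans[OF e(3) d(4)] I.mle_single by (intro bexI[of _ "cls e"]) (auto simp: W_le_cls W_cls del:)
qed

text \<open>Monotonicity makes the state constant on Cuntz classes, so evaluating it at a chosen
  representative is legitimate; a direct sum and the corresponding pair are comparable both ways,
  which gives additivity.\<close>

lemma dimension_function_of_state:
 fixes d :: "(nat \<Rightarrow> nat \<Rightarrow> 'a) fa multiset \<Rightarrow> ennreal"
 assumes d: "\<And>a b. d (a + b) = d a + d b" "\<And>a b. I.mle a b \<Longrightarrow> d a \<le> d b"
 obtains \<delta> where "dimension_function A \<delta>" "\<And>x. I.PS x \<Longrightarrow> \<delta> (cls x) = d {#x#}"
proof -
 define \<delta> where "\<delta> = (\<lambda>\<mu>. d {#I.hg (SOME a. a \<in> \<mu>)#})"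
 have \<delta>: "\<delta> (cls x) = d {#x#}" if x: "I.PS x" for x
 proof -
  define a where "a = (SOME a. a \<in> cls x)"
  have "I.pr x \<in> cls x" using pr_in_cls[OF x x] by simp
  then have "a \<in> cls x"
   unfolding a_def by (rule someI[of "\<lambda>a. a \<in> cls x"])
  then obtain y where y: "I.PS y" "a = I.pr y" "I.cz x y" "I.cz y x"
   unfolding cls_eq[OF x] by blast
  show ?thesis
   unfolding \<delta>_def a_def[symmetric] by (metis y I.eqv_cz I.eqv_sym I.hg_pr I.PS_st I.PS_ch antisym d I.mle_single)
 qed
 have "dimension_function A \<delta>"
  unfolding dimension_function_def
 proof (intro ballI conjI impI)
  fix \<mu> \<nu> assume \<mu>: "\<mu> \<in> W A" "\<nu> \<in> W A"
  obtain x where x: "I.PS x" "\<mu> = cls x" using \<mu>(1) by (rule W_clsE)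
  obtain y where y: "I.PS y" "\<nu> = cls y" using \<mu>(2) by (rule W_clsE)
  obtain m where m: "I.pr x \<in> carrier (Mn m)" using I.pr_carrier[of x] unfolding MI_carrier by blast
  obtain c where c: "I.PS c" "I.mle {#c#} {#x, y#}" "I.mle {#x, y#} {#c#}" using dsum_class[OF x(1) y(1) m] by blast
  have "d {#c#} = d {#x, y#}" by (intro antisym d c)
  also have "... = d {#x#} + d {#y#}" using d(1)[of "{#x#}" "{#y#}"] by (simp add: add_mset_commute)
  finally show "\<delta> (W_add A \<mu> \<nu>) = \<delta> \<mu> + \<delta> \<nu>" using W_add_cls[OF x(1) y(1) c] x y c by (simp add: \<delta>)
  assume "W_le A \<mu> \<nu>"
  then show "\<delta> \<mu> \<le> \<delta> \<nu>" using x y d(2) using W_le_cls I.mle_single by (simp add: \<delta>)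
 qed
 then show ?thesis using that \<delta> by blast
qed

text \<open>If a cut of \<open>x\<close> were not below \<open>y\<close>, ideal membership would
  bound it by finitely many copies of \<open>y\<close>, and almost unperforation would allow a state
  with value one at \<open>y\<close> and at least one at the cut. This contradicts the assumed
  strict inequality; letting the cut tend to zero finishes.\<close>

lemma W_weak_strict_comparison: "weak_strict_comparison A"
 unfolding weak_strict_comparison_def
proof (intro ballI impI)
 fix a b assume a: "a \<in> minf_pos A" and b: "b \<in> minf_pos A"
  and h: "minf_in_ideal A a b \<and> (\<forall>d. dimension_function A d \<and> d (W_class A b) = 1 \<longrightarrow> d (W_class A a) < d (W_class A b))"
 obtain x y where x: "I.PS x" "I.pr x = a" and y: "I.PS y" "I.pr y = b" using a b unfolding minf_pos_PS by blast
 have cls: "W_class A a = cls x" "W_class A b = cls y" by (simp_all add: cls_def x y)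
 have spn: "I.spn y x" using minf_in_ideal_spn[OF y(1) x(1)] h x y by simp
 have cut: "I.cz (I.cut x e) y" if e: "e > 0" for e
 proof (rule ccontr)
  assume n: "\<not> I.cz (I.cut x e) y"
  define c where "c = I.cut x e"
  have c: "I.PS c"
   unfolding c_def using x e by (intro I.PS_cut) auto
  \<comment> \<open>The monoid consists of all finite multisets over the free algebra; only the
    values of the state at positive elements are used afterwards.\<close>
  interpret P: preordered_monoid I.mle by unfold_locales (auto intro: I.mle_trans I.mle_add I.mle_subset)
  have nm: "nm k {#z#} = copies k z" for k and z :: "(nat \<Rightarrow> nat \<Rightarrow> 'a) fa" by (induction k) (simp_all)
  obtain k u w where k: "I.N (x - (\<Sum>i<(k::nat). u i * y * w i)) \<le> e / 2" using spn e unfolding I.spn_def by (meson half_gt_zero)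
  have le: "I.mle {#c#} (nm (2 * k) {#y#})"
   unfolding nm c_def using e by (intro I.ideal_cut_mle[OF I.PS_pos[OF x(1)] I.PS_pos[OF y(1)] k]) simp
  have unperf: "I.mle {#c#} {#y#}" if ij: "i < j" and ji: "I.mle (nm j {#c#}) (nm i {#y#})" for i j
  proof -
   obtain j' where j': "j = Suc j'" "i \<le> j'" using ij by (cases j) auto
   have "I.mle (nm j {#c#}) (nm j' {#y#})" using I.mle_trans[OF ji P.nm_mono[OF j'(2)]] .
   then show ?thesis using nm j'(1) I.almost_unperforated[OF c y(1)] by (simp add: I.mle_single)
  qed
  have nle: "\<not> I.mle {#c#} {#y#}" using n by (simp add: I.mle_single c_def)
  obtain d :: "(nat \<Rightarrow> nat \<Rightarrow> 'a) fa multiset \<Rightarrow> ennreal" where d: "\<And>a b. d (a + b) = d a + d b" "\<And>a b. I.mle a b \<Longrightarrow> d a \<le> d b" "d {#y#} = 1" "d {#c#} \<ge> 1"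
   by (rule P.exists_state[where x = "{#c#}" and y = "{#y#}" and L = "2 * k", OF le _ nle]) (rule unperf, assumption, assumption, blast)
  obtain \<delta> where \<delta>: "dimension_function A \<delta>" "\<And>x. I.PS x \<Longrightarrow> \<delta> (cls x) = d {#x#}" using dimension_function_of_state[OF d(1,2)] by blast
  have "d {#x#} < 1" using h \<delta>(1) unfolding cls using \<delta>(2)[OF x(1)] \<delta>(2)[OF y(1)] d(3) by auto
  moreover have "d {#c#} \<le> d {#x#}" using e by (intro d) (simp add: I.mle_single c_def I.cut_cz[OF I.PS_pos[OF x(1)]])
  ultimately show False using d(4) by (meson leD order_trans)
 qed
 show "minf_cuntz_le A a b"
  using minf_cuntz_le_iff[OF x(1) y(1)] x y by (metis I.cut_close[OF I.PS_pos[OF x(1)]] cut I.cz_sub_close less_imp_le)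
qed

end

theorem theorem4:
 fixes A :: "'a calg"
 assumes "cstar_algebra A" and "simple_calg A" and "tracially_Z_absorbing A"
 shows "almost_unperforated A \<and> weak_strict_comparison A \<and> weakly_almost_divisible A"
proof -
 interpret bcs A by (rule cstar_algebra_bcs) fact
 interpret zs A by (intro zs.intro zs_axioms.intro tz_A assms bcs_axioms)
 show ?thesis using W_almost_unperforated W_weak_strict_comparison W_weakly_almost_divisible by blast
qed

end
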